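(* Let $n\ge1$, let $J=\{k_1<\cdots<k_p\}\subset\{0,\ldots,n-1\}$ be nonempty, set $k_{p+1}:=n$, and put $k=k_1$, $m=k_2$. Let $w\in W_n^J$ be a pseudo $k$-Grassmannian element, i.e. an element of $W_n^J$ with one-line notation $$w=w_1w_2\cdots w_{k_2}\,|\,\overline{k_3}\,\overline{k_3-1}\cdots\overline{k_2+1}\,|\cdots|\,\overline n\,\overline{n-1}\cdots\overline{k_p+1}.$$ Let $\lambda$ be the $k$-strict partition in $\mathcal P_m^{(k)}$ associated to the signed permutation $(w_1\cdots w_m)$ consisting of the first $m$ letters of $w$, and $\chi=(\chi_1,\ldots,\chi_{m-k})$ its characteristic index. Then $$\mathfrak C_w=\sum_{I\subset D(\lambda)}\mathrm{Pf}\left[\vartheta_{\widetilde B_p}\cdots\vartheta_{\widetilde B_2}\ {}_k\vartheta_{\lambda_1+a_1^I}^{(\chi_1)}\cdots{}_k\vartheta_{\lambda_{m-k}+a_{m-k}^I}^{(\chi_{m-k})}\right],$$ where $I$ runs over all subsets of $D(\lambda)$, $a_s^I=\#\{j\mid(s,j)\in I\}-\#\{i\mid(i,s)\in I\}$, and for $i=2,\ldots,p$ $$\widetilde B_i=(k_i,\ldots,k_i\,;\ 2k_i+1,2k_i+2,\ldots,k_i+k_{i+1}\,;\ k_i,k_i+1,\ldots,k_{i+1}-1)\in\mathbb Z^{3(k_{i+1}-k_i)}.$$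
   Context: **Group.** $W_\infty$ is the group (under composition) of permutations $w$ of $\{1,2,\ldots\}\cup\{\bar1,\bar2,\ldots\}$, where $\bar i=-i$, with $w(\bar i)=\overline{w(i)}$ for all $i$ and $w(i)\ne i$ for only finitely many $i$. It is a Coxeter group with generators $s_0=(1,\bar1)$ and $s_i=(i,i+1)(\bar i,\overline{i+1})$ for $i\ge1$; $\ell$ is the length. $W_n=\{w\in W_\infty\mid w(i)=i\ \forall i>n\}$, with elements written in one-line notation $w(1)\cdots w(n)$ (vertical bars are only visual separators). For $J\subset\{0,\ldots,n-1\}$, $W^J=\{w\in W_\infty\mid \ell(w)<\ell(ws_i)\ \forall i\ge0,\ i\notin J\}$ and $W_n^J=W_n\cap W^J$. **Ring and operators.** $x,z,t$ are infinite sequences of variables. $Q_r(x)$ is defined by $\sum_{r\ge0}Q_r(x)u^r=\prod_{i\ge1}\frac{1+x_iu}{1-x_iu}$, $\Gamma=\mathbb Z[Q_1(x),Q_2(x),\ldots]$, and $\mathcal R_\infty=\Gamma[t_1,t_2,\ldots,z_1,z_2,\ldots]$. For $i\ge1$, $s_i^z$ is the ring automorphism of $\mathcal R_\infty$ exchanging $z_i,z_{i+1}$ and fixing the other $z_j$, all $t_j$ and all $Q_r(x)$; $s_0^z$ is the ring automorphism fixing all $t_j$ and all $z_j$ with $j\ge2$, with $s_0^z(z_1)=-z_1$ and $\sum_r s_0^z(Q_r(x))u^r=\frac{1+z_1u}{1-z_1u}\prod_{i\ge1}\frac{1+x_iu}{1-x_iu}$. Let $\omega$ be the ring automorphism with $\omega(t_i)=-z_i$,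 $\omega(z_i)=-t_i$, $\omega(Q_r(x))=Q_r(x)$, and put $s_i^t=\omega s_i^z\omega$ $(i\ge0)$. Put $\alpha_0=2t_1$, $\alpha_i=t_{i+1}-t_i$ $(i\ge1)$, and $\partial_if=\frac{f-s_i^zf}{\omega(\alpha_i)}$, $\delta_if=\frac{f-s_i^tf}{\alpha_i}$. **Double Schubert polynomials.** $\{\mathfrak C_w=\mathfrak C_w(z,t;x)\mid w\in W_\infty\}$ is the unique $\mathbb Z[t]$-basis of $\mathcal R_\infty$ such that for all $i\ge0$: $\partial_i\mathfrak C_w=\mathfrak C_{ws_i}$ if $\ell(ws_i)<\ell(w)$ and $0$ otherwise; $\delta_i\mathfrak C_w=\mathfrak C_{s_iw}$ if $\ell(s_iw)<\ell(w)$ and $0$ otherwise; and $\mathfrak C_w$ has no constant term except $\mathfrak C_e=1$. **$k$-strict partitions.** A partition is $k$-strict if no part greater than $k$ is repeated. $\mathcal P_m^{(k)}$ is the set of $k$-strict partitions with Young diagram inside the $(m-k)\times(m+k)$ rectangle; $\lambda\in\mathcal P_m^{(k)}$ is written $(\lambda_1,\ldots,\lambda_{m-k})$ with zeros allowed. For a pseudo $k$-Grassmannian $w$ as in the claim, the first $m=k_2$ letters form a $k$-Grassmannian permutation in $W_m$: $w_1\cdots w_m=v_1\cdots v_k|\overline{\zeta_1}\cdots\overline{\zeta_s}u_1\cdots u_{m-k-s}$ with $0<v_1<\cdots<v_k$, $\zeta_1>\cdots>\zeta_s>0$, $0<u_1<\cdots<u_{m-k-s}$. The associated $\lambda\in\mathcal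 P_m^{(k)}$ is $\lambda_i=\zeta_i+k$ for $1\le i\le s$ and $\lambda_{s+j}=\#\{q\mid v_q>u_j\}$ for $1\le j\le m-k-s$. The characteristic index is $\chi=(\zeta_1-1,\ldots,\zeta_s-1,-u_1,\ldots,-u_{m-k-s})\in\mathbb Z^{m-k}$, and $D(\lambda)=\{(i,j)\mid 1\le i<j\le m-k,\ \chi_i+\chi_j<0\}$. **Theta polynomials.** For integers $\kappa,l\ge0$, $\sum_{r\ge0}{}_\kappa\vartheta_r^{(l)}u^r=\prod_{i\ge1}\frac{1+x_iu}{1-x_iu}\prod_{i=1}^\kappa(1+z_iu)\prod_{i=1}^l(1-t_iu)$ and $\sum_{r\ge0}{}_\kappa\vartheta_r^{(-l)}u^r=\prod_{i\ge1}\frac{1+x_iu}{1-x_iu}\prod_{i=1}^\kappa(1+z_iu)\prod_{i=1}^l\frac1{1+t_iu}$; ${}_\kappa\vartheta_r^{(l)}=0$ for $r<0$. For $B=(\kappa_1,\ldots,\kappa_b;r_1,\ldots,r_b;l_1,\ldots,l_b)\in\mathbb Z^{3b}$ we write formally $\vartheta_B:={}_{\kappa_b}\vartheta_{r_b}^{(l_b)}\cdots{}_{\kappa_1}\vartheta_{r_1}^{(l_1)}$ (note the reversed order); inside $\mathrm{Pf}[\cdots]$ it stands for this ordered list of entries. **Multi Schur-Pfaffian.** For sequences of variables $c^{(i)}=(c_r^{(i)})_{r\in\mathbb Z}$, $1\le i\le N$: $\mathrm{Pf}[c_r^{(1)}]=c_r^{(1)}$; $\mathrm{Pf}[c_{r_1}^{(1)}c_{r_2}^{(2)}]=c_{r_1}^{(1)}c_{r_2}^{(2)}+2\sum_{s=1}^{r_2}(-1)^sc_{r_1+s}^{(1)}c_{r_2-s}^{(2)}$;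 for even $N\ge4$, $\mathrm{Pf}[c_{r_1}^{(1)}\cdots c_{r_N}^{(N)}]=\sum_{s=2}^N(-1)^s\mathrm{Pf}[c_{r_1}^{(1)}c_{r_s}^{(s)}]\,\mathrm{Pf}[c_{r_2}^{(2)}\cdots\widehat{c_{r_s}^{(s)}}\cdots c_{r_N}^{(N)}]$; for odd $N\ge3$, $\mathrm{Pf}[c_{r_1}^{(1)}\cdots c_{r_N}^{(N)}]=\sum_{s=1}^N(-1)^{s-1}c_{r_s}^{(s)}\mathrm{Pf}[c_{r_1}^{(1)}\cdots\widehat{c_{r_s}^{(s)}}\cdots c_{r_N}^{(N)}]$. $\mathrm{Pf}[{}_{\kappa_1}\vartheta_{r_1}^{(l_1)}\cdots{}_{\kappa_N}\vartheta_{r_N}^{(l_N)}]$ is obtained by first expanding $\mathrm{Pf}[c_{r_1}^{(1)}\cdots c_{r_N}^{(N)}]$ and then substituting ${}_{\kappa_i}\vartheta_s^{(l_i)}$ for $c_s^{(i)}$ for all $i$ and all $s\in\mathbb Z$. *)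

theory Defs
  imports
    Complex_Main
    "HOL-Library.Poly_Mapping"
    "HOL-Computational_Algebra.Formal_Power_Series"
    "HOL-Combinatorics.Transposition"
begin

section \<open>Formal power series over the integers in infinitely many variables\<close>

text \<open>
  A series is an arbitrary integer-valued function on monomials; a monomial is a finitely
  supported exponent function.
\<close>

typedef xseries = "UNIV :: ((nat \<Rightarrow>\<^sub>0 nat) \<Rightarrow> int) set"
  morphisms xcoeff Abs_xseries
  by auto

setup_lifting type_definition_xseries

lemma xseries_eqI: "(\<And>m. xcoeff f m = xcoeff g m) \<Longrightarrow> f = g"
  by (metis xcoeff_inject ext)

definition splits :: "('v \<Rightarrow>\<^sub>0 nat) \<Rightarrow> (('v \<Rightarrow>\<^sub>0 nat) \<times> ('v \<Rightarrow>\<^sub>0 nat)) set" where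
  "splits m = {(a, b). a + b = m}"

lemma finite_splits [simp]: "finite (splits m)"
proof -
  let ?F = "{f. \<forall>x. (x \<in> Poly_Mapping.keys m \<longrightarrow> f x \<in> {..Max (Poly_Mapping.range m \<union> {0})})
                 \<and> (x \<notin> Poly_Mapping.keys m \<longrightarrow> f x = (0::nat))}"
  let ?A = "{a. \<exists>b. a + b = m}"
  have fin: "finite ?F"
    by (rule finite_set_of_finite_funs) auto
  have le: "Poly_Mapping.lookup a x \<le> Poly_Mapping.lookup m x" if "a + b = m" for a b x
    using that by (auto simp: lookup_add)
  have F: "Poly_Mapping.lookup a \<in> ?F" if "a + b = m" for a b
  proof (clarify, intro conjI impI)
    fix x
    assume x: "x \<in> Poly_Mapping.keys m"
    have "Poly_Mapping.lookup m x \<in> Poly_Mapping.range m \<union> {0}"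
      using x by (simp add: in_keys_lookup_in_range)
    hence "Poly_Mapping.lookup m x \<le> Max (Poly_Mapping.range m \<union> {0})"
      by (intro Max_ge) auto
    with le[OF that, of x] show "Poly_Mapping.lookup a x \<in> {..Max (Poly_Mapping.range m \<union> {0})}"
      by simp
  next
    fix x
    assume "x \<notin> Poly_Mapping.keys m"
    with le[OF that, of x] show "Poly_Mapping.lookup a x = 0" by (simp add: in_keys_iff)
  qed
  have "Poly_Mapping.lookup ` ?A \<subseteq> ?F"
  proof (rule image_subsetI)
    fix a assume "a \<in> ?A"
    then obtain b where "a + b = m" by blast
    thus "Poly_Mapping.lookup a \<in> ?F" by (rule F)
  qed
  hence "finite (Poly_Mapping.lookup ` ?A)" using fin finite_subset by blast
  hence A: "finite ?A" by (rule finite_imageD) (simp add: inj_on_def)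
  have "splits m \<subseteq> ?A \<times> ?A"
    by (auto simp: splits_def) (metis add.commute)
  thus ?thesis using A by (meson finite_SigmaI finite_subset)
qed

instantiation xseries :: comm_ring_1
begin

lift_definition zero_xseries :: xseries is "\<lambda>_. 0" .
lift_definition one_xseries :: xseries is "\<lambda>m. if m = 0 then 1 else 0" .
lift_definition plus_xseries :: "xseries \<Rightarrow> xseries \<Rightarrow> xseries" is "\<lambda>f g m. f m + g m" .
lift_definition minus_xseries :: "xseries \<Rightarrow> xseries \<Rightarrow> xseries" is "\<lambda>f g m. f m - g m" .
lift_definition uminus_xseries :: "xseries \<Rightarrow> xseries" is "\<lambda>f m. - f m" .
lift_definition times_xseries :: "xseries \<Rightarrow> xseries \<Rightarrow> xseries"
  is "\<lambda>f g m. \<Sum>(a, b)\<in>splits m. f a * g b" .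

instance
proof
  fix f g h :: xseries
  show "f + g + h = f + (g + h)" "f + g = g + f" "0 + f = f" "- f + f = 0" "f - g = f + - g"
    by (transfer; auto)+
  show "f * g = g * f"
    by transfer
      (rule ext, rule sum.reindex_bij_witness[where i = prod.swap and j = prod.swap],
        auto simp: splits_def add.commute mult.commute)
  show "(f + g) * h = f * h + g * h"
    by transfer (auto simp: sum.distrib[symmetric] distrib_right intro!: sum.cong)
  show "(0::xseries) \<noteq> 1"
    by transfer (auto dest: fun_cong[of _ _ 0])
  show "1 * f = f"
  proof (transfer, rule ext)
    fix f :: "(nat \<Rightarrow>\<^sub>0 nat) \<Rightarrow> int" and m
    have "(\<Sum>(a, b)\<in>splits m. (if a = 0 then 1 else 0) * f b)
        = (\<Sum>(a, b)\<in>{(0::nat \<Rightarrow>\<^sub>0 nat, m)}. (if a = 0 then 1 else 0) * f b)"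
      by (rule sum.mono_neutral_right[OF finite_splits]) (auto simp: splits_def split: if_splits)
    thus "(\<Sum>(a, b)\<in>splits m. (if a = 0 then 1 else 0) * f b) = f m" by simp
  qed
  show "f * g * h = f * (g * h)"
  proof (transfer, rule ext)
    fix f g h :: "(nat \<Rightarrow>\<^sub>0 nat) \<Rightarrow> int" and m
    have "(\<Sum>(p, c)\<in>splits m. (\<Sum>(a, b)\<in>splits p. f a * g b) * h c)
        = (\<Sum>q\<in>splits m. \<Sum>r\<in>splits (fst q). f (fst r) * g (snd r) * h (snd q))"
      by (simp add: sum_distrib_right case_prod_beta)
    also have "\<dots> = (\<Sum>(q, r)\<in>Sigma (splits m) (\<lambda>q. splits (fst q)).
                       f (fst r) * g (snd r) * h (snd q))"
      by (rule sum.Sigma) auto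
    also have "\<dots> = (\<Sum>(q, r)\<in>Sigma (splits m) (\<lambda>q. splits (snd q)).
                       f (fst q) * (g (fst r) * h (snd r)))"
      by (rule sum.reindex_bij_witness
            [where j = "\<lambda>((p, c), (a, b)). ((a, b + c), (b, c))"
               and i = "\<lambda>((a, p), (b, c)). ((a + b, c), (a, b))"])
        (auto simp: splits_def add.assoc)
    also have "\<dots> = (\<Sum>q\<in>splits m. \<Sum>r\<in>splits (snd q). f (fst q) * (g (fst r) * h (snd r)))"
      by (rule sum.Sigma[symmetric]) auto
    also have "\<dots> = (\<Sum>(a, p)\<in>splits m. f a * (\<Sum>(b, c)\<in>splits p. g b * h c))"
      by (simp add: sum_distrib_left case_prod_beta)
    finally show "(\<Sum>(p, c)\<in>splits m. (\<Sum>(a, b)\<in>splits p. f a * g b) * h c)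
        = (\<Sum>(a, p)\<in>splits m. f a * (\<Sum>(b, c)\<in>splits p. g b * h c))" .
  qed
qed

end

text \<open>\<open>xvar i\<close> is the variable $x_i$ for \<open>i \<ge> 1\<close>.\<close>

definition xvar :: "nat \<Rightarrow> xseries" where
  "xvar i = Abs_xseries (\<lambda>m. if m = Poly_Mapping.single (i - 1) 1 then 1 else 0)"

section \<open>The rings $\Gamma$ and $\mathcal R_\infty$\<close>

text \<open>Power series in the auxiliary variable \<open>u\<close> are of type \<^typ>\<open>'a fps\<close>:
  \<open>lin a\<close> is $1 + a u$ and \<open>geom a\<close> is $1 / (1 - a u)$.\<close>

definition lin :: "'a::comm_ring_1 \<Rightarrow> 'a fps" where
  "lin a = 1 + fps_const a * fps_X"

definition geom :: "'a::comm_ring_1 \<Rightarrow> 'a fps" where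
  "geom a = Abs_fps (\<lambda>r. a ^ r)"

lemma geom_inverse: "(1 - fps_const a * fps_X) * geom a = 1"
  for a :: "'a::comm_ring_1"
proof (rule fps_ext)
  fix r
  show "fps_nth ((1 - fps_const a * fps_X) * geom a) r = fps_nth 1 r"
    by (cases r) (simp_all add: geom_def left_diff_distrib mult.assoc)
qed

definition Qpart :: "nat \<Rightarrow> xseries fps" where
  "Qpart N = (\<Prod>i\<in>{1..N}. lin (xvar i) * geom (xvar i))"

text \<open>The infinite product defining $Q_r(x)$ converges coefficientwise: every coefficient of
  the partial products is eventually constant.\<close>

definition Qx :: "nat \<Rightarrow> xseries" where
  "Qx r = Abs_xseries (\<lambda>m. THE c. \<forall>\<^sub>F N in sequentially. xcoeff (fps_nth (Qpart N) r) m = c)"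

inductive_set subring_gen :: "'a::comm_ring_1 set \<Rightarrow> 'a set" for S where
  base: "a \<in> S \<Longrightarrow> a \<in> subring_gen S"
| one: "1 \<in> subring_gen S"
| diff: "a \<in> subring_gen S \<Longrightarrow> b \<in> subring_gen S \<Longrightarrow> a - b \<in> subring_gen S"
| mult: "a \<in> subring_gen S \<Longrightarrow> b \<in> subring_gen S \<Longrightarrow> a * b \<in> subring_gen S"

lemma subring_gen_zero: "0 \<in> subring_gen S"
  using subring_gen.diff[OF subring_gen.one subring_gen.one] by simp

lemma subring_gen_uminus: "a \<in> subring_gen S \<Longrightarrow> - a \<in> subring_gen S"
  using subring_gen.diff[OF subring_gen_zero] by force

lemma subring_gen_add: "a \<in> subring_gen S \<Longrightarrow> b \<in> subring_gen S \<Longrightarrow> a + b \<in> subring_gen S"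
  using subring_gen.diff[OF _ subring_gen_uminus] by fastforce

typedef gamma = "subring_gen {Qx r |r. r \<ge> 1}"
  morphisms series_of_gamma Abs_gamma
  using subring_gen.one by blast

setup_lifting type_definition_gamma

instantiation gamma :: comm_ring_1
begin

lift_definition zero_gamma :: gamma is 0 by (rule subring_gen_zero)
lift_definition one_gamma :: gamma is 1 by (rule subring_gen.one)
lift_definition plus_gamma :: "gamma \<Rightarrow> gamma \<Rightarrow> gamma" is "(+)" by (rule subring_gen_add)
lift_definition minus_gamma :: "gamma \<Rightarrow> gamma \<Rightarrow> gamma" is "(-)" by (rule subring_gen.diff)
lift_definition uminus_gamma :: "gamma \<Rightarrow> gamma" is uminus by (rule subring_gen_uminus)
lift_definition times_gamma :: "gamma \<Rightarrow> gamma \<Rightarrow> gamma" is "(*)" by (rule subring_gen.mult)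

instance
  by standard (transfer; simp add: algebra_simps)+

end

text \<open>$\mathcal R_\infty = \Gamma[t_1, t_2, \ldots, z_1, z_2, \ldots]$ is the polynomial ring with
  coefficients in \<^typ>\<open>gamma\<close>. The constructors are indexed from 0, so that there is no variable
  $t_0$ or $z_0$; \<open>tv i\<close> and \<open>zv i\<close> are $t_i$ and $z_i$ for \<open>i \<ge> 1\<close>.\<close>

datatype tzvar = T nat | Z nat

type_synonym Rinf = "(tzvar \<Rightarrow>\<^sub>0 nat) \<Rightarrow>\<^sub>0 gamma"

definition tv :: "nat \<Rightarrow> Rinf" where
  "tv i = Poly_Mapping.single (Poly_Mapping.single (T (i - 1)) 1) 1"

definition zv :: "nat \<Rightarrow> Rinf" where
  "zv i = Poly_Mapping.single (Poly_Mapping.single (Z (i - 1)) 1) 1"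

text \<open>$Q_0(x) = 1$ lies in $\Gamma$ as well, so \<^const>\<open>Abs_gamma\<close> is applied inside its domain
  for every \<open>r\<close>.\<close>

definition Qr :: "nat \<Rightarrow> Rinf" where
  "Qr r = Poly_Mapping.single 0 (Abs_gamma (Qx r))"

definition Qgf :: "Rinf fps" where
  "Qgf = Abs_fps Qr"

definition const_term :: "Rinf \<Rightarrow> int" where
  "const_term f = xcoeff (series_of_gamma (Poly_Mapping.lookup f 0)) 0"

section \<open>Automorphisms and divided differences\<close>

definition ring_aut :: "(Rinf \<Rightarrow> Rinf) \<Rightarrow> bool" where
  "ring_aut \<phi> \<longleftrightarrow> bij \<phi> \<and> \<phi> 1 = 1 \<and>
     (\<forall>f g. \<phi> (f + g) = \<phi> f + \<phi> g) \<and> (\<forall>f g. \<phi> (f * g) = \<phi> f * \<phi> g)"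

definition sz :: "nat \<Rightarrow> Rinf \<Rightarrow> Rinf" where
  "sz i = (THE \<phi>. ring_aut \<phi> \<and> (\<forall>j\<ge>1. \<phi> (tv j) = tv j) \<and>
     (if i = 0 then
        \<phi> (zv 1) = - zv 1 \<and> (\<forall>j\<ge>2. \<phi> (zv j) = zv j) \<and>
        Abs_fps (\<lambda>r. \<phi> (Qr r)) = lin (zv 1) * geom (zv 1) * Qgf
      else
        (\<forall>j\<ge>1. \<phi> (zv j) = zv (transpose i (i + 1) j)) \<and> (\<forall>r. \<phi> (Qr r) = Qr r)))"

definition omega :: "Rinf \<Rightarrow> Rinf" where
  "omega = (THE \<phi>. ring_aut \<phi> \<and> (\<forall>j\<ge>1. \<phi> (tv j) = - zv j) \<and> (\<forall>j\<ge>1. \<phi> (zv j) = - tv j) \<and>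
     (\<forall>r. \<phi> (Qr r) = Qr r))"

definition st :: "nat \<Rightarrow> Rinf \<Rightarrow> Rinf" where
  "st i = omega \<circ> sz i \<circ> omega"

definition alpha :: "nat \<Rightarrow> Rinf" where
  "alpha i = (if i = 0 then 2 * tv 1 else tv (i + 1) - tv i)"

definition exact_quot :: "Rinf \<Rightarrow> Rinf \<Rightarrow> Rinf" where
  "exact_quot f g = (THE h. g * h = f)"

definition ddz :: "nat \<Rightarrow> Rinf \<Rightarrow> Rinf" where
  "ddz i f = exact_quot (f - sz i f) (omega (alpha i))"

definition ddt :: "nat \<Rightarrow> Rinf \<Rightarrow> Rinf" where
  "ddt i f = exact_quot (f - st i f) (alpha i)"

section \<open>The hyperoctahedral group\<close>

text \<open>Signed permutations are functions on \<^typ>\<open>int\<close>, with $\bar i = -i$; oddness forces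
  \<open>w 0 = 0\<close>.\<close>

definition W_inf :: "(int \<Rightarrow> int) set" where
  "W_inf = {w. bij w \<and> (\<forall>i. w (- i) = - w i) \<and> finite {i. w i \<noteq> i}}"

definition gen :: "nat \<Rightarrow> int \<Rightarrow> int" where
  "gen i = (if i = 0 then transpose 1 (- 1)
            else transpose (int i) (int i + 1) \<circ> transpose (- int i) (- (int i + 1)))"

definition len :: "(int \<Rightarrow> int) \<Rightarrow> nat" where
  "len w = (LEAST l. \<exists>is. length is = l \<and> w = foldr (\<lambda>i v. gen i \<circ> v) is id)"

definition W_fin :: "nat \<Rightarrow> (int \<Rightarrow> int) set" where
  "W_fin n = {w \<in> W_inf. \<forall>i > int n. w i = i}"

definition W_par :: "nat set \<Rightarrow> (int \<Rightarrow> int) set" where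
  "W_par J = {w \<in> W_inf. \<forall>i. i \<notin> J \<longrightarrow> len w < len (w \<circ> gen i)}"

section \<open>Double Schubert polynomials\<close>

definition Zt :: "Rinf set" where
  "Zt = subring_gen {tv i |i. i \<ge> 1}"

definition Zt_basis :: "'i set \<Rightarrow> ('i \<Rightarrow> Rinf) \<Rightarrow> bool" where
  "Zt_basis I C \<longleftrightarrow>
     (\<forall>f. \<exists>S a. finite S \<and> S \<subseteq> I \<and> (\<forall>w\<in>S. a w \<in> Zt) \<and> f = (\<Sum>w\<in>S. a w * C w)) \<and>
     (\<forall>S a. finite S \<and> S \<subseteq> I \<and> (\<forall>w\<in>S. a w \<in> Zt) \<and> (\<Sum>w\<in>S. a w * C w) = 0
        \<longrightarrow> (\<forall>w\<in>S. a w = 0))"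

text \<open>The double Schubert polynomials are the unique family \<open>C\<close> with this property; only the
  values on \<^const>\<open>W_inf\<close> are relevant.\<close>

definition double_schubert :: "((int \<Rightarrow> int) \<Rightarrow> Rinf) \<Rightarrow> bool" where
  "double_schubert C \<longleftrightarrow>
     Zt_basis W_inf C \<and>
     (\<forall>w\<in>W_inf. \<forall>i. ddz i (C w) = (if len (w \<circ> gen i) < len w then C (w \<circ> gen i) else 0)) \<and>
     (\<forall>w\<in>W_inf. \<forall>i. ddt i (C w) = (if len (gen i \<circ> w) < len w then C (gen i \<circ> w) else 0)) \<and>
     C id = 1 \<and>
     (\<forall>w\<in>W_inf. w \<noteq> id \<longrightarrow> const_term (C w) = 0)"

section \<open>Theta polynomials and the multi Schur-Pfaffian\<close>

definition theta_gf :: "nat \<Rightarrow> int \<Rightarrow> Rinf fps" where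
  "theta_gf \<kappa> l = Qgf * (\<Prod>i\<in>{1..\<kappa>}. lin (zv i)) *
     (if l \<ge> 0 then (\<Prod>i\<in>{1..nat l}. lin (- tv i)) else (\<Prod>i\<in>{1..nat (- l)}. geom (- tv i)))"

definition theta :: "nat \<Rightarrow> int \<Rightarrow> int \<Rightarrow> Rinf" where
  "theta \<kappa> l r = (if r < 0 then 0 else fps_nth (theta_gf \<kappa> l) (nat r))"

text \<open>An entry $c^{(i)}_{r_i}$ of a Pfaffian is the pair of the whole sequence $c^{(i)}$ and the
  index $r_i$. The recursion only uses ring operations, so evaluating it at sequences in a
  commutative ring is the same as expanding it in indeterminates and then substituting.
  List positions in the formulas count from 1: \<open>nth1 xs s\<close> is the \<open>s\<close>-th entry, and
  \<open>omit s xs\<close> is the list without it.\<close>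

definition nth1 :: "'a list \<Rightarrow> nat \<Rightarrow> 'a" where
  "nth1 xs s = xs ! (s - 1)"

definition omit :: "nat \<Rightarrow> 'a list \<Rightarrow> 'a list" where
  "omit s xs = take (s - 1) xs @ drop s xs"

fun Pf2 :: "(int \<Rightarrow> 'a::comm_ring_1) \<times> int \<Rightarrow> (int \<Rightarrow> 'a) \<times> int \<Rightarrow> 'a" where
  "Pf2 (c1, r1) (c2, r2) = c1 r1 * c2 r2 + 2 * (\<Sum>s\<in>{1..r2}. (- 1) ^ nat s * (c1 (r1 + s) * c2 (r2 - s)))"

text \<open>The empty Pfaffian never occurs in the definition for nonempty lists.\<close>

function Pf :: "((int \<Rightarrow> 'a::comm_ring_1) \<times> int) list \<Rightarrow> 'a" where
  "Pf xs =
     (if length xs = 0 then 1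
      else if length xs = 1 then (case nth1 xs 1 of (c, r) \<Rightarrow> c r)
      else if length xs = 2 then Pf2 (nth1 xs 1) (nth1 xs 2)
      else if even (length xs) then
        (\<Sum>s\<in>{2..length xs}. (- 1) ^ s * (Pf2 (nth1 xs 1) (nth1 xs s) * Pf (omit 1 (omit s xs))))
      else
        (\<Sum>s\<in>{1..length xs}. (- 1) ^ (s - 1) * ((case nth1 xs s of (c, r) \<Rightarrow> c r) * Pf (omit s xs))))"
  by auto
termination
  by (relation "measure length") (auto simp: omit_def)

declare Pf.simps [simp del]

definition entry :: "nat \<times> int \<times> int \<Rightarrow> (int \<Rightarrow> Rinf) \<times> int" where
  "entry = (\<lambda>(\<kappa>, r, l). (theta \<kappa> l, r))"

text \<open>$B = (\kappa_1, \ldots; r_1, \ldots; l_1, \ldots)$ is the list of the triples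
  $(\kappa_j, r_j, l_j)$.\<close>

definition theta_B :: "(nat \<times> int \<times> int) list \<Rightarrow> ((int \<Rightarrow> Rinf) \<times> int) list" where
  "theta_B B = rev (map entry B)"

section \<open>Pseudo $k$-Grassmannian elements\<close>

text \<open>\<open>K 1 < \<dots> < K p\<close> are the elements of \<open>J\<close> and \<open>K (p + 1) = n\<close>. The condition says that for
  \<open>2 \<le> i \<le> p\<close> the letters of \<open>w\<close> in positions \<open>K i + 1, \<dots>, K (i + 1)\<close> are
  the negatives of \<open>K (i + 1), \<dots>, K i + 1\<close>.\<close>

definition pseudo_grassmannian :: "nat \<Rightarrow> nat \<Rightarrow> nat set \<Rightarrow> (nat \<Rightarrow> nat) \<Rightarrow> (int \<Rightarrow> int) \<Rightarrow> bool" where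
  "pseudo_grassmannian n p J K w \<longleftrightarrow>
     w \<in> W_fin n \<inter> W_par J \<and>
     (\<forall>i\<in>{2..p}. \<forall>j\<in>{1..K (i + 1) - K i}. w (int (K i + j)) = - int (K (i + 1) + 1 - j))"

text \<open>The letters in positions \<open>k + 1, \<dots>, m\<close> are increasing, so the negative ones come first;
  \<open>s\<close> is their number.\<close>

definition num_neg :: "nat \<Rightarrow> nat \<Rightarrow> (int \<Rightarrow> int) \<Rightarrow> nat" where
  "num_neg k m w = card {i\<in>{k + 1..m}. w (int i) < 0}"

definition zeta :: "nat \<Rightarrow> (int \<Rightarrow> int) \<Rightarrow> nat \<Rightarrow> int" where
  "zeta k w i = - w (int (k + i))"

definition uu :: "nat \<Rightarrow> nat \<Rightarrow> (int \<Rightarrow> int) \<Rightarrow> nat \<Rightarrow> int" where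
  "uu k m w j = w (int (k + num_neg k m w + j))"

definition lam :: "nat \<Rightarrow> nat \<Rightarrow> (int \<Rightarrow> int) \<Rightarrow> nat \<Rightarrow> int" where
  "lam k m w i =
     (if i \<le> num_neg k m w then zeta k w i + int k
      else int (card {q\<in>{1..k}. w (int q) > uu k m w (i - num_neg k m w)}))"

definition chi :: "nat \<Rightarrow> nat \<Rightarrow> (int \<Rightarrow> int) \<Rightarrow> nat \<Rightarrow> int" where
  "chi k m w i =
     (if i \<le> num_neg k m w then zeta k w i - 1 else - uu k m w (i - num_neg k m w))"

definition DD :: "nat \<Rightarrow> nat \<Rightarrow> (int \<Rightarrow> int) \<Rightarrow> (nat \<times> nat) set" where
  "DD k m w = {(i, j). 1 \<le> i \<and> i < j \<and> j \<le> m - k \<and> chi k m w i + chi k m w j < 0}"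

definition aI :: "(nat \<times> nat) set \<Rightarrow> nat \<Rightarrow> int" where
  "aI I s = int (card {j. (s, j) \<in> I}) - int (card {i. (i, s) \<in> I})"

definition B_tilde :: "(nat \<Rightarrow> nat) \<Rightarrow> nat \<Rightarrow> (nat \<times> int \<times> int) list" where
  "B_tilde K i =
     map (\<lambda>j. (K i, int (2 * K i + j), int (K i + j) - 1)) [1..<K (i + 1) - K i + 1]"

end

theory Submission
  imports Defs "HOL-Computational_Algebra.Polynomial"
begin

text \<open>
  The proof is by localisation. Restricting \<open>\<CC>\<^sub>w\<close> to the torus fixed points \<open>u\<close> of the flag
  variety gives zero if \<open>len u \<le> len w\<close> and \<open>u \<noteq> w\<close>, and a polynomial of degree at most \<open>len w\<close>
  with these zeros is an integer multiple of \<open>\<CC>\<^sub>w\<close>. This criterion shows that inserting the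
  letter \<open>- (l + 1)\<close> at position \<open>\<kappa> + 1\<close> of a signed permutation in \<open>W\<^sub>l\<close> acts on Schubert
  polynomials by a raising operator, which on Pfaffians of theta polynomials prepends the entry
  \<open>\<vartheta>\<^bsub>\<kappa> + l + 1\<^esub>\<close> of index \<open>\<kappa>\<close> and level \<open>l\<close>: the constant is found by applying the divided
  differences that take the new letter out again.

  Inserting all barred blocks, including the one in positions \<open>k + 1, \<dots>, m\<close>, gives the Pfaffian of
  the longest pseudo-Grassmannian element, where \<open>D(\<lambda>)\<close> is empty. Every other one is reached from
  it by left divided differences \<open>\<delta>\<^sub>i\<close> with \<open>i < m\<close>. Only the slots with \<open>\<bar>\<chi>\<^sub>s\<bar> = i\<close> are affected:
  one such slot is lowered, while two of them, with indices \<open>i\<close> and \<open>- i\<close>, split the sum in two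
  and thereby add their pair to \<open>D(\<lambda>)\<close>.
\<close>

section \<open>Specialising one variable of \<open>\<Gamma>\<close>\<close>

text \<open>The number \<open>\<kappa> + l + 1\<close> has two sources. At a fixed point u the
  generating function of the theta polynomials of index \<open>\<kappa>\<close> and level l is
  rational; its z- and t-factors cancel the poles of the negative letters in positions up to
  \<open>\<kappa>\<close> or of absolute value up to l. If A is the set of the other poles, the
  numerator has degree at most |A| + \<open>\<kappa>\<close> + l, so replacing y^s by the
  coefficient of index \<open>\<kappa> + l + 1 + s\<close> kills every polynomial in y that vanishes
  at A. The same number is the least length lost when a negative letter beyond position
  \<open>\<kappa>\<close> and beyond l in absolute value is deleted, attained for one position and
  letter only. Such a deletion leaves the values of z_1, ..., z_\<open>\<kappa>\<close> and t_1,
  ..., t_l alone, whence the subring \<open>SA\<close>. The Q_r satisfy Q(u) Q(-u) = 1, so a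
  homomorphism cannot be prescribed freely on them. Those needed here come from a genuine
  substitution for one x-variable, which is why monomials are split at x_1.\<close>

definition consm :: "nat \<Rightarrow> (nat \<Rightarrow>\<^sub>0 nat) \<Rightarrow> (nat \<Rightarrow>\<^sub>0 nat)" where
  "consm k m = Abs_poly_mapping (\<lambda>i. case i of 0 \<Rightarrow> k | Suc j \<Rightarrow> Poly_Mapping.lookup m j)"

definition tlm :: "(nat \<Rightarrow>\<^sub>0 nat) \<Rightarrow> (nat \<Rightarrow>\<^sub>0 nat)" where
  "tlm m = Abs_poly_mapping (\<lambda>i. Poly_Mapping.lookup m (Suc i))"

lemma lookup_consm: "Poly_Mapping.lookup (consm k m) i =
    (case i of 0 \<Rightarrow> k | Suc j \<Rightarrow> Poly_Mapping.lookup m j)"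
proof -
  have "i \<in> insert 0 (Suc ` Poly_Mapping.keys m)"
    if "(case i of 0 \<Rightarrow> k | Suc j \<Rightarrow> Poly_Mapping.lookup m j) \<noteq> 0" for i
    using that by (cases i) (auto simp: in_keys_iff)
  then have "{i. (case i of 0 \<Rightarrow> k | Suc j \<Rightarrow> Poly_Mapping.lookup m j) \<noteq> 0}
      \<subseteq> insert 0 (Suc ` Poly_Mapping.keys m)"
    by blast
  then have "finite {i. (case i of 0 \<Rightarrow> k | Suc j \<Rightarrow> Poly_Mapping.lookup m j) \<noteq> 0}"
    by (rule finite_subset) auto
  then show ?thesis unfolding consm_def by simp
qed

lemma lookup_tlm: "Poly_Mapping.lookup (tlm m) i = Poly_Mapping.lookup m (Suc i)"
proof -
  have "{i. Poly_Mapping.lookup m (Suc i) \<noteq> 0} = Suc -` Poly_Mapping.keys m"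
    by (auto simp: in_keys_iff)
  then have "finite {i. Poly_Mapping.lookup m (Suc i) \<noteq> 0}"
    by (simp add: finite_vimageI)
  then show ?thesis unfolding tlm_def by simp
qed

lemma consm_tlm: "consm (Poly_Mapping.lookup m 0) (tlm m) = m"
  by (rule poly_mapping_eqI) (simp add: lookup_consm lookup_tlm split: nat.splits)

lemma consm_cases: obtains k m' where "m = consm k m'"
  using consm_tlm by metis

lemma consm_eq_iff [simp]: "consm k m = consm k' m' \<longleftrightarrow> k = k' \<and> m = m'"
proof
  assume *: "consm k m = consm k' m'"
  have "k = k'" using arg_cong[OF *, of "\<lambda>x. Poly_Mapping.lookup x 0"] by (simp add: lookup_consm)
  moreover have "Poly_Mapping.lookup m i = Poly_Mapping.lookup m' i" for i
    using arg_cong[OF *, of "\<lambda>x. Poly_Mapping.lookup x (Suc i)"] by (simp add: lookup_consm)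
  ultimately show "k = k' \<and> m = m'" by (simp add: poly_mapping_eqI)
qed auto

lemma consm_add: "consm i a + consm j b = consm (i + j) (a + b)"
  by (rule poly_mapping_eqI) (simp add: lookup_consm lookup_add split: nat.splits)

lemma consm_0_0 [simp]: "consm 0 0 = 0"
  by (rule poly_mapping_eqI) (simp add: lookup_consm split: nat.splits)

lemma consm_eq_0_iff [simp]: "consm k m = 0 \<longleftrightarrow> k = 0 \<and> m = 0"
  by (metis consm_0_0 consm_eq_iff)

lemma single_0_consm: "Poly_Mapping.single 0 k = consm k 0"
  by (rule poly_mapping_eqI) (simp add: lookup_consm lookup_single split: nat.splits)

lemma single_Suc_consm: "Poly_Mapping.single (Suc i) k = consm 0 (Poly_Mapping.single i k)"
  by (rule poly_mapping_eqI) (simp add: lookup_consm lookup_single when_def split: nat.splits)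

text \<open>The coefficient of x_1^k, with the remaining variables renumbered down by one;
  \<open>upx\<close> renumbers up. In exponent functions x_1 sits at index 0.\<close>

lift_definition shf :: "nat \<Rightarrow> xseries \<Rightarrow> xseries" is "\<lambda>k f m. f (consm k m)" .

lift_definition upx :: "xseries \<Rightarrow> xseries" is
  "\<lambda>f m. if Poly_Mapping.lookup m 0 = 0 then f (tlm m) else 0" .

lemma tlm_consm [simp]: "tlm (consm k m) = m"
  by (rule poly_mapping_eqI) (simp add: lookup_consm lookup_tlm)

lemma shf_eqI: "(\<And>k. shf k f = shf k g) \<Longrightarrow> f = g"
proof (rule xseries_eqI)
  fix m assume *: "\<And>k. shf k f = shf k g"
  obtain k m' where m: "m = consm k m'" by (rule consm_cases)
  show "xcoeff f m = xcoeff g m" using arg_cong[OF *[of k], of "\<lambda>h. xcoeff h m'"]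
    by (simp add: shf.rep_eq m)
qed

lemma shf_add: "shf k (f + g) = shf k f + shf k g"
  by transfer auto
lemma shf_diff: "shf k (f - g) = shf k f - shf k g"
  by transfer auto
lemma shf_one: "shf k 1 = (if k = 0 then 1 else 0)"
  by (rule xseries_eqI) (auto simp: shf.rep_eq one_xseries.rep_eq zero_xseries.rep_eq)
lemma shf_zero [simp]: "shf k 0 = 0"
  by transfer auto

lemma splits_consm:
  "bij_betw (\<lambda>(i, (a, b)). (consm i a, consm (k - i) b)) ({..k} \<times> splits m) (splits (consm k m))"
  unfolding bij_betw_def
proof
  show "inj_on (\<lambda>(i, (a, b)). (consm i a, consm (k - i) b)) ({..k} \<times> splits m)"
    by (auto simp: inj_on_def)
  show "(\<lambda>(i, (a, b)). (consm i a, consm (k - i) b)) ` ({..k} \<times> splits m) = splits (consm k m)"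
  proof (rule set_eqI, rule iffI)
    fix z assume "z \<in> splits (consm k m)"
    then obtain x y where z: "z = (x, y)" "x + y = consm k m" by (auto simp: splits_def)
    obtain i a where x: "x = consm i a" by (rule consm_cases)
    obtain j b where y: "y = consm j b" by (rule consm_cases)
    have "i + j = k" "a + b = m" using z(2) unfolding x y consm_add by simp_all
    then show "z \<in> (\<lambda>(i, (a, b)). (consm i a, consm (k - i) b)) ` ({..k} \<times> splits m)"
      by (intro image_eqI[of _ _ "(i, (a, b))"]) (auto simp: z(1) x y splits_def)
  qed (auto simp: splits_def consm_add)
qed

lemma xcoeff_mult: "xcoeff (f * g) m = (\<Sum>(a, b)\<in>splits m. xcoeff f a * xcoeff g b)"
  by (simp add: times_xseries.rep_eq)

lemma xcoeff_sum: "xcoeff (sum F A) m = (\<Sum>x\<in>A. xcoeff (F x) m)"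
  by (induction A rule: infinite_finite_induct) (auto simp: zero_xseries.rep_eq plus_xseries.rep_eq)

lemma shf_mult: "shf k (f * g) = (\<Sum>i\<le>k. shf i f * shf (k - i) g)"
proof (rule xseries_eqI)
  fix m
  have "xcoeff (shf k (f * g)) m = (\<Sum>(a, b)\<in>splits (consm k m). xcoeff f a * xcoeff g b)"
    by (simp add: shf.rep_eq xcoeff_mult)
  also have "\<dots> = (\<Sum>(i, (a, b))\<in>{..k} \<times> splits m. xcoeff f (consm i a) * xcoeff g (consm (k - i) b))"
    by (subst sum.reindex_bij_betw[OF splits_consm, symmetric]) (simp add: case_prod_beta)
  also have "\<dots> = (\<Sum>i\<le>k. \<Sum>(a, b)\<in>splits m. xcoeff f (consm i a) * xcoeff g (consm (k - i) b))"
    by (simp add: sum.cartesian_product)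
  also have "\<dots> = xcoeff (\<Sum>i\<le>k. shf i f * shf (k - i) g) m"
    by (simp add: xcoeff_sum xcoeff_mult shf.rep_eq)
  finally show "xcoeff (shf k (f * g)) m = xcoeff (\<Sum>i\<le>k. shf i f * shf (k - i) g) m" .
qed

lemma shf_upx: "shf k (upx f) = (if k = 0 then f else 0)"
  by (rule xseries_eqI) (auto simp: shf.rep_eq upx.rep_eq zero_xseries.rep_eq lookup_consm)

lemma upx_mult: "upx (f * g) = upx f * upx g"
proof (rule shf_eqI)
  fix k
  have "(\<Sum>i\<le>k. shf i (upx f) * shf (k - i) (upx g)) = (\<Sum>i\<le>k. if i = 0 then f * shf k (upx g) else 0)"
    by (rule sum.cong) (auto simp: shf_upx)
  also have "\<dots> = shf k (upx (f * g))"
    by (subst sum.delta) (auto simp: shf_upx)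
  finally show "shf k (upx (f * g)) = shf k (upx f * upx g)"
    by (simp add: shf_mult)
qed

lemma upx_add: "upx (f + g) = upx f + upx g"
  by transfer auto
lemma upx_one: "upx 1 = 1"
  by (rule shf_eqI) (simp add: shf_upx shf_one)

section \<open>Ring homomorphisms and their effect on power series in u\<close>

definition rhom :: "('a::comm_ring_1 \<Rightarrow> 'b::comm_ring_1) \<Rightarrow> bool" where
  "rhom h \<longleftrightarrow> h 1 = 1 \<and> (\<forall>f g. h (f + g) = h f + h g) \<and> (\<forall>f g. h (f * g) = h f * h g)"

lemma rhomD:
  assumes "rhom h"
  shows rhom_1: "h 1 = 1" and rhom_add: "h (f + g) = h f + h g" and rhom_mult: "h (f * g) = h f * h g"
    and rhom_0: "h 0 = 0" and rhom_minus: "h (- f) = - h f" and rhom_diff: "h (f - g) = h f - h g"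
proof -
  show a: "h 1 = 1" "h (f * g) = h f * h g" and b: "\<And>f g. h (f + g) = h f + h g"
    using assms by (auto simp: rhom_def)
  show z: "h 0 = 0" using b[of 0 0] by simp
  show n: "h (- f) = - h f" for f using b[of f "- f"] z by (simp add: eq_neg_iff_add_eq_0 add.commute)
  show "h (f - g) = h f - h g" using b[of f "- g"] n[of g] by simp
qed

lemma rhomI:
  assumes "h 1 = 1" "\<And>f g. h (f + g) = h f + h g" "\<And>f g. h (f * g) = h f * h g"
  shows "rhom h"
  using assms by (simp add: rhom_def)

lemma rhom_sum: "rhom h \<Longrightarrow> h (sum F A) = (\<Sum>x\<in>A. h (F x))"
  by (induction A rule: infinite_finite_induct) (auto simp: rhom_0 rhom_add)
lemma rhom_prod: "rhom h \<Longrightarrow> h (prod F A) = (\<Prod>x\<in>A. h (F x))"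
  by (induction A rule: infinite_finite_induct) (auto simp: rhom_1 rhom_mult)
lemma rhom_power: "rhom h \<Longrightarrow> h (f ^ n) = h f ^ n"
  by (induction n) (auto simp: rhom_1 rhom_mult)
lemma rhom_of_nat: "rhom h \<Longrightarrow> h (of_nat n) = of_nat n"
  by (induction n) (auto simp: rhom_0 rhom_1 rhom_add)
lemma rhom_of_int: "rhom h \<Longrightarrow> h (of_int n) = of_int n"
  by (cases n rule: int_diff_cases) (simp add: rhom_diff rhom_of_nat)
lemma rhom_numeral: "rhom h \<Longrightarrow> h (numeral n) = numeral n"
  using rhom_of_nat[of h "numeral n"] by simp
lemma rhom_comp: "rhom h \<Longrightarrow> rhom g \<Longrightarrow> rhom (\<lambda>x. h (g x))"
  by (simp add: rhom_def)
lemma rhom_id: "rhom (\<lambda>x. x)"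
  by (simp add: rhom_def)

definition fmap :: "('a::comm_ring_1 \<Rightarrow> 'b::comm_ring_1) \<Rightarrow> 'a fps \<Rightarrow> 'b fps" where
  "fmap h F = Abs_fps (\<lambda>r. h (fps_nth F r))"

lemma fmap_nth [simp]: "fps_nth (fmap h F) r = h (fps_nth F r)"
  by (simp add: fmap_def)

lemma fmap_rhom:
  assumes "rhom h"
  shows "rhom (fmap h)"
  by (rule rhomI; rule fps_ext)
    (auto simp: rhom_0[OF assms] rhom_1[OF assms] rhom_add[OF assms] rhom_sum[OF assms] rhom_mult[OF assms] fps_mult_nth)

lemma fmap_geom: "rhom h \<Longrightarrow> fmap h (geom a) = geom (h a)"
  by (rule fps_ext) (simp add: geom_def rhom_power)

lemma lin_nth: "fps_nth (lin a) r = (if r = 0 then 1 else if r = 1 then a else 0)"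
  by (cases r) (auto simp: lin_def)

lemma fmap_lin: "rhom h \<Longrightarrow> fmap h (lin a) = lin (h a)"
  by (rule fps_ext) (auto simp: lin_nth rhom_0 rhom_1)

lemma fmap_mult: "rhom h \<Longrightarrow> fmap h (F * G) = fmap h F * fmap h G"
  using fmap_rhom rhom_mult by blast

lemma fmap_prod: "rhom h \<Longrightarrow> fmap h (prod F A) = (\<Prod>x\<in>A. fmap h (F x))"
  using fmap_rhom rhom_prod by blast

lemma lin_geom_nth: "fps_nth (lin a * geom a) r = (if r = 0 then 1 else 2 * a ^ r)"
proof -
  have "fps_nth (lin a * geom a) r = fps_nth (geom a) r + a * fps_nth (fps_X * geom a) r"
    by (simp add: lin_def distrib_right mult.assoc)
  then show ?thesis by (cases r) (auto simp: geom_def)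
qed

lemma rhom_upx: "rhom upx"
  by (rule rhomI) (auto simp: upx_one upx_add upx_mult)

lemma xcoeff_xvar: "xcoeff (xvar i) m = (if m = Poly_Mapping.single (i - 1) 1 then 1 else 0)"
  by (simp add: xvar_def Abs_xseries_inverse)

lemma shf_xvar1: "shf k (xvar 1) = (if k = 1 then 1 else 0)"
  by (rule xseries_eqI)
    (auto simp: shf.rep_eq xcoeff_xvar single_0_consm zero_xseries.rep_eq one_xseries.rep_eq)

lemma upx_xvar: "i \<ge> 1 \<Longrightarrow> upx (xvar i) = xvar (Suc i)"
proof (rule xseries_eqI)
  fix m assume "i \<ge> 1"
  then obtain j where i: "i = Suc j" by (cases i) auto
  obtain k m' where m: "m = consm k m'" by (rule consm_cases)
  show "xcoeff (upx (xvar i)) m = xcoeff (xvar (Suc i)) m"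
    by (auto simp: upx.rep_eq m xcoeff_xvar i single_Suc_consm lookup_consm)
qed

lemma shf_xvar1_power: "shf k (xvar 1 ^ j) = (if k = j then 1 else 0)"
proof (induction j arbitrary: k)
  case (Suc j)
  have "shf k (xvar 1 ^ Suc j) = (\<Sum>i\<le>k. if i = 1 then (if k - 1 = j then 1 else 0) else 0)"
    unfolding power_Suc shf_mult by (rule sum.cong) (auto simp: shf_xvar1 Suc.IH simp del: One_nat_def)
  also have "\<dots> = (if k = Suc j then 1 else 0)"
    by (subst sum.delta) auto
  finally show ?case .
qed (simp add: shf_one)

lemma shf_xvar1_upx: "shf k (xvar 1 ^ j * upx f) = (if k = j then f else 0)"
proof -
  have "shf k (xvar 1 ^ j * upx f) = (\<Sum>i\<le>k. if i = j then shf (k - j) (upx f) else 0)"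
    unfolding shf_mult by (rule sum.cong) (auto simp: shf_xvar1_power simp del: One_nat_def)
  also have "\<dots> = (if k = j then f else 0)"
    by (subst sum.delta) (auto simp: shf_upx)
  finally show ?thesis .
qed

lemma shf_2: "shf k (2 * f) = 2 * shf k f"
  by (simp only: mult_2 shf_add)

lemma xcoeff_2: "xcoeff (2 * f) m = 2 * xcoeff f m"
  using plus_xseries.rep_eq[of f f] by (simp only: mult_2)

lemma shf_sum: "shf k (sum F A) = (\<Sum>x\<in>A. shf k (F x))"
  by (induction A rule: infinite_finite_induct) (auto simp: shf_add)

lemma Qpart_Suc: "Qpart (Suc N) = lin (xvar 1) * geom (xvar 1) * fmap upx (Qpart N)"
proof -
  have "Qpart (Suc N) = (\<Prod>i\<in>{1..Suc N}. lin (xvar i) * geom (xvar i))"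
    by (simp add: Qpart_def)
  also have "\<dots> = lin (xvar 1) * geom (xvar 1) * (\<Prod>i\<in>{Suc 1..Suc N}. lin (xvar i) * geom (xvar i))"
    by (rule prod.atLeast_Suc_atMost) simp
  also have "(\<Prod>i\<in>{Suc 1..Suc N}. lin (xvar i) * geom (xvar i))
      = (\<Prod>i\<in>{1..N}. lin (xvar (Suc i)) * geom (xvar (Suc i)))"
    by (rule prod.shift_bounds_cl_Suc_ivl)
  also have "\<dots> = fmap upx (Qpart N)"
    unfolding Qpart_def fmap_prod[OF rhom_upx]
    by (rule prod.cong) (auto simp: fmap_mult[OF rhom_upx] fmap_lin[OF rhom_upx] fmap_geom[OF rhom_upx] upx_xvar)
  finally show ?thesis .
qed

text \<open>The x_1^k-coefficient rule that results from (1 + x_1 u) / (1 - x_1 u) = 1 + 2 x_1 u + 2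
  x_1^2 u^2 + .... The sequence q is a parameter because the rule is applied to partial products, to
  single coefficients, to the limits and to elements of \<open>gamma\<close>.\<close>

definition qstep :: "nat \<Rightarrow> nat \<Rightarrow> (nat \<Rightarrow> 'a::comm_ring_1) \<Rightarrow> 'a" where
  "qstep k r q = (if k = 0 then q r else if k \<le> r then 2 * q (r - k) else 0)"

lemma shf_Qpart: "shf k (fps_nth (Qpart (Suc N)) r) = qstep k r (fps_nth (Qpart N))"
proof -
  have "shf k (fps_nth (Qpart (Suc N)) r)
      = (\<Sum>i=0..r. shf k ((if i = 0 then 1 else 2 * xvar 1 ^ i) * upx (fps_nth (Qpart N) (r - i))))"
    by (simp add: Qpart_Suc fps_mult_nth[of _ "fmap upx (Qpart N)"] lin_geom_nth shf_sum del: One_nat_def)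
  also have "\<dots> = (\<Sum>i=0..r. if i = k then (if i = 0 then 1 else 2) * fps_nth (Qpart N) (r - i) else 0)"
  proof (rule sum.cong, simp)
    fix i
    show "shf k ((if i = 0 then 1 else 2 * xvar 1 ^ i) * upx (fps_nth (Qpart N) (r - i)))
      = (if i = k then (if i = 0 then 1 else 2) * fps_nth (Qpart N) (r - i) else 0)"
      using shf_xvar1_upx[of k i "fps_nth (Qpart N) (r - i)"]
      by (auto simp: mult.assoc shf_2 shf_upx simp del: One_nat_def)
  qed
  also have "\<dots> = qstep k r (fps_nth (Qpart N))"
    by (subst sum.delta) (auto simp: qstep_def)
  finally show ?thesis .
qed

lemma xcoeff_Qpart_consm:
  "xcoeff (fps_nth (Qpart (Suc N)) r) (consm k m) = qstep k r (\<lambda>s. xcoeff (fps_nth (Qpart N) s) m)"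
  using arg_cong[OF shf_Qpart[of k N r], of "\<lambda>h. xcoeff h m"]
  unfolding shf.rep_eq by (auto simp: qstep_def xcoeff_2 zero_xseries.rep_eq)

text \<open>A monomial in the first b variables does not see the factors after the b-th. Splitting
  off the first variable lowers N and b together and leaves the same recursion \<open>qstep\<close>
  on both sides.\<close>

lemma Qpart_stable:
  "Poly_Mapping.keys m \<subseteq> {..<b} \<Longrightarrow> b \<le> N \<Longrightarrow> xcoeff (fps_nth (Qpart N) r) m = xcoeff (fps_nth (Qpart b) r) m"
proof (induction b arbitrary: m N r)
  case 0
  then have m: "m = 0" by simp
  have "xcoeff (fps_nth (Qpart N) r) 0 = xcoeff (fps_nth (Qpart 0) r) 0" for N
  proof (induction N arbitrary: r)
    case (Suc N)
    show ?case using xcoeff_Qpart_consm[of N r 0 0] Suc.IH[of r] by (simp add: qstep_def)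
  qed simp
  then show ?case by (simp add: m)
next
  case (Suc b)
  obtain k m' where m: "m = consm k m'" by (rule consm_cases)
  obtain N' where N: "N = Suc N'" using Suc.prems by (cases N) auto
  have "Poly_Mapping.keys m' \<subseteq> {..<b}"
  proof
    fix i assume "i \<in> Poly_Mapping.keys m'"
    then have "Suc i \<in> Poly_Mapping.keys m" by (simp add: in_keys_iff m lookup_consm)
    then show "i \<in> {..<b}" using Suc.prems by auto
  qed
  then have "xcoeff (fps_nth (Qpart N') s) m' = xcoeff (fps_nth (Qpart b) s) m'" for s
    using Suc.IH[of m' N' s] Suc.prems N by simp
  then show ?case
    unfolding m N xcoeff_Qpart_consm qstep_def by simp
qed

lemma xcoeff_Qx:
  assumes "Poly_Mapping.keys m \<subseteq> {..<b}"
  shows "xcoeff (Qx r) m = xcoeff (fps_nth (Qpart b) r) m"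
proof -
  have ev: "\<forall>\<^sub>F N in sequentially. xcoeff (fps_nth (Qpart N) r) m = xcoeff (fps_nth (Qpart b) r) m"
    unfolding eventually_sequentially using Qpart_stable[OF assms] by blast
  have "(THE c. \<forall>\<^sub>F N in sequentially. xcoeff (fps_nth (Qpart N) r) m = c) = xcoeff (fps_nth (Qpart b) r) m"
  proof (rule the_equality)
    show "\<forall>\<^sub>F N in sequentially. xcoeff (fps_nth (Qpart N) r) m = xcoeff (fps_nth (Qpart b) r) m" by (rule ev)
    fix c assume "\<forall>\<^sub>F N in sequentially. xcoeff (fps_nth (Qpart N) r) m = c"
    with ev have "\<forall>\<^sub>F N in sequentially. c = xcoeff (fps_nth (Qpart b) r) m"
      by eventually_elim auto
    then show "c = xcoeff (fps_nth (Qpart b) r) m" by simp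
  qed
  then show ?thesis by (simp add: Qx_def Abs_xseries_inverse)
qed

lemma finite_nat_bounded': "finite (A :: nat set) \<Longrightarrow> \<exists>b. A \<subseteq> {..<b}"
  using finite_nat_bounded by blast

lemma shf_Qx: "shf k (Qx r) = qstep k r Qx"
proof (rule xseries_eqI)
  fix m :: "nat \<Rightarrow>\<^sub>0 nat"
  obtain b where b: "Poly_Mapping.keys m \<subseteq> {..<b}" using finite_nat_bounded'[of "Poly_Mapping.keys m"] by auto
  have "Poly_Mapping.keys (consm k m) \<subseteq> {..<Suc b}"
  proof
    fix i assume "i \<in> Poly_Mapping.keys (consm k m)"
    then show "i \<in> {..<Suc b}" using b by (cases i) (auto simp: in_keys_iff lookup_consm subset_iff)
  qed
  then show "xcoeff (shf k (Qx r)) m = xcoeff (qstep k r Qx) m"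
    by (auto simp: shf.rep_eq xcoeff_Qx[of _ "Suc b"] xcoeff_Qpart_consm xcoeff_Qx[OF b] qstep_def
        xcoeff_2 zero_xseries.rep_eq)
qed

lemma Qpart_nth_0: "fps_nth (Qpart N) 0 = 1"
proof (induction N)
  case (Suc N)
  then show ?case by (simp add: Qpart_Suc lin_geom_nth fps_mult_nth[of _ "fmap upx (Qpart N)"] upx_one
        del: fps_mult_nth_0)
qed (simp add: Qpart_def)

lemma Qx_0: "Qx 0 = 1"
proof (rule xseries_eqI)
  fix m :: "nat \<Rightarrow>\<^sub>0 nat"
  obtain b where b: "Poly_Mapping.keys m \<subseteq> {..<b}" using finite_nat_bounded'[of "Poly_Mapping.keys m"] by auto
  show "xcoeff (Qx 0) m = xcoeff 1 m" by (simp add: xcoeff_Qx[OF b] Qpart_nth_0)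
qed

lemma xcoeff_Qx_0: "xcoeff (Qx r) 0 = (if r = 0 then 1 else 0)"
  by (subst xcoeff_Qx[of _ 0]) (auto simp: Qpart_def zero_xseries.rep_eq one_xseries.rep_eq)

abbreviation gammaset :: "xseries set" where "gammaset \<equiv> subring_gen {Qx r |r. r \<ge> 1}"

lemma Qx_gamma: "Qx r \<in> gammaset"
proof (cases "r = 0")
  case False
  then show ?thesis by (intro subring_gen.base) auto
qed (simp add: Qx_0 subring_gen.one)

lemma subring_gen_sum: "(\<And>x. x \<in> A \<Longrightarrow> F x \<in> subring_gen S) \<Longrightarrow> sum F A \<in> subring_gen S"
  by (induction A rule: infinite_finite_induct) (auto intro: subring_gen_zero subring_gen_add)

lemma shf_gamma: "f \<in> gammaset \<Longrightarrow> shf k f \<in> gammaset"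
proof (induction arbitrary: k rule: subring_gen.induct)
  case (base a)
  then obtain r where a: "a = Qx r" by auto
  have "2 * Qx (r - k) \<in> gammaset" unfolding mult_2 by (intro subring_gen_add Qx_gamma)
  then show ?case
    unfolding a shf_Qx qstep_def by (auto intro: Qx_gamma subring_gen_zero simp del: One_nat_def)
qed (auto simp: shf_one shf_diff shf_mult intro: subring_gen.intros subring_gen_zero subring_gen_sum)

text \<open>Each element of \<Gamma> involves finitely many Q_r, and Q_r has degree at most r in
  x_1. So the x_1-coefficients form a polynomial, and x_1 may be replaced by an element of any
  commutative ring, which makes no sense for general series.\<close>

lemma shf_gamma_bounded: "f \<in> gammaset \<Longrightarrow> \<exists>n. \<forall>k>n. shf k f = 0"
proof (induction rule: subring_gen.induct)
  case (base a)
  then obtain r where a: "a = Qx r" by auto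
  show ?case by (intro exI[of _ r]) (simp add: a shf_Qx qstep_def)
next
  case one
  then show ?case by (auto simp: shf_one)
next
  case (diff a b)
  then obtain n n' where "\<forall>k>n. shf k a = 0" "\<forall>k>n'. shf k b = 0" by auto
  then show ?case by (intro exI[of _ "max n n'"]) (auto simp: shf_diff)
next
  case (mult a b)
  then obtain n n' where n: "\<forall>k>n. shf k a = 0" "\<forall>k>n'. shf k b = 0" by auto
  have "shf k (a * b) = 0" if "k > n + n'" for k
    unfolding shf_mult
  proof (rule sum.neutral, rule ballI)
    fix i assume "i \<in> {..k}"
    then have "i > n \<or> k - i > n'" using that by auto
    then show "shf i a * shf (k - i) b = 0" using n by auto
  qed
  then show ?case by blast
qed

lift_definition gshf :: "nat \<Rightarrow> gamma \<Rightarrow> gamma" is shf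
  by (rule shf_gamma)

lemma gshf_add: "gshf k (f + g) = gshf k f + gshf k g"
  by transfer (rule shf_add)
lemma gshf_one: "gshf k 1 = (if k = 0 then 1 else 0)"
  by transfer (simp add: shf_one)

lemma series_of_gamma_sum: "series_of_gamma (sum F A) = (\<Sum>x\<in>A. series_of_gamma (F x))"
  by (induction A rule: infinite_finite_induct) (auto simp: zero_gamma.rep_eq plus_gamma.rep_eq)

lemma gshf_mult: "gshf k (f * g) = (\<Sum>i\<le>k. gshf i f * gshf (k - i) g)"
  by (rule series_of_gamma_inject[THEN iffD1])
    (simp add: series_of_gamma_sum gshf.rep_eq times_gamma.rep_eq shf_mult)

text \<open>\<open>eta\<close> splits off the variable \<open>x\<^sub>1\<close> as \<open>y\<close> and shifts the others back, so that
  it multiplies the generating function of the \<open>Q\<^sub>r\<close> by \<open>(1 + yu) / (1 - yu)\<close>.\<close>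

definition eta :: "gamma \<Rightarrow> gamma poly" where
  "eta c = Abs_poly (\<lambda>k. gshf k c)"

lemma coeff_eta: "coeff (eta c) k = gshf k c"
proof -
  obtain n where "\<forall>k>n. shf k (series_of_gamma c) = 0"
    using shf_gamma_bounded[OF series_of_gamma[of c]] by auto
  then have "\<forall>k>n. gshf k c = 0"
    by (simp add: gshf.rep_eq zero_gamma.rep_eq series_of_gamma_inject[symmetric])
  then show ?thesis unfolding eta_def by (subst coeff_Abs_poly[of n]) auto
qed

lemma rhom_eta: "rhom eta"
  by (rule rhomI; rule poly_eqI) (auto simp: coeff_eta gshf_add gshf_one gshf_mult coeff_mult)

definition Qg :: "nat \<Rightarrow> gamma" where "Qg r = Abs_gamma (Qx r)"

lemma series_Qg: "series_of_gamma (Qg r) = Qx r"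
  unfolding Qg_def by (rule Abs_gamma_inverse) (rule Qx_gamma)

lemma series_2: "series_of_gamma (2 * f) = 2 * series_of_gamma f"
  using plus_gamma.rep_eq[of f f] by (simp only: mult_2)

lemma gshf_Qg: "gshf k (Qg r) = qstep k r Qg"
  by (rule series_of_gamma_inject[THEN iffD1])
    (simp add: gshf.rep_eq series_Qg shf_Qx qstep_def series_2 zero_gamma.rep_eq)

lemma Qg_0: "Qg 0 = 1"
  by (rule series_of_gamma_inject[THEN iffD1]) (simp add: series_Qg Qx_0 one_gamma.rep_eq)

lemma gamma_induct:
  assumes "P 1" "\<And>r. r \<ge> 1 \<Longrightarrow> P (Qg r)" "\<And>a b. P a \<Longrightarrow> P b \<Longrightarrow> P (a - b)" "\<And>a b. P a \<Longrightarrow> P b \<Longrightarrow> P (a * b)"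
  shows "P c"
proof -
  have "x \<in> gammaset \<Longrightarrow> x \<in> gammaset \<and> P (Abs_gamma x)" for x
  proof (induction rule: subring_gen.induct)
    case (base a)
    then show ?case using assms(2) by (auto simp: Qg_def intro: subring_gen.base)
  next
    case one
    then show ?case using assms(1) by (auto simp: one_gamma_def intro: subring_gen.one)
  next
    case (diff a b)
    then have "Abs_gamma (a - b) = Abs_gamma a - Abs_gamma b"
      by (simp add: minus_gamma.abs_eq eq_onp_def)
    then show ?case using diff assms(3) by (auto intro: subring_gen.diff)
  next
    case (mult a b)
    then have "Abs_gamma (a * b) = Abs_gamma a * Abs_gamma b"
      by (simp add: times_gamma.abs_eq eq_onp_def)
    then show ?case using mult assms(4) by (auto intro: subring_gen.mult)
  qed
  from this[OF series_of_gamma[of c]] show ?thesis by (simp add: series_of_gamma_inverse)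
qed

text \<open>The extension of h to polynomials that sends the indeterminate to b.\<close>

definition pev :: "('a::comm_ring_1 \<Rightarrow> 'b::comm_ring_1) \<Rightarrow> 'b \<Rightarrow> 'a poly \<Rightarrow> 'b" where
  "pev h b p = (\<Sum>i\<le>degree p. h (coeff p i) * b ^ i)"

lemma pev_bound:
  assumes "rhom h" "degree p \<le> n"
  shows "pev h b p = (\<Sum>i\<le>n. h (coeff p i) * b ^ i)"
  unfolding pev_def
  by (rule sum.mono_neutral_left) (use assms in \<open>auto simp: coeff_eq_0 rhom_0\<close>)

lemma rhom_pev:
  assumes h: "rhom h"
  shows "rhom (pev h b)"
proof -
  note H = rhom_0[OF h] rhom_1[OF h] rhom_add[OF h] rhom_mult[OF h] rhom_sum[OF h]
  have add: "pev h b (p + q) = pev h b p + pev h b q" for p q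
    by (simp add: pev_bound[OF h, of _ "max (degree p) (degree q)"] degree_add_le H distrib_right sum.distrib)
  have smult: "pev h b (smult c p) = h c * pev h b p" for c p
    by (simp add: pev_bound[OF h, of _ "degree p"] degree_smult_le H sum_distrib_left mult.assoc)
  have pCons: "pev h b (pCons c p) = h c + b * pev h b p" for c p
  proof -
    have "pev h b (pCons c p) = (\<Sum>i\<le>Suc (degree p). h (coeff (pCons c p) i) * b ^ i)"
      by (intro pev_bound[OF h] degree_pCons_le)
    also have "\<dots> = h c + (\<Sum>i\<le>degree p. h (coeff p i) * b ^ Suc i)"
      by (subst sum.atMost_Suc_shift) simp
    finally show ?thesis by (simp add: pev_def sum_distrib_left mult_ac)
  qed
  have zero: "pev h b 0 = 0" by (simp add: pev_def H)
  have "pev h b (p * q) = pev h b p * pev h b q" for p q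
    by (induction p) (auto simp: zero add smult pCons H algebra_simps)
  then show ?thesis using add by (intro rhomI) (auto simp: pev_def H)
qed

text \<open>Adds one x-variable of value b to those that h sees. From \<open>gincl\<close> this
  gives s_0^z; repeated from \<open>gct\<close>, where all x_i are 0, it gives the
  localisations.\<close>

definition hsub :: "(gamma \<Rightarrow> 'b::comm_ring_1) \<Rightarrow> 'b \<Rightarrow> gamma \<Rightarrow> 'b" where
  "hsub h b c = pev h b (eta c)"

lemma rhom_hsub: "rhom h \<Longrightarrow> rhom (hsub h b)"
  unfolding hsub_def by (intro rhom_comp[of "pev h b" eta] rhom_pev rhom_eta)

definition Qfg :: "gamma fps" where "Qfg = Abs_fps Qg"

lemma fmap_hsub:
  assumes h: "rhom h"
  shows "fmap (hsub h b) Qfg = lin b * geom b * fmap h Qfg"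
proof (rule fps_ext)
  fix r
  have "degree (eta (Qg r)) \<le> r"
    by (rule degree_le) (simp add: coeff_eta gshf_Qg qstep_def)
  then have "hsub h b (Qg r) = (\<Sum>i\<le>r. h (qstep i r Qg) * b ^ i)"
    by (simp add: hsub_def pev_bound[OF h] coeff_eta gshf_Qg)
  also have "\<dots> = (\<Sum>i=0..r. (if i = 0 then 1 else 2 * b ^ i) * h (Qg (r - i)))"
    by (rule sum.cong) (auto simp: qstep_def rhom_mult[OF h] rhom_numeral[OF h] atLeast0AtMost)
  finally show "fps_nth (fmap (hsub h b) Qfg) r = fps_nth (lin b * geom b * fmap h Qfg) r"
    by (simp add: Qfg_def fps_mult_nth[of "lin b * geom b"] lin_geom_nth)
qed

definition gct :: "gamma \<Rightarrow> 'b::comm_ring_1" where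
  "gct c = of_int (xcoeff (series_of_gamma c) 0)"

lemma splits_0: "splits (0 :: nat \<Rightarrow>\<^sub>0 nat) = {(0, 0)}"
proof -
  have "a = 0 \<and> b = 0" if "a + b = 0" for a b :: "nat \<Rightarrow>\<^sub>0 nat"
  proof -
    have "Poly_Mapping.lookup a x + Poly_Mapping.lookup b x = 0" for x
      using arg_cong[OF that, of "\<lambda>m. Poly_Mapping.lookup m x"] by (simp add: lookup_add)
    then have "Poly_Mapping.lookup a x = 0" "Poly_Mapping.lookup b x = 0" for x by simp_all
    then show ?thesis by (metis lookup_zero poly_mapping_eqI)
  qed
  then have "splits (0 :: nat \<Rightarrow>\<^sub>0 nat) \<subseteq> {(0, 0)}" unfolding splits_def by blast
  moreover have "(0, 0) \<in> splits (0 :: nat \<Rightarrow>\<^sub>0 nat)" by (simp add: splits_def)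
  ultimately show ?thesis by blast
qed

lemma rhom_gct: "rhom gct"
  by (rule rhomI) (auto simp: gct_def one_gamma.rep_eq one_xseries.rep_eq plus_gamma.rep_eq
      plus_xseries.rep_eq times_gamma.rep_eq xcoeff_mult splits_0)

lemma fmap_gct: "fmap gct Qfg = 1"
  by (rule fps_ext) (auto simp: Qfg_def gct_def series_Qg xcoeff_Qx_0)

section \<open>Ring homomorphisms on \<open>R\<^sub>\<infinity>\<close>\<close>

definition mon :: "(tzvar \<Rightarrow> 'b::comm_ring_1) \<Rightarrow> (tzvar \<Rightarrow>\<^sub>0 nat) \<Rightarrow> 'b" where
  "mon val m = (\<Prod>v\<in>Poly_Mapping.keys m. val v ^ Poly_Mapping.lookup m v)"

lemma mon_superset:
  "finite A \<Longrightarrow> Poly_Mapping.keys m \<subseteq> A \<Longrightarrow> mon val m = (\<Prod>v\<in>A. val v ^ Poly_Mapping.lookup m v)"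
  unfolding mon_def by (rule prod.mono_neutral_left) (auto simp: in_keys_iff)

lemma mon_add: "mon val (a + b) = mon val a * mon val b"
proof -
  let ?A = "Poly_Mapping.keys a \<union> Poly_Mapping.keys b"
  have "mon val (a + b) = (\<Prod>v\<in>?A. val v ^ Poly_Mapping.lookup (a + b) v)"
    by (rule mon_superset) (auto simp: keys_add)
  also have "\<dots> = (\<Prod>v\<in>?A. val v ^ Poly_Mapping.lookup a v) * (\<Prod>v\<in>?A. val v ^ Poly_Mapping.lookup b v)"
    by (simp add: lookup_add power_add prod.distrib)
  also have "\<dots> = mon val a * mon val b"
    using mon_superset[of ?A a val] mon_superset[of ?A b val] by simp
  finally show ?thesis .
qed

definition pmev :: "(gamma \<Rightarrow> 'b::comm_ring_1) \<Rightarrow> (tzvar \<Rightarrow> 'b) \<Rightarrow> Rinf \<Rightarrow> 'b" where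
  "pmev h val f = (\<Sum>m\<in>Poly_Mapping.keys f. h (Poly_Mapping.lookup f m) * mon val m)"

lemma poly_mapping_sum_single:
  "(\<Sum>m\<in>Poly_Mapping.keys f. Poly_Mapping.single m (Poly_Mapping.lookup f m)) = f"
proof (rule poly_mapping_eqI)
  fix k
  have "Poly_Mapping.lookup (\<Sum>m\<in>Poly_Mapping.keys f. Poly_Mapping.single m (Poly_Mapping.lookup f m)) k
      = (\<Sum>m\<in>Poly_Mapping.keys f. if k = m then Poly_Mapping.lookup f k else 0)"
    by (simp add: lookup_sum lookup_single when_def eq_commute[of _ k] cong: if_cong)
  also have "\<dots> = Poly_Mapping.lookup f k"
    by (subst sum.delta') (auto simp: in_keys_iff)
  finally show "Poly_Mapping.lookup (\<Sum>m\<in>Poly_Mapping.keys f. Poly_Mapping.single m (Poly_Mapping.lookup f m)) k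
      = Poly_Mapping.lookup f k" .
qed

lemma pmev_single: "rhom h \<Longrightarrow> pmev h val (Poly_Mapping.single m c) = h c * mon val m"
  by (cases "c = 0") (auto simp: pmev_def rhom_0)

lemma pmev_superset:
  assumes "rhom h" "finite A" "Poly_Mapping.keys f \<subseteq> A"
  shows "pmev h val f = (\<Sum>m\<in>A. h (Poly_Mapping.lookup f m) * mon val m)"
  unfolding pmev_def
  by (rule sum.mono_neutral_left) (use assms in \<open>auto simp: in_keys_iff rhom_0\<close>)

lemma pmev_add:
  assumes "rhom h"
  shows "pmev h val (f + g) = pmev h val f + pmev h val g"
proof -
  let ?A = "Poly_Mapping.keys f \<union> Poly_Mapping.keys g"
  show ?thesis
    using pmev_superset[OF assms, of ?A f val] pmev_superset[OF assms, of ?A g val]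
      pmev_superset[OF assms, of ?A "f + g" val] keys_add[of f g]
    by (simp add: lookup_add rhom_add[OF assms] distrib_right sum.distrib)
qed

lemma pmev_sum: "rhom h \<Longrightarrow> pmev h val (sum F A) = (\<Sum>x\<in>A. pmev h val (F x))"
  by (induction A rule: infinite_finite_induct) (auto simp: pmev_add, auto simp: pmev_def)

lemma rhom_pmev:
  assumes h: "rhom h"
  shows "rhom (pmev h val)"
proof (rule rhomI)
  show "pmev h val 1 = 1"
    using pmev_single[OF h, of val 0 1] by (simp add: rhom_1[OF h] mon_def)
  show "pmev h val (f + g) = pmev h val f + pmev h val g" for f g by (rule pmev_add[OF h])
  show "pmev h val (f * g) = pmev h val f * pmev h val g" for f g
  proof -
    have "f * g = (\<Sum>m\<in>Poly_Mapping.keys f. \<Sum>n\<in>Poly_Mapping.keys g.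
        Poly_Mapping.single (m + n) (Poly_Mapping.lookup f m * Poly_Mapping.lookup g n))"
      by (subst (1 2) poly_mapping_sum_single[symmetric]) (simp only: sum_product mult_single)
    then have "pmev h val (f * g) = (\<Sum>m\<in>Poly_Mapping.keys f. \<Sum>n\<in>Poly_Mapping.keys g.
        (h (Poly_Mapping.lookup f m) * mon val m) * (h (Poly_Mapping.lookup g n) * mon val n))"
      by (simp add: pmev_sum[OF h] pmev_single[OF h] mon_add rhom_mult[OF h] mult_ac)
    then show ?thesis by (simp only: pmev_def sum_product)
  qed
qed

definition gincl :: "gamma \<Rightarrow> Rinf" where "gincl c = Poly_Mapping.single 0 c"

lemma rhom_gincl: "rhom gincl"
  by (rule rhomI) (auto simp: gincl_def single_add mult_single)

lemma Qr_gincl: "Qr r = gincl (Qg r)"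
  by (simp add: Qr_def gincl_def Qg_def)

lemma Qgf_gincl: "Qgf = fmap gincl Qfg"
  by (rule fps_ext) (simp add: Qgf_def Qfg_def Qr_gincl)

lemma pmev_gincl: "rhom h \<Longrightarrow> pmev h val (gincl c) = h c"
  by (simp add: gincl_def pmev_single mon_def)

lemma Qr_0: "Qr 0 = 1"
  by (simp add: Qr_gincl Qg_0 rhom_1[OF rhom_gincl])

lemma Rinf_induct [case_names one Q t z diff mult]:
  assumes "P 1" "\<And>r. r \<ge> 1 \<Longrightarrow> P (Qr r)" "\<And>i. i \<ge> 1 \<Longrightarrow> P (tv i)" "\<And>i. i \<ge> 1 \<Longrightarrow> P (zv i)"
    and d: "\<And>a b. P a \<Longrightarrow> P b \<Longrightarrow> P (a - b)" and m: "\<And>a b. P a \<Longrightarrow> P b \<Longrightarrow> P (a * b)"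
  shows "P (f :: Rinf)"
proof -
  have c: "P (gincl c)" for c
    by (induction c rule: gamma_induct)
      (use assms in \<open>auto simp: rhom_1[OF rhom_gincl] rhom_diff[OF rhom_gincl] rhom_mult[OF rhom_gincl]
         simp flip: Qr_gincl\<close>)
  have z: "P 0" using d[OF assms(1) assms(1)] by simp
  have a: "P (x + y)" if "P x" "P y" for x y
    using d[OF that(1) d[OF z that(2)]] by simp
  have s: "P (sum F A)" if "\<And>x. x \<in> A \<Longrightarrow> P (F x)" for A and F :: "(tzvar \<Rightarrow>\<^sub>0 nat) \<Rightarrow> Rinf"
    using that by (induction A rule: infinite_finite_induct) (auto intro: a z)
  have v: "P (Poly_Mapping.single (Poly_Mapping.single x 1) 1)" for x
  proof (cases x)
    case (T i)
    with assms(3)[of "Suc i"] show ?thesis by (simp add: tv_def)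
  next
    case (Z i)
    with assms(4)[of "Suc i"] show ?thesis by (simp add: zv_def)
  qed
  have vp: "P (Poly_Mapping.single (Poly_Mapping.single x n) 1)" for x n
  proof (induction n)
    case 0
    then show ?case using assms(1) by simp
  next
    case (Suc n)
    have "Poly_Mapping.single (Poly_Mapping.single x (Suc n)) (1::gamma)
        = Poly_Mapping.single (Poly_Mapping.single x n) 1 * Poly_Mapping.single (Poly_Mapping.single x 1) 1"
      by (simp add: mult_single flip: single_add)
    then show ?case using m[OF Suc v] by metis
  qed
  have mn: "P (Poly_Mapping.single m 1)" for m :: "tzvar \<Rightarrow>\<^sub>0 nat"
  proof -
    have *: "P (Poly_Mapping.single (\<Sum>x\<in>A. Poly_Mapping.single x (Poly_Mapping.lookup m x)) 1)" for A
    proof (induction A rule: infinite_finite_induct)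
      case (insert x A)
      have "Poly_Mapping.single (\<Sum>x\<in>insert x A. Poly_Mapping.single x (Poly_Mapping.lookup m x)) (1::gamma)
          = Poly_Mapping.single (Poly_Mapping.single x (Poly_Mapping.lookup m x)) 1
            * Poly_Mapping.single (\<Sum>x\<in>A. Poly_Mapping.single x (Poly_Mapping.lookup m x)) 1"
        using insert.hyps by (simp add: mult_single)
      then show ?case using m[OF vp insert.IH] by metis
    qed (use assms(1) in auto)
    have "(\<Sum>x\<in>Poly_Mapping.keys m. Poly_Mapping.single x (Poly_Mapping.lookup m x)) = m"
    proof (rule poly_mapping_eqI)
      fix k
      have "Poly_Mapping.lookup (\<Sum>x\<in>Poly_Mapping.keys m. Poly_Mapping.single x (Poly_Mapping.lookup m x)) k
          = (\<Sum>x\<in>Poly_Mapping.keys m. if k = x then Poly_Mapping.lookup m k else 0)"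
        by (simp add: lookup_sum lookup_single when_def eq_commute[of _ k] cong: if_cong)
      also have "\<dots> = Poly_Mapping.lookup m k"
        by (subst sum.delta') (auto simp: in_keys_iff)
      finally show "Poly_Mapping.lookup (\<Sum>x\<in>Poly_Mapping.keys m. Poly_Mapping.single x (Poly_Mapping.lookup m x)) k
          = Poly_Mapping.lookup m k" .
    qed
    with *[of "Poly_Mapping.keys m"] show ?thesis by simp
  qed
  have "P (Poly_Mapping.single m c)" for m c
  proof -
    have "Poly_Mapping.single m c = gincl c * Poly_Mapping.single m 1"
      by (simp add: gincl_def mult_single)
    then show ?thesis using m[OF c mn] by metis
  qed
  then have "P (\<Sum>m\<in>Poly_Mapping.keys f. Poly_Mapping.single m (Poly_Mapping.lookup f m))"
    by (intro s)
  then show ?thesis by (simp only: poly_mapping_sum_single)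
qed

text \<open>The uniqueness half of a universal property, and the way in which identities between
  homomorphisms are checked below. Comparing all Q_r at once through their generating function keeps
  the factors (1 + bu) / (1 - bu) visible.\<close>

lemma rhom_eqI:
  assumes h: "rhom h" and g: "rhom g"
    and "fmap h Qgf = fmap g Qgf" "\<And>i. i \<ge> 1 \<Longrightarrow> h (tv i) = g (tv i)" "\<And>i. i \<ge> 1 \<Longrightarrow> h (zv i) = g (zv i)"
  shows "h = g"
proof
  fix f
  have Q: "h (Qr r) = g (Qr r)" for r
    using arg_cong[OF assms(3), of "\<lambda>F. fps_nth F r"] by (simp add: Qgf_def)
  show "h f = g f"
    by (induction f rule: Rinf_induct)
      (use assms Q in \<open>auto simp: rhom_1[OF h] rhom_1[OF g] rhom_diff[OF h] rhom_diff[OF g] rhom_mult[OF h] rhom_mult[OF g]\<close>)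
qed

text \<open>The existence half. The values \<open>vt\<close> and \<open>vz\<close> are numbered from
  1 like the variables, the constructors \<open>T\<close> and \<open>Z\<close> from 0.\<close>

definition mkhom :: "(gamma \<Rightarrow> 'b::comm_ring_1) \<Rightarrow> (nat \<Rightarrow> 'b) \<Rightarrow> (nat \<Rightarrow> 'b) \<Rightarrow> Rinf \<Rightarrow> 'b" where
  "mkhom h vt vz = pmev h (case_tzvar (\<lambda>i. vt (Suc i)) (\<lambda>i. vz (Suc i)))"

lemma
  assumes h: "rhom h"
  shows rhom_mkhom: "rhom (mkhom h vt vz)"
    and mkhom_Q: "fmap (mkhom h vt vz) Qgf = fmap h Qfg"
    and mkhom_t: "i \<ge> 1 \<Longrightarrow> mkhom h vt vz (tv i) = vt i"
    and mkhom_z: "i \<ge> 1 \<Longrightarrow> mkhom h vt vz (zv i) = vz i"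
proof -
  show "rhom (mkhom h vt vz)" unfolding mkhom_def by (rule rhom_pmev[OF h])
  show "fmap (mkhom h vt vz) Qgf = fmap h Qfg"
    by (rule fps_ext) (simp add: mkhom_def Qgf_gincl pmev_gincl[OF h])
  show "i \<ge> 1 \<Longrightarrow> mkhom h vt vz (tv i) = vt i" "i \<ge> 1 \<Longrightarrow> mkhom h vt vz (zv i) = vz i"
    by (auto simp: mkhom_def tv_def zv_def pmev_single[OF h] rhom_1[OF h] mon_def)
qed

subsection \<open>The automorphisms\<close>

text \<open>An explicit model of the automorphism that \<open>sz\<close> selects by a definite
  description. For i = 0 the added x-value z_1 produces the prescribed factor of the
  Q-series.\<close>

definition szh :: "nat \<Rightarrow> Rinf \<Rightarrow> Rinf" where
  "szh i = mkhom (if i = 0 then hsub gincl (zv 1) else gincl) tv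
     (if i = 0 then zv(1 := - zv 1) else (\<lambda>j. zv (transpose i (i + 1) j)))"

lemma lin_geom_cancel: "lin (- a) * geom a = 1"
  using geom_inverse[of a] by (simp add: lin_def flip: fps_const_neg)

lemma lin_geom_cancel': "lin a * geom (- a) = 1"
  using lin_geom_cancel[of "- a"] by simp

lemma rhom_szh: "rhom (szh i)"
  unfolding szh_def by (intro rhom_mkhom) (simp add: rhom_gincl rhom_hsub)

lemma szh_t: "j \<ge> 1 \<Longrightarrow> szh i (tv j) = tv j"
  unfolding szh_def by (intro mkhom_t) (simp_all add: rhom_gincl rhom_hsub)

lemma szh_0_z: "szh 0 (zv (Suc 0)) = - zv 1" "j \<ge> 2 \<Longrightarrow> szh 0 (zv j) = zv j"
  unfolding szh_def by (subst mkhom_z; simp add: rhom_gincl rhom_hsub)+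

lemma szh_z: "i \<ge> 1 \<Longrightarrow> j \<ge> 1 \<Longrightarrow> szh i (zv j) = zv (transpose i (i + 1) j)"
  unfolding szh_def by (subst mkhom_z; simp add: rhom_gincl rhom_hsub)+

lemma szh_0_Q: "fmap (szh 0) Qgf = lin (zv 1) * geom (zv 1) * Qgf"
  unfolding szh_def by (subst mkhom_Q) (simp_all add: rhom_gincl rhom_hsub fmap_hsub Qgf_gincl)

lemma szh_Q: "i \<ge> 1 \<Longrightarrow> fmap (szh i) Qgf = Qgf"
  unfolding szh_def by (subst mkhom_Q) (simp_all add: rhom_gincl rhom_hsub Qgf_gincl)

lemma fmap_comp: "fmap h (fmap g F) = fmap (\<lambda>x. h (g x)) F"
  by (rule fps_ext) simp

lemma fmap_id: "fmap (\<lambda>x. x) F = F"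
  by (rule fps_ext) simp

lemma transpose_ge_1: "i \<ge> 1 \<Longrightarrow> j \<ge> 1 \<Longrightarrow> transpose i (i + 1) j \<ge> (1::nat)"
  by (simp add: transpose_def)

text \<open>For i = 0 the second application meets z_1 with the opposite sign, so the two factors of
  the Q-series are reciprocal. Being an involution also gives the bijectivity that
  \<open>ring_aut\<close> demands.\<close>

lemma szh_szh: "szh i (szh i f) = f"
proof -
  have "(\<lambda>f. szh i (szh i f)) = (\<lambda>f. f)"
  proof (rule rhom_eqI[OF rhom_comp[OF rhom_szh rhom_szh] rhom_id])
    show "fmap (\<lambda>f. szh i (szh i f)) Qgf = fmap (\<lambda>f. f) Qgf"
    proof (cases "i = 0")
      case True
      have "fmap (szh 0) (fmap (szh 0) Qgf) = lin (- zv 1) * geom (- zv 1) * (lin (zv 1) * geom (zv 1) * Qgf)"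
        unfolding szh_0_Q using rhom_szh[of 0] rhom_minus[OF rhom_szh[of 0]]
        by (simp add: fmap_mult fmap_lin fmap_geom szh_0_z szh_0_Q[simplified])
      also have "\<dots> = (lin (- zv 1) * geom (zv 1)) * (lin (zv 1) * geom (- zv 1)) * Qgf"
        by (simp only: mult_ac)
      finally show ?thesis by (simp add: True lin_geom_cancel lin_geom_cancel' fmap_comp fmap_id)
    next
      case False
      then have "fmap (szh i) (fmap (szh i) Qgf) = Qgf" by (simp add: szh_Q)
      then show ?thesis by (simp add: fmap_comp fmap_id)
    qed
    show "szh i (szh i (tv j)) = tv j" if "j \<ge> 1" for j using that by (simp add: szh_t)
    show "szh i (szh i (zv j)) = zv j" if "j \<ge> 1" for j
    proof (cases "i = 0")
      case True
      then show ?thesis using that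
        by (cases "j = 1") (auto simp: szh_0_z rhom_minus[OF rhom_szh])
    next
      case False
      then show ?thesis using that transpose_ge_1[of i j] by (simp add: szh_z)
    qed
  qed
  then show ?thesis by (rule fun_cong)
qed

lemma ring_aut_iff: "ring_aut h \<longleftrightarrow> bij h \<and> rhom h"
  by (auto simp: ring_aut_def rhom_def)

lemma Qr_fmapD: "fmap h Qgf = F \<Longrightarrow> h (Qr r) = fps_nth F r"
  by (metis Qgf_def fmap_nth fps_nth_Abs_fps)

lemma fmap_Qgf: "Abs_fps (\<lambda>r. h (Qr r)) = fmap h Qgf"
  by (simp add: fmap_def Qgf_def)

lemma sz_szh: "sz i = szh i"
  unfolding sz_def
proof (rule the_equality)
  have "bij (szh i)" by (rule involuntory_imp_bij) (rule szh_szh)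
  moreover have "szh i (Qr r) = Qr r" if "i \<ge> 1" for r
    using Qr_fmapD[OF szh_Q[OF that]] by (simp add: Qgf_def)
  ultimately show "ring_aut (szh i) \<and> (\<forall>j\<ge>1. szh i (tv j) = tv j) \<and>
     (if i = 0 then
        szh i (zv 1) = - zv 1 \<and> (\<forall>j\<ge>2. szh i (zv j) = zv j) \<and>
        Abs_fps (\<lambda>r. szh i (Qr r)) = lin (zv 1) * geom (zv 1) * Qgf
      else
        (\<forall>j\<ge>1. szh i (zv j) = zv (transpose i (i + 1) j)) \<and> (\<forall>r. szh i (Qr r) = Qr r))"
    using szh_0_Q by (auto simp: ring_aut_iff rhom_szh szh_t szh_0_z szh_z fmap_Qgf)
next
  fix \<phi>
  assume *: "ring_aut \<phi> \<and> (\<forall>j\<ge>1. \<phi> (tv j) = tv j) \<and>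
     (if i = 0 then
        \<phi> (zv 1) = - zv 1 \<and> (\<forall>j\<ge>2. \<phi> (zv j) = zv j) \<and>
        Abs_fps (\<lambda>r. \<phi> (Qr r)) = lin (zv 1) * geom (zv 1) * Qgf
      else
        (\<forall>j\<ge>1. \<phi> (zv j) = zv (transpose i (i + 1) j)) \<and> (\<forall>r. \<phi> (Qr r) = Qr r))"
  show "\<phi> = szh i"
  proof (rule rhom_eqI[OF _ rhom_szh])
    show "rhom \<phi>" using * by (simp add: ring_aut_iff)
    show "fmap \<phi> Qgf = fmap (szh i) Qgf"
    proof (cases "i = 0")
      case True
      then show ?thesis using * by (simp add: szh_0_Q fmap_Qgf)
    next
      case False
      then show ?thesis using * szh_Q[of i] by (auto intro!: fps_ext simp: Qgf_def)
    qed
    show "\<phi> (tv j) = szh i (tv j)" if "j \<ge> 1" for j using * that by (simp add: szh_t)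
    show "\<phi> (zv j) = szh i (zv j)" if "j \<ge> 1" for j
    proof (cases "i = 0")
      case True
      then show ?thesis using * that by (cases "j = 1") (auto simp: szh_0_z)
    next
      case False
      then show ?thesis using * that by (simp add: szh_z)
    qed
  qed
qed

lemmas rhom_sz = rhom_szh[folded sz_szh]
  and sz_t = szh_t[folded sz_szh]
  and sz_0_z = szh_0_z[folded sz_szh]
  and sz_z = szh_z[folded sz_szh]
  and sz_0_Q = szh_0_Q[folded sz_szh]
  and sz_Q = szh_Q[folded sz_szh]
  and sz_sz = szh_szh[folded sz_szh]

definition omh :: "Rinf \<Rightarrow> Rinf" where
  "omh = mkhom gincl (\<lambda>j. - zv j) (\<lambda>j. - tv j)"

lemma rhom_omh: "rhom omh"
  unfolding omh_def by (rule rhom_mkhom[OF rhom_gincl])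
lemma omh_t: "j \<ge> 1 \<Longrightarrow> omh (tv j) = - zv j"
  unfolding omh_def by (rule mkhom_t[OF rhom_gincl])
lemma omh_z: "j \<ge> 1 \<Longrightarrow> omh (zv j) = - tv j"
  unfolding omh_def by (rule mkhom_z[OF rhom_gincl])
lemma omh_Q: "fmap omh Qgf = Qgf"
  unfolding omh_def by (subst mkhom_Q) (simp_all add: rhom_gincl Qgf_gincl)

lemma omh_omh: "omh (omh f) = f"
proof -
  have "(\<lambda>f. omh (omh f)) = (\<lambda>f. f)"
  proof (rule rhom_eqI[OF rhom_comp[OF rhom_omh rhom_omh] rhom_id])
    have "fmap omh (fmap omh Qgf) = Qgf" by (simp add: omh_Q)
    then show "fmap (\<lambda>f. omh (omh f)) Qgf = fmap (\<lambda>f. f) Qgf" by (simp add: fmap_comp fmap_id)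
  qed (auto simp: omh_t omh_z rhom_minus[OF rhom_omh])
  then show ?thesis by (rule fun_cong)
qed

lemma omega_omh: "omega = omh"
  unfolding omega_def
proof (rule the_equality)
  have "bij omh" by (rule involuntory_imp_bij) (rule omh_omh)
  moreover have "omh (Qr r) = Qr r" for r
    using Qr_fmapD[OF omh_Q] by (simp add: Qgf_def)
  ultimately show "ring_aut omh \<and> (\<forall>j\<ge>1. omh (tv j) = - zv j) \<and> (\<forall>j\<ge>1. omh (zv j) = - tv j) \<and>
     (\<forall>r. omh (Qr r) = Qr r)"
    by (auto simp: ring_aut_iff rhom_omh omh_t omh_z)
next
  fix \<phi>
  assume *: "ring_aut \<phi> \<and> (\<forall>j\<ge>1. \<phi> (tv j) = - zv j) \<and> (\<forall>j\<ge>1. \<phi> (zv j) = - tv j) \<and>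
     (\<forall>r. \<phi> (Qr r) = Qr r)"
  show "\<phi> = omh"
    by (rule rhom_eqI[OF _ rhom_omh])
      (use * omh_Q in \<open>auto simp: ring_aut_iff omh_t omh_z Qgf_def intro!: fps_ext\<close>)
qed

lemmas rhom_omega = rhom_omh[folded omega_omh]
  and omega_t = omh_t[folded omega_omh]
  and omega_z = omh_z[folded omega_omh]
  and omega_Q = omh_Q[folded omega_omh]
  and omega_omega = omh_omh[folded omega_omh]

lemma st_eq: "st i f = omega (sz i (omega f))"
  by (simp add: st_def)

lemma rhom_st: "rhom (st i)"
  unfolding st_def comp_def
  by (rule rhom_comp[OF rhom_omega rhom_comp[OF rhom_sz rhom_omega]])

lemma st_z: "j \<ge> 1 \<Longrightarrow> st i (zv j) = zv j"
  by (simp add: st_eq omega_z omega_t rhom_minus[OF rhom_omega] rhom_minus[OF rhom_sz] sz_t)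

lemma st_0_t: "st 0 (tv (Suc 0)) = - tv 1" "j \<ge> 2 \<Longrightarrow> st 0 (tv j) = tv j"
  by (simp_all add: st_eq omega_z omega_t rhom_minus[OF rhom_omega] rhom_minus[OF rhom_sz] sz_0_z)

lemma st_t: "i \<ge> 1 \<Longrightarrow> j \<ge> 1 \<Longrightarrow> st i (tv j) = tv (transpose i (i + 1) j)"
  using transpose_ge_1[of i j]
  by (simp add: st_eq omega_z omega_t rhom_minus[OF rhom_omega] rhom_minus[OF rhom_sz] sz_z)

text \<open>The minus signs come from \<open>omega\<close>, which sends z_1 to -t_1.\<close>

lemma st_0_Q: "fmap (st 0) Qgf = lin (- tv 1) * geom (- tv 1) * Qgf"
proof -
  have "fmap omega (fmap (sz 0) (fmap omega Qgf)) = lin (- tv 1) * geom (- tv 1) * Qgf"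
    by (simp add: omega_Q sz_0_Q[simplified] fmap_mult[OF rhom_omega] fmap_lin[OF rhom_omega] fmap_geom[OF rhom_omega] omega_z)
  then show ?thesis by (simp add: fmap_comp st_eq[abs_def])
qed

lemma st_Q: "i \<ge> 1 \<Longrightarrow> fmap (st i) Qgf = Qgf"
proof -
  assume "i \<ge> 1"
  then have "fmap omega (fmap (sz i) (fmap omega Qgf)) = Qgf"
    by (simp add: omega_Q sz_Q)
  then show ?thesis by (simp add: fmap_comp st_eq[abs_def])
qed

subsection \<open>Non-zero-divisors\<close>

text \<open>Cancelling particular linear forms is all that exact quotients and the triangularity
  arguments require, so this notion stands in for a proof that the ring is a domain.\<close>

definition nzd :: "'a::comm_ring_1 \<Rightarrow> bool" where
  "nzd g \<longleftrightarrow> (\<forall>f. g * f = 0 \<longrightarrow> f = 0)"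

lemma nzdD: "nzd g \<Longrightarrow> g * f = 0 \<Longrightarrow> f = 0"
  by (simp add: nzd_def)

lemma nzd_mult: "nzd g \<Longrightarrow> nzd h \<Longrightarrow> nzd (g * h)"
  unfolding nzd_def mult.assoc by blast

lemma nzd_minus: "nzd g \<Longrightarrow> nzd (- g)"
  by (simp add: nzd_def)

lemma nzd_1: "nzd 1"
  by (simp add: nzd_def)

definition pvar :: "tzvar \<Rightarrow> Rinf" where
  "pvar v = Poly_Mapping.single (Poly_Mapping.single v 1) 1"

lemma pvar_mult_single:
  "pvar v * Poly_Mapping.single m c = Poly_Mapping.single (m + Poly_Mapping.single v 1) c"
  by (simp add: pvar_def mult_single add.commute)

lemma lookup_pvar_mult:
  "Poly_Mapping.lookup (pvar v * f) k =
     (if Poly_Mapping.lookup k v > 0 then Poly_Mapping.lookup f (k - Poly_Mapping.single v 1) else 0)"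
proof -
  let ?e = "Poly_Mapping.single v (1::nat)"
  have key: "k = m + ?e \<longleftrightarrow> Poly_Mapping.lookup k v > 0 \<and> m = k - ?e" for m
  proof
    assume "k = m + ?e"
    then show "Poly_Mapping.lookup k v > 0 \<and> m = k - ?e" by (simp add: lookup_add)
  next
    assume *: "Poly_Mapping.lookup k v > 0 \<and> m = k - ?e"
    show "k = m + ?e"
      by (rule poly_mapping_eqI) (use * in \<open>auto simp: lookup_add lookup_minus lookup_single when_def\<close>)
  qed
  have "pvar v * f = (\<Sum>m\<in>Poly_Mapping.keys f. Poly_Mapping.single (m + ?e) (Poly_Mapping.lookup f m))"
    by (subst poly_mapping_sum_single[symmetric, of f]) (simp only: sum_distrib_left pvar_mult_single)
  then have "Poly_Mapping.lookup (pvar v * f) k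
      = (\<Sum>m\<in>Poly_Mapping.keys f. if Poly_Mapping.lookup k v > 0 \<and> m = k - ?e then Poly_Mapping.lookup f m else 0)"
    by (simp add: lookup_sum lookup_single when_def eq_commute[of _ k] key del: One_nat_def)
  also have "\<dots> = (if Poly_Mapping.lookup k v > 0 then Poly_Mapping.lookup f (k - ?e) else 0)"
    by (cases "Poly_Mapping.lookup k v > 0") (auto simp: sum.delta in_keys_iff)
  finally show ?thesis .
qed

lemma lookup_pvar_mult_add:
  "Poly_Mapping.lookup (pvar v * f) (k + Poly_Mapping.single v 1) = Poly_Mapping.lookup f k"
  by (simp add: lookup_pvar_mult lookup_add)

text \<open>If the product is 0, the coefficient of f at k agrees up to sign with the one at k plus
  \<open>v\<close> minus \<open>v'\<close>. Following this, the exponent of \<open>v'\<close>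
  decreases until it is 0, where the coefficient has to vanish.\<close>

lemma nzd_pvar_add:
  assumes "v \<noteq> v'" "s = 1 \<or> s = - 1"
  shows "nzd (pvar v + s * pvar v')"
  unfolding nzd_def
proof (intro allI impI)
  fix f assume f: "(pvar v + s * pvar v') * f = 0"
  then have eq: "pvar v * f = - (s * (pvar v' * f))"
    by (simp add: distrib_right mult.assoc eq_neg_iff_add_eq_0)
  have look: "Poly_Mapping.lookup (pvar v * f) k = 0" if "Poly_Mapping.lookup (pvar v' * f) k = 0" for k
    using that assms(2) unfolding eq by auto
  have "Poly_Mapping.lookup f k = 0" for k
  proof (induction "Poly_Mapping.lookup k v'" arbitrary: k)
    case 0
    then show ?case
      using look[of "k + Poly_Mapping.single v 1"] assms(1)
      by (simp only: lookup_pvar_mult_add) (simp add: lookup_pvar_mult lookup_add lookup_single when_def)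
  next
    case (Suc n)
    let ?k = "k + Poly_Mapping.single v 1 - Poly_Mapping.single v' 1"
    have "Poly_Mapping.lookup ?k v' = n"
      using Suc.hyps(2) assms(1) by (simp add: lookup_minus lookup_add lookup_single when_def)
    then have "Poly_Mapping.lookup f ?k = 0" using Suc.hyps(1) by auto
    then have "Poly_Mapping.lookup (pvar v' * f) (k + Poly_Mapping.single v 1) = 0"
      by (simp add: lookup_pvar_mult)
    from look[OF this] show ?case by (simp only: lookup_pvar_mult_add)
  qed
  then show "f = 0" by (intro poly_mapping_eqI) simp
qed

lemma gamma_2: "2 * c = 0 \<Longrightarrow> c = (0 :: gamma)"
proof -
  assume *: "2 * c = 0"
  have "xcoeff (series_of_gamma c) m = 0" for m
    using arg_cong[OF *, of "\<lambda>c. xcoeff (series_of_gamma c) m"]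
    by (simp add: series_2 xcoeff_2 zero_gamma.rep_eq zero_xseries.rep_eq)
  then have "series_of_gamma c = series_of_gamma 0"
    by (intro xseries_eqI) (simp add: zero_gamma.rep_eq zero_xseries.rep_eq)
  then show ?thesis by (simp add: series_of_gamma_inject)
qed

lemma nzd_2_pvar: "nzd (2 * pvar v)"
  unfolding nzd_def
proof (intro allI impI)
  fix f assume f: "2 * pvar v * f = 0"
  then have f: "pvar v * f + pvar v * f = 0" by (simp only: mult_2 distrib_right)
  have "Poly_Mapping.lookup f k = 0" for k
  proof -
    have "Poly_Mapping.lookup f k + Poly_Mapping.lookup f k = 0"
      using arg_cong[OF f, of "\<lambda>h. Poly_Mapping.lookup h (k + Poly_Mapping.single v 1)"]
      by (simp only: lookup_add lookup_pvar_mult_add lookup_zero)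
    then show ?thesis by (rule gamma_2[OF mult_2[THEN trans]])
  qed
  then show "f = 0" by (intro poly_mapping_eqI) simp
qed

lemma tv_pvar: "tv i = pvar (T (i - 1))" and zv_pvar: "zv i = pvar (Z (i - 1))"
  by (simp_all add: tv_def zv_def pvar_def)

lemma nzd_alpha: "nzd (alpha i)"
proof (cases "i = 0")
  case True
  then show ?thesis using nzd_2_pvar[of "T 0"] by (simp add: alpha_def tv_pvar)
next
  case False
  then show ?thesis using nzd_pvar_add[of "T i" "T (i - 1)" "- 1"] by (simp add: alpha_def tv_pvar)
qed

lemma nzd_omega: "nzd g \<Longrightarrow> nzd (omega g)"
  unfolding nzd_def
proof (intro allI impI)
  fix f assume *: "\<forall>f. g * f = 0 \<longrightarrow> f = 0" and f: "omega g * f = 0"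
  have "g * omega f = omega (omega g * f)"
    by (simp add: rhom_mult[OF rhom_omega] omega_omega)
  then have "omega f = 0" using * f by (simp add: rhom_0[OF rhom_omega])
  then show "f = 0" by (metis omega_omega rhom_0[OF rhom_omega])
qed

subsection \<open>Divided differences\<close>

lemma exact_quot_eq:
  assumes "nzd g" "g * h = f"
  shows "exact_quot f g = h"
  unfolding exact_quot_def
proof (rule the_equality)
  show "g * h = f" by (rule assms(2))
  fix h' assume "g * h' = f"
  then have "g * (h' - h) = 0" using assms(2) by (simp add: right_diff_distrib)
  then show "h' = h" using nzdD[OF assms(1)] by fastforce
qed

abbreviation beta :: "nat \<Rightarrow> Rinf" where "beta i \<equiv> omega (alpha i)"

lemma beta_0: "beta 0 = - 2 * zv 1"
  by (simp add: alpha_def rhom_mult[OF rhom_omega] rhom_numeral[OF rhom_omega] omega_t)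

lemma beta_Suc: "i \<ge> 1 \<Longrightarrow> beta i = zv i - zv (i + 1)"
  by (simp add: alpha_def rhom_diff[OF rhom_omega] omega_t)

text \<open>The identity fg - s(fg) = (f - s f) g + s f (g - s g) reduces divisibility to
  generators. The only one that is not immediate is Q_r for i = 0, where each term of the difference
  carries 2 z_1^j with j at least 1.\<close>

lemma sz_dvd: "beta i dvd f - sz i f"
proof (induction f rule: Rinf_induct)
  case one
  then show ?case by (simp add: rhom_1[OF rhom_sz])
next
  case (Q r)
  show ?case
  proof (cases "i = 0")
    case True
    have "sz 0 (Qr r) = (\<Sum>j=0..r. (if j = 0 then 1 else 2 * zv 1 ^ j) * Qr (r - j))"
      unfolding Qr_fmapD[OF sz_0_Q, of r] fps_mult_nth[of "lin (zv 1) * geom (zv 1)" Qgf]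
      by (simp add: lin_geom_nth Qgf_def del: One_nat_def)
    also have "\<dots> = Qr r + (\<Sum>j=1..r. 2 * zv 1 ^ j * Qr (r - j))"
      by (simp add: sum.atLeast_Suc_atMost)
    finally have "Qr r - sz 0 (Qr r) = - (\<Sum>j=1..r. 2 * zv 1 ^ j * Qr (r - j))" by simp
    moreover have "beta 0 dvd (\<Sum>j=1..r. 2 * zv 1 ^ j * Qr (r - j))"
    proof (rule dvd_sum)
      fix j assume "j \<in> {1..r}"
      then obtain j' where "j = Suc j'" by (cases j) auto
      then have "2 * zv 1 ^ j * Qr (r - j) = beta 0 * (- (zv 1 ^ j') * Qr (r - j))"
        by (simp add: beta_0 mult_ac)
      then show "beta 0 dvd 2 * zv 1 ^ j * Qr (r - j)" by (metis dvd_triv_left)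
    qed
    ultimately show ?thesis using True by simp
  next
    case False
    then show ?thesis using Qr_fmapD[OF sz_Q, of i r] by (simp add: Qgf_def)
  qed
next
  case (t j)
  then show ?case by (simp add: sz_t)
next
  case (z j)
  show ?case
  proof (cases "i = 0")
    case True
    show ?thesis
    proof (cases "j = 1")
      case True
      have "zv 1 - sz 0 (zv 1) = beta 0 * (- 1)" by (simp add: sz_0_z beta_0)
      then show ?thesis using True \<open>i = 0\<close> by (metis dvd_triv_left)
    qed (use z True in \<open>simp add: sz_0_z\<close>)
  next
    case False
    then have i: "i \<ge> 1" by simp
    consider "j = i" | "j = i + 1" | "j \<noteq> i" "j \<noteq> i + 1" by blast
    then show ?thesis
    proof cases
      case 2
      have "zv j - sz i (zv j) = beta i * (- 1)"
        using i 2 z by (simp add: sz_z beta_Suc)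
      then show ?thesis by (metis dvd_triv_left)
    qed (use i z in \<open>simp_all add: sz_z beta_Suc transpose_apply_other\<close>)
  qed
next
  case (diff a b)
  have "a - b - sz i (a - b) = (a - sz i a) - (b - sz i b)"
    by (simp add: rhom_diff[OF rhom_sz])
  then show ?case using diff by (metis dvd_diff)
next
  case (mult a b)
  have "a * b - sz i (a * b) = (a - sz i a) * b + sz i a * (b - sz i b)"
    by (simp add: rhom_mult[OF rhom_sz] algebra_simps)
  then show ?case using mult by (metis dvd_add dvd_mult dvd_mult2)
qed

lemma nzd_beta: "nzd (beta i)"
  by (rule nzd_omega[OF nzd_alpha])

lemma beta_ddz: "beta i * ddz i f = f - sz i f"
proof -
  obtain h where "f - sz i f = beta i * h" using sz_dvd by (rule dvdE)
  then show ?thesis unfolding ddz_def using exact_quot_eq[OF nzd_beta] by metis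
qed

lemma ddz_eqI: "beta i * h = f - sz i f \<Longrightarrow> ddz i f = h"
  unfolding ddz_def by (rule exact_quot_eq[OF nzd_beta])

text \<open>Conjugation by \<open>omega\<close> transports the z-side, so divisibility is not shown
  a second time.\<close>

lemma alpha_ddt: "alpha i * ddt i f = f - st i f"
proof -
  have "omega (beta i * ddz i (omega f)) = omega (omega f - sz i (omega f))"
    by (simp only: beta_ddz)
  then have "alpha i * omega (ddz i (omega f)) = f - st i f"
    by (simp add: rhom_mult[OF rhom_omega] rhom_diff[OF rhom_omega] omega_omega st_eq)
  then show ?thesis unfolding ddt_def using exact_quot_eq[OF nzd_alpha] by metis
qed

lemma ddt_eqI: "alpha i * h = f - st i f \<Longrightarrow> ddt i f = h"
  unfolding ddt_def by (rule exact_quot_eq[OF nzd_alpha])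

lemma sz_ddz: "sz i f = f - beta i * ddz i f"
  by (simp add: beta_ddz)
lemma st_ddt: "st i f = f - alpha i * ddt i f"
  by (simp add: alpha_ddt)

lemma ddz_add: "ddz i (f + g) = ddz i f + ddz i g"
  by (rule ddz_eqI) (simp add: distrib_left beta_ddz rhom_add[OF rhom_sz])
lemma ddz_diff: "ddz i (f - g) = ddz i f - ddz i g"
  by (rule ddz_eqI) (simp add: right_diff_distrib beta_ddz rhom_diff[OF rhom_sz])
lemma ddz_lin: "sz i a = a \<Longrightarrow> ddz i (a * f) = a * ddz i f"
proof (rule ddz_eqI)
  assume a: "sz i a = a"
  have "beta i * (a * ddz i f) = a * (beta i * ddz i f)" by (simp only: mult_ac)
  then show "beta i * (a * ddz i f) = a * f - sz i (a * f)"
    by (simp add: beta_ddz rhom_mult[OF rhom_sz] a right_diff_distrib)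
qed
lemma ddt_lin: "st i a = a \<Longrightarrow> ddt i (a * f) = a * ddt i f"
proof (rule ddt_eqI)
  assume a: "st i a = a"
  have "alpha i * (a * ddt i f) = a * (alpha i * ddt i f)" by (simp only: mult_ac)
  then show "alpha i * (a * ddt i f) = a * f - st i (a * f)"
    by (simp add: alpha_ddt rhom_mult[OF rhom_st] a right_diff_distrib)
qed
lemma ddz_mult: "ddz i (f * g) = ddz i f * g + sz i f * ddz i g"
proof (rule ddz_eqI)
  have "beta i * (ddz i f * g + sz i f * ddz i g) = (beta i * ddz i f) * g + sz i f * (beta i * ddz i g)"
    by (simp add: algebra_simps)
  also have "\<dots> = f * g - sz i (f * g)"
    unfolding beta_ddz by (simp add: rhom_mult[OF rhom_sz] algebra_simps)
  finally show "beta i * (ddz i f * g + sz i f * ddz i g) = f * g - sz i (f * g)" .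
qed
lemma ddz_0: "ddz i 0 = 0"
  by (rule ddz_eqI) (simp add: rhom_0[OF rhom_sz])
lemma ddt_0: "ddt i 0 = 0"
  by (rule ddt_eqI) (simp add: rhom_0[OF rhom_st])
lemma ddz_sum: "ddz i (sum F A) = (\<Sum>x\<in>A. ddz i (F x))"
  by (induction A rule: infinite_finite_induct) (auto simp: ddz_0 ddz_add)
lemma ddz_sz_fixed: "sz i f = f \<Longrightarrow> ddz i f = 0"
  by (rule ddz_eqI) simp
lemma Zt_sz: "a \<in> Zt \<Longrightarrow> sz i a = a"
  unfolding Zt_def
  by (induction rule: subring_gen.induct)
    (auto simp: sz_t rhom_1[OF rhom_sz] rhom_diff[OF rhom_sz] rhom_mult[OF rhom_sz])

section \<open>Length and inversions in the hyperoctahedral group\<close>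

lemma gen_0: "gen 0 x = (if x = 1 then - 1 else if x = - 1 then 1 else x)"
  by (simp add: gen_def transpose_def)

lemma gen_pos: "i \<ge> 1 \<Longrightarrow> gen i x = (if x = int i then int i + 1 else if x = int i + 1 then int i
    else if x = - int i then - (int i + 1) else if x = - (int i + 1) then - int i else x)"
  by (auto simp: gen_def transpose_def)

lemma gen_gen [simp]: "gen i (gen i x) = x"
  by (cases "i = 0") (auto simp: gen_0 gen_pos)

lemma gen_comp_gen: "gen i \<circ> gen i = id"
  by (rule ext) simp

lemma gen_minus: "gen i (- x) = - gen i x"
  by (cases "i = 0") (auto simp: gen_0 gen_pos)

lemma W_infI: "bij w \<Longrightarrow> (\<And>i. w (- i) = - w i) \<Longrightarrow> finite {i. w i \<noteq> i} \<Longrightarrow> w \<in> W_inf"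
  by (simp add: W_inf_def)

lemma W_infD:
  assumes "w \<in> W_inf"
  shows W_inf_bij: "bij w" and W_inf_minus: "w (- i) = - w i" and W_inf_fin: "finite {i. w i \<noteq> i}"
    and W_inf_inj: "w i = w j \<longleftrightarrow> i = j"
  using assms by (auto simp: W_inf_def bij_def inj_def)

lemma W_inf_0: "w \<in> W_inf \<Longrightarrow> w 0 = 0"
  using W_inf_minus[of w 0] by simp

lemma W_inf_eq_0: "w \<in> W_inf \<Longrightarrow> w i = 0 \<longleftrightarrow> i = 0"
  using W_inf_0[of w] W_inf_inj[of w i 0] by auto

lemma W_inf_id: "id \<in> W_inf"
  by (rule W_infI) auto

lemma W_inf_gen: "gen i \<in> W_inf"
proof (rule W_infI)
  show "bij (gen i)" by (rule involuntory_imp_bij) simp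
  show "finite {x. gen i x \<noteq> x}"
    by (rule finite_subset[of _ "{-1, 1, int i, int i + 1, - int i, - (int i + 1)}"])
      (cases "i = 0"; auto simp: gen_0 gen_pos split: if_splits)+
qed (simp add: gen_minus)

lemma W_inf_comp: "w \<in> W_inf \<Longrightarrow> v \<in> W_inf \<Longrightarrow> w \<circ> v \<in> W_inf"
proof (rule W_infI)
  assume w: "w \<in> W_inf" "v \<in> W_inf"
  show "bij (w \<circ> v)" using w by (intro bij_comp W_inf_bij)
  show "(w \<circ> v) (- i) = - (w \<circ> v) i" for i using w by (simp add: W_inf_minus)
  have "{i. (w \<circ> v) i \<noteq> i} \<subseteq> {i. w i \<noteq> i} \<union> {i. v i \<noteq> i}" by auto
  then show "finite {i. (w \<circ> v) i \<noteq> i}"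
    by (rule finite_subset) (use w W_inf_fin in blast)
qed

lemma W_inf_inv: "w \<in> W_inf \<Longrightarrow> inv w \<in> W_inf"
proof (rule W_infI)
  assume w: "w \<in> W_inf"
  note b = W_inf_bij[OF w]
  show "bij (inv w)" by (rule bij_imp_bij_inv[OF b])
  have ww: "w (inv w i) = i" for i using b by (simp add: bij_is_surj surj_f_inv_f)
  show "inv w (- i) = - inv w i" for i
    using ww W_inf_minus[OF w] W_inf_inj[OF w] by metis
  have "{i. inv w i \<noteq> i} = {i. w i \<noteq> i}"
    using ww W_inf_inj[OF w] by (metis (no_types, lifting))
  then show "finite {i. inv w i \<noteq> i}" using W_inf_fin[OF w] by simp
qed

lemma W_inf_bound:
  assumes w: "w \<in> W_inf"
  obtains N :: int where "N \<ge> 0" "\<And>i. \<bar>i\<bar> > N \<Longrightarrow> w i = i" "\<And>i. \<bar>i\<bar> \<le> N \<Longrightarrow> \<bar>w i\<bar> \<le> N"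
proof -
  have "finite (abs ` {i. w i \<noteq> i})" using W_inf_fin[OF w] by simp
  then obtain N where N: "\<And>x. x \<in> abs ` {i. w i \<noteq> i} \<Longrightarrow> x \<le> N"
    by (metis bdd_above.E bdd_above_finite)
  let ?N = "max N 0"
  have fix': "w i = i" if "\<bar>i\<bar> > ?N" for i using N[of "\<bar>i\<bar>"] that by force
  have "\<bar>w i\<bar> \<le> ?N" if "\<bar>i\<bar> \<le> ?N" for i
  proof (rule ccontr)
    assume "\<not> \<bar>w i\<bar> \<le> ?N"
    then have "w (w i) = w i" by (intro fix') linarith
    then have "w i = i" using W_inf_inj[OF w] by blast
    then show False using \<open>\<not> \<bar>w i\<bar> \<le> ?N\<close> that by simp
  qed
  then show ?thesis using that[of ?N] fix' by auto
qed

text \<open>Pairs \<open>- j \<le> i < j\<close> with \<open>i \<noteq> 0\<close> correspond to the positive roots of type C, the pair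
  \<open>(- j, j)\<close> to the long ones.\<close>

definition Inv :: "(int \<Rightarrow> int) \<Rightarrow> (int \<times> int) set" where
  "Inv w = {(i, j). 0 < j \<and> - j \<le> i \<and> i < j \<and> i \<noteq> 0 \<and> w i > w j}"

lemma finite_Inv: "w \<in> W_inf \<Longrightarrow> finite (Inv w)"
proof -
  assume w: "w \<in> W_inf"
  obtain N where N: "N \<ge> 0" "\<And>i. \<bar>i\<bar> > N \<Longrightarrow> w i = i" "\<And>i. \<bar>i\<bar> \<le> N \<Longrightarrow> \<bar>w i\<bar> \<le> N"
    by (rule W_inf_bound[OF w]) blast
  have "Inv w \<subseteq> {-N..N} \<times> {-N..N}"
  proof
    fix x assume x: "x \<in> Inv w"
    obtain i j where ij: "x = (i, j)" by (cases x)
    then have *: "0 < j" "- j \<le> i" "i < j" "w i > w j" using x by (auto simp: Inv_def)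
    have "j \<le> N"
    proof (rule ccontr)
      assume "\<not> j \<le> N"
      then have "w j = j" using N(2)[of j] by simp
      moreover have "w i \<le> max N i" using N(2)[of i] N(3)[of i] by linarith
      ultimately show False using * \<open>\<not> j \<le> N\<close> by auto
    qed
    then show "x \<in> {-N..N} \<times> {-N..N}" using * ij by auto
  qed
  then show ?thesis by (rule finite_subset) auto
qed

text \<open>The pair that stands for the simple root of the i-th generator.\<close>

definition rt :: "nat \<Rightarrow> int \<times> int" where
  "rt i = (if i = 0 then - 1 else int i, int i + 1)"

definition desc :: "(int \<Rightarrow> int) \<Rightarrow> nat \<Rightarrow> bool" where
  "desc w i \<longleftrightarrow> (if i = 0 then w 1 < 0 else w (int i) > w (int i + 1))"

lemma rt_Inv: "w \<in> W_inf \<Longrightarrow> rt i \<in> Inv w \<longleftrightarrow> desc w i"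
  using W_inf_minus[of w 1] by (auto simp: rt_def Inv_def desc_def)

lemma desc_comp_gen: "w \<in> W_inf \<Longrightarrow> desc (w \<circ> gen i) i \<longleftrightarrow> \<not> desc w i"
  using W_inf_minus[of w 1] W_inf_eq_0[of w 1] W_inf_inj[of w "int i" "int i + 1"]
  by (auto simp: desc_def gen_0 gen_pos)

text \<open>The generator s_i permutes the positive roots other than its own. The exceptional pair
  stands for e_i + e_(i+1), which s_i fixes; moving both entries would give (-(i+1), i), the same
  root in a form that \<open>Inv\<close> does not admit.\<close>

definition act :: "nat \<Rightarrow> int \<times> int \<Rightarrow> int \<times> int" where
  "act i p = (if i \<ge> 1 \<and> p = (- int i, int i + 1) then p else (gen i (fst p), gen i (snd p)))"

lemma act_Inv:
  assumes w: "w \<in> W_inf"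
  shows "bij_betw (act i) (Inv (w \<circ> gen i) - {rt i}) (Inv w - {rt i})"
proof -
  have aa: "act i (act i p) = p" if "p \<in> Inv v" for p v
    using that by (cases p) (auto simp: act_def gen_pos Inv_def split: if_splits)
  have "act i p \<in> Inv w - {rt i}" if "p \<in> Inv (w \<circ> gen i) - {rt i}" and w: "w \<in> W_inf" for p w
  proof (cases "i = 0")
    case True
    then show ?thesis using that by (cases p) (auto simp: act_def Inv_def rt_def gen_0 split: if_splits)
  next
    case False
    then have i: "i \<ge> 1" by simp
    obtain a b where p: "p = (a, b)" by (cases p)
    show ?thesis
    proof (cases "p = (- int i, int i + 1)")
      case True
      then show ?thesis using that(1) i W_inf_minus[OF w, of "int i"] W_inf_minus[OF w, of "int i + 1"]
        by (auto simp: act_def Inv_def rt_def gen_pos)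
    next
      case n: False
      have "0 < gen i b \<and> - gen i b \<le> gen i a \<and> gen i a < gen i b \<and> gen i a \<noteq> 0 \<and> (gen i a, gen i b) \<noteq> rt i"
        using that(1) i n False unfolding p gen_pos[OF i] Inv_def rt_def by (simp split: if_splits)
      then show ?thesis using that(1) n by (auto simp: act_def p Inv_def)
    qed
  qed
  note * = this
  have "act i ` (Inv (w \<circ> gen i) - {rt i}) = Inv w - {rt i}"
  proof (intro equalityI subsetI)
    fix p assume p: "p \<in> Inv w - {rt i}"
    have "w \<circ> gen i \<circ> gen i = w" by (rule ext) simp
    then have "act i p \<in> Inv (w \<circ> gen i) - {rt i}"
      using *[of p "w \<circ> gen i"] p W_inf_comp[OF w W_inf_gen] by simp
    then show "p \<in> act i ` (Inv (w \<circ> gen i) - {rt i})" using aa[of p w] p by (metis image_eqI DiffD1)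
  next
    fix p assume "p \<in> act i ` (Inv (w \<circ> gen i) - {rt i})"
    then obtain q where q: "p = act i q" "q \<in> Inv (w \<circ> gen i) - {rt i}" by (rule imageE)
    show "p \<in> Inv w - {rt i}" unfolding q(1) by (rule *[OF q(2) w])
  qed
  moreover have "inj_on (act i) (Inv (w \<circ> gen i) - {rt i})" using aa by (metis inj_onI DiffD1)
  ultimately show ?thesis by (simp add: bij_betw_def)
qed

definition invn :: "(int \<Rightarrow> int) \<Rightarrow> nat" where "invn w = card (Inv w)"

lemma invn_gen:
  assumes w: "w \<in> W_inf"
  shows "desc w i \<Longrightarrow> invn w = Suc (invn (w \<circ> gen i))" "\<not> desc w i \<Longrightarrow> invn (w \<circ> gen i) = Suc (invn w)"
proof -
  note w' = W_inf_comp[OF w W_inf_gen[of i]]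
  have e: "card (Inv (w \<circ> gen i) - {rt i}) = card (Inv w - {rt i})"
    using bij_betw_same_card[OF act_Inv[OF w]] .
  show "invn w = Suc (invn (w \<circ> gen i))" if "desc w i"
  proof -
    have "rt i \<in> Inv w" "rt i \<notin> Inv (w \<circ> gen i)"
      using rt_Inv[OF w] rt_Inv[OF w'] desc_comp_gen[OF w] that by blast+
    then have "card (Inv w) = Suc (card (Inv w - {rt i}))" "Inv (w \<circ> gen i) - {rt i} = Inv (w \<circ> gen i)"
      using card.remove[OF finite_Inv[OF w]] by blast+
    then show ?thesis using e by (simp add: invn_def)
  qed
  show "invn (w \<circ> gen i) = Suc (invn w)" if "\<not> desc w i"
  proof -
    have "rt i \<notin> Inv w" "rt i \<in> Inv (w \<circ> gen i)"
      using rt_Inv[OF w] rt_Inv[OF w'] desc_comp_gen[OF w] that by blast+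
    then have "card (Inv (w \<circ> gen i)) = Suc (card (Inv (w \<circ> gen i) - {rt i}))" "Inv w - {rt i} = Inv w"
      using card.remove[OF finite_Inv[OF w']] by blast+
    then show ?thesis using e by (simp add: invn_def)
  qed
qed

text \<open>Without descents w increases by at least one at each step from w 0 = 0, and since w is
  the identity far out no step can increase by more.\<close>

lemma no_desc_id:
  assumes w: "w \<in> W_inf" and nd: "\<And>i. \<not> desc w i"
  shows "w = id"
proof
  obtain N where N: "N \<ge> 0" "\<And>i. \<bar>i\<bar> > N \<Longrightarrow> w i = i" "\<And>i. \<bar>i\<bar> \<le> N \<Longrightarrow> \<bar>w i\<bar> \<le> N"
    by (rule W_inf_bound[OF w]) blast
  have st: "w (int i) < w (int i + 1)" for i
  proof (cases "i = 0")
    case True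
    then show ?thesis using nd[of 0] W_inf_0[OF w] W_inf_eq_0[OF w, of 1] by (simp add: desc_def)
  next
    case False
    then show ?thesis using nd[of i] W_inf_inj[OF w, of "int i" "int i + 1"] by (simp add: desc_def)
  qed
  have up: "w (int (i + d)) \<ge> w (int i) + int d" for i d
  proof (induction d)
    case (Suc d)
    then show ?case using st[of "i + d"] by (simp add: ac_simps)
  qed simp
  have pos: "w (int i) = int i" for i
  proof -
    have "w (int i) \<ge> int i" using up[of 0 i] W_inf_0[OF w] by simp
    moreover have "w (int (i + nat (N + 1))) = int (i + nat (N + 1))" using N by simp
    then have "w (int i) \<le> int i" using up[of i "nat (N + 1)"] by simp
    ultimately show ?thesis by simp
  qed
  fix x show "w x = id x"
    using pos[of "nat \<bar>x\<bar>"] W_inf_minus[OF w, of x] by (cases "x \<ge> 0") auto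
qed

definition wd :: "nat list \<Rightarrow> int \<Rightarrow> int" where
  "wd is = foldr (\<lambda>i v. gen i \<circ> v) is id"

lemma wd_Nil [simp]: "wd [] = id" and wd_Cons: "wd (i # is) = gen i \<circ> wd is"
  by (simp_all add: wd_def)

lemma wd_append: "wd (is @ js) = wd is \<circ> wd js"
  by (induction "is") (auto simp: wd_Cons comp_assoc)

lemma wd_snoc: "wd (is @ [i]) = wd is \<circ> gen i"
  by (simp add: wd_append wd_Cons)

lemma wd_W: "wd is \<in> W_inf"
proof (induction "is")
  case (Cons i "is")
  then show ?case unfolding wd_Cons by (intro W_inf_comp W_inf_gen)
qed (simp only: wd_Nil W_inf_id)

lemma wd_rev: "wd (rev is) \<circ> wd is = id"
proof (induction "is")
  case (Cons i "is")
  have "wd (rev (i # is)) \<circ> wd (i # is) = wd (rev is) \<circ> (gen i \<circ> gen i) \<circ> wd is"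
    by (simp add: wd_Cons wd_append comp_assoc)
  then show ?case using Cons by (simp add: gen_comp_gen)
qed simp

lemma invn_wd: "invn (wd is) \<le> length is"
proof (induction "is" rule: rev_induct)
  case Nil
  have e: "Inv id = {}" by (auto simp: Inv_def)
  show ?case unfolding wd_Nil invn_def e by simp
next
  case (snoc i "is")
  then have "invn (wd is \<circ> gen i) \<le> length (is @ [i])" using invn_gen[OF wd_W, of "is" i]
    by (cases "desc (wd is) i") auto
  then show ?case by (simp only: wd_snoc)
qed

lemma ex_wd: "w \<in> W_inf \<Longrightarrow> \<exists>is. length is = invn w \<and> w = wd is"
proof (induction "invn w" arbitrary: w)
  case 0
  then have "\<not> desc w i" for i using invn_gen(1)[of w i] by auto
  then have "w = id" using no_desc_id 0 by blast
  then show ?case using 0 by (intro exI[of _ "[]"]) simp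
next
  case (Suc n)
  have "\<exists>i. desc w i"
  proof (rule ccontr)
    assume "\<not> (\<exists>i. desc w i)"
    then have "w = id" using no_desc_id Suc.prems by blast
    then show False using Suc.hyps(2) invn_wd[of "[]"] by simp
  qed
  then obtain i where i: "desc w i" ..
  then have "n = invn (w \<circ> gen i)" using invn_gen(1)[OF Suc.prems i] Suc.hyps(2) by simp
  then obtain "is" where "length is = n" "w \<circ> gen i = wd is"
    using Suc.hyps(1)[of "w \<circ> gen i"] W_inf_comp[OF Suc.prems W_inf_gen] by auto
  moreover have "w = w \<circ> gen i \<circ> gen i" by (rule ext) simp
  ultimately show ?case using Suc.hyps(2) by (intro exI[of _ "is @ [i]"]) (auto simp: wd_snoc)
qed

text \<open>One more generator changes the number of inversions by exactly one, which bounds words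
  from below; removing descents one by one yields a word of that length.\<close>

lemma len_invn: "w \<in> W_inf \<Longrightarrow> len w = invn w"
  unfolding len_def wd_def[symmetric]
proof (rule Least_equality)
  assume "w \<in> W_inf"
  then show "\<exists>is. length is = invn w \<and> w = wd is" by (rule ex_wd)
qed (use invn_wd in blast)

lemma len_gen:
  assumes w: "w \<in> W_inf"
  shows "desc w i \<Longrightarrow> len w = Suc (len (w \<circ> gen i))" "\<not> desc w i \<Longrightarrow> len (w \<circ> gen i) = Suc (len w)"
  using invn_gen[OF w, of i] len_invn[OF w] len_invn[OF W_inf_comp[OF w W_inf_gen]] by auto

lemma len_less_iff: "w \<in> W_inf \<Longrightarrow> len (w \<circ> gen i) < len w \<longleftrightarrow> desc w i"
  using len_gen[of w i] by (cases "desc w i") auto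

lemma len_less_iff': "w \<in> W_inf \<Longrightarrow> len w < len (w \<circ> gen i) \<longleftrightarrow> \<not> desc w i"
  using len_gen[of w i] by (cases "desc w i") auto

lemma len_id [simp]: "len id = 0"
  using len_invn[OF W_inf_id] invn_wd[of "[]"] by simp

lemma len_0: "w \<in> W_inf \<Longrightarrow> len w = 0 \<longleftrightarrow> w = id"
  using ex_wd[of w] len_invn[of w] by auto

lemma inv_unique: "bij w \<Longrightarrow> v \<circ> w = id \<Longrightarrow> inv w = v"
proof -
  assume "bij w" and v: "v \<circ> w = id"
  then have "w (inv w x) = x" for x by (simp add: bij_is_surj surj_f_inv_f)
  then have "inv w x = v x" for x using fun_cong[OF v, of "inv w x"] by simp
  then show ?thesis by (rule ext)
qed

lemma len_inv_le: "w \<in> W_inf \<Longrightarrow> len (inv w) \<le> len w"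
proof -
  assume w: "w \<in> W_inf"
  then obtain "is" where i: "length is = invn w" "w = wd is" using ex_wd by blast
  have "inv w = wd (rev is)" using inv_unique[OF W_inf_bij[OF w]] wd_rev[of "is"] i by simp
  then show ?thesis using invn_wd[of "rev is"] i len_invn[OF w] len_invn[OF wd_W, of "rev is"] by simp
qed

lemma len_inv: "w \<in> W_inf \<Longrightarrow> len (inv w) = len w"
  using len_inv_le[of w] len_inv_le[of "inv w"] W_inf_inv[of w] inv_inv_eq[OF W_inf_bij[of w]] by simp

lemma gen_comp_inv: "w \<in> W_inf \<Longrightarrow> inv (gen i \<circ> w) = inv w \<circ> gen i"
proof -
  assume w: "w \<in> W_inf"
  have "inv (gen i \<circ> w) = inv w \<circ> inv (gen i)" by (intro o_inv_distrib W_inf_bij W_inf_gen w)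
  moreover have "inv (gen i) = gen i" by (rule inv_unique[OF W_inf_bij[OF W_inf_gen]]) (rule gen_comp_gen)
  ultimately show ?thesis by simp
qed

lemma len_left:
  assumes w: "w \<in> W_inf"
  shows "desc (inv w) i \<Longrightarrow> len w = Suc (len (gen i \<circ> w))" "\<not> desc (inv w) i \<Longrightarrow> len (gen i \<circ> w) = Suc (len w)"
  using len_gen[OF W_inf_inv[OF w], of i] len_inv[OF w] len_inv[OF W_inf_comp[OF W_inf_gen w, of i]]
  by (auto simp: gen_comp_inv[OF w])

lemma len_left_iff: "w \<in> W_inf \<Longrightarrow> len (gen i \<circ> w) < len w \<longleftrightarrow> desc (inv w) i"
  using len_left[of w i] by (cases "desc (inv w) i") auto

lemma inv_W_eq: "w \<in> W_inf \<Longrightarrow> w a = b \<Longrightarrow> inv w b = a"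
  by (metis W_inf_bij bij_inv_eq_iff)

lemma W_fin_bound:
  assumes "v \<in> W_fin l" "\<bar>i\<bar> \<le> int l"
  shows "\<bar>v i\<bar> \<le> int l"
proof (rule ccontr)
  have v: "v \<in> W_inf" and f: "\<And>i. i > int l \<Longrightarrow> v i = i" using assms(1) by (auto simp: W_fin_def)
  assume "\<not> \<bar>v i\<bar> \<le> int l"
  then have "v (\<bar>v i\<bar>) = \<bar>v i\<bar>" by (intro f) simp
  then have "v (v i) = v i" using W_inf_minus[OF v, of "v i"] by (cases "v i \<ge> 0") auto
  then have "v i = i" using W_inf_inj[OF v] by blast
  then show False using assms(2) \<open>\<not> \<bar>v i\<bar> \<le> int l\<close> by simp
qed

text \<open>Left descents below l are the ones whose divided differences commute with the insertion
  operator of level l, so v can be reduced to the identity underneath it.\<close>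

lemma W_fin_left_desc:
  assumes v: "v \<in> W_fin l" "v \<noteq> id"
  obtains i where "i < l" "len (gen i \<circ> v) < len v" "gen i \<circ> v \<in> W_fin l"
proof -
  have vw: "v \<in> W_inf" and f: "\<And>i. i > int l \<Longrightarrow> v i = i" using v(1) by (auto simp: W_fin_def)
  have fi: "inv v i = i" if "i > int l" for i using inv_W_eq[OF vw f[OF that]] .
  have iv: "inv v \<in> W_fin l" using W_inf_inv[OF vw] fi by (simp add: W_fin_def)
  have "\<exists>i. desc (inv v) i"
  proof (rule ccontr)
    assume "\<not> (\<exists>i. desc (inv v) i)"
    then have "inv v = id" using no_desc_id W_inf_inv[OF vw] by blast
    then have "v = id" using inv_inv_eq[OF W_inf_bij[OF vw]] by (metis inv_id)
    then show False using v(2) by simp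
  qed
  then obtain i where i: "desc (inv v) i" ..
  have "i < l"
  proof (rule ccontr)
    assume "\<not> i < l"
    then have "inv v (int i + 1) = int i + 1" "inv v (int i) \<le> int i"
      using fi[of "int i + 1"] fi[of "int i"] W_fin_bound[OF iv, of "int i"] by (simp, cases "i = l", auto)
    then show False using i by (auto simp: desc_def split: if_splits)
  qed
  moreover have "gen i \<circ> v \<in> W_fin l"
  proof -
    have "gen i x = x" if "x > int l" for x using \<open>i < l\<close> that by (cases "i = 0") (auto simp: gen_0 gen_pos)
    then show ?thesis using W_inf_comp[OF W_inf_gen vw] f by (simp add: W_fin_def)
  qed
  ultimately show ?thesis using that len_left_iff[OF vw] i by blast
qed

subsection \<open>Deleting a negative letter\<close>

text \<open>\<open>del b u\<close> omits the position \<open>b\<close> with letter \<open>u b = - a\<close> and standardises: \<open>sk b\<close> skips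
  the positions \<open>\<plusminus> b\<close> and \<open>un a\<close> closes the gap at the letters \<open>\<plusminus> a\<close>.\<close>

definition sk :: "int \<Rightarrow> int \<Rightarrow> int" where
  "sk b i = (if i \<ge> b then i + 1 else if i \<le> - b then i - 1 else i)"

definition un :: "int \<Rightarrow> int \<Rightarrow> int" where
  "un a c = (if c > a then c - 1 else if c < - a then c + 1 else c)"

definition del :: "int \<Rightarrow> (int \<Rightarrow> int) \<Rightarrow> int \<Rightarrow> int" where
  "del b u i = un (- u b) (u (sk b i))"

lemma un_sk: "a > 0 \<Longrightarrow> un a (sk a c) = c"
  by (auto simp: un_def sk_def)

lemma sk_un: "a > 0 \<Longrightarrow> c \<noteq> a \<Longrightarrow> c \<noteq> - a \<Longrightarrow> sk a (un a c) = c"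
  by (auto simp: un_def sk_def)

lemma sk_neq: "b > 0 \<Longrightarrow> sk b i \<noteq> b \<and> sk b i \<noteq> - b"
  by (auto simp: sk_def)

lemma sk_minus: "b > 0 \<Longrightarrow> sk b (- i) = - sk b i" and un_minus: "b > 0 \<Longrightarrow> un b (- i) = - un b i"
  by (auto simp: sk_def un_def)

lemma sk_less_iff: "b > 0 \<Longrightarrow> sk b i < sk b j \<longleftrightarrow> i < j" and sk_eq_iff: "b > 0 \<Longrightarrow> sk b i = sk b j \<longleftrightarrow> i = j"
  by (auto simp: sk_def)

lemma sk_0: "b > 0 \<Longrightarrow> sk b i > 0 \<longleftrightarrow> i > 0" "b > 0 \<Longrightarrow> sk b i = 0 \<longleftrightarrow> i = 0"
  by (auto simp: sk_def)

lemma u_sk_neq: "u \<in> W_inf \<Longrightarrow> b > 0 \<Longrightarrow> u (sk b i) \<noteq> u b \<and> u (sk b i) \<noteq> - u b"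
  using sk_neq[of b i] W_inf_inj[of u "sk b i" b] W_inf_inj[of u "sk b i" "- b"] W_inf_minus[of u b] by auto

lemma sk_del: "u \<in> W_inf \<Longrightarrow> b > 0 \<Longrightarrow> u b < 0 \<Longrightarrow> sk (- u b) (del b u i) = u (sk b i)"
  unfolding del_def using u_sk_neq[of u b i] by (subst sk_un) auto

lemma del_W:
  assumes u: "u \<in> W_inf" "b > 0" "u b < 0"
  shows "del b u \<in> W_inf"
proof (rule W_infI)
  let ?a = "- u b"
  have a: "?a > 0" using u by simp
  note s = sk_del[OF u]
  show "bij (del b u)"
  proof (rule bijI)
    show "inj (del b u)"
      by (rule injI) (metis s W_inf_inj[OF u(1)] sk_eq_iff[OF u(2)])
    show "surj (del b u)"
    proof (rule surjI)
      fix y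
      define x where "x = un b (inv u (sk ?a y))"
      have ux: "u (inv u (sk ?a y)) = sk ?a y" using W_inf_bij[OF u(1)] by (simp add: bij_is_surj surj_f_inv_f)
      have "inv u (sk ?a y) \<noteq> b \<and> inv u (sk ?a y) \<noteq> - b"
        using ux sk_neq[OF a, of y] W_inf_minus[OF u(1), of b] by auto
      then have "sk b x = inv u (sk ?a y)" unfolding x_def using sk_un[OF u(2)] by blast
      then show "del b u (un b (inv u (sk ?a y))) = y"
        unfolding x_def[symmetric] del_def using ux un_sk[OF a] by simp
    qed
  qed
  show "del b u (- i) = - del b u i" for i
    unfolding del_def using u a by (simp add: sk_minus W_inf_minus[OF u(1)] un_minus[OF a])
  obtain N where N: "N \<ge> 0" "\<And>i. \<bar>i\<bar> > N \<Longrightarrow> u i = i" "\<And>i. \<bar>i\<bar> \<le> N \<Longrightarrow> \<bar>u i\<bar> \<le> N"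
    by (rule W_inf_bound[OF u(1)]) blast
  have "del b u i = i" if "\<bar>i\<bar> > N + b + ?a" for i
  proof -
    have "u (sk b i) = sk b i" by (rule N(2)) (use that u a N in \<open>auto simp: sk_def\<close>)
    then show ?thesis unfolding del_def using that u a N by (auto simp: sk_def un_def)
  qed
  then have "{i. del b u i \<noteq> i} \<subseteq> {- (N + b + ?a)..N + b + ?a}" by force
  then show "finite {i. del b u i \<noteq> i}" by (rule finite_subset) auto
qed

text \<open>Each absolute value 1, ..., a - 1 occurs at exactly one positive position.\<close>

lemma card_small_values:
  assumes u: "u \<in> W_inf" and a: "a > 0"
  shows "finite {j. 0 < j \<and> \<bar>u j\<bar> < a}" "card {j. 0 < j \<and> \<bar>u j\<bar> < a} = nat (a - 1)"
proof -
  have "bij_betw (\<lambda>j. \<bar>u j\<bar>) {j. 0 < j \<and> \<bar>u j\<bar> < a} {1..a - 1}"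
    unfolding bij_betw_def
  proof
    show "inj_on (\<lambda>j. \<bar>u j\<bar>) {j. 0 < j \<and> \<bar>u j\<bar> < a}"
    proof (rule inj_onI)
      fix i j assume ij: "i \<in> {j. 0 < j \<and> \<bar>u j\<bar> < a}" "j \<in> {j. 0 < j \<and> \<bar>u j\<bar> < a}" "\<bar>u i\<bar> = \<bar>u j\<bar>"
      then have "u i = u j \<or> u i = u (- j)" using W_inf_minus[OF u, of j] by (auto simp: abs_eq_iff)
      then show "i = j" using ij W_inf_inj[OF u] by auto
    qed
    show "(\<lambda>j. \<bar>u j\<bar>) ` {j. 0 < j \<and> \<bar>u j\<bar> < a} = {1..a - 1}"
    proof (intro equalityI subsetI)
      fix c assume "c \<in> (\<lambda>j. \<bar>u j\<bar>) ` {j. 0 < j \<and> \<bar>u j\<bar> < a}"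
      then obtain j where j: "0 < j" "\<bar>u j\<bar> < a" "c = \<bar>u j\<bar>" by blast
      then have "u j \<noteq> 0" using W_inf_eq_0[OF u, of j] by simp
      then show "c \<in> {1..a - 1}" using j by simp
    next
      fix c assume c: "c \<in> {1..a - 1}"
      have uc: "u (inv u c) = c" using W_inf_bij[OF u] by (simp add: bij_is_surj surj_f_inv_f)
      let ?j = "\<bar>inv u c\<bar>"
      have "\<bar>u ?j\<bar> = c" using uc c W_inf_minus[OF u, of "inv u c"] by (cases "inv u c \<ge> 0") auto
      moreover have "?j > 0" using uc c W_inf_0[OF u] by (cases "inv u c = 0") auto
      ultimately show "c \<in> (\<lambda>j. \<bar>u j\<bar>) ` {j. 0 < j \<and> \<bar>u j\<bar> < a}"
        using c by (intro image_eqI[of _ _ ?j]) auto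
    qed
  qed
  from bij_betw_same_card[OF this] bij_betw_finite[OF this]
  show "finite {j. 0 < j \<and> \<bar>u j\<bar> < a}" "card {j. 0 < j \<and> \<bar>u j\<bar> < a} = nat (a - 1)" by auto
qed

text \<open>The inversions of the shorter element embed by skipping position b. With u b = -a there
  remain at least b + a - 1 pairs that involve b: the pair (-b, b), one for each of the b - 1
  earlier positions, and one more for each of the a - 1 positions whose letter is smaller than a in
  absolute value.\<close>

lemma len_del:
  assumes u: "u \<in> W_inf" "b > 0" "u b < 0"
  shows "int (len u) \<ge> int (len (del b u)) + (b - u b - 1)"
proof -
  define a where "a = - u b"
  have a: "a > 0" using u by (simp add: a_def)
  note uw = u(1) and um = W_inf_minus[OF u(1)]
  define A1 where "A1 = {1..b - 1}"
  define A2 where "A2 = {j. 0 < j \<and> j < b \<and> \<bar>u j\<bar> < a}"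
  define A3 where "A3 = {j. j > b \<and> \<bar>u j\<bar> < a}"
  \<comment> \<open>If u i is above -a then (i, b) is an inversion; otherwise u (-i) exceeds a, and
    (-i, b) is one.\<close>
  define g where "g = (\<lambda>i. if u i > - a then (i, b) else (- i, b))"
  define E where "E = insert (- b, b) (g ` A1 \<union> (\<lambda>j. (- j, b)) ` A2 \<union> (\<lambda>j. (- b, j)) ` A3)"
  define D where "D = (\<lambda>(i, j). (sk b i, sk b j)) ` Inv (del b u)"
  have A23: "A2 \<union> A3 = {j. 0 < j \<and> \<bar>u j\<bar> < a}" "A2 \<inter> A3 = {}"
    using u(2) by (auto simp: A2_def A3_def a_def not_less order.order_iff_strict u(3))
  have fin: "finite A2" "finite A3"
    using card_small_values(1)[OF uw a] A23(1) by (metis finite_Un)+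
  have c23: "card A2 + card A3 = nat (a - 1)"
    using card_Un_disjoint[OF fin A23(2)] card_small_values(2)[OF uw a] A23(1) by simp
  have E: "E \<subseteq> Inv u"
  proof
    fix x assume "x \<in> E"
    then consider "x = (- b, b)" | i where "i \<in> A1" "x = g i" | j where "j \<in> A2" "x = (- j, b)"
      | j where "j \<in> A3" "x = (- b, j)" by (auto simp: E_def)
    then show "x \<in> Inv u"
    proof cases
      case 1
      then show ?thesis using u um[of b] by (auto simp: Inv_def)
    next
      case 2
      then show ?thesis using u a um[of i] by (auto simp: Inv_def A1_def g_def a_def)
    next
      case 3
      then show ?thesis using u um[of j] by (auto simp: Inv_def A2_def a_def)
    next
      case 4
      then show ?thesis using u um[of b] by (auto simp: Inv_def A3_def a_def)
    qed
  qed
  have cE: "card E = Suc (nat (b - 1) + nat (a - 1))"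
  proof -
    have 1: "card (g ` A1) = nat (b - 1)"
      by (subst card_image) (auto simp: inj_on_def g_def A1_def split: if_splits)
    have 2: "card ((\<lambda>j. (- j, b)) ` A2) = card A2"
      by (subst card_image) (auto simp: inj_on_def)
    have 3: "card ((\<lambda>j. (- b, j)) ` A3) = card A3"
      by (subst card_image) (auto simp: inj_on_def)
    have d1: "g ` A1 \<inter> (\<lambda>j. (- j, b)) ` A2 = {}"
      by (auto simp: g_def A1_def A2_def split: if_splits)
    have d2: "(g ` A1 \<union> (\<lambda>j. (- j, b)) ` A2) \<inter> (\<lambda>j. (- b, j)) ` A3 = {}"
      by (auto simp: g_def A1_def A2_def A3_def split: if_splits)
    have d3: "(- b, b) \<notin> g ` A1 \<union> (\<lambda>j. (- j, b)) ` A2 \<union> (\<lambda>j. (- b, j)) ` A3"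
      using u by (auto simp: g_def A1_def A2_def A3_def split: if_splits)
    have f1: "finite (g ` A1)" by (simp add: A1_def)
    have "card (g ` A1 \<union> (\<lambda>j. (- j, b)) ` A2 \<union> (\<lambda>j. (- b, j)) ` A3) = nat (b - 1) + card A2 + card A3"
      using f1 fin by (simp add: card_Un_disjoint[OF _ _ d2] card_Un_disjoint[OF _ _ d1] 1 2 3)
    then show ?thesis using d3 f1 fin c23 unfolding E_def by simp
  qed
  have dw: "del b u \<in> W_inf" by (rule del_W[OF u])
  have D: "D \<subseteq> Inv u"
  proof
    fix x assume "x \<in> D"
    then obtain i j where x: "x = (sk b i, sk b j)" and ij: "(i, j) \<in> Inv (del b u)" by (auto simp: D_def)
    have "u (sk b j) < u (sk b i)"
      using ij sk_less_iff[of "- u b" "del b u j" "del b u i"] u(3) sk_del[OF u] by (auto simp: Inv_def)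
    moreover have "- sk b j \<le> sk b i" using ij u(2) by (auto simp: Inv_def sk_def)
    ultimately show "x \<in> Inv u"
      using ij u(2) by (auto simp: Inv_def x sk_less_iff sk_0)
  qed
  have cD: "card D = len (del b u)"
    unfolding D_def len_invn[OF dw] invn_def using u(2)
    by (subst card_image) (auto simp: inj_on_def sk_eq_iff)
  have "fst x = - b \<or> snd x = b" if "x \<in> E" for x
    using that by (auto simp: E_def g_def split: if_splits)
  moreover have "fst x \<noteq> - b \<and> snd x \<noteq> b" if "x \<in> D" for x
    using that sk_neq[OF u(2)] by (auto simp: D_def)
  ultimately have "D \<inter> E = {}" by blast
  then have "card D + card E = card (D \<union> E)"
    using finite_subset[OF D finite_Inv[OF uw]] finite_subset[OF E finite_Inv[OF uw]]
    by (simp add: card_Un_disjoint)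
  also have "\<dots> \<le> card (Inv u)" by (rule card_mono[OF finite_Inv[OF uw]]) (use D E in blast)
  finally have "len (del b u) + Suc (nat (b - 1) + nat (a - 1)) \<le> len u"
    by (simp add: cD cE len_invn[OF uw] invn_def)
  then show ?thesis using u(2) a by (simp add: a_def)
qed

lemma del_inject:
  assumes "u \<in> W_inf" "w \<in> W_inf" "b > 0" "u b < 0" "w b = u b" "del b u = del b w"
  shows "u = w"
proof
  fix i
  show "u i = w i"
  proof (cases "i = b \<or> i = - b")
    case True
    then show ?thesis using assms(5) W_inf_minus[OF assms(1), of b] W_inf_minus[OF assms(2), of b] by auto
  next
    case False
    then have i: "i = sk b (un b i)" using sk_un[OF assms(3)] by auto
    have "u (sk b (un b i)) = w (sk b (un b i))"
      using sk_del[of u b "un b i"] sk_del[of w b "un b i"] assms by simp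
    then show ?thesis using i by simp
  qed
qed

section \<open>Localisation\<close>

text \<open>Specialisation of x to a finite list of values.\<close>

fun hq :: "'b::comm_ring_1 list \<Rightarrow> gamma \<Rightarrow> 'b" where
  "hq [] = gct"
| "hq (b # bs) = hsub (hq bs) b"

lemma rhom_hq: "rhom (hq bs)"
  by (induction bs) (auto simp: rhom_gct rhom_hsub)

lemma hq_Q: "fmap (hq bs) Qfg = (\<Prod>b\<leftarrow>bs. lin b * geom b)"
  by (induction bs) (auto simp: fmap_gct fmap_hsub[OF rhom_hq])

definition negs :: "(int \<Rightarrow> int) \<Rightarrow> int set" where
  "negs u = {j. 0 < j \<and> u j < 0}"

lemma finite_negs: "u \<in> W_inf \<Longrightarrow> finite (negs u)"
  by (rule finite_subset[OF _ W_inf_fin]) (auto simp: negs_def)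

definition sg :: "(nat \<Rightarrow> 'b::comm_ring_1) \<Rightarrow> int \<Rightarrow> 'b" where
  "sg \<tau> c = (if c > 0 then \<tau> (nat c) else - \<tau> (nat (- c)))"

lemma sg_minus: "c \<noteq> 0 \<Longrightarrow> sg \<tau> (- c) = - sg \<tau> c"
  by (auto simp: sg_def)

text \<open>The restriction to the torus fixed point \<open>u\<close> at the equivariant parameters \<open>\<tau>\<close>: the factor of
  \<open>Q\<close> for a letter \<open>- a < 0\<close> of \<open>u\<close> is \<open>(1 + \<tau>\<^sub>a u) / (1 - \<tau>\<^sub>a u)\<close>.\<close>

definition loc :: "(nat \<Rightarrow> Rinf) \<Rightarrow> (int \<Rightarrow> int) \<Rightarrow> Rinf \<Rightarrow> Rinf" where
  "loc \<tau> u = mkhom (hq (map (\<lambda>j. - sg \<tau> (u j)) (sorted_list_of_set (negs u)))) \<tau> (\<lambda>i. sg \<tau> (u (int i)))"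

definition qq :: "'b::comm_ring_1 \<Rightarrow> 'b fps" where "qq a = lin a * geom a"

lemma qq_minus: "qq a * qq (- a) = 1" "qq (- a) * qq a = 1"
proof -
  have "qq a * qq (- a) = (lin a * geom (- a)) * (lin (- a) * geom a)"
    unfolding qq_def by (simp only: mult_ac)
  then show "qq a * qq (- a) = 1" by (simp add: lin_geom_cancel lin_geom_cancel')
  then show "qq (- a) * qq a = 1" by (simp only: mult.commute)
qed

lemma fmap_qq: "rhom h \<Longrightarrow> fmap h (qq a) = qq (h a)"
  by (simp add: qq_def fmap_mult fmap_lin fmap_geom)

lemma rhom_loc: "rhom (loc \<tau> u)"
  unfolding loc_def by (rule rhom_mkhom[OF rhom_hq])

lemma loc_t: "j \<ge> 1 \<Longrightarrow> loc \<tau> u (tv j) = \<tau> j"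
  unfolding loc_def by (rule mkhom_t[OF rhom_hq])

lemma loc_z: "j \<ge> 1 \<Longrightarrow> loc \<tau> u (zv j) = sg \<tau> (u (int j))"
  unfolding loc_def by (rule mkhom_z[OF rhom_hq])

lemma loc_Q: "u \<in> W_inf \<Longrightarrow> fmap (loc \<tau> u) Qgf = (\<Prod>j\<in>negs u. qq (- sg \<tau> (u j)))"
proof -
  assume u: "u \<in> W_inf"
  have "fmap (loc \<tau> u) Qgf = (\<Prod>j\<leftarrow>sorted_list_of_set (negs u). qq (- sg \<tau> (u j)))"
    by (simp add: loc_def mkhom_Q[OF rhom_hq] hq_Q qq_def comp_def)
  also have "\<dots> = (\<Prod>j\<in>negs u. qq (- sg \<tau> (u j)))"
    using finite_negs[OF u] prod.distinct_set_conv_list[of "sorted_list_of_set (negs u)" "\<lambda>j. qq (- sg \<tau> (u j))"]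
    by simp
  finally show ?thesis .
qed

lemma gen_int: "j \<ge> 1 \<Longrightarrow> i \<ge> 1 \<Longrightarrow> gen i (int j) = int (transpose i (i + 1) j)"
  by (auto simp: gen_pos transpose_def)

text \<open>Localisation reads z_i as the letter in position i, so composing u with s_i on the right
  permutes the z-values. For i = 0 the first letter changes sign, and its Q-factor appears or
  disappears; this is the factor built into s_0^z.\<close>

lemma loc_sz:
  assumes u: "u \<in> W_inf"
  shows "loc \<tau> (u \<circ> gen i) = (\<lambda>f. loc \<tau> u (sz i f))"
proof (rule rhom_eqI[OF rhom_loc rhom_comp[OF rhom_loc rhom_sz]])
  note u' = W_inf_comp[OF u W_inf_gen[of i]]
  show "loc \<tau> (u \<circ> gen i) (tv j) = loc \<tau> u (sz i (tv j))" if "j \<ge> 1" for j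
    using that by (simp add: loc_t sz_t)
  show "loc \<tau> (u \<circ> gen i) (zv j) = loc \<tau> u (sz i (zv j))" if "j \<ge> 1" for j
  proof (cases "i = 0")
    case True
    show ?thesis
    proof (cases "j = 1")
      case True
      then show ?thesis using \<open>i = 0\<close> W_inf_minus[OF u, of 1] W_inf_eq_0[OF u, of 1]
        by (simp add: loc_z sz_0_z gen_0 rhom_minus[OF rhom_loc] sg_minus)
    next
      case False
      then have "gen 0 (int j) = int j" using that by (simp add: gen_0)
      then show ?thesis using True False that by (simp add: loc_z sz_0_z)
    qed
  next
    case False
    then show ?thesis using that transpose_ge_1[of i j] gen_int[of j i] by (simp add: loc_z sz_z)
  qed
  have fm: "fmap (\<lambda>f. loc \<tau> u (sz i f)) Qgf = fmap (loc \<tau> u) (fmap (sz i) Qgf)" by (simp add: fmap_comp)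
  show "fmap (loc \<tau> (u \<circ> gen i)) Qgf = fmap (\<lambda>f. loc \<tau> u (sz i f)) Qgf"
  proof (cases "i = 0")
    case True
    let ?F = "\<lambda>j. qq (- sg \<tau> (u j))"
    have g0: "gen 0 j = j" if "j > 0" "j \<noteq> 1" for j using that by (simp add: gen_0)
    have rhs: "fmap (\<lambda>f. loc \<tau> u (sz i f)) Qgf = qq (sg \<tau> (u 1)) * prod ?F (negs u)"
      unfolding fm using True
      by (simp add: sz_0_Q[simplified] loc_z loc_Q[OF u] fmap_mult[OF rhom_loc] fmap_lin[OF rhom_loc] fmap_geom[OF rhom_loc] qq_def)
    have u1: "u (- 1) = - u 1" "u 1 \<noteq> 0" using W_inf_minus[OF u, of 1] W_inf_eq_0[OF u, of 1] by auto
    have split: "negs (u \<circ> gen i) = (if u 1 < 0 then negs u - {1} else insert 1 (negs u))"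
    proof (rule set_eqI)
      fix j
      show "j \<in> negs (u \<circ> gen i) \<longleftrightarrow> j \<in> (if u 1 < 0 then negs u - {1} else insert 1 (negs u))"
        using True u1 by (cases "j = 1") (auto simp: negs_def gen_0)
    qed
    have cong: "(\<Prod>j\<in>A. qq (- sg \<tau> ((u \<circ> gen i) j))) = prod ?F A" if "A \<subseteq> negs u - {1}" for A
      proof (rule prod.cong[OF refl])
      fix j assume "j \<in> A"
      then have "gen 0 j = j" using that g0[of j] by (auto simp: negs_def)
      then show "qq (- sg \<tau> ((u \<circ> gen i) j)) = ?F j" using True by simp
    qed
    show ?thesis
    proof (cases "u 1 < 0")
      case neg: True
      then have "prod ?F (negs u) = ?F 1 * prod ?F (negs u - {1})"
        by (intro prod.remove[OF finite_negs[OF u]]) (simp add: negs_def)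
      then have "fmap (\<lambda>f. loc \<tau> u (sz i f)) Qgf = (qq (sg \<tau> (u 1)) * ?F 1) * prod ?F (negs u - {1})"
        unfolding rhs by (simp only: mult_ac)
      also have "\<dots> = prod ?F (negs u - {1})" by (simp add: qq_minus)
      finally show ?thesis using neg by (simp only: loc_Q[OF u'] split if_True cong[OF subset_refl])
    next
      case nneg: False
      then have nin: "1 \<notin> negs u" by (simp add: negs_def)
      then have "negs u \<subseteq> negs u - {1}" by blast
      have "fmap (loc \<tau> (u \<circ> gen i)) Qgf = qq (- sg \<tau> ((u \<circ> gen i) 1)) * prod ?F (negs u)"
        unfolding loc_Q[OF u'] split using nneg nin finite_negs[OF u] cong[OF \<open>negs u \<subseteq> negs u - {1}\<close>] by simp
      moreover have "- sg \<tau> ((u \<circ> gen i) 1) = sg \<tau> (u 1)"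
        using True u1 by (simp add: gen_0 sg_minus)
      ultimately show ?thesis unfolding rhs by simp
    qed
  next
    case False
    then have i: "i \<ge> 1" by simp
    have pos: "0 < gen i j \<longleftrightarrow> 0 < j" for j using i by (auto simp: gen_pos)
    have "(\<Prod>j\<in>negs (u \<circ> gen i). qq (- sg \<tau> ((u \<circ> gen i) j))) = (\<Prod>j\<in>negs u. qq (- sg \<tau> (u j)))"
      by (rule prod.reindex_bij_witness[of _ "gen i" "gen i"]) (auto simp: negs_def pos)
    then show ?thesis unfolding fm loc_Q[OF u'] sz_Q[OF i] loc_Q[OF u] .
  qed
qed

definition stw :: "nat \<Rightarrow> (nat \<Rightarrow> Rinf) \<Rightarrow> nat \<Rightarrow> Rinf" where
  "stw i \<tau> = (if i = 0 then \<tau>(1 := - \<tau> 1) else (\<lambda>j. \<tau> (transpose i (i + 1) j)))"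

lemma negs_id: "negs id = {}"
  by (auto simp: negs_def)

text \<open>At the identity, permuting the parameters moves the t-values and the z-values alike. The
  t-part is s_i^t, and the z-part is the passage from the identity to the point s_i. For i = 0 the
  Q-factor of that point cancels the one from s_0^t.\<close>

lemma loc_st: "loc (stw i \<tau>) id = (\<lambda>f. loc \<tau> (gen i) (st i f))"
proof (rule rhom_eqI[OF rhom_loc rhom_comp[OF rhom_loc rhom_st]])
  have fm: "fmap (\<lambda>f. loc \<tau> (gen i) (st i f)) Qgf = fmap (loc \<tau> (gen i)) (fmap (st i) Qgf)" by (simp add: fmap_comp)
  show "loc (stw i \<tau>) id (tv j) = loc \<tau> (gen i) (st i (tv j))" if "j \<ge> 1" for j
  proof (cases "i = 0")
    case True
    then show ?thesis using that
      by (cases "j = 1") (auto simp: loc_t st_0_t stw_def rhom_minus[OF rhom_loc])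
  next
    case False
    then show ?thesis using that transpose_ge_1[of i j] by (simp add: loc_t st_t stw_def)
  qed
  show "loc (stw i \<tau>) id (zv j) = loc \<tau> (gen i) (st i (zv j))" if "j \<ge> 1" for j
  proof (cases "i = 0")
    case True
    then show ?thesis using that
      by (cases "j = 1") (auto simp: loc_z st_z stw_def gen_0 sg_def)
  next
    case False
    then show ?thesis using that transpose_ge_1[of i j] gen_int[of j i]
      by (simp add: loc_z st_z stw_def sg_def)
  qed
  show "fmap (loc (stw i \<tau>) id) Qgf = fmap (\<lambda>f. loc \<tau> (gen i) (st i f)) Qgf"
  proof (cases "i = 0")
    case True
    have n: "negs (gen 0) = {1}" by (auto simp: negs_def gen_0 split: if_splits)
    have "fmap (loc \<tau> (gen 0)) Qgf = qq (\<tau> 1)"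
      by (simp add: loc_Q[OF W_inf_gen] n gen_0 sg_def)
    then have "fmap (loc \<tau> (gen 0)) (fmap (st 0) Qgf) = qq (- \<tau> 1) * qq (\<tau> 1)"
      by (simp add: st_0_Q[simplified] fmap_mult[OF rhom_loc] fmap_lin[OF rhom_loc] fmap_geom[OF rhom_loc]
          loc_t rhom_minus[OF rhom_loc] qq_def)
    then show ?thesis unfolding fm using True by (simp add: qq_minus loc_Q[OF W_inf_id] negs_id)
  next
    case False
    then have n: "negs (gen i) = {}" by (auto simp: negs_def gen_pos split: if_splits)
    show ?thesis unfolding fm using False by (simp add: st_Q loc_Q[OF W_inf_id] loc_Q[OF W_inf_gen] n negs_id)
  qed
qed

lemma ivl_subset: "{1..N} \<subseteq> {1..max N N'}" "{1..N'} \<subseteq> {1..max N (N' :: nat)}"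
  by auto

text \<open>An element involves finitely many variables, and at the identity there are no negative
  letters, so every Q_r becomes a constant.\<close>

lemma loc_id_dep: "\<exists>N. \<forall>\<tau> \<tau>'. (\<forall>j\<in>{1..N}. \<tau> j = \<tau>' j) \<longrightarrow> loc \<tau> id f = loc \<tau>' id f"
proof (induction f rule: Rinf_induct)
  case one
  then show ?case by (simp add: rhom_1[OF rhom_loc])
next
  case (Q r)
  have *: "loc \<tau> id (Qr r) = fps_nth 1 r" for \<tau>
    using loc_Q[OF W_inf_id, of \<tau>] by (intro Qr_fmapD) (simp only: negs_id prod.empty)
  show ?case unfolding * by blast
next
  case (t i)
  then show ?case by (intro exI[of _ i]) (auto simp: loc_t)
next
  case (z i)
  then show ?case by (intro exI[of _ i]) (auto simp: loc_z sg_def)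
next
  case (diff a b)
  then obtain N N' where "\<forall>\<tau> \<tau>'. (\<forall>j\<in>{1..N}. \<tau> j = \<tau>' j) \<longrightarrow> loc \<tau> id a = loc \<tau>' id a"
    "\<forall>\<tau> \<tau>'. (\<forall>j\<in>{1..N'}. \<tau> j = \<tau>' j) \<longrightarrow> loc \<tau> id b = loc \<tau>' id b" by blast
  then have "\<forall>\<tau> \<tau>'. (\<forall>j\<in>{1..max N N'}. \<tau> j = \<tau>' j) \<longrightarrow> loc \<tau> id a = loc \<tau>' id a \<and> loc \<tau> id b = loc \<tau>' id b"
    using ivl_subset by blast
  then show ?case unfolding rhom_diff[OF rhom_loc] by metis
next
  case (mult a b)
  then obtain N N' where "\<forall>\<tau> \<tau>'. (\<forall>j\<in>{1..N}. \<tau> j = \<tau>' j) \<longrightarrow> loc \<tau> id a = loc \<tau>' id a"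
    "\<forall>\<tau> \<tau>'. (\<forall>j\<in>{1..N'}. \<tau> j = \<tau>' j) \<longrightarrow> loc \<tau> id b = loc \<tau>' id b" by blast
  then have "\<forall>\<tau> \<tau>'. (\<forall>j\<in>{1..max N N'}. \<tau> j = \<tau>' j) \<longrightarrow> loc \<tau> id a = loc \<tau>' id a \<and> loc \<tau> id b = loc \<tau>' id b"
    using ivl_subset by blast
  then show ?case unfolding rhom_mult[OF rhom_loc] by metis
qed

lemma loc_const: "loc (\<lambda>_. 0) id f = of_int (const_term f)"
proof -
  have m0: "mon (\<lambda>_. 0) m = (if m = 0 then 1 else (0::Rinf))" for m
  proof (cases "m = 0")
    case False
    then obtain v where v: "v \<in> Poly_Mapping.keys m" by (metis keys_eq_empty equals0I poly_mapping_eqI lookup_zero in_keys_iff)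
    then have "(0::Rinf) ^ Poly_Mapping.lookup m v = 0" by (simp add: in_keys_iff zero_power)
    then have "mon (\<lambda>_. 0) m = (0::Rinf)" unfolding mon_def by (intro prod_zero) (use v in auto)
    then show ?thesis using False by simp
  qed (simp add: mon_def)
  have "case_tzvar (\<lambda>i. 0) (\<lambda>i. 0) = (\<lambda>_. 0::Rinf)" by (rule ext) (simp split: tzvar.splits)
  then have "loc (\<lambda>_. 0) id f = pmev gct (\<lambda>_. 0) f"
    by (simp add: loc_def negs_id mkhom_def sg_def)
  also have "\<dots> = (\<Sum>m\<in>Poly_Mapping.keys f. if m = 0 then gct (Poly_Mapping.lookup f 0) else 0)"
    unfolding pmev_def by (rule sum.cong) (auto simp: m0)
  also have "\<dots> = gct (Poly_Mapping.lookup f 0)"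
    by (subst sum.delta) (auto simp: in_keys_iff rhom_0[OF rhom_gct])
  finally show ?thesis by (simp add: gct_def const_term_def)
qed

text \<open>Only finitely many parameters matter. By symmetry each of them can be exchanged with a
  zero stored beyond the last relevant index, until all parameters are 0 and only the constant term
  is left.\<close>

lemma symmetric_const:
  fixes f :: Rinf
  assumes sym: "\<And>i \<tau>. i \<ge> 1 \<Longrightarrow> loc (stw i \<tau>) id f = loc \<tau> id f"
  shows "loc \<tau> id f = of_int (const_term f)"
proof -
  let ?P = "\<lambda>\<tau>. loc \<tau> id f"
  have adj: "?P (\<sigma> \<circ> transpose i (Suc i)) = ?P \<sigma>" if "i \<ge> 1" for i \<sigma>
    using sym[OF that, of \<sigma>] that by (simp add: stw_def comp_def)
  have tr: "?P (\<sigma> \<circ> transpose a (Suc (a + d))) = ?P \<sigma>" if "a \<ge> 1" for a d \<sigma>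
  proof (induction d arbitrary: \<sigma>)
    case 0
    show ?case using adj[OF that, of \<sigma>] by (simp only: add_0_right)
  next
    case (Suc d)
    let ?b = "Suc (a + d)"
    have "transpose a (Suc ?b) = transpose ?b (Suc ?b) \<circ> transpose a ?b \<circ> transpose ?b (Suc ?b)"
      by (rule ext) (auto simp: transpose_def)
    then have "?P (\<sigma> \<circ> transpose a (Suc ?b)) = ?P (((\<sigma> \<circ> transpose ?b (Suc ?b)) \<circ> transpose a ?b) \<circ> transpose ?b (Suc ?b))"
      by (simp only: comp_assoc)
    also have "\<dots> = ?P ((\<sigma> \<circ> transpose ?b (Suc ?b)) \<circ> transpose a ?b)" by (rule adj) simp
    also have "\<dots> = ?P (\<sigma> \<circ> transpose ?b (Suc ?b))" by (rule Suc)
    also have "\<dots> = ?P \<sigma>" by (rule adj) simp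
    finally show ?case by (simp only: add_Suc_right)
  qed
  obtain N where N: "\<And>\<tau> \<tau>'. (\<forall>j\<in>{1..N}. \<tau> j = \<tau>' j) \<Longrightarrow> ?P \<tau> = ?P \<tau>'"
    using loc_id_dep[of f] by blast
  \<comment> \<open>The first k parameters are already cleared. Exchanging positions k + 1 and N + 1
    brings in a zero and moves the old value to a place on which f does not depend.\<close>
  define \<sigma> where "\<sigma> = (\<lambda>k j. if j \<le> k \<or> j > N then 0 else \<tau> j)"
  have "?P \<tau> = ?P (\<sigma> k)" if "k \<le> N" for k
    using that
  proof (induction k)
    case 0
    show ?case by (rule N) (auto simp: \<sigma>_def)
  next
    case (Suc k)
    have "?P (\<sigma> k) = ?P (\<sigma> k \<circ> transpose (Suc k) (Suc (Suc k + (N - Suc k))))"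
      using tr[of "Suc k" "\<sigma> k" "N - Suc k"] by simp
    also have "\<dots> = ?P (\<sigma> (Suc k))"
      by (rule N) (use Suc.prems in \<open>auto simp: \<sigma>_def transpose_def\<close>)
    finally have e: "?P (\<sigma> k) = ?P (\<sigma> (Suc k))" .
    from Suc.prems have "k \<le> N" by simp
    from Suc.IH[OF this] e show ?case by (rule trans)
  qed
  from this[of N] have "?P \<tau> = ?P (\<sigma> N)" by simp
  also have "\<dots> = ?P (\<lambda>_. 0)" by (rule N) (auto simp: \<sigma>_def)
  finally show ?thesis by (simp add: loc_const)
qed

lemma nzd_tv_add: "a \<ge> 1 \<Longrightarrow> b \<ge> 1 \<Longrightarrow> a \<noteq> b \<Longrightarrow> nzd (tv a + tv b)"
  and nzd_tv_diff: "a \<ge> 1 \<Longrightarrow> b \<ge> 1 \<Longrightarrow> a \<noteq> b \<Longrightarrow> nzd (tv a - tv b)"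
  using nzd_pvar_add[of "T (a - 1)" "T (b - 1)" 1] nzd_pvar_add[of "T (a - 1)" "T (b - 1)" "- 1"]
  by (auto simp: tv_pvar)

lemma nzd_sg_diff:
  assumes "c \<noteq> 0" "d \<noteq> 0" "c \<noteq> d" "c \<noteq> - d"
  shows "nzd (sg tv c - sg tv d)"
proof -
  let ?a = "nat \<bar>c\<bar>" and ?b = "nat \<bar>d\<bar>"
  have ab: "?a \<ge> 1" "?b \<ge> 1" "?a \<noteq> ?b" "?b \<noteq> ?a" using assms by auto
  have c: "sg tv c = (if c > 0 then tv ?a else - tv ?a)" and d: "sg tv d = (if d > 0 then tv ?b else - tv ?b)"
    using assms by (auto simp: sg_def)
  have "- tv ?a - tv ?b = - (tv ?a + tv ?b)" "- tv ?a - - tv ?b = tv ?b - tv ?a" "tv ?a - - tv ?b = tv ?a + tv ?b" by simp_all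
  then have "sg tv c - sg tv d \<in> {tv ?a + tv ?b, tv ?a - tv ?b, tv ?b - tv ?a, - (tv ?a + tv ?b)}"
    unfolding c d by auto
  then show ?thesis
    using nzd_tv_add[OF ab(1,2,3)] nzd_tv_diff[OF ab(1,2,3)] nzd_tv_diff[OF ab(2,1,4)] nzd_minus[OF nzd_tv_add[OF ab(1,2,3)]]
    unfolding insert_iff by (elim disjE emptyE) (simp_all only:)
qed

lemma nzd_loc_beta:
  assumes u: "u \<in> W_inf"
  shows "nzd (loc tv u (beta i))"
proof (cases "i = 0")
  case True
  have c: "u 1 \<noteq> 0" using W_inf_eq_0[OF u] by simp
  have "loc tv u (beta 0) = - (2 * sg tv (u 1))"
    unfolding beta_0 by (simp add: rhom_mult[OF rhom_loc] rhom_minus[OF rhom_loc] rhom_numeral[OF rhom_loc] loc_z)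
  also have "\<dots> = (if u 1 > 0 then - (2 * pvar (T (nat \<bar>u 1\<bar> - 1))) else 2 * pvar (T (nat \<bar>u 1\<bar> - 1)))"
    using c by (simp add: sg_def tv_pvar)
  finally show ?thesis using True nzd_2_pvar nzd_minus[OF nzd_2_pvar] by simp
next
  case False
  then have "loc tv u (beta i) = sg tv (u (int i)) - sg tv (u (int i + 1))"
    using beta_Suc[of i] by (simp add: rhom_diff[OF rhom_loc] loc_z add.commute)
  moreover have "u (int i) \<noteq> 0" "u (int i + 1) \<noteq> 0" "u (int i) \<noteq> u (int i + 1)" "u (int i) \<noteq> - u (int i + 1)"
    using False W_inf_eq_0[OF u] W_inf_inj[OF u] W_inf_minus[OF u, of "int i + 1"]
      W_inf_inj[OF u, of "int i" "- (int i + 1)"] by auto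
  ultimately show ?thesis using nzd_sg_diff by simp
qed

text \<open>At the parameters \<open>tv\<close> localisation is linear over Z[t] and can be applied
  termwise to expansions in the Schubert basis.\<close>

lemma Zt_loc: "a \<in> Zt \<Longrightarrow> loc tv u a = a"
  unfolding Zt_def
  by (induction rule: subring_gen.induct)
    (auto simp: loc_t rhom_1[OF rhom_loc] rhom_diff[OF rhom_loc] rhom_mult[OF rhom_loc])

section \<open>Degrees\<close>

text \<open>A filtration by degree, with t and z in degree 1 and Q_r in degree r. The degree is an
  integer so that divided differences can lower it below 0.\<close>

inductive Dg :: "int \<Rightarrow> Rinf \<Rightarrow> bool" where
  Dg_int: "Dg 0 (of_int n)"
| Dg_t: "j \<ge> 1 \<Longrightarrow> Dg 1 (tv j)"
| Dg_z: "j \<ge> 1 \<Longrightarrow> Dg 1 (zv j)"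
| Dg_Q: "Dg (int r) (Qr r)"
| Dg_zero: "Dg d 0"
| Dg_diff: "Dg d f \<Longrightarrow> Dg d g \<Longrightarrow> Dg d (f - g)"
| Dg_mult: "Dg a f \<Longrightarrow> Dg b g \<Longrightarrow> Dg (a + b) (f * g)"
| Dg_mono: "Dg a f \<Longrightarrow> a \<le> b \<Longrightarrow> Dg b f"

text \<open>The filtration is useful because nothing but 0 lies in negative degree and nothing but
  integers in degree 0. In a product of total degree at most 0, either one factor has negative
  degree and is 0, or both are integers.\<close>

lemma Dg_nonpos: "Dg d f \<Longrightarrow> (d < 0 \<longrightarrow> f = 0) \<and> (d = 0 \<longrightarrow> (\<exists>n. f = of_int n))"
proof (induction rule: Dg.induct)
  case (Dg_Q r)
  then show ?case by (auto simp: Qr_0 intro: exI[of _ 1])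
next
  case (Dg_zero d)
  then show ?case by (auto intro: exI[of _ 0])
next
  case (Dg_diff d f g)
  then show ?case by (metis diff_0_right of_int_diff)
next
  case (Dg_mult a f b g)
  consider "a < 0" | "b < 0" | "a = 0" "b = 0" | "a + b > 0" by linarith
  then show ?case
  proof cases
    case 3
    then show ?thesis using Dg_mult by (auto simp flip: of_int_mult)
  qed (use Dg_mult in \<open>auto intro: exI[of _ 0]\<close>)
next
  case (Dg_mono a f b)
  then show ?case by (cases "a < 0") (auto intro: exI[of _ 0])
qed auto

lemma Dg_z1: "Dg 1 (zv (Suc 0))"
  using Dg_z[of 1] by simp
lemma Dg_minus: "Dg d f \<Longrightarrow> Dg d (- f)"
  using Dg_diff[OF Dg_zero, of d f] by simp
lemma Dg_add: "Dg d f \<Longrightarrow> Dg d g \<Longrightarrow> Dg d (f + g)"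
  using Dg_diff[OF _ Dg_minus, of d f g] by simp
lemma Dg_sum: "(\<And>x. x \<in> A \<Longrightarrow> Dg d (F x)) \<Longrightarrow> Dg d (sum F A)"
  by (induction A rule: infinite_finite_induct) (auto intro: Dg_add Dg_zero)
lemma Dg_1: "Dg 0 1"
  using Dg_int[of 1] by simp
lemma Dg_2: "Dg d f \<Longrightarrow> Dg d (2 * f)"
  using Dg_add[of d f f] by (simp only: mult_2)
lemma Dg_power: "Dg d f \<Longrightarrow> Dg (int n * d) (f ^ n)"
  by (induction n) (auto simp: Dg_1 algebra_simps intro: Dg_mult)

lemma sz_0_Qr: "sz 0 (Qr r) = Qr r + 2 * (\<Sum>j=1..r. zv 1 ^ j * Qr (r - j))"
proof -
  have "sz 0 (Qr r) = (\<Sum>j=0..r. (if j = 0 then 1 else 2 * zv 1 ^ j) * Qr (r - j))"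
    unfolding Qr_fmapD[OF sz_0_Q, of r] fps_mult_nth[of "lin (zv 1) * geom (zv 1)" Qgf]
    by (simp add: lin_geom_nth Qgf_def del: One_nat_def)
  also have "\<dots> = Qr r + (\<Sum>j=1..r. 2 * zv 1 ^ j * Qr (r - j))"
    by (simp add: sum.atLeast_Suc_atMost)
  finally show ?thesis by (simp add: sum_distrib_left mult.assoc)
qed

lemma ddz_0_Qr: "ddz 0 (Qr r) = (\<Sum>j=1..r. zv 1 ^ (j - 1) * Qr (r - j))"
proof (rule ddz_eqI)
  have "zv 1 * (\<Sum>j=1..r. zv 1 ^ (j - 1) * Qr (r - j)) = (\<Sum>j=1..r. zv 1 ^ j * Qr (r - j))"
    unfolding sum_distrib_left by (rule sum.cong) (auto simp: Suc_le_eq simp flip: power_Suc mult.assoc)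
  then show "beta 0 * (\<Sum>j=1..r. zv 1 ^ (j - 1) * Qr (r - j)) = Qr r - sz 0 (Qr r)"
    unfolding sz_0_Qr beta_0 by (simp add: mult.assoc)
qed

lemma sz_Qr: "i \<ge> 1 \<Longrightarrow> sz i (Qr r) = Qr r"
  using Qr_fmapD[OF sz_Q, of i r] by (simp add: Qgf_def)

lemma Dg_zQ: "j \<le> r \<Longrightarrow> Dg (int r) (zv 1 ^ j * Qr (r - j))"
  using Dg_mult[OF Dg_power[OF Dg_z[of 1], of j] Dg_Q[of "r - j"]] by (simp add: of_nat_diff)

lemma Dg_sz: "Dg d f \<Longrightarrow> Dg d (sz i f)"
proof (induction rule: Dg.induct)
  case (Dg_Q r)
  show ?case
  proof (cases "i = 0")
    case True
    then show ?thesis unfolding True sz_0_Qr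
      by (intro Dg_add Dg_2 Dg_sum Dg.Dg_Q Dg_zQ) auto
  qed (simp add: sz_Qr Dg.Dg_Q)
next
  case (Dg_z j)
  show ?case
  proof (cases "i = 0")
    case True
    then show ?thesis using Dg_z by (cases "j = 1") (auto simp: sz_0_z intro: Dg_minus Dg.Dg_z Dg_z1)
  next
    case False
    then show ?thesis using Dg_z transpose_ge_1[of i j] by (simp add: sz_z Dg.Dg_z)
  qed
qed (auto simp: rhom_of_int[OF rhom_sz] sz_t rhom_0[OF rhom_sz] rhom_diff[OF rhom_sz] rhom_mult[OF rhom_sz]
  intro: Dg.intros)

text \<open>On products this is the twisted Leibniz rule, together with the fact that s_i^z
  preserves degrees.\<close>

lemma Dg_ddz: "Dg d f \<Longrightarrow> Dg (d - 1) (ddz i f)"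
proof (induction rule: Dg.induct)
  case (Dg_int n)
  then show ?case by (simp add: ddz_sz_fixed rhom_of_int[OF rhom_sz] Dg_zero)
next
  case (Dg_t j)
  then show ?case by (simp add: ddz_sz_fixed sz_t Dg_zero)
next
  case (Dg_z j)
  have "\<exists>n. ddz i (zv j) = of_int n"
  proof (cases "i = 0")
    case True
    show ?thesis
    proof (cases "j = 1")
      case True
      have "ddz 0 (zv 1) = - 1" by (rule ddz_eqI) (simp add: sz_0_z beta_0)
      then show ?thesis using True \<open>i = 0\<close> by (intro exI[of _ "- 1"]) simp
    next
      case False
      then have "ddz 0 (zv j) = 0" using Dg_z by (intro ddz_sz_fixed) (simp add: sz_0_z)
      then show ?thesis using True by (intro exI[of _ 0]) simp
    qed
  next
    case False
    then have i: "i \<ge> 1" by simp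
    consider "j = i" | "j = i + 1" | "j \<noteq> i" "j \<noteq> i + 1" by blast
    then show ?thesis
    proof cases
      case 1
      have "ddz i (zv i) = 1" using i by (intro ddz_eqI) (simp add: beta_Suc sz_z)
      then show ?thesis using 1 by (intro exI[of _ 1]) simp
    next
      case 2
      have "ddz i (zv (i + 1)) = - 1" using i by (intro ddz_eqI) (simp add: beta_Suc sz_z)
      then show ?thesis using 2 by (intro exI[of _ "- 1"]) simp
    next
      case 3
      then have "ddz i (zv j) = 0" using i Dg_z by (intro ddz_sz_fixed) (simp add: sz_z transpose_apply_other)
      then show ?thesis by (intro exI[of _ 0]) simp
    qed
  qed
  then show ?case using Dg_int by auto
next
  case (Dg_Q r)
  show ?case
  proof (cases "i = 0")
    case True
    have "Dg (int r - 1) (zv 1 ^ (j - 1) * Qr (r - j))" if "j \<in> {1..r}" for j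
      using Dg_zQ[of "j - 1" "r - 1"] that by (simp add: of_nat_diff Suc_le_eq diff_le_mono)
    then show ?thesis unfolding True ddz_0_Qr by (intro Dg_sum)
  qed (simp add: ddz_sz_fixed sz_Qr Dg_zero)
next
  case (Dg_mult a f b g)
  have "Dg (a - 1 + b) (ddz i f * g)" "Dg (a + (b - 1)) (sz i f * ddz i g)"
    using Dg_mult Dg_sz by (auto intro: Dg.Dg_mult)
  then show ?case unfolding ddz_mult by (intro Dg_add) (simp_all add: algebra_simps)
next
  case (Dg_mono a f b)
  then show ?case by (auto intro: Dg.Dg_mono)
qed (auto simp: ddz_0 ddz_diff intro: Dg_zero Dg_diff)

section \<open>Localisation of double Schubert polynomials\<close>

locale schubert =
  fixes C :: "(int \<Rightarrow> int) \<Rightarrow> Rinf"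
  assumes ds: "double_schubert C"
begin

lemma ddz_C: "w \<in> W_inf \<Longrightarrow> ddz i (C w) = (if desc w i then C (w \<circ> gen i) else 0)"
  using ds by (simp add: double_schubert_def len_less_iff)

lemma ddt_C: "w \<in> W_inf \<Longrightarrow> ddt i (C w) = (if desc (inv w) i then C (gen i \<circ> w) else 0)"
  using ds by (simp add: double_schubert_def len_left_iff)

lemma C_id: "C id = 1"
  using ds by (simp add: double_schubert_def)

lemma C_const: "w \<in> W_inf \<Longrightarrow> w \<noteq> id \<Longrightarrow> const_term (C w) = 0"
  using ds by (simp add: double_schubert_def)

lemma C_span:
  obtains S a where "finite S" "S \<subseteq> W_inf" "\<And>w. w \<in> S \<Longrightarrow> a w \<in> Zt" "f = (\<Sum>w\<in>S. a w * C w)"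
  using ds unfolding double_schubert_def Zt_basis_def by metis

lemma C_indep:
  "finite S \<Longrightarrow> S \<subseteq> W_inf \<Longrightarrow> (\<And>w. w \<in> S \<Longrightarrow> a w \<in> Zt) \<Longrightarrow> (\<Sum>w\<in>S. a w * C w) = 0 \<Longrightarrow> w \<in> S \<Longrightarrow> a w = 0"
  using ds unfolding double_schubert_def Zt_basis_def by blast

lemma comp_gen_eq_id: "v \<circ> gen i = id \<longleftrightarrow> v = gen i"
proof
  assume *: "v \<circ> gen i = id"
  show "v = gen i"
  proof
    fix x show "v x = gen i x" using fun_cong[OF *, of "gen i x"] by simp
  qed
qed (simp add: gen_comp_gen)

lemma gen_comp_eq_id: "gen i \<circ> v = id \<longleftrightarrow> v = gen i"
proof
  assume *: "gen i \<circ> v = id"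
  show "v = gen i"
  proof
    fix x have "gen i (gen i (v x)) = gen i x" using fun_cong[OF *, of x] by simp
    then show "v x = gen i x" by simp
  qed
qed (simp add: gen_comp_gen)

lemma desc_gen: "desc (gen i) i"
  by (auto simp: desc_def gen_0 gen_pos)

lemma inv_gen: "inv (gen i) = gen i"
  by (rule inv_unique[OF W_inf_bij[OF W_inf_gen]]) (rule gen_comp_gen)

text \<open>Evaluation at \<open>z = t\<close>, \<open>x = 0\<close>: the recursions make \<open>loc \<tau> id (C v)\<close> invariant under all
  permutations of the infinitely many values \<open>\<tau> j\<close>, hence constant.\<close>

lemma loc_id_C:
  assumes "v \<in> W_inf" "v \<noteq> id"
  shows "loc \<tau> id (C v) = 0"
  using assms
proof (induction "len v" arbitrary: v \<tau> rule: less_induct)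
  case less
  note v = less.prems(1)
  have IH: "loc \<tau> id (C x) = (if x = id then 1 else 0)" if "len x < len v" "x \<in> W_inf" for x \<tau>
    using less.hyps[OF that] by (simp add: C_id rhom_1[OF rhom_loc])
  \<comment> \<open>Write E for the localisation at the identity. Permuting the parameters turns
    E(C_v) into E(s_i^z s_i^t C_v), which expands into C_v and three correction terms. The mixed
    one, with both divided differences, belongs to s_i v s_i, which is shorter than v and not the
    identity, or is 0 outright. The other two have equal values of the divided differences, and they
    cancel because E(beta i) = -E(alpha i).\<close>
  have inv: "loc (stw i \<tau>) id (C v) = loc \<tau> id (C v)" for i \<tau>
  proof -
    let ?E = "loc \<tau> id" and ?D = "ddt i (C v)"
    note R = rhom_diff[OF rhom_loc] rhom_mult[OF rhom_loc]
    have Eb: "?E (beta i) = - ?E (alpha i)"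
    proof (cases "i = 0")
      case True
      then show ?thesis unfolding True beta_0
        by (simp add: alpha_def R loc_z loc_t rhom_numeral[OF rhom_loc] rhom_minus[OF rhom_loc] sg_def)
    next
      case False
      then have b: "beta i = zv i - zv (i + 1)" and a: "alpha i = tv (i + 1) - tv i"
        by (simp_all add: beta_Suc) (simp add: alpha_def)
      show ?thesis using False unfolding b
        unfolding a by (simp add: R loc_z loc_t sg_def nat_add_distrib)
    qed
    have E1: "?E (ddz i (C v)) = (if v = gen i then 1 else 0)"
    proof (cases "desc v i")
      case True
      then show ?thesis using len_gen(1)[OF v True] IH[of "v \<circ> gen i" \<tau>] W_inf_comp[OF v W_inf_gen]
        by (simp add: ddz_C[OF v] comp_gen_eq_id)
    next
      case False
      then show ?thesis using desc_gen by (auto simp: ddz_C[OF v] rhom_0[OF rhom_loc])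
    qed
    have E2: "?E ?D = (if v = gen i then 1 else 0)"
    proof (cases "desc (inv v) i")
      case True
      then show ?thesis using len_left(1)[OF v True] IH[of "gen i \<circ> v" \<tau>] W_inf_comp[OF W_inf_gen v]
        by (simp add: ddt_C[OF v] gen_comp_eq_id)
    next
      case False
      then show ?thesis using desc_gen by (auto simp: ddt_C[OF v] rhom_0[OF rhom_loc] inv_gen)
    qed
    have E3: "?E (ddz i ?D) = 0"
    proof (cases "desc (inv v) i")
      case True
      let ?x = "gen i \<circ> v"
      have x: "?x \<in> W_inf" using W_inf_comp[OF W_inf_gen v] .
      have lx: "len ?x < len v" using len_left(1)[OF v True] by simp
      show ?thesis
      proof (cases "desc ?x i")
        case d: True
        have "len (?x \<circ> gen i) < len v" using len_gen(1)[OF x d] lx by simp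
        moreover have "?x \<circ> gen i \<noteq> id"
        proof
          assume "?x \<circ> gen i = id"
          then have g: "gen i \<circ> v = gen i" by (simp only: comp_gen_eq_id)
          have "v x = x" for x using fun_cong[OF g, of x] gen_gen[of i "v x"] by simp
          then have "v = id" by (intro ext) simp
          then show False using less.prems(2) by blast
        qed
        ultimately show ?thesis using IH[of "?x \<circ> gen i" \<tau>] W_inf_comp[OF x W_inf_gen] d True
          by (simp only: ddt_C[OF v] ddz_C[OF x] if_True if_False)
      next
        case d: False
        then show ?thesis using True by (simp only: ddt_C[OF v] ddz_C[OF x] if_True if_False rhom_0[OF rhom_loc])
      qed
    next
      case False
      then show ?thesis by (simp add: ddt_C[OF v] ddz_0 rhom_0[OF rhom_loc])
    qed
    have a: "sz i (alpha i) = alpha i"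
      by (cases "i = 0") (auto simp: alpha_def rhom_diff[OF rhom_sz] rhom_mult[OF rhom_sz] rhom_numeral[OF rhom_sz] sz_t)
    have "gen i = id \<circ> gen i" by simp
    have "loc (stw i \<tau>) id (C v) = loc \<tau> (gen i) (st i (C v))"
      using fun_cong[OF loc_st] .
    also have "\<dots> = ?E (sz i (st i (C v)))"
      using fun_cong[OF loc_sz[OF W_inf_id]] by simp
    also have "sz i (st i (C v)) = sz i (C v) - alpha i * sz i ?D"
      unfolding st_ddt by (simp add: rhom_diff[OF rhom_sz] rhom_mult[OF rhom_sz] a)
    also have "\<dots> = C v - beta i * ddz i (C v) - alpha i * (?D - beta i * ddz i ?D)"
      by (simp only: sz_ddz)
    also have "?E \<dots> = ?E (C v)"
      by (simp only: R Eb E1 E2 E3) (simp add: algebra_simps)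
    finally show ?thesis .
  qed
  show ?case using symmetric_const[OF inv] C_const[OF less.prems] by simp
qed

text \<open>Let i be a right descent of u. The value at u is that of C_v - beta_i (divided
  difference of C_v) at the shorter point u s_i, and there C_v and C_(v s_i) vanish by induction.
  Comparing lengths takes the place of the Bruhat order.\<close>

lemma loc_C_zero:
  assumes "u \<in> W_inf" "v \<in> W_inf" "len u \<le> len v" "u \<noteq> v"
  shows "loc \<tau> u (C v) = 0"
  using assms
proof (induction "len u" arbitrary: u v rule: less_induct)
  case less
  show ?case
  proof (cases "u = id")
    case True
    then show ?thesis using loc_id_C less.prems by metis
  next
    case False
    then obtain i where i: "desc u i" using no_desc_id less.prems(1) by blast
    let ?u = "u \<circ> gen i"
    have u': "?u \<in> W_inf" using W_inf_comp[OF less.prems(1) W_inf_gen] .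
    have lu: "len u = Suc (len ?u)" by (rule len_gen(1)[OF less.prems(1) i])
    have uu: "u = ?u \<circ> gen i" by (rule ext) simp
    have "loc \<tau> u (C v) = loc \<tau> ?u (sz i (C v))"
      using fun_cong[OF loc_sz[OF u', of \<tau> i], of "C v"] by (simp only: uu[symmetric])
    also have "\<dots> = loc \<tau> ?u (C v) - loc \<tau> ?u (beta i) * loc \<tau> ?u (ddz i (C v))"
      by (simp only: sz_ddz rhom_diff[OF rhom_loc] rhom_mult[OF rhom_loc])
    also have "loc \<tau> ?u (C v) = 0"
      by (rule less.hyps) (use lu u' less.prems in auto)
    also have "loc \<tau> ?u (ddz i (C v)) = 0"
    proof (cases "desc v i")
      case True
      have "loc \<tau> ?u (C (v \<circ> gen i)) = 0"
      proof (rule less.hyps)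
        show "v \<circ> gen i \<in> W_inf" using W_inf_comp[OF less.prems(2) W_inf_gen] .
        show "len ?u \<le> len (v \<circ> gen i)" using lu len_gen(1)[OF less.prems(2) True] less.prems(3) by simp
        show "?u \<noteq> v \<circ> gen i"
        proof
          assume "?u = v \<circ> gen i"
          then have "u x = v x" for x using fun_cong[of ?u "v \<circ> gen i" "gen i x"] unfolding comp_apply gen_gen by blast
          then show False using less.prems(4) by blast
        qed
      qed (use lu u' in auto)
      then show ?thesis using True by (simp only: ddz_C[OF less.prems(2)] if_True)
    next
      case False
      then show ?thesis by (simp only: ddz_C[OF less.prems(2)] if_False rhom_0[OF rhom_loc])
    qed
    finally show ?thesis by simp
  qed
qed

text \<open>The same recursion at u = v leaves one term: up to sign the value is a product of
  localised simple roots, each of which can be cancelled.\<close>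

lemma nzd_loc_C:
  assumes "u \<in> W_inf"
  shows "nzd (loc tv u (C u))"
  using assms
proof (induction "len u" arbitrary: u rule: less_induct)
  case less
  show ?case
  proof (cases "u = id")
    case True
    have "loc tv id (C id) = 1" by (simp only: C_id rhom_1[OF rhom_loc])
    then show ?thesis using True nzd_1 by metis
  next
    case False
    then obtain i where i: "desc u i" using no_desc_id less.prems(1) by blast
    let ?u = "u \<circ> gen i"
    have u': "?u \<in> W_inf" using W_inf_comp[OF less.prems(1) W_inf_gen] .
    have lu: "len u = Suc (len ?u)" by (rule len_gen(1)[OF less.prems(1) i])
    have uu: "u = ?u \<circ> gen i" by (rule ext) simp
    have "loc tv u (C u) = loc tv ?u (sz i (C u))"
      using fun_cong[OF loc_sz[OF u', of tv i], of "C u"] by (simp only: uu[symmetric])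
    also have "\<dots> = loc tv ?u (C u) - loc tv ?u (beta i) * loc tv ?u (ddz i (C u))"
      by (simp only: sz_ddz rhom_diff[OF rhom_loc] rhom_mult[OF rhom_loc])
    also have "loc tv ?u (C u) = 0"
      by (rule loc_C_zero) (use lu u' less.prems in auto)
    also have "ddz i (C u) = C ?u"
      using i by (simp only: ddz_C[OF less.prems] if_True)
    finally have "loc tv u (C u) = - (loc tv ?u (beta i) * loc tv ?u (C ?u))" by (simp only: diff_0)
    then show ?thesis
      using nzd_minus[OF nzd_mult[OF nzd_loc_beta[OF u'] less.hyps[OF _ u']]] lu by (simp only: lessI simp_thms)
  qed
qed

text \<open>The coefficients lie in Z[t] and pass through the divided difference, which merely
  relabels w as w s_i and discards the terms without a descent at i.\<close>

lemma ddz_expansion: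
  assumes S: "finite S" "S \<subseteq> W_inf" "\<And>w. w \<in> S \<Longrightarrow> a w \<in> Zt"
  shows "ddz i (\<Sum>w\<in>S. a w * C w) =
     (\<Sum>x\<in>(\<lambda>w. w \<circ> gen i) ` {w\<in>S. desc w i}. a (x \<circ> gen i) * C x)"
proof -
  have gg: "w \<circ> gen i \<circ> gen i = w" for w :: "int \<Rightarrow> int" by (rule ext) simp
  have inj: "inj_on (\<lambda>w. w \<circ> gen i) {w\<in>S. desc w i}"
    by (rule inj_onI) (metis gg)
  have "ddz i (\<Sum>w\<in>S. a w * C w) = (\<Sum>w\<in>S. a w * ddz i (C w))"
    unfolding ddz_sum by (rule sum.cong) (auto intro: ddz_lin Zt_sz S)
  also have "\<dots> = (\<Sum>w\<in>S. if desc w i then a w * C (w \<circ> gen i) else 0)"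
    by (rule sum.cong) (use S(2) ddz_C in auto)
  also have "\<dots> = (\<Sum>w\<in>{w\<in>S. desc w i}. a w * C (w \<circ> gen i))"
    by (simp add: sum.inter_filter[OF S(1)])
  also have "\<dots> = (\<Sum>x\<in>(\<lambda>w. w \<circ> gen i) ` {w\<in>S. desc w i}. a (x \<circ> gen i) * C x)"
    by (subst sum.reindex[OF inj]) (simp add: gg)
  finally show ?thesis .
qed

lemma ex_int0: "\<exists>n. (0::Rinf) = of_int n"
  by (rule exI[of _ 0]) simp

text \<open>The Schubert basis is adapted to the degree filtration. A right divided difference along
  a descent of w lowers the length and the degree by one and keeps the coefficient, so everything is
  pushed down to nonpositive degree, where \<open>Dg_nonpos\<close> and independence decide.\<close>

lemma degree_coeffs:
  assumes "Dg d (\<Sum>w\<in>S. a w * C w)" "finite S" "S \<subseteq> W_inf" "\<And>w. w \<in> S \<Longrightarrow> a w \<in> Zt" "w \<in> S"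
  shows "(int (len w) > d \<longrightarrow> a w = 0) \<and> (int (len w) = d \<longrightarrow> (\<exists>n. a w = of_int n))"
proof -
  have gg: "w \<circ> gen i \<circ> gen i = w" for w :: "int \<Rightarrow> int" and i by (rule ext) simp
  \<comment> \<open>Induction on an upper bound k of the degree; its base case covers all negative
    degrees.\<close>
  have key: "(int (len w) > d \<longrightarrow> a w = 0) \<and> (int (len w) = d \<longrightarrow> (\<exists>n. a w = of_int n))"
    if "d < int k" "Dg d (\<Sum>w\<in>S. a w * C w)" "finite S" "S \<subseteq> W_inf" "\<And>w. w \<in> S \<Longrightarrow> a w \<in> Zt" "w \<in> S" for k d S a w
    using that
  proof (induction k arbitrary: d S a w)
    case 0
    then have "(\<Sum>w\<in>S. a w * C w) = 0" using Dg_nonpos by auto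
    then have "a w = 0" using C_indep[OF 0(3,4)] 0 by blast
    then show ?case using ex_int0 by simp
  next
    case (Suc k)
    note w = subsetD[OF Suc.prems(4)]
    have step: "(int (len w) > d \<longrightarrow> a w = 0) \<and> (int (len w) = d \<longrightarrow> (\<exists>n. a w = of_int n))" if wS: "w \<in> S" and "w \<noteq> id" for w
    proof -
      obtain i where i: "desc w i" using no_desc_id w[OF wS] \<open>w \<noteq> id\<close> by blast
      let ?S = "(\<lambda>w. w \<circ> gen i) ` {w\<in>S. desc w i}" and ?a = "\<lambda>x. a (x \<circ> gen i)"
      have dgs: "Dg (d - 1) (\<Sum>x\<in>?S. ?a x * C x)"
        using Dg_ddz[OF Suc.prems(2), of i]
        by (simp only: ddz_expansion[where S = S and a = a and i = i, OF Suc.prems(3,4,5)])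
      have "(int (len (w \<circ> gen i)) > d - 1 \<longrightarrow> ?a (w \<circ> gen i) = 0) \<and>
          (int (len (w \<circ> gen i)) = d - 1 \<longrightarrow> (\<exists>n. ?a (w \<circ> gen i) = of_int n))"
      proof (rule Suc.IH[where a = ?a, OF _ dgs])
        show "d - 1 < int k" using Suc.prems(1) by simp
        show "finite ?S" using Suc.prems(3) by simp
        show "?S \<subseteq> W_inf" using w W_inf_comp[OF _ W_inf_gen] by blast
        show "w \<circ> gen i \<in> ?S" using wS i by blast
        show "a (x \<circ> gen i) \<in> Zt" if x: "x \<in> ?S" for x
        proof -
          obtain v where v: "x = v \<circ> gen i" "v \<in> S" using x by blast
          show ?thesis unfolding v(1) gg by (rule Suc.prems(5)[OF v(2)])
        qed
      qed
      then show ?thesis using len_gen(1)[OF w[OF wS] i] unfolding gg by simp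
    qed
    show ?case
    proof (cases "w = id")
      case True
      show ?thesis
      proof (cases "d < 0")
        case True
        then have "(\<Sum>w\<in>S. a w * C w) = 0" using Dg_nonpos Suc.prems(2) by auto
        then have "a w = 0" using C_indep[OF Suc.prems(3,4)] Suc.prems by blast
        then show ?thesis using ex_int0 by simp
      next
        case d: False
        \<comment> \<open>In degree 0 every coefficient other than that of the identity vanishes by
          \<open>step\<close>, so the whole sum is this coefficient, and an element of degree 0 is
          an integer.\<close>
        have "\<exists>n. a w = of_int n" if "d = 0"
        proof -
          have "a x * C x = 0" if "x \<in> S - {id}" for x
          proof -
            have "len x \<noteq> 0" using that len_0[OF w] by auto
            then have "a x = 0" using step[of x] that \<open>d = 0\<close> by auto
            then show ?thesis by simp
          qed
          then have "(\<Sum>w\<in>S. a w * C w) = a id * C id"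
            unfolding sum.remove[OF Suc.prems(3) Suc.prems(6)[unfolded True]] by simp
          then show ?thesis using Dg_nonpos[OF Suc.prems(2)] that True by (auto simp: C_id)
        qed
        then have "\<exists>n. a w = of_int n" if "d = 0" using that by (simp only: True)
        moreover have "len w = 0" by (simp only: True len_id)
        ultimately show ?thesis using d by auto
      qed
    qed (use step Suc.prems(6) in blast)
  qed
  show ?thesis by (rule key[OF _ assms, of "nat (d + 1)"]) auto
qed

text \<open>Triangularity: elements longer than d are excluded by degree. At a u of length at most d
  other than w, terms at least as long as u vanish by \<open>loc_C_zero\<close> and shorter ones by
  induction, so the vanishing of F at u forces its own coefficient to be 0.\<close>

lemma multiple_of_C:
  assumes w: "w \<in> W_inf" and deg: "Dg d F" "d \<le> int (len w)"
    and van: "\<And>u. u \<in> W_inf \<Longrightarrow> int (len u) \<le> d \<Longrightarrow> u \<noteq> w \<Longrightarrow> loc tv u F = 0"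
  shows "\<exists>n. F = of_int n * C w"
proof -
  obtain S a where S: "finite S" "S \<subseteq> W_inf" "\<And>w. w \<in> S \<Longrightarrow> a w \<in> Zt" and F: "F = (\<Sum>w\<in>S. a w * C w)"
    by (rule C_span[of F]) blast
  have dg: "(int (len u) > d \<longrightarrow> a u = 0) \<and> (int (len u) = d \<longrightarrow> (\<exists>n. a u = of_int n))" if "u \<in> S" for u
    using degree_coeffs[OF deg(1)[unfolded F] S that] by simp
  have "a u = 0" if "u \<in> S" "u \<noteq> w" for u
    using that
  proof (induction "len u" arbitrary: u rule: less_induct)
    case less
    show ?case
    proof (cases "int (len u) \<le> d")
      case True
      have u: "u \<in> W_inf" using S less by blast
      have "a x * loc tv u (C x) = 0" if "x \<in> S - {u}" for x
      proof (cases "len u \<le> len x")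
        case True
        then show ?thesis using loc_C_zero[OF u, of x] that S(2) by auto
      next
        case False
        \<comment> \<open>Here x is shorter than u, whereas the length of w is at least d and hence
          at least that of u.\<close>
        then have "x \<noteq> w" using True deg(2) by auto
        then have "a x = 0" using False less.hyps[of x] that by auto
        then show ?thesis by simp
      qed
      then have "(\<Sum>x\<in>S. a x * loc tv u (C x)) = a u * loc tv u (C u)"
        using less.prems(1) by (subst sum.remove[OF S(1), of u]) auto
      moreover have "loc tv u F = (\<Sum>x\<in>S. a x * loc tv u (C x))"
        unfolding F rhom_sum[OF rhom_loc] rhom_mult[OF rhom_loc]
        by (rule sum.cong) (auto simp: Zt_loc S)
      ultimately have "loc tv u (C u) * a u = 0"
        using van[OF u True less.prems(2)] by (simp add: mult.commute)
      then show ?thesis by (rule nzdD[OF nzd_loc_C[OF u]])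
    qed (use dg less.prems in auto)
  qed
  then have "F = (\<Sum>x\<in>S. if x = w then a w * C w else 0)"
    unfolding F by (intro sum.cong) auto
  then have F': "F = (if w \<in> S then a w * C w else 0)"
    using S(1) by (simp add: sum.delta)
  show ?thesis
  proof (cases "w \<in> S")
    case True
    have "\<exists>n. a w = of_int n"
      using dg[OF True] deg(2) ex_int0 by (cases "int (len w) = d") auto
    then show ?thesis using F' True by auto
  next
    case False
    then show ?thesis using F' by (intro exI[of _ 0]) simp
  qed
qed

text \<open>Closed under all divided differences. In the normalisations below one only follows that
  the unknown factor stays in this set, not which element it is.\<close>

definition Cset :: "Rinf set" where "Cset = insert 0 (C ` W_inf)"

lemma Cset_ddz: "X \<in> Cset \<Longrightarrow> ddz i X \<in> Cset"
  using W_inf_comp[OF _ W_inf_gen] by (auto simp: Cset_def ddz_0 ddz_C)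

lemma Cset_ddt: "X \<in> Cset \<Longrightarrow> ddt i X \<in> Cset"
  using W_inf_comp[OF W_inf_gen] by (auto simp: Cset_def ddt_0 ddt_C)

lemma Zt_int: "of_int n \<in> Zt"
proof -
  have 0: "0 \<in> Zt" "1 \<in> Zt" unfolding Zt_def by (auto intro: subring_gen.one subring_gen_zero)
  have "of_nat k \<in> Zt" for k
    by (induction k) (use 0 in \<open>auto simp: Zt_def intro: subring_gen_add\<close>)
  then show ?thesis
    by (cases n rule: int_diff_cases) (auto simp: Zt_def intro: subring_gen.diff)
qed

text \<open>If X were C_w with w other than the identity, then C_id - n C_w = 0 would be a relation
  in the basis with coefficient 1 at the identity.\<close>

lemma Cset_one:
  assumes "X \<in> Cset" "1 = of_int n * X"
  shows "of_int n = (1::Rinf)"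
proof (cases "X = 0")
  case False
  then obtain w where w: "w \<in> W_inf" "X = C w" using assms(1) by (auto simp: Cset_def)
  show ?thesis
  proof (cases "w = id")
    case True
    then show ?thesis using assms(2) w C_id by simp
  next
    case False
    define a where "a = (\<lambda>x :: int \<Rightarrow> int. if x = id then 1 else - of_int n :: Rinf)"
    have "(\<Sum>x\<in>{id, w}. a x * C x) = 0"
      using False assms(2) w(2) C_id by (simp add: a_def)
    moreover have "a x \<in> Zt" for x
      using Zt_int[of 1] Zt_int[of "- n"] by (auto simp: a_def)
    ultimately have "a id = 0" using C_indep[of "{id, w}" a id] w(1) W_inf_id by simp
    then show ?thesis by (simp add: a_def)
  qed
qed (use assms in simp)

end

section \<open>Theta polynomials\<close>

definition sq :: "'a::comm_ring_1 fps \<Rightarrow> int \<Rightarrow> 'a" where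
  "sq F r = (if r < 0 then 0 else fps_nth F (nat r))"

lemma theta_sq: "theta \<kappa> l = sq (theta_gf \<kappa> l)"
  by (rule ext) (simp add: theta_def sq_def)

lemma sq_mult_lin: "sq (F * lin x) r = sq F r + x * sq F (r - 1)"
proof -
  have "F * lin x = F + fps_const x * (F * fps_X)"
    by (simp add: lin_def distrib_left mult_ac)
  then have "fps_nth (F * lin x) n = fps_nth F n + x * (if n = 0 then 0 else fps_nth F (n - 1))" for n
    by simp
  then show ?thesis by (auto simp: sq_def nat_diff_distrib)
qed

lemma rhom_sq: "rhom h \<Longrightarrow> h (sq F r) = sq (fmap h F) r"
  by (simp add: sq_def rhom_0)

lemma theta_nat: "theta \<kappa> l (int r) = fps_nth (theta_gf \<kappa> l) r"
  by (simp add: theta_def)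

lemma theta_neg: "r < 0 \<Longrightarrow> theta \<kappa> l r = 0"
  by (simp add: theta_def)

definition tpart :: "int \<Rightarrow> Rinf fps" where
  "tpart l = (if l \<ge> 0 then (\<Prod>i\<in>{1..nat l}. lin (- tv i)) else (\<Prod>i\<in>{1..nat (- l)}. geom (- tv i)))"

lemma theta_gf_tpart: "theta_gf \<kappa> l = Qgf * (\<Prod>i\<in>{1..\<kappa>}. lin (zv i)) * tpart l"
  by (simp add: theta_gf_def tpart_def)

lemma prod_transpose:
  assumes "i \<noteq> L" "i \<ge> 1"
  shows "(\<Prod>j\<in>{1..L}. F (transpose i (i + 1) j)) = (\<Prod>j\<in>{1..L::nat}. F j)"
  by (rule prod.reindex_bij_witness[of _ "transpose i (i + 1)" "transpose i (i + 1)"])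
    (use assms in \<open>auto simp: transpose_def\<close>)

lemma st_tpart: "i \<ge> 1 \<Longrightarrow> i \<noteq> nat \<bar>l\<bar> \<Longrightarrow> fmap (st i) (tpart l) = tpart l"
proof -
  assume i: "i \<ge> 1" "i \<noteq> nat \<bar>l\<bar>"
  note R = fmap_prod[OF rhom_st] fmap_lin[OF rhom_st] fmap_geom[OF rhom_st] rhom_minus[OF rhom_st]
  show ?thesis
  proof (cases "l \<ge> 0")
    case True
    have "fmap (st i) (tpart l) = (\<Prod>j\<in>{1..nat l}. lin (- tv (transpose i (i + 1) j)))"
      using True i(1) by (simp add: tpart_def R) (rule prod.cong, auto simp: st_t)
    also have "\<dots> = tpart l"
      using True i prod_transpose[of i "nat l" "\<lambda>j. lin (- tv j)"] by (simp add: tpart_def)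
    finally show ?thesis .
  next
    case False
    have "fmap (st i) (tpart l) = (\<Prod>j\<in>{1..nat (- l)}. geom (- tv (transpose i (i + 1) j)))"
      using False i(1) by (simp add: tpart_def R) (rule prod.cong, auto simp: st_t)
    also have "\<dots> = tpart l"
      using False i prod_transpose[of i "nat (- l)" "\<lambda>j. geom (- tv j)"] by (simp add: tpart_def)
    finally show ?thesis .
  qed
qed

text \<open>The sign change of t_1 in the first t-factor is compensated by the factor that s_0^t
  puts on the Q-series. At level 0 there is no such t-factor.\<close>

lemma st_0_tpart: "l \<noteq> 0 \<Longrightarrow> lin (- tv 1) * geom (- tv 1) * fmap (st 0) (tpart l) = tpart l"
proof -
  assume l: "l \<noteq> 0"
  note R = fmap_prod[OF rhom_st] fmap_lin[OF rhom_st] fmap_geom[OF rhom_st] rhom_minus[OF rhom_st]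
  show ?thesis
  proof (cases "l \<ge> 0")
    case True
    then have pos: "1 \<le> nat l" using l by simp
    have "fmap (st 0) (tpart l) = (\<Prod>j\<in>{1..nat l}. lin (- st 0 (tv j)))"
      using True by (simp add: tpart_def R)
    also have "\<dots> = lin (tv 1) * (\<Prod>j\<in>{Suc 1..nat l}. lin (- st 0 (tv j)))"
      unfolding prod.atLeast_Suc_atMost[OF pos] by (simp add: st_0_t)
    also have "(\<Prod>j\<in>{Suc 1..nat l}. lin (- st 0 (tv j))) = (\<Prod>j\<in>{Suc 1..nat l}. lin (- tv j))"
      by (rule prod.cong) (auto simp: st_0_t)
    finally have 1: "fmap (st 0) (tpart l) = lin (tv 1) * (\<Prod>j\<in>{Suc 1..nat l}. lin (- tv j))" .
    have 2: "tpart l = lin (- tv 1) * (\<Prod>j\<in>{Suc 1..nat l}. lin (- tv j))"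
      using True prod.atLeast_Suc_atMost[OF pos, of "\<lambda>j. lin (- tv j)"] by (simp add: tpart_def)
    have "lin (- tv 1) * geom (- tv 1) * fmap (st 0) (tpart l)
        = (lin (tv 1) * geom (- tv 1)) * (lin (- tv 1) * (\<Prod>j\<in>{Suc 1..nat l}. lin (- tv j)))"
      unfolding 1 by (simp only: mult_ac)
    then show ?thesis by (simp only: lin_geom_cancel' 2 mult_1_left)
  next
    case False
    then have pos: "1 \<le> nat (- l)" by simp
    have "fmap (st 0) (tpart l) = (\<Prod>j\<in>{1..nat (- l)}. geom (- st 0 (tv j)))"
      using False by (simp add: tpart_def R)
    also have "\<dots> = geom (tv 1) * (\<Prod>j\<in>{Suc 1..nat (- l)}. geom (- st 0 (tv j)))"
      unfolding prod.atLeast_Suc_atMost[OF pos] by (simp add: st_0_t)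
    also have "(\<Prod>j\<in>{Suc 1..nat (- l)}. geom (- st 0 (tv j))) = (\<Prod>j\<in>{Suc 1..nat (- l)}. geom (- tv j))"
      by (rule prod.cong) (auto simp: st_0_t)
    finally have 1: "fmap (st 0) (tpart l) = geom (tv 1) * (\<Prod>j\<in>{Suc 1..nat (- l)}. geom (- tv j))" .
    have 2: "tpart l = geom (- tv 1) * (\<Prod>j\<in>{Suc 1..nat (- l)}. geom (- tv j))"
      using False prod.atLeast_Suc_atMost[OF pos, of "\<lambda>j. geom (- tv j)"] by (simp add: tpart_def)
    have "lin (- tv 1) * geom (- tv 1) * fmap (st 0) (tpart l)
        = (lin (- tv 1) * geom (tv 1)) * (geom (- tv 1) * (\<Prod>j\<in>{Suc 1..nat (- l)}. geom (- tv j)))"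
      unfolding 1 by (simp only: mult_ac)
    then show ?thesis by (simp only: lin_geom_cancel 2 mult_1_left)
  qed
qed

lemma st_zpart: "fmap (st i) (\<Prod>j\<in>{1..\<kappa>}. lin (zv j)) = (\<Prod>j\<in>{1..\<kappa>}. lin (zv j))"
  by (simp add: fmap_prod[OF rhom_st] fmap_lin[OF rhom_st]) (rule prod.cong, auto simp: st_z)

text \<open>The product over t_1, ..., t_|l| is symmetric under s_i unless it ends exactly between
  t_i and t_(i+1).\<close>

lemma st_theta_gf: "i \<noteq> nat \<bar>l\<bar> \<Longrightarrow> fmap (st i) (theta_gf \<kappa> l) = theta_gf \<kappa> l"
proof (cases "i = 0")
  case True
  assume "i \<noteq> nat \<bar>l\<bar>"
  then have l: "l \<noteq> 0" using True by auto
  have "fmap (st 0) (theta_gf \<kappa> l)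
      = Qgf * (\<Prod>j\<in>{1..\<kappa>}. lin (zv j)) * (lin (- tv 1) * geom (- tv 1) * fmap (st 0) (tpart l))"
    unfolding theta_gf_tpart fmap_mult[OF rhom_st] st_0_Q st_zpart by (simp only: mult_ac)
  then show ?thesis using True by (simp only: st_0_tpart[OF l] theta_gf_tpart)
next
  case False
  assume "i \<noteq> nat \<bar>l\<bar>"
  then show ?thesis using False
    by (simp add: theta_gf_tpart fmap_mult[OF rhom_st] st_Q st_zpart[simplified] st_tpart)
qed

lemma st_theta: "i \<noteq> nat \<bar>l\<bar> \<Longrightarrow> st i (theta \<kappa> l r) = theta \<kappa> l r"
  unfolding theta_sq rhom_sq[OF rhom_st] by (simp add: st_theta_gf)

lemma theta_pos_step:
  assumes "i \<ge> 1"
  shows "theta \<kappa> (int i) r = theta \<kappa> (int i - 1) r - tv i * theta \<kappa> (int i - 1) (r - 1)"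
    and "st i (theta \<kappa> (int i) r) = theta \<kappa> (int i - 1) r - tv (i + 1) * theta \<kappa> (int i - 1) (r - 1)"
proof -
  obtain n where i: "i = Suc n" using assms by (cases i) auto
  have t: "tpart (int n) = (\<Prod>j\<in>{1..n}. lin (- tv j))" for n by (simp add: tpart_def)
  have "int i - 1 = int n" using i by simp
  then have "tpart (int i) = tpart (int i - 1) * lin (- tv i)" by (simp only: t i) simp
  then have gf: "theta_gf \<kappa> (int i) = theta_gf \<kappa> (int i - 1) * lin (- tv i)"
    by (simp add: theta_gf_tpart mult.assoc)
  then have "fmap (st i) (theta_gf \<kappa> (int i)) = theta_gf \<kappa> (int i - 1) * lin (- tv (i + 1))"
    using assms st_theta_gf[of i "int i - 1" \<kappa>]
    by (simp add: fmap_mult[OF rhom_st] fmap_lin[OF rhom_st] rhom_minus[OF rhom_st] st_t)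
  then show "theta \<kappa> (int i) r = theta \<kappa> (int i - 1) r - tv i * theta \<kappa> (int i - 1) (r - 1)"
    "st i (theta \<kappa> (int i) r) = theta \<kappa> (int i - 1) r - tv (i + 1) * theta \<kappa> (int i - 1) (r - 1)"
    unfolding theta_sq rhom_sq[OF rhom_st] by (simp_all add: gf sq_mult_lin)
qed

text \<open>Going from level -i to level -i - 1 adds the denominator 1 + t_(i+1) u, so the former is
  a linear factor times a series that s_i^t fixes. The image of t_(i+1) is left unevaluated so that
  i = 0, where it is -t_1, is included.\<close>

lemma theta_neg_step:
  shows "theta \<kappa> (- int i) r = theta \<kappa> (- int i - 1) r + tv (i + 1) * theta \<kappa> (- int i - 1) (r - 1)"
    and "st i (theta \<kappa> (- int i) r) = theta \<kappa> (- int i - 1) r + st i (tv (i + 1)) * theta \<kappa> (- int i - 1) (r - 1)"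
proof -
  have "tpart (- int i) = tpart (- int i - 1) * lin (tv (i + 1))"
  proof -
    have 1: "tpart (- int i) = (\<Prod>j\<in>{1..i}. geom (- tv j))"
      by (simp add: tpart_def)
    have "tpart (- int i - 1) = (\<Prod>j\<in>{1..Suc i}. geom (- tv j))"
      by (simp add: tpart_def nat_add_distrib)
    then have "tpart (- int i - 1) * lin (tv (i + 1)) = (\<Prod>j\<in>{1..i}. geom (- tv j)) * (lin (tv (i + 1)) * geom (- tv (i + 1)))"
      by (simp add: mult_ac)
    then show ?thesis by (simp only: 1 lin_geom_cancel' mult_1_right)
  qed
  then have gf: "theta_gf \<kappa> (- int i) = theta_gf \<kappa> (- int i - 1) * lin (tv (i + 1))"
    by (simp add: theta_gf_tpart mult.assoc)
  then have "fmap (st i) (theta_gf \<kappa> (- int i)) = theta_gf \<kappa> (- int i - 1) * lin (st i (tv (i + 1)))"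
    using st_theta_gf[of i "- int i - 1" \<kappa>]
    by (simp add: fmap_mult[OF rhom_st] fmap_lin[OF rhom_st])
  then show "theta \<kappa> (- int i) r = theta \<kappa> (- int i - 1) r + tv (i + 1) * theta \<kappa> (- int i - 1) (r - 1)"
    "st i (theta \<kappa> (- int i) r) = theta \<kappa> (- int i - 1) r + st i (tv (i + 1)) * theta \<kappa> (- int i - 1) (r - 1)"
    unfolding theta_sq rhom_sq[OF rhom_st] by (simp_all add: gf sq_mult_lin)
qed

lemma alpha_st: "alpha i = tv (i + 1) - st i (tv (i + 1))"
proof (cases "i = 0")
  case True
  then show ?thesis by (simp add: alpha_def st_0_t)
qed (simp add: alpha_def st_t)

lemma ddt_theta_pos: "i \<ge> 1 \<Longrightarrow> ddt i (theta \<kappa> (int i) r) = theta \<kappa> (int i - 1) (r - 1)"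
  by (rule ddt_eqI, subst theta_pos_step(1), simp, subst theta_pos_step(2), simp)
    (simp add: alpha_def algebra_simps)

lemma ddz_theta: "\<kappa> \<ge> 1 \<Longrightarrow> ddz \<kappa> (theta \<kappa> 0 r) = theta (\<kappa> - 1) 0 (r - 1)"
proof (rule ddz_eqI)
  assume k: "\<kappa> \<ge> 1"
  then obtain n where n: "\<kappa> = Suc n" by (cases \<kappa>) auto
  have gf: "theta_gf \<kappa> 0 = theta_gf (\<kappa> - 1) 0 * lin (zv \<kappa>)"
    by (simp add: theta_gf_tpart tpart_def n mult_ac)
  have "fmap (sz \<kappa>) (theta_gf (\<kappa> - 1) 0) = theta_gf (\<kappa> - 1) 0"
  proof -
    have "fmap (sz \<kappa>) (\<Prod>j\<in>{1..\<kappa> - 1}. lin (zv j)) = (\<Prod>j\<in>{1..\<kappa> - 1}. lin (zv (transpose \<kappa> (\<kappa> + 1) j)))"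
      using k by (simp add: fmap_prod[OF rhom_sz] fmap_lin[OF rhom_sz]) (rule prod.cong, auto simp: sz_z)
    also have "\<dots> = (\<Prod>j\<in>{1..\<kappa> - 1}. lin (zv j))"
      by (rule prod_transpose) (use k in auto)
    finally show ?thesis using k
      by (simp add: theta_gf_tpart tpart_def fmap_mult[OF rhom_sz] sz_Q)
  qed
  then have "fmap (sz \<kappa>) (theta_gf \<kappa> 0) = theta_gf (\<kappa> - 1) 0 * lin (zv (\<kappa> + 1))"
    using k by (simp add: gf fmap_mult[OF rhom_sz] fmap_lin[OF rhom_sz] sz_z)
  then show "beta \<kappa> * theta (\<kappa> - 1) 0 (r - 1) = theta \<kappa> 0 r - sz \<kappa> (theta \<kappa> 0 r)"
    unfolding theta_sq rhom_sq[OF rhom_sz] using k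
    by (simp only: gf sq_mult_lin beta_Suc) (simp add: algebra_simps)
qed

section \<open>Degrees of theta polynomials and the variables occurring in them\<close>

definition fDg :: "Rinf fps \<Rightarrow> bool" where "fDg F \<longleftrightarrow> (\<forall>r. Dg (int r) (fps_nth F r))"

lemma fDg_mult: "fDg F \<Longrightarrow> fDg G \<Longrightarrow> fDg (F * G)"
  unfolding fDg_def
proof (intro allI)
  fix r assume *: "\<forall>r. Dg (int r) (fps_nth F r)" "\<forall>r. Dg (int r) (fps_nth G r)"
  have "Dg (int r) (fps_nth F i * fps_nth G (r - i))" if "i \<in> {0..r}" for i
    using Dg_mult[of "int i" "fps_nth F i" "int (r - i)" "fps_nth G (r - i)"] * that by (simp add: of_nat_diff)
  then show "Dg (int r) (fps_nth (F * G) r)" unfolding fps_mult_nth by (rule Dg_sum)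
qed

lemma fDg_1: "fDg 1"
  by (simp add: fDg_def Dg_1 Dg_zero)

lemma fDg_prod: "(\<And>x. x \<in> A \<Longrightarrow> fDg (F x)) \<Longrightarrow> fDg (prod F A)"
  by (induction A rule: infinite_finite_induct) (auto intro: fDg_1 fDg_mult)

lemma fDg_lin: "Dg 1 a \<Longrightarrow> fDg (lin a)"
  by (auto simp: fDg_def lin_nth Dg_1 Dg_zero)

lemma fDg_theta: "fDg (theta_gf \<kappa> (int l))"
proof -
  have "fDg Qgf" by (simp add: fDg_def Qgf_def Dg_Q)
  then show ?thesis unfolding theta_gf_tpart tpart_def
    by (simp) (intro fDg_mult fDg_prod fDg_lin Dg_minus Dg_z Dg_t; simp)
qed

text \<open>The elements whose localisation does not notice the deletion of a letter that stands
  beyond position \<kappa> and exceeds l in absolute value, once the factor of that letter is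
  removed from the Q-series.\<close>

definition SA :: "nat \<Rightarrow> nat \<Rightarrow> Rinf set" where
  "SA \<kappa> l = subring_gen (range Qr \<union> tv ` {1..l} \<union> zv ` {1..\<kappa>})"

lemma SA_intros:
  "Qr r \<in> SA \<kappa> l" "j \<in> {1..l} \<Longrightarrow> tv j \<in> SA \<kappa> l" "j \<in> {1..\<kappa>} \<Longrightarrow> zv j \<in> SA \<kappa> l"
  "1 \<in> SA \<kappa> l" "0 \<in> SA \<kappa> l" "f \<in> SA \<kappa> l \<Longrightarrow> g \<in> SA \<kappa> l \<Longrightarrow> f - g \<in> SA \<kappa> l"
  "f \<in> SA \<kappa> l \<Longrightarrow> g \<in> SA \<kappa> l \<Longrightarrow> f * g \<in> SA \<kappa> l" "f \<in> SA \<kappa> l \<Longrightarrow> - f \<in> SA \<kappa> l"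
  "f \<in> SA \<kappa> l \<Longrightarrow> g \<in> SA \<kappa> l \<Longrightarrow> f + g \<in> SA \<kappa> l"
  unfolding SA_def
  by (auto intro: subring_gen.intros subring_gen_zero subring_gen_add subring_gen_uminus)

lemma SA_sum: "(\<And>x. x \<in> A \<Longrightarrow> F x \<in> SA \<kappa> l) \<Longrightarrow> sum F A \<in> SA \<kappa> l"
  unfolding SA_def by (rule subring_gen_sum)

lemma SA_mono: "\<kappa> \<le> \<kappa>' \<Longrightarrow> l \<le> l' \<Longrightarrow> f \<in> SA \<kappa> l \<Longrightarrow> f \<in> SA \<kappa>' l'"
  unfolding SA_def
proof -
  assume le: "\<kappa> \<le> \<kappa>'" "l \<le> l'"
  assume "f \<in> subring_gen (range Qr \<union> tv ` {1..l} \<union> zv ` {1..\<kappa>})"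
  then show "f \<in> subring_gen (range Qr \<union> tv ` {1..l'} \<union> zv ` {1..\<kappa>'})"
  proof (induction rule: subring_gen.induct)
    case (base a)
    then show ?case using le by (intro subring_gen.base) auto
  qed (auto intro: subring_gen.intros)
qed

definition fSA :: "nat \<Rightarrow> nat \<Rightarrow> Rinf fps \<Rightarrow> bool" where "fSA \<kappa> l F \<longleftrightarrow> (\<forall>r. fps_nth F r \<in> SA \<kappa> l)"

lemma fSA_mult: "fSA \<kappa> l F \<Longrightarrow> fSA \<kappa> l G \<Longrightarrow> fSA \<kappa> l (F * G)"
  unfolding fSA_def fps_mult_nth by (auto intro: SA_sum SA_intros)

lemma fSA_prod: "(\<And>x. x \<in> A \<Longrightarrow> fSA \<kappa> l (F x)) \<Longrightarrow> fSA \<kappa> l (prod F A)"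
  by (induction A rule: infinite_finite_induct) (auto intro: fSA_mult, auto simp: fSA_def SA_intros)

lemma fSA_lin: "a \<in> SA \<kappa> l \<Longrightarrow> fSA \<kappa> l (lin a)"
  by (auto simp: fSA_def lin_nth SA_intros)

lemma fSA_theta: "fSA \<kappa> l (theta_gf \<kappa> (int l))"
proof -
  have "fSA \<kappa> l Qgf" by (simp add: fSA_def Qgf_def SA_intros)
  then show ?thesis unfolding theta_gf_tpart tpart_def
    by simp (intro fSA_mult fSA_prod fSA_lin; simp add: SA_intros)
qed

section \<open>Insertion of a letter\<close>

definition cp :: "'a::comm_ring_1 \<Rightarrow> 'a poly" where "cp a = [:a:]"

lemma rhom_cp: "rhom cp"
  by (rule rhomI) (auto simp: cp_def one_pCons)

definition yy :: "'a::comm_ring_1 poly" where "yy = [:0, 1:]"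

text \<open>\<open>G\<close> multiplies the generating function of the \<open>Q\<^sub>r\<close> by \<open>(1 - yu) / (1 + yu)\<close>, and \<open>Psi\<close> below
  replaces \<open>y\<^sup>s\<close> by \<open>\<vartheta>\<^bsub>r + s\<^esub>\<close>. On a Pfaffian of theta polynomials this prepends an entry, because
  \<open>(1 - yu) / (1 + yu)\<close> is the generating function of \<open>Pf2\<close>.\<close>

definition G :: "Rinf \<Rightarrow> Rinf poly" where
  "G = mkhom (hsub (\<lambda>c. cp (gincl c)) (- yy)) (\<lambda>j. cp (tv j)) (\<lambda>j. cp (zv j))"

lemma rhom_G0: "rhom (hsub (\<lambda>c. cp (gincl c)) (- yy))"
  by (intro rhom_hsub rhom_comp[OF rhom_cp rhom_gincl])

lemma rhom_G: "rhom G"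
  unfolding G_def by (rule rhom_mkhom[OF rhom_G0])

lemma G_t: "j \<ge> 1 \<Longrightarrow> G (tv j) = cp (tv j)" and G_z: "j \<ge> 1 \<Longrightarrow> G (zv j) = cp (zv j)"
  unfolding G_def by (simp_all add: mkhom_t[OF rhom_G0] mkhom_z[OF rhom_G0])

lemma G_Q: "fmap G Qgf = qq (- yy) * fmap cp Qgf"
  unfolding G_def mkhom_Q[OF rhom_G0] fmap_hsub[OF rhom_comp[OF rhom_cp rhom_gincl]]
  by (simp add: qq_def Qgf_gincl fmap_comp)

lemma rhom_map_poly:
  assumes h: "rhom h"
  shows "rhom (map_poly h)"
  by (rule rhomI; rule poly_eqI)
    (auto simp: coeff_map_poly rhom_0[OF h] rhom_1[OF h] rhom_add[OF h] rhom_sum[OF h] rhom_mult[OF h] coeff_mult)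

lemma map_poly_cp: "rhom h \<Longrightarrow> map_poly h (cp a) = cp (h a)"
  by (rule poly_eqI) (simp add: coeff_map_poly rhom_0 cp_def coeff_pCons split: nat.splits)

lemma map_poly_yy: "rhom h \<Longrightarrow> map_poly h yy = yy"
  by (rule poly_eqI) (simp add: coeff_map_poly rhom_0 rhom_1 yy_def coeff_pCons split: nat.splits)

text \<open>The factor (1 - yu) / (1 + yu) contains no t, so s_i^t may act on coefficients before or
  after \<open>G\<close>.\<close>

lemma G_st: "G (st i f) = map_poly (st i) (G f)"
proof -
  note M = rhom_map_poly[OF rhom_st[of i]]
  have "(\<lambda>f. G (st i f)) = (\<lambda>f. map_poly (st i) (G f))"
  proof (rule rhom_eqI[OF rhom_comp[OF rhom_G rhom_st] rhom_comp[OF M rhom_G]])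
    show "G (st i (tv j)) = map_poly (st i) (G (tv j))" if "j \<ge> 1" for j
    proof (cases "i = 0")
      case True
      then show ?thesis using that
        by (cases "j = 1") (auto simp: st_0_t G_t rhom_minus[OF rhom_G] map_poly_cp[OF rhom_st] rhom_minus[OF rhom_cp])
    next
      case False
      then show ?thesis using that transpose_ge_1[of i j] by (simp add: st_t G_t map_poly_cp[OF rhom_st])
    qed
    show "G (st i (zv j)) = map_poly (st i) (G (zv j))" if "j \<ge> 1" for j
      using that by (simp add: st_z G_z map_poly_cp[OF rhom_st])
    have "fmap (\<lambda>f. map_poly (st i) (G f)) Qgf = fmap (map_poly (st i)) (fmap G Qgf)" by (simp add: fmap_comp)
    also have "\<dots> = qq (- yy) * fmap cp (fmap (st i) Qgf)"
      by (simp add: G_Q fmap_mult[OF M] fmap_qq[OF M] rhom_minus[OF M] map_poly_yy[OF rhom_st] fmap_comp map_poly_cp[OF rhom_st])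
    also have "\<dots> = fmap G (fmap (st i) Qgf)"
    proof (cases "i = 0")
      case True
      have Q: "fmap (st i) Qgf = qq (- tv 1) * Qgf" using st_0_Q True by (simp add: qq_def)
      have "fmap G (fmap (st i) Qgf) = qq (cp (- tv 1)) * (qq (- yy) * fmap cp Qgf)"
        unfolding Q by (simp add: fmap_mult[OF rhom_G] fmap_qq[OF rhom_G] G_t G_Q rhom_minus[OF rhom_G] rhom_minus[OF rhom_cp])
      moreover have "fmap cp (fmap (st i) Qgf) = qq (cp (- tv 1)) * fmap cp Qgf"
        unfolding Q by (simp add: fmap_mult[OF rhom_cp] fmap_qq[OF rhom_cp])
      ultimately show ?thesis by (simp only: mult_ac)
    next
      case False
      then show ?thesis by (simp add: st_Q G_Q)
    qed
    finally show "fmap (\<lambda>f. G (st i f)) Qgf = fmap (\<lambda>f. map_poly (st i) (G f)) Qgf" by (simp add: fmap_comp)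
  qed
  then show ?thesis by (rule fun_cong)
qed

text \<open>The linear functional y^s -> c s. It respects coefficients but not products of
  polynomials in y.\<close>

definition Lam :: "(nat \<Rightarrow> 'a::comm_ring_1) \<Rightarrow> 'a poly \<Rightarrow> 'a" where
  "Lam c p = (\<Sum>s\<le>degree p. c s * coeff p s)"

lemma Lam_bound: "degree p \<le> n \<Longrightarrow> Lam c p = (\<Sum>s\<le>n. c s * coeff p s)"
  unfolding Lam_def by (rule sum.mono_neutral_left) (auto simp: coeff_eq_0)

lemma Lam_add: "Lam c (p + q) = Lam c p + Lam c q"
  by (simp add: Lam_bound[of _ "max (degree p) (degree q)"] degree_add_le distrib_left sum.distrib)

lemma Lam_diff: "Lam c (p - q) = Lam c p - Lam c q"
  by (simp add: Lam_bound[of _ "max (degree p) (degree q)"] degree_diff_le right_diff_distrib sum_subtractf)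

lemma Lam_cp_mult: "Lam c (cp a * p) = a * Lam c p"
  by (simp add: cp_def Lam_bound[of _ "degree p"] degree_smult_le sum_distrib_left mult_ac)

lemma Lam_1: "Lam c 1 = c 0"
  by (simp add: Lam_def)

lemma Lam_0: "Lam c 0 = 0"
  by (simp add: Lam_def)

lemma Lam_pCons: "Lam c (pCons a p) = c 0 * a + Lam (\<lambda>s. c (Suc s)) p"
proof -
  have "Lam c (pCons a p) = (\<Sum>s\<le>Suc (degree p). c s * coeff (pCons a p) s)"
    by (rule Lam_bound) (rule degree_pCons_le)
  then show ?thesis by (simp add: sum.atMost_Suc_shift Lam_def del: sum.atMost_Suc)
qed

lemma Lam_yy: "Lam c (yy * p) = Lam (\<lambda>s. c (Suc s)) p"
proof -
  have "yy * p = pCons 0 p" by (simp add: yy_def)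
  then show ?thesis by (simp add: Lam_pCons)
qed

lemma degree_map_poly_bound: "h 0 = 0 \<Longrightarrow> degree (map_poly h p) \<le> degree p"
  by (rule degree_le) (simp add: coeff_map_poly coeff_eq_0)

lemma Lam_hom: "rhom h \<Longrightarrow> h (Lam c p) = Lam (\<lambda>s. h (c s)) (map_poly h p)"
  by (simp add: Lam_bound[of "map_poly h p" "degree p"] degree_map_poly_bound coeff_map_poly rhom_0)
    (simp add: Lam_def rhom_sum rhom_mult)

lemma Lam_fun_lin: "Lam (\<lambda>s. c s - a * d s) p = Lam c p - a * Lam d p"
  by (simp add: Lam_def left_diff_distrib sum_subtractf sum_distrib_left mult.assoc)

lemma Lam_zero_fun: "(\<And>s. c s = 0) \<Longrightarrow> Lam c p = 0"
  by (simp add: Lam_def)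

definition Psi :: "nat \<Rightarrow> nat \<Rightarrow> Rinf \<Rightarrow> Rinf" where
  "Psi \<kappa> l f = Lam (\<lambda>s. fps_nth (theta_gf \<kappa> (int l)) (\<kappa> + l + 1 + s)) (G f)"

lemma Psi_1: "Psi \<kappa> l 1 = fps_nth (theta_gf \<kappa> (int l)) (\<kappa> + l + 1)"
  by (simp add: Psi_def rhom_1[OF rhom_G] Lam_1)

lemma G_alpha: "G (alpha i) = cp (alpha i)"
  by (cases "i = 0")
    (auto simp: alpha_def rhom_mult[OF rhom_G] rhom_mult[OF rhom_cp] rhom_diff[OF rhom_G] rhom_diff[OF rhom_cp]
      rhom_numeral[OF rhom_G] rhom_numeral[OF rhom_cp] G_t)

text \<open>For i < l the coefficients of the new theta series are fixed by s_i^t, so the divided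
  difference acts on f alone.\<close>

lemma ddt_Psi:
  assumes "i < l"
  shows "ddt i (Psi \<kappa> l f) = Psi \<kappa> l (ddt i f)"
proof (rule ddt_eqI)
  let ?c = "\<lambda>s. fps_nth (theta_gf \<kappa> (int l)) (\<kappa> + l + 1 + s)"
  have gf: "fmap (st i) (theta_gf \<kappa> (int l)) = theta_gf \<kappa> (int l)" using assms by (intro st_theta_gf) auto
  have c: "st i (?c s) = ?c s" for s
    using arg_cong[OF gf, of "\<lambda>F. fps_nth F (\<kappa> + l + 1 + s)"] by simp
  have "alpha i * Psi \<kappa> l (ddt i f) = Lam ?c (G (alpha i * ddt i f))"
    by (simp add: Psi_def rhom_mult[OF rhom_G] G_alpha Lam_cp_mult)
  also have "\<dots> = Psi \<kappa> l f - Lam ?c (map_poly (st i) (G f))"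
    by (simp add: alpha_ddt rhom_diff[OF rhom_G] Lam_diff G_st Psi_def)
  also have "Lam ?c (map_poly (st i) (G f)) = st i (Psi \<kappa> l f)"
    unfolding Psi_def Lam_hom[OF rhom_st] by (simp only: c)
  finally show "alpha i * Psi \<kappa> l (ddt i f) = Psi \<kappa> l f - st i (Psi \<kappa> l f)" .
qed

text \<open>Degree at most d, with y counted in degree 1.\<close>

definition PD :: "int \<Rightarrow> Rinf poly \<Rightarrow> bool" where "PD d p \<longleftrightarrow> (\<forall>s. Dg (d - int s) (coeff p s))"

lemma PD_mult: "PD a p \<Longrightarrow> PD b q \<Longrightarrow> PD (a + b) (p * q)"
  unfolding PD_def
proof (intro allI)
  fix s assume *: "\<forall>s. Dg (a - int s) (coeff p s)" "\<forall>s. Dg (b - int s) (coeff q s)"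
  have "Dg (a + b - int s) (coeff p i * coeff q (s - i))" if "i \<in> {..s}" for i
    using Dg_mult[of "a - int i" "coeff p i" "b - int (s - i)" "coeff q (s - i)"] * that
    by (simp add: of_nat_diff algebra_simps)
  then show "Dg (a + b - int s) (coeff (p * q) s)" unfolding coeff_mult by (rule Dg_sum)
qed

lemma PD_cp: "Dg d f \<Longrightarrow> PD d (cp f)"
  by (auto simp: PD_def cp_def coeff_pCons Dg_zero split: nat.splits)
lemma PD_yy: "PD 1 (- yy)"
  using Dg_minus[OF Dg_1] by (auto simp: PD_def yy_def coeff_pCons Dg_zero split: nat.splits)
lemma PD_power: "PD d p \<Longrightarrow> PD (int n * d) (p ^ n)"
proof (induction n)
  case 0
  show ?case using PD_cp[OF Dg_1] by (simp add: cp_def one_pCons)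
next
  case (Suc n)
  then show ?case using PD_mult[of d p "int n * d" "p ^ n"] by (simp add: algebra_simps)
qed
lemma PD_sum: "(\<And>x. x \<in> A \<Longrightarrow> PD d (F x)) \<Longrightarrow> PD d (sum F A)"
  unfolding PD_def coeff_sum by (auto intro: Dg_sum)

lemma G_Qr: "G (Qr r) = (\<Sum>j=0..r. (if j = 0 then 1 else 2 * (- yy) ^ j) * cp (Qr (r - j)))"
proof -
  have "G (Qr r) = fps_nth (qq (- yy) * fmap cp Qgf) r"
    by (rule Qr_fmapD[OF G_Q])
  also have "\<dots> = (\<Sum>j=0..r. fps_nth (lin (- yy) * geom (- yy)) j * cp (Qr (r - j)))"
    unfolding fps_mult_nth[of "qq (- yy)"] unfolding qq_def by (simp add: Qgf_def)
  finally show ?thesis by (simp only: lin_geom_nth)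
qed

lemma Dg_G: "Dg d f \<Longrightarrow> PD d (G f)"
proof (induction rule: Dg.induct)
  case (Dg_int n)
  have "G (of_int n) = cp (of_int n)" by (simp add: rhom_of_int[OF rhom_G] rhom_of_int[OF rhom_cp])
  then show ?case using PD_cp[OF Dg.Dg_int] by simp
next
  case (Dg_Q r)
  have "PD (int r) ((if j = 0 then 1 else 2 * (- yy) ^ j) * cp (Qr (r - j)))" if "j \<in> {0..r}" for j
  proof -
    have *: "PD (int r) ((- yy) ^ j * cp (Qr (r - j)))"
      using PD_mult[OF PD_power[OF PD_yy, of j] PD_cp[OF Dg.Dg_Q, of "r - j"]] that by (simp add: of_nat_diff)
    have "PD 0 (cp 2)" using Dg_2[OF Dg_1] by (intro PD_cp) simp
    from PD_mult[OF this *] have "PD (int r) (cp 2 * ((- yy) ^ j * cp (Qr (r - j))))" by simp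
    moreover have "cp 2 = (2 :: Rinf poly)" by (rule rhom_numeral[OF rhom_cp])
    ultimately show ?thesis using * by (cases "j = 0") (auto simp: mult.assoc)
  qed
  then show ?case unfolding G_Qr by (rule PD_sum)
next
  case (Dg_zero d)
  then show ?case by (simp add: rhom_0[OF rhom_G] PD_def Dg.Dg_zero)
next
  case (Dg_diff d f g)
  then show ?case by (auto simp: rhom_diff[OF rhom_G] PD_def intro: Dg.Dg_diff)
next
  case (Dg_mult a f b g)
  then show ?case by (auto simp: rhom_mult[OF rhom_G] intro: PD_mult)
next
  case (Dg_mono a f b)
  then show ?case unfolding PD_def by (metis Dg.Dg_mono diff_right_mono)
next
  case (Dg_t j)
  then show ?case unfolding G_t[OF Dg_t] by (intro PD_cp Dg.Dg_t)
next
  case (Dg_z j)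
  then show ?case unfolding G_z[OF Dg_z] by (intro PD_cp Dg.Dg_z)
qed

lemma Dg_Psi: "Dg d f \<Longrightarrow> Dg (d + int (\<kappa> + l + 1)) (Psi \<kappa> l f)"
  unfolding Psi_def Lam_def
proof (rule Dg_sum)
  fix s assume d: "Dg d f"
  have "Dg (int (\<kappa> + l + 1 + s) + (d - int s)) (fps_nth (theta_gf \<kappa> (int l)) (\<kappa> + l + 1 + s) * coeff (G f) s)"
    using fDg_theta Dg_G[OF d] by (intro Dg_mult) (auto simp only: fDg_def PD_def)
  then show "Dg (d + int (\<kappa> + l + 1)) (fps_nth (theta_gf \<kappa> (int l)) (\<kappa> + l + 1 + s) * coeff (G f) s)"
    by (simp add: algebra_simps)
qed

definition PS :: "nat \<Rightarrow> nat \<Rightarrow> Rinf poly \<Rightarrow> bool" where "PS \<kappa> l p \<longleftrightarrow> (\<forall>s. coeff p s \<in> SA \<kappa> l)"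

lemma PS_mult: "PS \<kappa> l p \<Longrightarrow> PS \<kappa> l q \<Longrightarrow> PS \<kappa> l (p * q)"
  unfolding PS_def coeff_mult by (auto intro: SA_sum SA_intros)
lemma PS_cp: "f \<in> SA \<kappa> l \<Longrightarrow> PS \<kappa> l (cp f)"
  by (auto simp: PS_def cp_def coeff_pCons SA_intros split: nat.splits)
lemma PS_yy: "PS \<kappa> l (- yy)"
  by (auto simp: PS_def yy_def coeff_pCons SA_intros split: nat.splits)
lemma PS_1: "PS \<kappa> l 1"
  using PS_cp[OF SA_intros(4)] by (simp add: cp_def one_pCons)
lemma PS_power: "PS \<kappa> l p \<Longrightarrow> PS \<kappa> l (p ^ n)"
  by (induction n) (auto intro: PS_mult PS_1)
lemma PS_sum: "(\<And>x. x \<in> A \<Longrightarrow> PS \<kappa> l (F x)) \<Longrightarrow> PS \<kappa> l (sum F A)"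
  unfolding PS_def coeff_sum by (auto intro: SA_sum)
lemma PS_add: "PS \<kappa> l p \<Longrightarrow> PS \<kappa> l q \<Longrightarrow> PS \<kappa> l (p + q)"
  by (auto simp: PS_def SA_intros)

lemma SA_G: "f \<in> SA \<kappa> l \<Longrightarrow> PS \<kappa> l (G f)"
  unfolding SA_def
proof (induction rule: subring_gen.induct)
  case (base a)
  then consider r where "a = Qr r" | j where "j \<in> {1..l}" "a = tv j" | j where "j \<in> {1..\<kappa>}" "a = zv j" by auto
  then show ?case
  proof cases
    case 1
    have "PS \<kappa> l ((if j = 0 then 1 else 2 * (- yy) ^ j) * cp (Qr (r - j)))" for j
    proof (cases "j = 0")
      case False
      have "PS \<kappa> l ((- yy) ^ j * cp (Qr (r - j)))" by (intro PS_mult PS_power PS_yy PS_cp SA_intros)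
      then have "PS \<kappa> l ((- yy) ^ j * cp (Qr (r - j)) + (- yy) ^ j * cp (Qr (r - j)))" by (intro PS_add)
      then show ?thesis using False by (simp only: mult_2 distrib_right if_False)
    qed (simp add: PS_cp SA_intros)
    then show ?thesis unfolding 1 G_Qr by (intro PS_sum)
  next
    case 2
    then show ?thesis by (simp add: G_t PS_cp SA_intros)
  next
    case 3
    then show ?thesis by (simp add: G_z PS_cp SA_intros)
  qed
next
  case one
  then show ?case by (simp add: rhom_1[OF rhom_G] PS_1)
next
  case (diff a b)
  then show ?case by (auto simp: rhom_diff[OF rhom_G] PS_def intro: SA_intros)
next
  case (mult a b)
  then show ?case by (auto simp: rhom_mult[OF rhom_G] intro: PS_mult)
qed

lemma SA_Psi: "f \<in> SA \<kappa> l \<Longrightarrow> Psi \<kappa> l f \<in> SA \<kappa> l"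
  unfolding Psi_def Lam_def using fSA_theta[of \<kappa> l] SA_G[of f \<kappa> l]
  by (intro SA_sum SA_intros(7)) (auto simp: fSA_def PS_def)

text \<open>The parameters with t_a omitted and the later ones moved down, matching the
  standardisation of letters by \<open>un\<close>.\<close>

definition tvd :: "int \<Rightarrow> nat \<Rightarrow> Rinf" where
  "tvd a j = (if int j < a then tv j else tv (j + 1))"

lemma sg_un: "a > 0 \<Longrightarrow> c \<noteq> 0 \<Longrightarrow> c \<noteq> a \<Longrightarrow> c \<noteq> - a \<Longrightarrow> sg (tvd a) (un a c) = sg tv c"
proof -
  assume *: "a > 0" "c \<noteq> 0" "c \<noteq> a" "c \<noteq> - a"
  consider "c > a" | "0 < c" "c < a" | "- a < c" "c < 0" | "c < - a" using * by linarith
  then show ?thesis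
  proof cases
    case 1
    then have "Suc (nat (c - 1)) = nat c" using * by simp
    then show ?thesis using 1 * by (simp add: sg_def un_def tvd_def)
  next
    case 4
    then have "Suc (nat (- c - 1)) = nat (- c)" using * by simp
    then show ?thesis using 4 * by (simp add: sg_def un_def tvd_def)
  qed (use * in \<open>auto simp: sg_def un_def tvd_def\<close>)
qed

lemma un_neg_iff: "a > 0 \<Longrightarrow> c \<noteq> 0 \<Longrightarrow> c \<noteq> a \<Longrightarrow> c \<noteq> - a \<Longrightarrow> un a c < 0 \<longleftrightarrow> c < 0"
  by (auto simp: un_def)

lemma rhom_poly: "rhom (\<lambda>p. poly p x)"
  by (rule rhomI) auto

lemma poly_cp: "poly (cp a) x = a"
  by (simp add: cp_def)

lemma poly_yy: "poly yy x = x"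
  by (simp add: yy_def)

text \<open>Evaluating \<open>y\<close> at the letter \<open>b\<close> removes its contribution to the specialisation of \<open>Q\<close>.\<close>

lemma loc_G_del:
  assumes u: "u \<in> W_inf" and b: "b \<in> negs u" "int \<kappa> < b" "int l < - u b" and f: "f \<in> SA \<kappa> l"
  shows "poly (map_poly (loc tv u) (G f)) (- sg tv (u b)) = loc (tvd (- u b)) (del b u) f"
proof -
  have ub: "b > 0" "u b < 0" using b(1) by (auto simp: negs_def)
  note uw = u ub
  have a: "- u b > 0" using ub by simp
  let ?L = "loc tv u" and ?x = "- sg tv (u b)" and ?R = "loc (tvd (- u b)) (del b u)"
  let ?H = "\<lambda>f. poly (map_poly ?L (G f)) ?x"
  note M = rhom_map_poly[OF rhom_loc[of tv u]]
  have H: "rhom ?H" by (intro rhom_comp[OF rhom_poly rhom_comp[OF M rhom_G]])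
  have d: "del b u \<in> W_inf" by (rule del_W[OF uw])
  have sgd: "sg (tvd (- u b)) (del b u j) = sg tv (u (sk b j))" if "j \<noteq> 0" for j
    unfolding del_def
    by (rule sg_un[OF a]) (use u_sk_neq[OF u ub(1), of j] W_inf_eq_0[OF u, of "sk b j"] sk_0(2)[OF ub(1), of j] that in auto)
  have "fmap ?H Qgf = fmap (\<lambda>p. poly p ?x) (fmap (map_poly ?L) (fmap G Qgf))"
    by (simp add: fmap_comp)
  also have "\<dots> = qq (- ?x) * fmap ?L Qgf"
    by (simp add: G_Q fmap_mult[OF M] fmap_qq[OF M] rhom_minus[OF M] map_poly_yy[OF rhom_loc]
        fmap_mult[OF rhom_poly] fmap_qq[OF rhom_poly] poly_yy fmap_comp map_poly_cp[OF rhom_loc] poly_cp)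
  also have "fmap ?L Qgf = qq ?x * (\<Prod>j\<in>negs u - {b}. qq (- sg tv (u j)))"
    unfolding loc_Q[OF u] by (rule prod.remove[OF finite_negs[OF u] b(1)])
  also have "qq (- ?x) * (qq ?x * (\<Prod>j\<in>negs u - {b}. qq (- sg tv (u j)))) = (\<Prod>j\<in>negs u - {b}. qq (- sg tv (u j)))"
    unfolding mult.assoc[symmetric] by (simp only: qq_minus mult_1_left)
  also have "\<dots> = (\<Prod>j\<in>negs (del b u). qq (- sg (tvd (- u b)) (del b u j)))"
  proof (rule prod.reindex_bij_witness[of _ "sk b" "un b"])
    fix j assume j: "j \<in> negs u - {b}"
    then have j': "j > 0" "u j < 0" "j \<noteq> b" "j \<noteq> - b" using ub by (auto simp: negs_def)
    show s: "sk b (un b j) = j" using sk_un[OF ub(1)] j' by blast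
    have p: "un b j > 0" using j' ub by (auto simp: un_def)
    have "del b u (un b j) < 0"
      unfolding del_def s
      using un_neg_iff[OF a, of "u j"] j' W_inf_eq_0[OF u] W_inf_inj[OF u, of j b]
        W_inf_inj[OF u, of j "- b"] W_inf_minus[OF u, of b] by auto
    then show "un b j \<in> negs (del b u)" using p by (simp add: negs_def)
    show "qq (- sg (tvd (- u b)) (del b u (un b j))) = qq (- sg tv (u j))"
      using sgd[of "un b j"] p s by simp
  next
    fix j assume j: "j \<in> negs (del b u)"
    then have j': "j > 0" "del b u j < 0" by (auto simp: negs_def)
    show "un b (sk b j) = j" by (rule un_sk[OF ub(1)])
    have "u (sk b j) < 0"
      using j'(2) un_neg_iff[OF a, of "u (sk b j)"] u_sk_neq[OF u ub(1), of j] W_inf_eq_0[OF u, of "sk b j"] sk_0[OF ub(1), of j] j'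
      by (auto simp: del_def)
    then show "sk b j \<in> negs u - {b}" using sk_neq[OF ub(1), of j] sk_0[OF ub(1), of j] j' by (simp add: negs_def)
  qed
  also have "\<dots> = fmap ?R Qgf" by (rule loc_Q[OF d, symmetric])
  finally have Q: "fmap ?H Qgf = fmap ?R Qgf" .
  show ?thesis
    using f unfolding SA_def
  proof (induction rule: subring_gen.induct)
    case (base g)
    \<comment> \<open>The generators t_j and z_j of \<open>SA\<close> have j below the deleted
      letter and position, so the shifts do not reach them; the Q_r are settled by the generating
      functions just compared.\<close>
    then consider r where "g = Qr r" | j where "j \<in> {1..l}" "g = tv j" | j where "j \<in> {1..\<kappa>}" "g = zv j" by auto
    then show ?case
    proof cases
      case 1
      then show ?thesis using Qr_fmapD[OF Q, of r] by (simp add: Qgf_def)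
    next
      case 2
      then show ?thesis using b(3) by (simp add: G_t map_poly_cp[OF rhom_loc] poly_cp loc_t tvd_def)
    next
      case 3
      then have "sk b (int j) = int j" using b(2) by (simp add: sk_def)
      then show ?thesis using 3 sgd[of "int j"] by (simp add: G_z map_poly_cp[OF rhom_loc] poly_cp loc_z)
    qed
  next
    case one
    then show ?case by (simp only: rhom_1[OF H] rhom_1[OF rhom_loc])
  next
    case (diff f g)
    then show ?case by (simp only: rhom_diff[OF H] rhom_diff[OF rhom_loc])
  next
    case (mult f g)
    then show ?case by (simp only: rhom_mult[OF H] rhom_mult[OF rhom_loc])
  qed
qed

definition fb :: "nat \<Rightarrow> 'a::comm_ring_1 fps \<Rightarrow> bool" where
  "fb N F \<longleftrightarrow> (\<forall>r>N. fps_nth F r = 0)"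

lemma fb_mult: "fb N F \<Longrightarrow> fb M H \<Longrightarrow> fb (N + M) (F * H)"
  unfolding fb_def fps_mult_nth
proof (intro allI impI sum.neutral ballI)
  fix r i assume *: "\<forall>r>N. fps_nth F r = 0" "\<forall>r>M. fps_nth H r = 0" "N + M < r" "i \<in> {0..r}"
  then have "i > N \<or> r - i > M" by auto
  then show "fps_nth F i * fps_nth H (r - i) = 0" using * by auto
qed

lemma fb_prod_lin: "finite A \<Longrightarrow> fb (card A) (\<Prod>x\<in>A. lin (a x))"
proof (induction A rule: finite_induct)
  case (insert x A)
  have "fb 1 (lin (a x))" by (auto simp: fb_def lin_nth)
  from fb_mult[OF this insert.IH] show ?case using insert by simp
qed (simp add: fb_def)

text \<open>The factor theorem, one root at a time. Since differences of roots can be cancelled, the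
  other roots of p are roots of the quotient.\<close>

lemma prod_linear_dvd:
  assumes "finite A" "\<And>b. b \<in> A \<Longrightarrow> poly p (a b) = 0" "\<And>b b'. b \<in> A \<Longrightarrow> b' \<in> A \<Longrightarrow> b \<noteq> b' \<Longrightarrow> nzd (a b - a b')"
  shows "(\<Prod>b\<in>A. [:- a b, 1:]) dvd p"
  using assms
proof (induction A arbitrary: p rule: finite_induct)
  case (insert b A)
  have "[:- a b, 1:] dvd p" using insert.prems(1)[of b] by (simp add: poly_eq_0_iff_dvd)
  then obtain q where q: "p = [:- a b, 1:] * q" by (rule dvdE)
  have "poly q (a b') = 0" if "b' \<in> A" for b'
  proof -
    have "(a b' - a b) * poly q (a b') = 0"
      using insert.prems(1)[of b'] that by (simp add: q algebra_simps)
    moreover have "nzd (a b' - a b)" using insert.prems(2)[of b' b] insert.hyps that by auto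
    ultimately show ?thesis by (rule nzdD[rotated])
  qed
  then have "(\<Prod>b\<in>A. [:- a b, 1:]) dvd q" using insert by auto
  then show ?case unfolding q prod.insert[OF insert.hyps] by (rule mult_dvd_mono[OF dvd_refl])
qed simp

text \<open>A rational series satisfies a linear recurrence whose characteristic polynomial has its
  poles as roots. Each factor y - a of the polynomial is traded for a factor 1 - au of the series
  and raises the starting index by one; when all are used up, the series is a polynomial and the
  index exceeds its degree.\<close>

lemma Lam_recurrence:
  assumes "finite A" "fb N (F * (\<Prod>b\<in>A. lin (- a b)))" "r0 + card A > N"
  shows "Lam (\<lambda>s. fps_nth F (r0 + s)) (h * (\<Prod>b\<in>A. [:- a b, 1:])) = 0"
  using assms
proof (induction A arbitrary: F r0 rule: finite_induct)
  case empty
  then show ?case by (intro Lam_zero_fun) (auto simp: fb_def)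
next
  case (insert b A)
  let ?P = "h * (\<Prod>b\<in>A. [:- a b, 1:])" and ?F = "F * lin (- a b)"
  have F': "fps_nth ?F (Suc r) = fps_nth F (Suc r) - a b * fps_nth F r" for r
  proof -
    have "?F = F - fps_const (a b) * (F * fps_X)"
      by (simp add: lin_def distrib_left mult_ac right_diff_distrib flip: fps_const_neg)
    then show ?thesis by simp
  qed
  have l: "[:- a b, 1:] = yy - cp (a b)" by (simp add: yy_def cp_def)
  have "h * (\<Prod>b\<in>insert b A. [:- a b, 1:]) = [:- a b, 1:] * ?P"
    unfolding prod.insert[OF insert.hyps] by (simp only: mult_ac)
  then have e: "h * (\<Prod>b\<in>insert b A. [:- a b, 1:]) = yy * ?P - cp (a b) * ?P"
    by (simp only: l left_diff_distrib)
  have "Lam (\<lambda>s. fps_nth F (r0 + s)) (h * (\<Prod>b\<in>insert b A. [:- a b, 1:]))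
      = Lam (\<lambda>s. fps_nth ?F (Suc r0 + s)) ?P"
    unfolding e Lam_diff Lam_yy Lam_cp_mult Lam_fun_lin[symmetric] by (simp add: F' add.commute)
  also have "\<dots> = 0"
    by (rule insert.IH) (use insert in \<open>auto simp: mult.assoc\<close>)
  finally show ?case .
qed

text \<open>The set \<open>A\<close> consists of the poles of the localised theta series that
  survive: those of negative letters in positions up to \<kappa> cancel against z-factors, those of
  absolute value up to l against t-factors. As \<open>G f\<close> vanishes at the survivors it is
  divisible by the characteristic polynomial of the recurrence.\<close>

lemma loc_Psi_zero:
  assumes u: "u \<in> W_inf"
    and A: "A = {j \<in> negs u. int \<kappa> < j \<and> int l < - u j}"
    and zero: "\<And>b. b \<in> A \<Longrightarrow> poly (map_poly (loc tv u) (G f)) (- sg tv (u b)) = 0"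
  shows "loc tv u (Psi \<kappa> l f) = 0"
proof -
  let ?L = "loc tv u" and ?x = "\<lambda>j. - sg tv (u j)"
  let ?F = "fmap ?L (theta_gf \<kappa> (int l))"
  define B where "B = {j \<in> negs u. j \<le> int \<kappa>}"
  define D where "D = {j \<in> negs u. int \<kappa> < j \<and> - u j \<le> int l}"
  have fin: "finite A" "finite B" "finite D" using finite_negs[OF u] by (auto simp: A B_def D_def)
  have un: "negs u = A \<union> (B \<union> D)" "A \<inter> (B \<union> D) = {}" "B \<inter> D = {}"
    by (auto simp: A B_def D_def)
  have xn: "?x j = tv (nat (- u j))" if "j \<in> negs u" for j
    using that by (simp add: negs_def sg_def)
  have F: "?F = (\<Prod>j\<in>negs u. qq (?x j)) * (\<Prod>i\<in>{1..\<kappa>}. lin (sg tv (u (int i)))) * (\<Prod>i\<in>{1..l}. lin (- tv i))"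
  proof -
    have 1: "fmap ?L (\<Prod>i\<in>{1..\<kappa>}. lin (zv i)) = (\<Prod>i\<in>{1..\<kappa>}. lin (sg tv (u (int i))))"
      unfolding fmap_prod[OF rhom_loc] by (rule prod.cong) (auto simp: fmap_lin[OF rhom_loc] loc_z)
    have 2: "fmap ?L (\<Prod>i\<in>{1..l}. lin (- tv i)) = (\<Prod>i\<in>{1..l}. lin (- tv i))"
      unfolding fmap_prod[OF rhom_loc] by (rule prod.cong) (auto simp: fmap_lin[OF rhom_loc] loc_t rhom_minus[OF rhom_loc])
    have 3: "theta_gf \<kappa> (int l) = Qgf * (\<Prod>i\<in>{1..\<kappa>}. lin (zv i)) * (\<Prod>i\<in>{1..l}. lin (- tv i))"
      by (simp add: theta_gf_tpart tpart_def)
    show ?thesis unfolding 3 fmap_mult[OF rhom_loc] 1 2 loc_Q[OF u] ..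
  qed
  define Bn where "Bn = nat ` B"
  have Bn: "Bn \<subseteq> {1..\<kappa>}" by (auto simp: Bn_def B_def negs_def)
  have BnB: "(\<Prod>i\<in>Bn. lin (sg tv (u (int i)))) = (\<Prod>j\<in>B. lin (- ?x j))"
    unfolding Bn_def by (subst prod.reindex) (auto simp: inj_on_def B_def negs_def intro!: prod.cong)
  define Dn where "Dn = (\<lambda>j. nat (- u j)) ` D"
  have Dn: "Dn \<subseteq> {1..l}" by (auto simp: Dn_def D_def negs_def)
  have injD: "inj_on (\<lambda>j. nat (- u j)) D"
  proof (rule inj_onI)
    fix i j assume "i \<in> D" "j \<in> D" "nat (- u i) = nat (- u j)"
    then have "u i = u j" by (auto simp: D_def negs_def)
    then show "i = j" using W_inf_inj[OF u] by blast
  qed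
  have DnD: "(\<Prod>i\<in>Dn. lin (- tv i)) = (\<Prod>j\<in>D. lin (- ?x j))"
    unfolding Dn_def prod.reindex[OF injD] by (rule prod.cong) (auto simp: xn D_def)
  have card: "card (negs u) = card A + (card B + card D)"
    unfolding un(1) using fin un by (simp add: card_Un_disjoint)
  have cBn: "card Bn = card B" "card Dn = card D"
  proof -
    have "inj_on nat B" by (auto simp: inj_on_def B_def negs_def)
    then show "card Bn = card B" "card Dn = card D"
      unfolding Bn_def Dn_def using injD by (auto simp: card_image)
  qed
  have cancel: "(\<Prod>j\<in>X. geom (?x j)) * (\<Prod>j\<in>X. lin (- ?x j)) = 1" for X
    unfolding prod.distrib[symmetric] by (rule prod.neutral) (metis lin_geom_cancel mult.commute)
  have s1: "(\<Prod>j\<in>negs u. qq (?x j)) = (\<Prod>j\<in>negs u. lin (?x j)) *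
      ((\<Prod>j\<in>A. geom (?x j)) * ((\<Prod>j\<in>B. geom (?x j)) * (\<Prod>j\<in>D. geom (?x j))))"
    unfolding qq_def prod.distrib
    by (subst (2) un(1)) (use fin un(2,3) in \<open>simp add: prod.union_disjoint\<close>)
  have s2: "(\<Prod>i\<in>{1..\<kappa>}. lin (sg tv (u (int i)))) = (\<Prod>i\<in>{1..\<kappa>} - Bn. lin (sg tv (u (int i)))) * (\<Prod>j\<in>B. lin (- ?x j))"
    unfolding BnB[symmetric] by (rule prod.subset_diff[OF Bn]) simp
  have s3: "(\<Prod>i\<in>{1..l}. lin (- tv i)) = (\<Prod>i\<in>{1..l} - Dn. lin (- tv i)) * (\<Prod>j\<in>D. lin (- ?x j))"
    unfolding DnD[symmetric] by (rule prod.subset_diff[OF Dn]) simp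
  have "?F * (\<Prod>b\<in>A. lin (- ?x b)) = (\<Prod>j\<in>negs u. lin (?x j)) *
      (\<Prod>i\<in>{1..\<kappa>} - Bn. lin (sg tv (u (int i)))) * (\<Prod>i\<in>{1..l} - Dn. lin (- tv i)) *
      ((\<Prod>j\<in>A. geom (?x j)) * (\<Prod>j\<in>A. lin (- ?x j))) *
      ((\<Prod>j\<in>B. geom (?x j)) * (\<Prod>j\<in>B. lin (- ?x j))) *
      ((\<Prod>j\<in>D. geom (?x j)) * (\<Prod>j\<in>D. lin (- ?x j)))"
    unfolding F s1 s2 s3 by (simp only: mult_ac)
  also have "\<dots> = (\<Prod>j\<in>negs u. lin (?x j)) *
      (\<Prod>i\<in>{1..\<kappa>} - Bn. lin (sg tv (u (int i)))) * (\<Prod>i\<in>{1..l} - Dn. lin (- tv i))"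
    by (simp only: cancel mult_1_right)
  finally have eq: "?F * (\<Prod>b\<in>A. lin (- ?x b)) = (\<Prod>j\<in>negs u. lin (?x j)) *
      (\<Prod>i\<in>{1..\<kappa>} - Bn. lin (sg tv (u (int i)))) * (\<Prod>i\<in>{1..l} - Dn. lin (- tv i))" .
  \<comment> \<open>The degree bound is |\<open>negs u\<close>| + (\<kappa> - |\<open>B\<close>|) +
    (l - |\<open>D\<close>|) = |\<open>A\<close>| + \<kappa> + l, so \<kappa> + l + 1 is the first
    starting index that the recurrence allows.\<close>
  have "fb (card (negs u) + card ({1..\<kappa>} - Bn) + card ({1..l} - Dn)) (?F * (\<Prod>b\<in>A. lin (- ?x b)))"
    unfolding eq by (intro fb_mult fb_prod_lin) (use finite_negs[OF u] in auto)
  moreover have "card ({1..\<kappa>} - Bn) = \<kappa> - card B" "card ({1..l} - Dn) = l - card D"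
    using Bn Dn cBn by (simp_all add: card_Diff_subset finite_subset)
  moreover have "card B \<le> \<kappa>" "card D \<le> l"
    using card_mono[OF _ Bn] card_mono[OF _ Dn] cBn by simp_all
  ultimately have "fb (card A + \<kappa> + l) (?F * (\<Prod>b\<in>A. lin (- ?x b)))" using card by (simp add: add.assoc)
  note rec = Lam_recurrence[OF fin(1) this, of "\<kappa> + l + 1"]
  have "(\<Prod>b\<in>A. [:- ?x b, 1:]) dvd map_poly ?L (G f)"
  proof (rule prod_linear_dvd[OF fin(1) zero])
    fix b b' assume b: "b \<in> A" "b' \<in> A" "b \<noteq> b'"
    then have n: "b \<in> negs u" "b' \<in> negs u" by (auto simp: A)
    have "u b \<noteq> u b'" using b(3) W_inf_inj[OF u] by blast
    then have "nat (- u b) \<noteq> nat (- u b')" using n by (auto simp: negs_def)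
    then show "nzd (?x b - ?x b')"
      unfolding xn[OF n(1)] xn[OF n(2)] using n by (intro nzd_tv_diff) (auto simp: negs_def)
  qed
  then obtain h where "map_poly ?L (G f) = h * (\<Prod>b\<in>A. [:- ?x b, 1:])"
    by (metis dvdE mult.commute)
  then have "Lam (\<lambda>s. fps_nth ?F (\<kappa> + l + 1 + s)) (map_poly ?L (G f)) = 0"
    using rec by simp
  then show ?thesis unfolding Psi_def Lam_hom[OF rhom_loc] by simp
qed

context schubert
begin

text \<open>Left divided differences strip the level l down to 0, right ones then strip the index
  \<kappa> down to 0, and each lowers the degree by one. The integer n stays in front
  throughout.\<close>

lemma theta_norm:
  "fps_nth (theta_gf \<kappa> (int l)) (\<kappa> + l + 1) = of_int n * X \<Longrightarrow> X \<in> Cset \<Longrightarrow> of_int n = (1::Rinf)"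
proof (induction l arbitrary: X)
  case 0
  then show ?case
  proof (induction \<kappa> arbitrary: X)
    case 0
    \<comment> \<open>What is left is Q_1, whose divided difference at 0 is 1.\<close>
    have "Qr 1 = of_int n * X" using 0 by (simp add: theta_gf_def Qgf_def)
    then have "ddz 0 (Qr 1) = of_int n * ddz 0 X" using ddz_lin[OF rhom_of_int[OF rhom_sz]] by simp
    moreover have "ddz 0 (Qr 1) = 1" by (simp add: ddz_0_Qr Qr_0)
    ultimately have "1 = of_int n * ddz 0 X" by simp
    then show ?case by (rule Cset_one[OF Cset_ddz[OF 0(2)]])
  next
    case (Suc \<kappa>)
    have "theta (Suc \<kappa>) 0 (int (Suc \<kappa>) + 1) = of_int n * X"
      using Suc.prems(1) theta_nat[of "Suc \<kappa>" 0 "Suc (Suc \<kappa>)"] by (simp add: add.commute)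
    then have "ddz (Suc \<kappa>) (theta (Suc \<kappa>) 0 (int (Suc \<kappa>) + 1)) = of_int n * ddz (Suc \<kappa>) X"
      using ddz_lin[OF rhom_of_int[OF rhom_sz]] by simp
    then have "theta \<kappa> 0 (int (Suc \<kappa>)) = of_int n * ddz (Suc \<kappa>) X"
      using ddz_theta[of "Suc \<kappa>"] by simp
    then have "fps_nth (theta_gf \<kappa> (int 0)) (\<kappa> + 0 + 1) = of_int n * ddz (Suc \<kappa>) X"
      unfolding theta_nat by simp
    then show ?case by (rule Suc.IH[OF _ Cset_ddz[OF Suc.prems(2)]])
  qed
next
  case (Suc l)
  have "theta \<kappa> (int (Suc l)) (int (\<kappa> + Suc l) + 1) = of_int n * X"
    using Suc.prems(1) theta_nat[of \<kappa> "int (Suc l)" "\<kappa> + Suc l + 1"] by (simp add: add_ac)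
  then have "ddt (Suc l) (theta \<kappa> (int (Suc l)) (int (\<kappa> + Suc l) + 1)) = of_int n * ddt (Suc l) X"
    using ddt_lin[OF rhom_of_int[OF rhom_st]] by simp
  then have "theta \<kappa> (int l) (int (\<kappa> + Suc l)) = of_int n * ddt (Suc l) X"
    using ddt_theta_pos[of "Suc l" \<kappa> "int (\<kappa> + Suc l) + 1"] by simp
  then have "fps_nth (theta_gf \<kappa> (int l)) (\<kappa> + l + 1) = of_int n * ddt (Suc l) X"
    unfolding theta_nat by simp
  then show ?case by (rule Suc.IH[OF _ Cset_ddt[OF Suc.prems(2)]])
qed

text \<open>Left divided differences below l commute with the operator and reduce C_v to 1, which
  leaves the case of a single theta polynomial.\<close>

lemma Psi_norm:
  "v \<in> W_fin l \<Longrightarrow> Psi \<kappa> l (C v) = of_int n * X \<Longrightarrow> X \<in> Cset \<Longrightarrow> of_int n = (1::Rinf)"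
proof (induction "len v" arbitrary: v X rule: less_induct)
  case less
  show ?case
  proof (cases "v = id")
    case True
    have "fps_nth (theta_gf \<kappa> (int l)) (\<kappa> + l + 1) = of_int n * X"
      using less.prems(2) by (simp only: True C_id Psi_1)
    then show ?thesis using less.prems(3) by (rule theta_norm)
  next
    case False
    obtain i where i: "i < l" "len (gen i \<circ> v) < len v" "gen i \<circ> v \<in> W_fin l"
      by (rule W_fin_left_desc[OF less.prems(1) False])
    have v: "v \<in> W_inf" using less.prems(1) by (simp add: W_fin_def)
    have "ddt i (C v) = C (gen i \<circ> v)"
      unfolding ddt_C[OF v] using i(2) by (simp only: len_left_iff[OF v] if_True)
    then have "Psi \<kappa> l (C (gen i \<circ> v)) = ddt i (Psi \<kappa> l (C v))" by (simp only: ddt_Psi[OF i(1)])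
    also have "\<dots> = of_int n * ddt i X"
      unfolding less.prems(2) by (rule ddt_lin[OF rhom_of_int[OF rhom_st]])
    finally show ?thesis by (rule less.hyps[OF i(2,3) _ Cset_ddt[OF less.prems(3)]])
  qed
qed

text \<open>Let u have length at most that of v plus \<kappa> + l + 1. Deleting at a surviving pole
  costs at least \<kappa> + l + 1, so the rest is no longer than v and C_v vanishes there unless the
  rest is v. In that case the cost is exactly \<kappa> + l + 1, which fixes the position and the
  letter and gives u = w. Membership in \<open>SA\<close> and the degree bound are carried along for
  the next insertion.\<close>

theorem insertion:
  assumes w: "w \<in> W_inf" "w (int \<kappa> + 1) = - (int l + 1)" and v: "v = del (int \<kappa> + 1) w" "v \<in> W_fin l"
    and C: "C v \<in> SA \<kappa> l" "Dg (int (len v)) (C v)"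
  shows "C w = Psi \<kappa> l (C v)" "C w \<in> SA \<kappa> l" "Dg (int (len w)) (C w)"
proof -
  have vw: "v \<in> W_inf" using v(2) by (simp add: W_fin_def)
  let ?d = "int (len v) + int (\<kappa> + l + 1)"
  have d: "Dg ?d (Psi \<kappa> l (C v))" by (rule Dg_Psi[OF C(2)])
  have le: "?d \<le> int (len w)" using len_del[OF w(1), of "int \<kappa> + 1"] w(2) v(1) by simp
  have van: "loc tv u (Psi \<kappa> l (C v)) = 0" if u: "u \<in> W_inf" "int (len u) \<le> ?d" "u \<noteq> w" for u
  proof (rule loc_Psi_zero[OF u(1) refl])
    fix b assume b: "b \<in> {j \<in> negs u. int \<kappa> < j \<and> int l < - u j}"
    then have b': "b \<in> negs u" "int \<kappa> < b" "int l < - u b" "b > 0" "u b < 0" by (auto simp: negs_def)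
    have ld: "int (len u) \<ge> int (len (del b u)) + (b - u b - 1)" by (rule len_del[OF u(1) b'(4,5)])
    then have "len (del b u) \<le> len v" using u(2) b' by simp
    moreover have "del b u \<noteq> v"
    proof
      assume e: "del b u = v"
      then have "b = int \<kappa> + 1" "u b = - (int l + 1)" using ld u(2) b' by auto
      then have "u = w" using del_inject[OF u(1) w(1), of b] e v(1) w(2) b' by simp
      then show False using u(3) by simp
    qed
    ultimately have "loc (tvd (- u b)) (del b u) (C v) = 0"
      using loc_C_zero[OF del_W[OF u(1) b'(4,5)] vw] by blast
    then show "poly (map_poly (loc tv u) (G (C v))) (- sg tv (u b)) = 0"
      using loc_G_del[OF u(1) b'(1-3) C(1)] by simp
  qed
  obtain n where n: "Psi \<kappa> l (C v) = of_int n * C w"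
    using multiple_of_C[OF w(1) d le van] by blast
  have "C w \<in> Cset" using w(1) by (simp add: Cset_def)
  from Psi_norm[OF v(2) n this] show e: "C w = Psi \<kappa> l (C v)" using n by simp
  show "C w \<in> SA \<kappa> l" unfolding e by (rule SA_Psi[OF C(1)])
  show "Dg (int (len w)) (C w)" unfolding e by (rule Dg_mono[OF d le])
qed

end

section \<open>Pfaffians\<close>

text \<open>The signed sum over the ways to remove one element.\<close>

fun ctr :: "('b \<Rightarrow> 'a::comm_ring_1) \<Rightarrow> ('b list \<Rightarrow> 'a) \<Rightarrow> 'b list \<Rightarrow> 'a" where
  "ctr \<phi> F [] = 0"
| "ctr \<phi> F (a # xs) = \<phi> a * F xs - ctr \<phi> (\<lambda>ys. F (a # ys)) xs"

lemma ctr_cong':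
  assumes "\<And>b. b \<in> set xs \<Longrightarrow> \<phi> b = \<psi> b"
    and "\<And>ys. set ys \<subseteq> set xs \<Longrightarrow> length ys < length xs \<Longrightarrow> F ys = H ys"
  shows "ctr \<phi> F xs = ctr \<psi> H xs"
  using assms
proof (induction xs arbitrary: F H)
  case (Cons a xs)
  have "ctr \<phi> (\<lambda>ys. F (a # ys)) xs = ctr \<psi> (\<lambda>ys. H (a # ys)) xs"
  proof (rule Cons.IH)
    fix ys assume "set ys \<subseteq> set xs" "length ys < length xs"
    then show "F (a # ys) = H (a # ys)" by (intro Cons.prems(2)) auto
  qed (use Cons.prems(1) in auto)
  moreover have "F xs = H xs" using Cons.prems(2)[of xs] by auto
  ultimately show ?case using Cons.prems(1)[of a] by simp
qed simp

text \<open>Restricting to shorter lists is what shows that the recursion of \<open>pf\<close>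
  through \<open>ctr\<close> terminates.\<close>

lemma ctr_cong [fundef_cong]:
  assumes "\<phi> = \<psi>" "xs = xs'" "\<And>ys. length ys < length xs' \<Longrightarrow> F ys = H ys"
  shows "ctr \<phi> F xs = ctr \<psi> H xs'"
  using assms ctr_cong'[of xs \<phi> \<psi> F H] by auto

text \<open>Pfaffian expansion along the first entry; it gives 0 on lists of odd length.\<close>

function pf :: "('b \<Rightarrow> 'b \<Rightarrow> 'a::comm_ring_1) \<Rightarrow> 'b list \<Rightarrow> 'a" where
  "pf p [] = 1"
| "pf p (a # xs) = ctr (p a) (pf p) xs"
  by pat_completeness auto
termination by (relation "measure (length \<circ> snd)") auto

lemma ctr_add: "ctr \<phi> (\<lambda>ys. F ys + H ys) xs = ctr \<phi> F xs + ctr \<phi> H xs"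
  by (induction xs arbitrary: F H) (auto simp: algebra_simps)
lemma ctr_smult: "ctr \<phi> (\<lambda>ys. c * F ys) xs = c * ctr \<phi> F xs"
  by (induction xs arbitrary: F) (auto simp: algebra_simps)
lemma ctr_minus: "ctr \<phi> (\<lambda>ys. - F ys) xs = - ctr \<phi> F xs"
  using ctr_smult[of \<phi> "- 1" F xs] by simp
lemma ctr_diff: "ctr \<phi> (\<lambda>ys. F ys - H ys) xs = ctr \<phi> F xs - ctr \<phi> H xs"
  using ctr_add[of \<phi> F "\<lambda>ys. - H ys"] by (simp add: ctr_minus)
lemma ctr_zero: "ctr \<phi> (\<lambda>ys. 0) xs = 0"
  using ctr_smult[of \<phi> 0] by simp
lemma ctr_fun_lin: "ctr (\<lambda>b. \<phi> b + c * \<psi> b - d * \<chi> b) F xs = ctr \<phi> F xs + c * ctr \<psi> F xs - d * ctr \<chi> F xs"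
  by (induction xs arbitrary: F) (auto simp: algebra_simps)

text \<open>Contractions of an exterior form anticommute.\<close>

lemma ctr_anti: "ctr \<phi> (ctr \<psi> F) xs = - ctr \<psi> (ctr \<phi> F) xs"
proof (induction xs arbitrary: F)
  case (Cons a xs)
  show ?case by (simp add: ctr_diff ctr_smult Cons.IH)
qed simp

text \<open>Anticommutativity would only give twice this, and 2 need not be cancellable in the
  ring.\<close>

lemma ctr_self: "ctr \<phi> (ctr \<phi> F) xs = 0"
proof (induction xs arbitrary: F)
  case (Cons a xs)
  show ?case by (simp add: ctr_diff ctr_smult Cons.IH)
qed simp

text \<open>In exterior algebra terms, replacing the form \<open>p\<close> by \<open>p + y \<and> x\<close> multiplies its exponential
  by \<open>1 + y \<and> x\<close>.\<close>

lemma pf_rank_two: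
  assumes p': "\<And>a b. p' a b = p a b + y a * x b - x a * y b"
  shows "pf p' xs = pf p xs + ctr y (ctr x (pf p)) xs"
proof (induction "length xs" arbitrary: xs rule: less_induct)
  case less
  show ?case
  proof (cases xs)
    case (Cons a ys)
    let ?E = "\<lambda>ys. pf p ys + ctr y (ctr x (pf p)) ys"
    have e: "ctr \<phi> (pf p') ys = ctr \<phi> ?E ys" for \<phi>
      by (rule ctr_cong) (use less Cons in auto)
    have self: "ctr x (ctr x F) = (\<lambda>ys. 0)" for F :: "'a list \<Rightarrow> 'b"
      by (rule ext) (rule ctr_self)
    have 1: "ctr x ?E ys = ctr x (pf p) ys"
      unfolding ctr_add ctr_anti[of x y] self ctr_zero by simp
    have 2: "ctr y ?E ys = ctr y (pf p) ys"
      unfolding ctr_add by (simp add: ctr_self)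
    have an: "ctr \<psi> (ctr \<phi> F) = (\<lambda>ys. - ctr \<phi> (ctr \<psi> F) ys)" for \<phi> \<psi> and F :: "'a list \<Rightarrow> 'b"
      by (rule ext) (rule ctr_anti)
    have 3: "ctr (p a) ?E ys = ctr (p a) (pf p) ys + ctr y (ctr x (ctr (p a) (pf p))) ys"
      unfolding ctr_add ctr_anti[of "p a" y] an[of "p a" x] ctr_minus by simp
    have pa: "p' a = (\<lambda>b. p a b + y a * x b - x a * y b)" by (rule ext) (rule p')
    have "pf p' xs = ctr (p a) (pf p) ys + ctr y (ctr x (ctr (p a) (pf p))) ys + y a * ctr x (pf p) ys - x a * ctr y (pf p) ys"
      by (simp add: Cons pa ctr_fun_lin e[unfolded pa] 1 2 3)
    moreover have "ctr y (\<lambda>ys. ctr x (pf p) (a # ys)) ys = x a * ctr y (pf p) ys - ctr y (ctr x (ctr (p a) (pf p))) ys"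
      by (simp add: ctr_diff ctr_smult)
    ultimately show ?thesis by (simp add: Cons del: ctr.simps(2)) (simp add: algebra_simps)
  qed simp
qed

lemma ctr_hom: "rhom h \<Longrightarrow> h (ctr \<phi> F xs) = ctr (\<lambda>b. h (\<phi> b)) (\<lambda>ys. h (F ys)) xs"
  by (induction xs arbitrary: F) (auto simp: rhom_0 rhom_diff rhom_mult)

lemma pf_hom: "rhom h \<Longrightarrow> h (pf p xs) = pf (\<lambda>a b. h (p a b)) xs"
proof (induction "length xs" arbitrary: xs rule: less_induct)
  case less
  show ?case
  proof (cases xs)
    case (Cons a ys)
    have "ctr (\<lambda>b. h (p a b)) (\<lambda>ys. h (pf p ys)) ys = ctr (\<lambda>b. h (p a b)) (pf (\<lambda>a b. h (p a b))) ys"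
      by (rule ctr_cong) (use less Cons in auto)
    then show ?thesis by (simp add: Cons ctr_hom[OF less.prems])
  qed (simp add: rhom_1[OF less.prems])
qed

lemma pf_cong: "(\<And>a b. a \<in> set xs \<Longrightarrow> b \<in> set xs \<Longrightarrow> p a b = q a b) \<Longrightarrow> pf p xs = pf q xs"
proof (induction "length xs" arbitrary: xs rule: less_induct)
  case less
  show ?case
  proof (cases xs)
    case (Cons a ys)
    have "ctr (p a) (pf p) ys = ctr (q a) (pf q) ys"
    proof (rule ctr_cong')
      fix zs assume z: "set zs \<subseteq> set ys" "length zs < length ys"
      show "pf p zs = pf q zs"
      proof (rule less.hyps)
        fix c d assume "c \<in> set zs" "d \<in> set zs"
        then show "p c d = q c d" using z Cons by (intro less.prems) auto
      qed (use z Cons in simp)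
    qed (use less.prems Cons in auto)
    then show ?thesis by (simp add: Cons)
  qed simp
qed

lemma ctr_map: "ctr \<phi> F (map f xs) = ctr (\<lambda>b. \<phi> (f b)) (\<lambda>ys. F (map f ys)) xs"
  by (induction xs arbitrary: F) auto

lemma pf_map: "pf p (map f xs) = pf (\<lambda>a b. p (f a) (f b)) xs"
proof (induction "length xs" arbitrary: xs rule: less_induct)
  case less
  show ?case
  proof (cases xs)
    case (Cons a ys)
    have "ctr (\<lambda>b. p (f a) (f b)) (\<lambda>ys. pf p (map f ys)) ys
        = ctr (\<lambda>b. p (f a) (f b)) (pf (\<lambda>a b. p (f a) (f b))) ys"
      by (rule ctr_cong) (use less Cons in auto)
    then show ?thesis by (simp add: Cons ctr_map)
  qed simp
qed

section \<open>Comparison with the recursion that defines \<open>Pf\<close>\<close>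

definition ev1 :: "(int \<Rightarrow> 'a) \<times> int \<Rightarrow> 'a" where "ev1 x = fst x (snd x)"

lemma nth1_Cons: "s \<ge> 1 \<Longrightarrow> nth1 (a # xs) (Suc s) = nth1 xs s"
  by (cases s) (auto simp: nth1_def)
lemma omit_Cons: "s \<ge> 1 \<Longrightarrow> omit (Suc s) (a # xs) = a # omit s xs"
  by (cases s) (auto simp: omit_def)
lemma omit_1: "omit (Suc 0) (a # xs) = xs"
  by (simp add: omit_def)
lemma length_omit: "s \<in> {1..length xs} \<Longrightarrow> length (omit s xs) = length xs - 1"
  by (auto simp: omit_def)

lemma ctr_sum: "ctr \<phi> F xs = (\<Sum>s\<in>{1..length xs}. (- 1) ^ (s - 1) * (\<phi> (nth1 xs s) * F (omit s xs)))"
proof (induction xs arbitrary: F)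
  case (Cons a xs)
  have "(\<Sum>s\<in>{1..length (a # xs)}. (- 1) ^ (s - 1) * (\<phi> (nth1 (a # xs) s) * F (omit s (a # xs))))
     = \<phi> a * F xs + (\<Sum>s\<in>{Suc 1..Suc (length xs)}. (- 1) ^ (s - 1) * (\<phi> (nth1 (a # xs) s) * F (omit s (a # xs))))"
    by (subst sum.atLeast_Suc_atMost) (simp_all add: nth1_def omit_1)
  also have "(\<Sum>s\<in>{Suc 1..Suc (length xs)}. (- 1) ^ (s - 1) * (\<phi> (nth1 (a # xs) s) * F (omit s (a # xs))))
     = (\<Sum>s\<in>{1..length xs}. (- 1) ^ s * (\<phi> (nth1 (a # xs) (Suc s)) * F (omit (Suc s) (a # xs))))"
    by (subst sum.shift_bounds_cl_Suc_ivl) simp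
  also have "\<dots> = (\<Sum>s\<in>{1..length xs}. - ((- 1) ^ (s - 1) * (\<phi> (nth1 xs s) * F (a # omit s xs))))"
  proof (rule sum.cong[OF refl])
    fix s assume "s \<in> {1..length xs}"
    then obtain s' where "s = Suc s'" by (cases s) auto
    then show "(- 1) ^ s * (\<phi> (nth1 (a # xs) (Suc s)) * F (omit (Suc s) (a # xs)))
      = - ((- 1) ^ (s - 1) * (\<phi> (nth1 xs s) * F (a # omit s xs)))"
      by (simp add: nth1_Cons omit_Cons)
  qed
  finally show ?case using Cons.IH[of "\<lambda>ys. F (a # ys)"] by (simp add: sum_negf)
qed simp

text \<open>Replaces indices and omissions by structural recursion. In odd length the alternating
  sum is one contraction with the entries themselves, as if a further row were added in
  front.\<close>

lemma Pf_pf: "Pf xs = (if even (length xs) then pf Pf2 xs else ctr ev1 (pf Pf2) xs)"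
proof (induction "length xs" arbitrary: xs rule: less_induct)
  case less
  consider "xs = []" | a where "xs = [a]" | a b where "xs = [a, b]" | "length xs \<ge> 3"
  proof -
    assume *: "xs = [] \<Longrightarrow> thesis" "\<And>a. xs = [a] \<Longrightarrow> thesis" "\<And>a b. xs = [a, b] \<Longrightarrow> thesis" "3 \<le> length xs \<Longrightarrow> thesis"
    consider "length xs = 0" | "length xs = 1" | "length xs = 2" | "3 \<le> length xs" by linarith
    then show thesis
    proof cases
      case 3
      then obtain a b where "xs = [a, b]" by (auto simp: length_Suc_conv numeral_2_eq_2)
      then show ?thesis by (rule *(3))
    qed (use * in \<open>auto simp: length_Suc_conv\<close>)
  qed
  then show ?case
  proof cases
    case 4
    show ?thesis
    proof (cases "even (length xs)")
      case True
      obtain a ys where xs: "xs = a # ys" using 4 by (cases xs) auto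
      have "Pf xs = (\<Sum>s\<in>{Suc 1..Suc (length ys)}. (- 1) ^ s * (Pf2 (nth1 xs 1) (nth1 xs s) * Pf (omit 1 (omit s xs))))"
        using 4 True by (subst Pf.simps) (auto simp: xs numeral_2_eq_2)
      also have "\<dots> = (\<Sum>s\<in>{1..length ys}. (- 1) ^ Suc s * (Pf2 (nth1 xs 1) (nth1 xs (Suc s)) * Pf (omit 1 (omit (Suc s) xs))))"
        by (rule sum.shift_bounds_cl_Suc_ivl)
      also have "\<dots> = (\<Sum>s\<in>{1..length ys}. (- 1) ^ (s - 1) * (Pf2 a (nth1 ys s) * pf Pf2 (omit s ys)))"
      proof (rule sum.cong[OF refl])
        fix s assume s: "s \<in> {1..length ys}"
        then obtain s' where s': "s = Suc s'" by (cases s) auto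
        have "Pf (omit s ys) = pf Pf2 (omit s ys)"
          using less[of "omit s ys"] length_omit[OF s] True xs s by auto
        then show "(- 1) ^ Suc s * (Pf2 (nth1 xs 1) (nth1 xs (Suc s)) * Pf (omit 1 (omit (Suc s) xs)))
          = (- 1) ^ (s - 1) * (Pf2 a (nth1 ys s) * pf Pf2 (omit s ys))"
          using s' by (simp add: xs nth1_Cons omit_Cons omit_1) (simp add: nth1_def)
      qed
      also have "\<dots> = pf Pf2 xs" by (simp add: xs ctr_sum)
      finally show ?thesis using True by simp
    next
      case False
      then have "Pf xs = (\<Sum>s\<in>{1..length xs}. (- 1) ^ (s - 1) * ((case nth1 xs s of (c, r) \<Rightarrow> c r) * Pf (omit s xs)))"
        using 4 by (subst Pf.simps) auto
      also have "\<dots> = (\<Sum>s\<in>{1..length xs}. (- 1) ^ (s - 1) * (ev1 (nth1 xs s) * pf Pf2 (omit s xs)))"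
      proof (rule sum.cong[OF refl])
        fix s assume s: "s \<in> {1..length xs}"
        have "Pf (omit s xs) = pf Pf2 (omit s xs)"
          using less[of "omit s xs"] length_omit[OF s] False s by auto
        then show "(- 1) ^ (s - 1) * ((case nth1 xs s of (c, r) \<Rightarrow> c r) * Pf (omit s xs))
           = (- 1) ^ (s - 1) * (ev1 (nth1 xs s) * pf Pf2 (omit s xs))"
          by (simp add: ev1_def case_prod_beta)
      qed
      also have "\<dots> = ctr ev1 (pf Pf2) xs" by (rule ctr_sum[symmetric])
      finally show ?thesis using False by simp
    qed
  qed (simp_all add: Pf.simps nth1_def ev1_def case_prod_beta)
qed

lemma Pf2_nat: "Pf2 (c1, r1) (c2, int n) = c1 r1 * c2 (int n)
    + 2 * (\<Sum>s\<in>{1..n}. (- 1) ^ s * (c1 (r1 + int s) * c2 (int n - int s)))"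
proof -
  have "(\<Sum>s\<in>{1..int n}. (- 1) ^ nat s * (c1 (r1 + s) * c2 (int n - s)))
     = (\<Sum>s\<in>{1..n}. (- 1) ^ s * (c1 (r1 + int s) * c2 (int n - int s)))"
    by (rule sum.reindex_bij_witness[of _ int nat]) auto
  then show ?thesis by simp
qed

text \<open>With X raising r1 and lowering r2, the two-entry Pfaffian is (1 - X) / (1 + X) applied
  to the product; multiplying by 1 + X gives the recursion. It stops since the second sequence is 0
  at negative indices.\<close>

lemma Pf2_rec:
  assumes c2: "\<And>q. q < 0 \<Longrightarrow> c2 q = 0"
  shows "Pf2 (c1, r1) (c2, r2) = c1 r1 * c2 r2 - c1 (r1 + 1) * c2 (r2 - 1) - Pf2 (c1, r1 + 1) (c2, r2 - 1)"
proof (cases "r2 \<le> 0")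
  case True
  then show ?thesis using c2 by simp
next
  case False
  then obtain n where n: "r2 = int (Suc n)" by (metis not_le pos_int_cases zero_less_imp_eq_int Suc_pred')
  have "(\<Sum>s\<in>{1..Suc n}. (- 1) ^ s * (c1 (r1 + int s) * c2 (int (Suc n) - int s)))
    = - (c1 (r1 + 1) * c2 (int n)) + (\<Sum>s\<in>{Suc 1..Suc n}. (- 1) ^ s * (c1 (r1 + int s) * c2 (int (Suc n) - int s)))"
    by (subst sum.atLeast_Suc_atMost) simp_all
  also have "(\<Sum>s\<in>{Suc 1..Suc n}. (- 1) ^ s * (c1 (r1 + int s) * c2 (int (Suc n) - int s)))
    = (\<Sum>s\<in>{1..n}. (- 1) ^ Suc s * (c1 (r1 + int (Suc s)) * c2 (int (Suc n) - int (Suc s))))"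
    by (rule sum.shift_bounds_cl_Suc_ivl)
  also have "\<dots> = - (\<Sum>s\<in>{1..n}. (- 1) ^ s * (c1 (r1 + 1 + int s) * c2 (int n - int s)))"
    unfolding sum_negf[symmetric] by (rule sum.cong) (auto simp: add_ac)
  finally have "Pf2 (c1, r1) (c2, r2) = c1 r1 * c2 r2 + 2 * (- (c1 (r1 + 1) * c2 (int n))
     - (\<Sum>s\<in>{1..n}. (- 1) ^ s * (c1 (r1 + 1 + int s) * c2 (int n - int s))))"
    unfolding n Pf2_nat by simp
  moreover have "Pf2 (c1, r1 + 1) (c2, r2 - 1) = c1 (r1 + 1) * c2 (int n)
    + 2 * (\<Sum>s\<in>{1..n}. (- 1) ^ s * (c1 (r1 + 1 + int s) * c2 (int n - int s)))"
    using Pf2_nat[of c1 "r1 + 1" c2 n] by (simp add: n)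
  ultimately show ?thesis by (simp add: n algebra_simps)
qed

definition is_theta :: "(int \<Rightarrow> Rinf) \<times> int \<Rightarrow> bool" where
  "is_theta x \<longleftrightarrow> (\<exists>\<kappa> l. fst x = theta \<kappa> l)"

lemma G_theta_gf: "fmap G (theta_gf \<kappa> l) = qq (- yy) * fmap cp (theta_gf \<kappa> l)"
proof -
  have z: "fmap G (\<Prod>i\<in>{1..\<kappa>}. lin (zv i)) = fmap cp (\<Prod>i\<in>{1..\<kappa>}. lin (zv i))"
    unfolding fmap_prod[OF rhom_G] fmap_prod[OF rhom_cp]
    by (rule prod.cong) (auto simp: fmap_lin[OF rhom_G] fmap_lin[OF rhom_cp] G_z)
  have t: "fmap G (tpart l) = fmap cp (tpart l)"
    unfolding tpart_def
    by (auto simp: fmap_prod[OF rhom_G] fmap_prod[OF rhom_cp] fmap_lin[OF rhom_G] fmap_lin[OF rhom_cp]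
      fmap_geom[OF rhom_G] fmap_geom[OF rhom_cp] rhom_minus[OF rhom_G] rhom_minus[OF rhom_cp] G_t intro!: prod.cong)
  show ?thesis unfolding theta_gf_tpart fmap_mult[OF rhom_G] fmap_mult[OF rhom_cp] z t G_Q by (simp only: mult_ac)
qed

text \<open>The denominator 1 + yu of the new factor is cleared, so that coefficients can be
  compared.\<close>

lemma G_theta_rec:
  "G (theta \<kappa> l r) + yy * G (theta \<kappa> l (r - 1)) = cp (theta \<kappa> l r) - yy * cp (theta \<kappa> l (r - 1))"
proof -
  have "fmap G (theta_gf \<kappa> l) * lin yy = fmap cp (theta_gf \<kappa> l) * lin (- yy) * (lin yy * geom (- yy))"
    unfolding G_theta_gf qq_def by (simp only: mult_ac)
  then have "fmap G (theta_gf \<kappa> l) * lin yy = fmap cp (theta_gf \<kappa> l) * lin (- yy)"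
    by (simp add: lin_geom_cancel')
  then have "sq (fmap G (theta_gf \<kappa> l) * lin yy) r = sq (fmap cp (theta_gf \<kappa> l) * lin (- yy)) r" by simp
  then show ?thesis unfolding sq_mult_lin theta_sq rhom_sq[OF rhom_G] rhom_sq[OF rhom_cp] by simp
qed

lemma rhom_Pf2: "rhom h \<Longrightarrow> h (Pf2 (c1, r1) (c2, r2)) = Pf2 (\<lambda>q. h (c1 q), r1) (\<lambda>q. h (c2 q), r2)"
  by (simp add: rhom_add rhom_mult rhom_sum rhom_power rhom_minus rhom_1 rhom_numeral)

text \<open>Both sides obey the recursion \<open>Pf2_rec\<close>. The correction is a form of rank
  two in the entries and their images, exactly the shape that \<open>pf_rank_two\<close>
  handles.\<close>

lemma G_Pf2:
  assumes "is_theta a" "is_theta b"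
  shows "G (Pf2 a b) = cp (Pf2 a b) + G (ev1 a) * cp (ev1 b) - cp (ev1 a) * G (ev1 b)"
proof -
  obtain \<kappa> l \<kappa>' l' where ab: "fst a = theta \<kappa> l" "fst b = theta \<kappa>' l'" using assms by (auto simp: is_theta_def)
  let ?c = "theta \<kappa> l" and ?d = "theta \<kappa>' l'"
  have d0: "?d q = 0" if "q < 0" for q using that by (simp add: theta_neg)
  have key: "G (Pf2 (?c, r1) (?d, r2)) = cp (Pf2 (?c, r1) (?d, r2)) + G (?c r1) * cp (?d r2) - cp (?c r1) * G (?d r2)" for r1 r2
  \<comment> \<open>The measure is 0 exactly for negative r2, where all terms vanish.\<close>
  proof (induction "nat (r2 + 1)" arbitrary: r1 r2)
    case 0
    then show ?case using d0 by (simp add: rhom_0[OF rhom_G] rhom_0[OF rhom_cp])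
  next
    case (Suc n)
    have "nat (r2 - 1 + 1) = n" using Suc.hyps(2) by simp
    then have IH: "G (Pf2 (?c, r1 + 1) (?d, r2 - 1)) = cp (Pf2 (?c, r1 + 1) (?d, r2 - 1))
        + G (?c (r1 + 1)) * cp (?d (r2 - 1)) - cp (?c (r1 + 1)) * G (?d (r2 - 1))"
      using Suc.hyps(1)[of "r2 - 1" "r1 + 1"] by (simp del: Pf2.simps)
    have rc: "G (?c (r1 + 1)) = cp (?c (r1 + 1)) - yy * cp (?c r1) - yy * G (?c r1)"
      using G_theta_rec[of \<kappa> l "r1 + 1"] by (simp add: algebra_simps)
    have rd: "G (?d r2) = cp (?d r2) - yy * cp (?d (r2 - 1)) - yy * G (?d (r2 - 1))"
      using G_theta_rec[of \<kappa>' l' r2] by (simp add: algebra_simps)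
    have P: "Pf2 (?c, r1) (?d, r2) = ?c r1 * ?d r2 - ?c (r1 + 1) * ?d (r2 - 1) - Pf2 (?c, r1 + 1) (?d, r2 - 1)"
      by (rule Pf2_rec) (rule d0)
    have EG: "G (Pf2 (?c, r1) (?d, r2)) = G (?c r1) * G (?d r2) - G (?c (r1 + 1)) * G (?d (r2 - 1))
        - G (Pf2 (?c, r1 + 1) (?d, r2 - 1))"
      by (subst P) (simp only: rhom_diff[OF rhom_G] rhom_mult[OF rhom_G])
    have EC: "cp (Pf2 (?c, r1) (?d, r2)) = cp (?c r1) * cp (?d r2) - cp (?c (r1 + 1)) * cp (?d (r2 - 1))
        - cp (Pf2 (?c, r1 + 1) (?d, r2 - 1))"
      by (subst P) (simp only: rhom_diff[OF rhom_cp] rhom_mult[OF rhom_cp])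
    show ?case
      unfolding EG EC IH rc rd by (simp add: algebra_simps del: Pf2.simps)
  qed
  show ?thesis using key[of "snd a" "snd b"] ab by (metis ev1_def prod.collapse)
qed

lemma Lam_cp: "Lam c (cp a) = c 0 * a"
  by (simp add: Lam_def cp_def)

text \<open>On a single entry the series (1 - yu) / (1 + yu), with y^s read as \<open>c s\<close>,
  is the generating function of the pairing \<open>Pf2\<close>. The index is normalised so that the
  new entry starts at 0.\<close>

lemma Lam_G_theta:
  fixes c :: "nat \<Rightarrow> Rinf"
  assumes "is_theta b"
  shows "Lam c (G (ev1 b)) = Pf2 (\<lambda>q. c (nat q), 0) b"
proof -
  obtain \<kappa> l r where b: "b = (theta \<kappa> l, r)" using assms by (cases b) (auto simp: is_theta_def)
  have neg: "theta \<kappa> l q = 0" if "q < 0" for q using that by (simp add: theta_neg)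
  have "Lam c (G (theta \<kappa> l r)) = Pf2 (\<lambda>q. c (nat (q)), r1) (theta \<kappa> l, r)" if "r1 = 0" for c :: "nat \<Rightarrow> Rinf" and r1
    unfolding that
  proof (induction "nat (r + 1)" arbitrary: r c)
    case 0
    then show ?case using neg by (simp add: rhom_0[OF rhom_G] Lam_0)
  next
    case (Suc n)
    have n: "n = nat (r - 1 + 1)" using Suc.hyps(2) by simp
    have e: "G (theta \<kappa> l r) = cp (theta \<kappa> l r) - yy * cp (theta \<kappa> l (r - 1)) - yy * G (theta \<kappa> l (r - 1))"
      using G_theta_rec[of \<kappa> l r] by (simp add: algebra_simps)
    have s: "Pf2 (\<lambda>q. c (nat q), 0 + 1) (theta \<kappa> l, r - 1) = Pf2 (\<lambda>q. c (Suc (nat q)), 0) (theta \<kappa> l, r - 1)"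
      by (simp add: nat_add_distrib)
    show ?case
      unfolding e Lam_diff Lam_yy Lam_cp Suc.hyps(1)[OF n]
      by (subst Pf2_rec[of "theta \<kappa> l" _ 0 r, OF neg], assumption) (simp only: s, simp)
  qed
  then show ?thesis by (simp add: b ev1_def del: Pf2.simps)
qed

lemma Lam_ctr: "Lam c (ctr y (\<lambda>ys. cp (F ys)) xs) = ctr (\<lambda>b. Lam c (y b)) F xs"
proof (induction xs arbitrary: F)
  case (Cons a xs)
  have "Lam c (y a * cp (F xs)) = Lam c (y a) * F xs" by (metis Lam_cp_mult mult.commute)
  then show ?case by (simp add: Lam_diff Cons.IH)
qed (simp add: Lam_0)

text \<open>\<open>G\<close> is multiplicative but \<open>Lam\<close> is merely linear. By
  \<open>pf_rank_two\<close> the image of a Pfaffian is affine in the images of its entries, so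
  \<open>Lam\<close> can be evaluated entry by entry, turning each image into the pairing with the
  new entry. The result is the expansion along that entry.\<close>

lemma Psi_Pf:
  assumes th: "\<And>x. x \<in> set xs \<Longrightarrow> is_theta x"
  shows "Psi \<kappa> l (Pf xs) = Pf ((theta \<kappa> (int l), int (\<kappa> + l + 1)) # xs)"
proof -
  let ?c = "\<lambda>s. fps_nth (theta_gf \<kappa> (int l)) (\<kappa> + l + 1 + s)" and ?e = "(theta \<kappa> (int l), int (\<kappa> + l + 1))"
  let ?x = "\<lambda>b. cp (ev1 b)" and ?y = "\<lambda>b. G (ev1 b)"
  let ?q = "\<lambda>a b. cp (Pf2 a b)" and ?p' = "\<lambda>a b. cp (Pf2 a b) + G (ev1 a) * cp (ev1 b) - cp (ev1 a) * G (ev1 b)"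
  have c: "Lam ?c (?y b) = Pf2 ?e b" if "b \<in> set xs" for b
  proof -
    obtain d r where b: "b = (d, r)" by (cases b)
    have c: "theta \<kappa> (int l) (int (\<kappa> + l + 1) + q) = ?c (nat q)" if "q \<ge> 0" for q
    proof -
      have "int (\<kappa> + l + 1) + q = int (\<kappa> + l + 1 + nat q)" using that by simp
      then show ?thesis by (simp only: theta_nat)
    qed
    have "Lam ?c (?y b) = Pf2 (\<lambda>q. ?c (nat q), 0) b" by (rule Lam_G_theta[OF th[OF that]])
    also have "\<dots> = Pf2 ?e b"
    proof -
      have "(\<Sum>s\<in>{1..r}. (- 1) ^ nat s * (?c (nat (0 + s)) * d (r - s)))
        = (\<Sum>s\<in>{1..r}. (- 1) ^ nat s * (theta \<kappa> (int l) (int (\<kappa> + l + 1) + s) * d (r - s)))"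
      proof (rule sum.cong[OF refl])
        fix s assume "s \<in> {1..r}"
        then have "0 \<le> s" by simp
        then show "(- 1) ^ nat s * (?c (nat (0 + s)) * d (r - s))
          = (- 1) ^ nat s * (theta \<kappa> (int l) (int (\<kappa> + l + 1) + s) * d (r - s))"
          by (simp only: c add_0_left)
      qed
      then show ?thesis unfolding b Pf2.simps using c[of 0] by (simp only: add_0_right order_refl)
    qed
    finally show ?thesis .
  qed
  have q: "pf ?q = (\<lambda>ys. cp (pf Pf2 ys))" by (rule ext) (simp add: pf_hom[OF rhom_cp])
  have cx: "ctr ?x (pf ?q) = (\<lambda>ys. cp (ctr ev1 (pf Pf2) ys))"
    by (rule ext) (simp add: q ctr_hom[OF rhom_cp])
  have r2: "pf ?p' ys = cp (pf Pf2 ys) + ctr ?y (\<lambda>ys. cp (ctr ev1 (pf Pf2) ys)) ys" for ys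
    using pf_rank_two[of ?p' ?q ?y ?x ys] unfolding cx by (simp add: q)
  have G_pf: "G (pf Pf2 ys) = pf ?p' ys" if "set ys \<subseteq> set xs" for ys
    unfolding pf_hom[OF rhom_G] by (rule pf_cong) (use that th G_Pf2 in blast)
  have phi: "ctr (\<lambda>b. Lam ?c (?y b)) F xs = ctr (Pf2 ?e) F xs" for F :: "_ \<Rightarrow> Rinf"
    by (rule ctr_cong') (use c in auto)
  have e: "ev1 ?e = ?c 0" using theta_nat[of \<kappa> "int l" "\<kappa> + l + 1"] by (simp add: ev1_def)
  show ?thesis
  proof (cases "even (length xs)")
    case True
    have "Psi \<kappa> l (Pf xs) = Lam ?c (pf ?p' xs)"
      unfolding Psi_def using True G_pf[of xs] by (simp add: Pf_pf)
    also have "\<dots> = ?c 0 * pf Pf2 xs + ctr (Pf2 ?e) (ctr ev1 (pf Pf2)) xs"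
      unfolding r2 Lam_add Lam_cp Lam_ctr phi ..
    also have "\<dots> = ctr ev1 (pf Pf2) (?e # xs)"
      unfolding ctr_anti[of "Pf2 ?e"] ctr.simps e pf.simps by (simp del: Pf2.simps)
    finally show ?thesis using True by (simp only: Pf_pf[of "?e # xs"] length_Cons even_Suc if_False simp_thms)
  next
    case False
    have "G (ctr ev1 (pf Pf2) xs) = ctr ?y (\<lambda>ys. G (pf Pf2 ys)) xs" by (rule ctr_hom[OF rhom_G])
    also have "\<dots> = ctr ?y (pf ?p') xs" by (rule ctr_cong') (use G_pf in auto)
    \<comment> \<open>The quadratic part is a contraction taken twice with the same
      \<open>?y\<close> and vanishes.\<close>
    also have "\<dots> = ctr ?y (\<lambda>ys. cp (pf Pf2 ys)) xs"
      unfolding r2[abs_def] ctr_add ctr_self by simp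
    finally have g: "G (ctr ev1 (pf Pf2) xs) = ctr ?y (\<lambda>ys. cp (pf Pf2 ys)) xs" .
    have "Pf xs = ctr ev1 (pf Pf2) xs" using False by (simp add: Pf_pf)
    then have "Psi \<kappa> l (Pf xs) = ctr (Pf2 ?e) (pf Pf2) xs"
      by (simp only: Psi_def g Lam_ctr phi)
    then show ?thesis using False by (simp only: Pf_pf[of "?e # xs"] length_Cons even_Suc if_True simp_thms pf.simps)
  qed
qed

lemma Pf_hom:
  assumes "rhom h"
  shows "h (Pf xs) = Pf (map (\<lambda>(c, r). (\<lambda>q. h (c q), r)) xs)"
proof -
  let ?f = "\<lambda>(c, r). (\<lambda>q. h (c q), r)"
  have 1: "(\<lambda>a b. h (Pf2 a b)) = (\<lambda>a b. Pf2 (?f a) (?f b))"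
    by (intro ext) (auto simp: rhom_Pf2[OF assms] simp del: Pf2.simps)
  have 2: "(\<lambda>b. h (ev1 b)) = (\<lambda>b. ev1 (?f b))" by (rule ext) (auto simp: ev1_def)
  show ?thesis
    by (simp add: Pf_pf pf_hom[OF assms] ctr_hom[OF assms] pf_map ctr_map 1 2)
qed


text \<open>Additivity in one slot. The length bound n serves the induction, since each
  \<open>ctr\<close> consumes an element.\<close>

definition lin_slot :: "'b \<Rightarrow> 'b \<Rightarrow> 'b \<Rightarrow> 'a \<Rightarrow> nat \<Rightarrow> ('b list \<Rightarrow> 'a::comm_ring_1) \<Rightarrow> bool" where
  "lin_slot b b1 b2 u n F \<longleftrightarrow> (\<forall>xs ys. length xs + length ys < n \<longrightarrow>
     F (xs @ b # ys) = F (xs @ b1 # ys) + u * F (xs @ b2 # ys))"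

lemma ctr_lin_slot:
  fixes F :: "'b list \<Rightarrow> 'a::comm_ring_1"
  assumes \<phi>: "\<phi> b = \<phi> b1 + u * \<phi> b2"
  shows "lin_slot b b1 b2 u n F \<Longrightarrow> lin_slot b b1 b2 u (Suc n) (ctr \<phi> F)"
  unfolding lin_slot_def
proof (intro allI impI)
  fix xs ys :: "'b list"
  assume "\<forall>xs ys. length xs + length ys < n \<longrightarrow> F (xs @ b # ys) = F (xs @ b1 # ys) + u * F (xs @ b2 # ys)"
    and "length xs + length ys < Suc n"
  then show "ctr \<phi> F (xs @ b # ys) = ctr \<phi> F (xs @ b1 # ys) + u * ctr \<phi> F (xs @ b2 # ys)"
  proof (induction xs arbitrary: F n)
    case Nil
    have "ctr \<phi> (\<lambda>zs. F (b # zs)) ys = ctr \<phi> (\<lambda>zs. F (b1 # zs) + u * F (b2 # zs)) ys"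
    proof (rule ctr_cong[OF refl refl])
      fix zs :: "'b list" assume "length zs < length ys"
      then show "F (b # zs) = F (b1 # zs) + u * F (b2 # zs)"
        using Nil.prems(1)[rule_format, of "[]" zs] Nil.prems(2) by simp
    qed
    then show ?case by (simp add: \<phi> ctr_add ctr_smult algebra_simps)
  next
    case (Cons a xs)
    have "ctr \<phi> (\<lambda>zs. F (a # zs)) (xs @ b # ys)
        = ctr \<phi> (\<lambda>zs. F (a # zs)) (xs @ b1 # ys) + u * ctr \<phi> (\<lambda>zs. F (a # zs)) (xs @ b2 # ys)"
    proof (rule Cons.IH[of "n - 1"])
      show "\<forall>xs ys. length xs + length ys < n - 1 \<longrightarrow> F (a # xs @ b # ys) = F (a # xs @ b1 # ys) + u * F (a # xs @ b2 # ys)"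
        using Cons.prems(1)[rule_format, of "a # _" _] by simp
    qed (use Cons.prems(2) in simp)
    moreover have "F (xs @ b # ys) = F (xs @ b1 # ys) + u * F (xs @ b2 # ys)"
      using Cons.prems by simp
    ultimately show ?case by (simp add: algebra_simps)
  qed
qed

lemma pf_lin_slot:
  assumes 1: "\<And>a. p a b = p a b1 + u * p a b2" and 2: "\<And>a. p b a = p b1 a + u * p b2 a"
  shows "lin_slot b b1 b2 u n (pf p)"
proof (induction n)
  case (Suc n)
  show ?case
    unfolding lin_slot_def
  proof (intro allI impI)
    fix xs ys :: "'a list" assume len: "length xs + length ys < Suc n"
    show "pf p (xs @ b # ys) = pf p (xs @ b1 # ys) + u * pf p (xs @ b2 # ys)"
    proof (cases xs)
      case Nil
      have "p b = (\<lambda>a. p b1 a + u * p b2 a - 0 * p b2 a)" by (rule ext) (simp add: 2)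
      then have "ctr (p b) (pf p) ys = ctr (p b1) (pf p) ys + u * ctr (p b2) (pf p) ys"
        by (simp only: ctr_fun_lin) simp
      then show ?thesis by (simp add: Nil)
    next
      case (Cons a zs)
      have "lin_slot b b1 b2 u (Suc n) (ctr (p a) (pf p))"
        by (rule ctr_lin_slot[OF 1 Suc.IH])
      then show ?thesis using len by (simp add: Cons lin_slot_def)
    qed
  qed
qed (simp add: lin_slot_def)

text \<open>The pairings with the slot in either position, and its own value, are all linear in the
  sequence placed there; the Pfaffian uses the slot once in each term.\<close>

lemma Pf_slot:
  assumes c: "\<And>q. c q = d q + u * d (q - 1)" and d: "\<And>q. q < 0 \<Longrightarrow> d q = 0"
  shows "Pf (xs @ (c, r) # ys) = Pf (xs @ (d, r) # ys) + u * Pf (xs @ (d, r - 1) # ys)"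
proof -
  let ?b = "(c, r)" and ?b1 = "(d, r)" and ?b2 = "(d, r - 1)"
  have 1: "Pf2 a ?b = Pf2 a ?b1 + u * Pf2 a ?b2" for a
  proof -
    obtain f q where a: "a = (f, q)" by (cases a)
    \<comment> \<open>Lowering the slot also shortens the range of summation; the extra term s = r
      involves d (-1) = 0.\<close>
    have "(\<Sum>s\<in>{1..r}. (- 1) ^ nat s * (f (q + s) * d (r - s - 1)))
        = (\<Sum>s\<in>{1..r - 1}. (- 1) ^ nat s * (f (q + s) * d (r - 1 - s)))"
      by (rule sum.mono_neutral_cong_right) (auto simp: d algebra_simps)
    moreover have "(\<Sum>s\<in>{1..r}. (- 1) ^ nat s * (f (q + s) * c (r - s)))
       = (\<Sum>s\<in>{1..r}. (- 1) ^ nat s * (f (q + s) * d (r - s)))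
        + u * (\<Sum>s\<in>{1..r}. (- 1) ^ nat s * (f (q + s) * d (r - s - 1)))"
      unfolding sum_distrib_left sum.distrib[symmetric] by (simp add: c algebra_simps)
    ultimately have "(\<Sum>s\<in>{1..r}. (- 1) ^ nat s * (f (q + s) * c (r - s)))
       = (\<Sum>s\<in>{1..r}. (- 1) ^ nat s * (f (q + s) * d (r - s)))
        + u * (\<Sum>s\<in>{1..r - 1}. (- 1) ^ nat s * (f (q + s) * d (r - 1 - s)))"
      by simp
    then show ?thesis by (simp add: a c algebra_simps)
  qed
  have 2: "Pf2 ?b a = Pf2 ?b1 a + u * Pf2 ?b2 a" for a
  proof -
    obtain f q where a: "a = (f, q)" by (cases a)
    show ?thesis by (simp add: a c algebra_simps sum.distrib sum_distrib_left)
  qed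
  have 3: "ev1 ?b = ev1 ?b1 + u * ev1 ?b2" by (simp add: ev1_def c)
  have e: "lin_slot ?b ?b1 ?b2 u n (pf Pf2)" for n by (rule pf_lin_slot[OF 1 2])
  have "lin_slot ?b ?b1 ?b2 u n (ctr ev1 (pf Pf2))" for n
    using ctr_lin_slot[OF 3 e, of n] by (simp add: lin_slot_def)
  from this[of "Suc (length xs + length ys)"] e[of "Suc (length xs + length ys)"]
  show ?thesis unfolding lin_slot_def Pf_pf by simp
qed

section \<open>The longest element\<close>

lemma W_inf_eqI:
  assumes "w \<in> W_inf" "v \<in> W_inf" "\<And>x. x > 0 \<Longrightarrow> w x = v x"
  shows "w = v"
proof
  fix x show "w x = v x"
    using assms(3)[of x] assms(3)[of "- x"] W_inf_minus[OF assms(1), of x] W_inf_minus[OF assms(2), of x]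
      W_inf_0[OF assms(1)] W_inf_0[OF assms(2)]
    by (cases "x > 0"; cases "x = 0") auto
qed

text \<open>The list \<open>theta_B (B_tilde K i)\<close> with its length as a parameter. Because
  \<open>theta_B\<close> reverses, each further letter adds its entry in front.\<close>

definition blk :: "nat \<Rightarrow> nat \<Rightarrow> ((int \<Rightarrow> Rinf) \<times> int) list" where
  "blk \<kappa> d = theta_B (map (\<lambda>j. (\<kappa>, int (2 * \<kappa> + j), int (\<kappa> + j) - 1)) [1..<d + 1])"

lemma blk_0: "blk \<kappa> 0 = []"
  by (simp add: blk_def theta_B_def)

lemma blk_Suc: "blk \<kappa> (Suc d) = (theta \<kappa> (int (\<kappa> + d)), int (\<kappa> + (\<kappa> + d) + 1)) # blk \<kappa> d"
  by (simp add: blk_def theta_B_def entry_def)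

lemma blk_theta: "x \<in> set (blk \<kappa> d) \<Longrightarrow> \<exists>l r. x = (theta \<kappa> l, r) \<and> l \<ge> int \<kappa>"
  by (auto simp: blk_def theta_B_def entry_def)

context schubert
begin

text \<open>The invariant of repeated insertion: the formula together with what
  \<open>insertion\<close> and \<open>Psi_Pf\<close> demand of the previous element.\<close>

definition good :: "(int \<Rightarrow> int) \<Rightarrow> ((int \<Rightarrow> Rinf) \<times> int) list \<Rightarrow> nat \<Rightarrow> nat \<Rightarrow> bool" where
  "good w xs \<kappa> l \<longleftrightarrow> C w = Pf xs \<and> (\<forall>x\<in>set xs. is_theta x) \<and> C w \<in> SA \<kappa> l \<and> Dg (int (len w)) (C w)"

text \<open>The barred block grows from its right end: each step puts a letter larger in absolute
  value at position \<kappa> + 1 and moves the earlier ones to the right. The function f records the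
  first \<kappa> letters, which never change.\<close>

lemma block:
  assumes base: "\<And>v. v \<in> W_inf \<Longrightarrow> (\<And>q. q \<in> {1..\<kappa>} \<Longrightarrow> v (int q) = f q) \<Longrightarrow> (\<And>x. x > int \<kappa> \<Longrightarrow> v x = x)
     \<Longrightarrow> good v xs \<kappa> \<kappa>"
  shows "w \<in> W_inf \<Longrightarrow> (\<And>q. q \<in> {1..\<kappa>} \<Longrightarrow> w (int q) = f q)
     \<Longrightarrow> (\<And>j. j \<in> {1..d} \<Longrightarrow> w (int (\<kappa> + j)) = - int (\<kappa> + d + 1 - j)) \<Longrightarrow> (\<And>x. x > int (\<kappa> + d) \<Longrightarrow> w x = x)
     \<Longrightarrow> good w (blk \<kappa> d @ xs) \<kappa> (\<kappa> + d)"
proof (induction d arbitrary: w)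
  case 0
  then show ?case using base[of w] by (simp add: blk_0)
next
  case (Suc d)
  note w = Suc.prems(1)
  let ?l = "\<kappa> + d"
  have wb: "w (int \<kappa> + 1) = - (int ?l + 1)" using Suc.prems(3)[of 1] by (simp add: add.commute)
  define v where "v = del (int \<kappa> + 1) w"
  have v: "v \<in> W_inf" unfolding v_def by (rule del_W[OF w]) (use wb in auto)
  have v_eq: "v x = un (int ?l + 1) (w (sk (int \<kappa> + 1) x))" for x
    by (simp only: v_def del_def wb minus_minus)
  \<comment> \<open>The absolute values above \<kappa> are used up by the block, so closing the gap
    does not alter the first \<kappa> letters.\<close>
  have small: "\<bar>w (int q)\<bar> \<le> int \<kappa>" if q: "q \<in> {1..\<kappa>}" for q
  proof (rule ccontr)
    assume *: "\<not> \<bar>w (int q)\<bar> \<le> int \<kappa>"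
    have "w \<in> W_fin (\<kappa> + Suc d)" using w Suc.prems(4) by (simp add: W_fin_def)
    then have "\<bar>w (int q)\<bar> \<le> int (\<kappa> + Suc d)" by (rule W_fin_bound) (use q in simp)
    then have j: "\<kappa> + Suc d + 1 - nat \<bar>w (int q)\<bar> \<in> {1..Suc d}" using * by auto
    have "w (int (\<kappa> + (\<kappa> + Suc d + 1 - nat \<bar>w (int q)\<bar>))) = - \<bar>w (int q)\<bar>"
      using Suc.prems(3)[OF j] * \<open>\<bar>w (int q)\<bar> \<le> int (\<kappa> + Suc d)\<close> by auto
    then have "w (int (\<kappa> + (\<kappa> + Suc d + 1 - nat \<bar>w (int q)\<bar>))) = w (int q) \<or>
       w (int (\<kappa> + (\<kappa> + Suc d + 1 - nat \<bar>w (int q)\<bar>))) = w (- int q)"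
      using W_inf_minus[OF w, of "int q"] by (auto simp: abs_if)
    then have "int (\<kappa> + (\<kappa> + Suc d + 1 - nat \<bar>w (int q)\<bar>)) = int q \<or> int (\<kappa> + (\<kappa> + Suc d + 1 - nat \<bar>w (int q)\<bar>)) = - int q"
      using W_inf_inj[OF w] by blast
    then show False using q j by auto
  qed
  have g: "good v (blk \<kappa> d @ xs) \<kappa> ?l"
  proof (rule Suc.IH[OF v])
    show "v (int q) = f q" if q: "q \<in> {1..\<kappa>}" for q
    proof -
      have "sk (int \<kappa> + 1) (int q) = int q" using q by (simp add: sk_def)
      then show ?thesis using small[OF q] Suc.prems(2)[OF q] by (auto simp: v_eq un_def abs_le_iff)
    qed
    show "v (int (\<kappa> + j)) = - int (\<kappa> + d + 1 - j)" if j: "j \<in> {1..d}" for j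
    proof -
      have "sk (int \<kappa> + 1) (int (\<kappa> + j)) = int (\<kappa> + Suc j)" using j by (simp add: sk_def)
      moreover have "w (int (\<kappa> + Suc j)) = - int (\<kappa> + d + 1 - j)" using Suc.prems(3)[of "Suc j"] j by simp
      ultimately show ?thesis using j by (simp add: v_eq un_def)
    qed
    show "v x = x" if x: "x > int ?l" for x
    proof -
      have "sk (int \<kappa> + 1) x = x + 1" using x by (simp add: sk_def)
      moreover have "w (x + 1) = x + 1" using Suc.prems(4)[of "x + 1"] x by simp
      ultimately show ?thesis using x by (simp add: v_eq un_def)
    qed
  qed
  have vf: "v \<in> W_fin ?l"
  proof -
    have "v x = x" if x: "x > int ?l" for x
    proof -
      have "sk (int \<kappa> + 1) x = x + 1" using x by (simp add: sk_def)
      moreover have "w (x + 1) = x + 1" using Suc.prems(4)[of "x + 1"] x by simp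
      ultimately show ?thesis using x by (simp add: v_eq un_def)
    qed
    then show ?thesis using v by (simp add: W_fin_def)
  qed
  note ins = insertion[OF w wb v_def vf]
  have Cv: "C v = Pf (blk \<kappa> d @ xs)" "C v \<in> SA \<kappa> ?l" "Dg (int (len v)) (C v)" "\<And>x. x \<in> set (blk \<kappa> d @ xs) \<Longrightarrow> is_theta x"
    using g by (auto simp: good_def)
  have "C w = Pf (blk \<kappa> (Suc d) @ xs)"
    unfolding ins(1)[OF Cv(2,3)] Cv(1) blk_Suc append_Cons by (rule Psi_Pf) (rule Cv(4))
  moreover have "C w \<in> SA \<kappa> (\<kappa> + Suc d)"
    by (rule SA_mono[OF _ _ ins(2)[OF Cv(2,3)]]) auto
  moreover have "\<forall>x\<in>set (blk \<kappa> (Suc d) @ xs). is_theta x"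
    using Cv(4) by (auto simp: blk_Suc is_theta_def)
  ultimately show ?case using ins(3)[OF Cv(2,3)] by (simp add: good_def)
qed

end

locale flag = schubert C for C :: "(int \<Rightarrow> int) \<Rightarrow> Rinf" +
  fixes p :: nat and K :: "nat \<Rightarrow> nat"
  assumes p: "p \<ge> 1" and K: "\<And>i. i \<in> {1..p} \<Longrightarrow> K i < K (i + 1)"
begin

lemma K_le: "1 \<le> i \<Longrightarrow> i \<le> j \<Longrightarrow> j \<le> p + 1 \<Longrightarrow> K i \<le> K j"
proof (induction j)
  case (Suc j)
  show ?case
  proof (cases "i = Suc j")
    case False
    then have "K i \<le> K j" using Suc by simp
    also have "K j < K (j + 1)" using Suc.prems False by (intro K) auto
    finally show ?thesis by simp
  qed simp
qed simp

lemma B_tilde_blk: "theta_B (B_tilde K i) = blk (K i) (K (i + 1) - K i)"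
  by (simp add: B_tilde_def blk_def)

text \<open>Starting from the identity and the empty Pfaffian 1, the blocks are inserted from left
  to right, the first of them included.\<close>

lemma longest:
  assumes "i \<le> p" "w \<in> W_inf" "\<And>q. q \<in> {1..K 1} \<Longrightarrow> w (int q) = int q"
    and "\<And>i' j. i' \<in> {1..i} \<Longrightarrow> j \<in> {1..K (i' + 1) - K i'} \<Longrightarrow> w (int (K i' + j)) = - int (K (i' + 1) + 1 - j)"
    and "\<And>x. x > int (K (i + 1)) \<Longrightarrow> w x = x"
  shows "good w (concat (map (\<lambda>i. theta_B (B_tilde K i)) (rev [1..<i + 1]))) (K (i + 1)) (K (i + 1))"
  using assms
proof (induction i arbitrary: w)
  case 0
  have "w = id"
  proof (rule W_inf_eqI[OF 0(2) W_inf_id])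
    fix x :: int assume x: "x > 0"
    show "w x = id x"
    proof (cases "x > int (K 1)")
      case False
      then have "nat x \<in> {1..K 1}" using x by (auto simp: nat_le_iff Suc_le_eq)
      from 0(3)[OF this] show ?thesis using x by simp
    qed (use 0(5)[of x] in simp)
  qed
  have Pf0: "Pf [] = (1 :: Rinf)" by (simp add: Pf.simps)
  have g: "good id [] (K 1) (K 1)"
    unfolding good_def C_id len_id Pf0 by (simp add: SA_intros Dg_1)
  have l: "concat (map (\<lambda>i. theta_B (B_tilde K i)) (rev [1..<0 + 1])) = []" by simp
  show ?case unfolding l \<open>w = id\<close> unfolding add_0 by (rule g)
next
  case (Suc i)
  let ?k = "K (i + 1)" and ?d = "K (i + 2) - K (i + 1)"
  let ?xs = "concat (map (\<lambda>i. theta_B (B_tilde K i)) (rev [1..<i + 1]))"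
  have lt: "K (i + 1) < K (i + 2)" using K[of "i + 1"] Suc.prems(1) by (simp add: numeral_2_eq_2)
  have "good w (blk ?k ?d @ ?xs) ?k (?k + ?d)"
  proof (rule block[of ?k "\<lambda>q. w (int q)" ?xs w ?d])
    fix v assume v: "v \<in> W_inf" "\<And>q. q \<in> {1..?k} \<Longrightarrow> v (int q) = w (int q)" "\<And>x. x > int ?k \<Longrightarrow> v x = x"
    show "good v ?xs ?k ?k"
    proof (rule Suc.IH)
      show "v (int q) = int q" if "q \<in> {1..K 1}" for q
        using that v(2)[of q] Suc.prems(3)[of q] K_le[of 1 "i + 1"] Suc.prems(1) by auto
      show "v (int (K i' + j)) = - int (K (i' + 1) + 1 - j)" if ij: "i' \<in> {1..i}" "j \<in> {1..K (i' + 1) - K i'}" for i' j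
      proof -
        have "K (i' + 1) \<le> K (i + 1)" using ij Suc.prems(1) by (intro K_le) auto
        then have "v (int (K i' + j)) = w (int (K i' + j))" using ij by (intro v(2)) auto
        then show ?thesis using Suc.prems(4)[of i' j] ij by simp
      qed
    qed (use Suc.prems(1) v in auto)
  next
    fix j assume j: "j \<in> {1..?d}"
    then show "w (int (?k + j)) = - int (?k + ?d + 1 - j)"
      using Suc.prems(4)[of "i + 1" j] lt by (simp add: numeral_2_eq_2)
  next
    fix x assume "x > int (?k + ?d)"
    then show "w x = x" using Suc.prems(5)[of x] lt by (simp add: numeral_2_eq_2)
  qed (use Suc.prems(2) in auto)
  moreover have "concat (map (\<lambda>i. theta_B (B_tilde K i)) (rev [1..<Suc i + 1])) = blk ?k ?d @ ?xs"
    using B_tilde_blk[of "Suc i"] by (simp add: numeral_2_eq_2)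
  ultimately have g: "good w (concat (map (\<lambda>i. theta_B (B_tilde K i)) (rev [1..<Suc i + 1]))) ?k (?k + ?d)" by simp
  have "SA ?k (?k + ?d) \<subseteq> SA (K (i + 2)) (K (i + 2))"
    using SA_mono[of ?k "K (i + 2)" "?k + ?d" "K (i + 2)"] lt by auto
  then show ?case using g by (auto simp: good_def)
qed

end

section \<open>Divided differences of Pfaffian sums\<close>

lemma st_Pf_slot:
  assumes "\<And>x. x \<in> set xs \<union> set ys \<Longrightarrow> \<exists>\<kappa> l. fst x = theta \<kappa> l \<and> nat \<bar>l\<bar> \<noteq> i"
  shows "st i (Pf (xs @ (c, r) # ys)) = Pf (xs @ (\<lambda>q. st i (c q), r) # ys)"
proof -
  have fix': "(\<lambda>(c, r). (\<lambda>q. st i (c q), r)) x = x" if x: "x \<in> set xs \<union> set ys" for x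
  proof -
    obtain \<kappa> l where l: "fst x = theta \<kappa> l" "nat \<bar>l\<bar> \<noteq> i" using assms[OF x] by blast
    have "st i (theta \<kappa> l q) = theta \<kappa> l q" for q using st_theta[of i l \<kappa> q] l(2) by simp
    then show ?thesis using l(1) by (cases x) auto
  qed
  have "map (\<lambda>(c, r). (\<lambda>q. st i (c q), r)) xs = xs" "map (\<lambda>(c, r). (\<lambda>q. st i (c q), r)) ys = ys"
    using fix' by (auto intro!: map_idI)
  then show ?thesis unfolding Pf_hom[OF rhom_st] by simp
qed

text \<open>The Pfaffian and its image under s_i^t expand in the slot with the same two Pfaffians
  and differ only in the factors u and u'. Their difference is alpha_i, for either sign of the
  level.\<close>

lemma ddt_Pf_single:
  assumes "\<And>x. x \<in> set xs \<union> set ys \<Longrightarrow> \<exists>\<kappa> l. fst x = theta \<kappa> l \<and> nat \<bar>l\<bar> \<noteq> i"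
    and "\<And>q. theta \<kappa> l q = theta \<kappa> l' q + u * theta \<kappa> l' (q - 1)"
    and "\<And>q. st i (theta \<kappa> l q) = theta \<kappa> l' q + u' * theta \<kappa> l' (q - 1)"
    and "alpha i = u - u'"
  shows "ddt i (Pf (xs @ (theta \<kappa> l, r) # ys)) = Pf (xs @ (theta \<kappa> l', r - 1) # ys)"
proof (rule ddt_eqI)
  have n: "theta \<kappa> l' q = 0" if "q < 0" for q using that by (rule theta_neg)
  have 1: "Pf (xs @ (theta \<kappa> l, r) # ys) = Pf (xs @ (theta \<kappa> l', r) # ys) + u * Pf (xs @ (theta \<kappa> l', r - 1) # ys)"
    by (rule Pf_slot, rule assms(2), rule n)
  have 2: "Pf (xs @ (\<lambda>q. st i (theta \<kappa> l q), r) # ys)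
      = Pf (xs @ (theta \<kappa> l', r) # ys) + u' * Pf (xs @ (theta \<kappa> l', r - 1) # ys)"
    by (rule Pf_slot, rule assms(3), rule n)
  have 3: "st i (Pf (xs @ (theta \<kappa> l, r) # ys)) = Pf (xs @ (theta \<kappa> l', r) # ys) + u' * Pf (xs @ (theta \<kappa> l', r - 1) # ys)"
    using st_Pf_slot[OF assms(1), of xs ys "theta \<kappa> l" r] 2 by simp
  show "alpha i * Pf (xs @ (theta \<kappa> l', r - 1) # ys)
      = Pf (xs @ (theta \<kappa> l, r) # ys) - st i (Pf (xs @ (theta \<kappa> l, r) # ys))"
    unfolding 3 unfolding 1 assms(4) by (simp add: algebra_simps)
qed

lemma theta_step_neg:
  shows "theta \<kappa> (- int i) q = theta \<kappa> (- int i - 1) q + tv (i + 1) * theta \<kappa> (- int i - 1) (q - 1)"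
    and "st i (theta \<kappa> (- int i) q) = theta \<kappa> (- int i - 1) q + st i (tv (i + 1)) * theta \<kappa> (- int i - 1) (q - 1)"
  by (rule theta_neg_step)+

lemma theta_step_pos:
  assumes "i \<ge> 1"
  shows "theta \<kappa> (int i) q = theta \<kappa> (int i - 1) q + (- tv i) * theta \<kappa> (int i - 1) (q - 1)"
    and "st i (theta \<kappa> (int i) q) = theta \<kappa> (int i - 1) q + (- tv (i + 1)) * theta \<kappa> (int i - 1) (q - 1)"
  using theta_pos_step[OF assms] by simp_all

text \<open>For two slots of levels \<open>i\<close> and \<open>- i\<close>, the divided difference multiplies the
  generating function by \<open>u + u'\<close>; this creates the new pair of \<open>D\<close>.\<close>

lemma ddt_Pf_double:
  assumes i: "i \<ge> 1"
    and inv: "\<And>x. x \<in> set xs \<union> set ys \<union> set zs \<Longrightarrow> \<exists>\<kappa> l. fst x = theta \<kappa> l \<and> nat \<bar>l\<bar> \<noteq> i"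
  shows "ddt i (Pf (xs @ (theta \<kappa> (int i), r) # ys @ (theta \<kappa> (- int i), r') # zs))
    = Pf (xs @ (theta \<kappa> (int i - 1), r - 1) # ys @ (theta \<kappa> (- int i - 1), r') # zs)
    + Pf (xs @ (theta \<kappa> (int i - 1), r) # ys @ (theta \<kappa> (- int i - 1), r' - 1) # zs)"
proof (rule ddt_eqI)
  let ?A = "theta \<kappa> (int i - 1)" and ?B = "theta \<kappa> (- int i - 1)"
  let ?P = "\<lambda>c r d r'. Pf (xs @ (c, r) # ys @ (d, r') # zs)"
  have nA: "?A q = 0" and nB: "?B q = 0" if "q < 0" for q using that by (auto simp: theta_neg)
  have sA: "?P c r d r' = ?P ?A r d r' + u * ?P ?A (r - 1) d r'"
    if "\<And>q. c q = ?A q + u * ?A (q - 1)" for c u d r r'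
    by (rule Pf_slot, rule that, rule nA)
  have sB: "?P c r d r' = ?P c r ?B r' + u * ?P c r ?B (r' - 1)"
    if "\<And>q. d q = ?B q + u * ?B (q - 1)" for c u d r r'
  proof -
    have "Pf ((xs @ (c, r) # ys) @ (d, r') # zs) = Pf ((xs @ (c, r) # ys) @ (?B, r') # zs)
      + u * Pf ((xs @ (c, r) # ys) @ (?B, r' - 1) # zs)"
      by (rule Pf_slot, rule that, rule nB)
    then show ?thesis by simp
  qed
  have inv': "map (\<lambda>(c, r). (\<lambda>q. st i (c q), r)) l = l" if l: "set l \<subseteq> set xs \<union> set ys \<union> set zs" for l
  proof (rule map_idI)
    fix x assume x: "x \<in> set l"
    then obtain \<kappa> l where l: "fst x = theta \<kappa> l" "nat \<bar>l\<bar> \<noteq> i" using inv[of x] l by blast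
    have "st i (theta \<kappa> l q) = theta \<kappa> l q" for q using st_theta[of i l \<kappa> q] l(2) by simp
    then show "(\<lambda>(c, r). (\<lambda>q. st i (c q), r)) x = x" using l(1) by (cases x) auto
  qed
  have st: "st i (?P (theta \<kappa> (int i)) r (theta \<kappa> (- int i)) r')
      = ?P (\<lambda>q. st i (theta \<kappa> (int i) q)) r (\<lambda>q. st i (theta \<kappa> (- int i) q)) r'"
  proof -
    have m: "map (\<lambda>(c, r). (\<lambda>q. st i (c q), r)) xs = xs" "map (\<lambda>(c, r). (\<lambda>q. st i (c q), r)) ys = ys"
      "map (\<lambda>(c, r). (\<lambda>q. st i (c q), r)) zs = zs"
      by (rule inv', blast)+
    show ?thesis unfolding Pf_hom[OF rhom_st] map_append list.map m by simp
  qed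
  have sti: "st i (tv (i + 1)) = tv i" using i by (simp add: st_t)
  have e1: "?P (theta \<kappa> (int i)) r (theta \<kappa> (- int i)) r' = ?P ?A r ?B r' + tv (i + 1) * ?P ?A r ?B (r' - 1)
      + (- tv i) * (?P ?A (r - 1) ?B r' + tv (i + 1) * ?P ?A (r - 1) ?B (r' - 1))"
    unfolding sA[OF theta_step_pos(1)[OF i], of r "theta \<kappa> (- int i)" r']
    unfolding sB[OF theta_step_neg(1)] ..
  have e2: "?P (\<lambda>q. st i (theta \<kappa> (int i) q)) r (\<lambda>q. st i (theta \<kappa> (- int i) q)) r'
      = ?P ?A r ?B r' + tv i * ?P ?A r ?B (r' - 1)
      + (- tv (i + 1)) * (?P ?A (r - 1) ?B r' + tv i * ?P ?A (r - 1) ?B (r' - 1))"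
    unfolding sA[OF theta_step_pos(2)[OF i], of r "\<lambda>q. st i (theta \<kappa> (- int i) q)" r']
    unfolding sB[OF theta_step_neg(2)] sti ..
  have a: "alpha i = tv (i + 1) - tv i" using i by (simp add: alpha_def)
  \<comment> \<open>In the difference the constant terms cancel, and so does the quadratic term with
    factor -t_i t_(i+1), which is symmetric. Both linear terms have coefficient t_(i+1) -
    t_i.\<close>
  show "alpha i * (?P ?A (r - 1) ?B r' + ?P ?A r ?B (r' - 1))
      = ?P (theta \<kappa> (int i)) r (theta \<kappa> (- int i)) r' - st i (?P (theta \<kappa> (int i)) r (theta \<kappa> (- int i)) r')"
    unfolding st unfolding e1 e2 a by (simp add: algebra_simps)
qed

lemma ddt_add: "ddt i (f + g) = ddt i f + ddt i g"
  by (rule ddt_eqI) (simp add: distrib_left alpha_ddt rhom_add[OF rhom_st])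
lemma ddt_sum: "ddt i (sum F A) = (\<Sum>x\<in>A. ddt i (F x))"
  by (induction A rule: infinite_finite_induct) (auto simp: ddt_0 ddt_add)

definition ent :: "nat \<Rightarrow> nat \<Rightarrow> (nat \<Rightarrow> int) \<Rightarrow> (nat \<Rightarrow> int) \<Rightarrow> ((int \<Rightarrow> Rinf) \<times> int) list" where
  "ent k N r l = map (\<lambda>s. entry (k, r s, l s)) [1..<N + 1]"

lemma upt_split: "a \<in> {1..N} \<Longrightarrow> [1..<N + 1] = [1..<a] @ a # [a + 1..<N + 1]"
  using upt_add_eq_append[of 1 a "N + 1 - a"] upt_conv_Cons[of a "N + 1"] by auto

lemma ent_cong: "(\<And>s. s \<in> {1..N} \<Longrightarrow> r s = r' s \<and> l s = l' s) \<Longrightarrow> ent k N r l = ent k N r' l'"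
  by (auto simp: ent_def)

lemma ent_split:
  assumes "a \<in> {1..N}"
  shows "ent k N r l = map (\<lambda>s. entry (k, r s, l s)) [1..<a] @ (theta k (l a), r a) #
     map (\<lambda>s. entry (k, r s, l s)) [a + 1..<N + 1]"
  unfolding ent_def upt_split[OF assms] by (simp add: entry_def)

lemma ddt_ent_single:
  assumes us: "\<And>x. x \<in> set us \<Longrightarrow> \<exists>\<kappa> l. fst x = theta \<kappa> l \<and> nat \<bar>l\<bar> \<noteq> i"
    and a: "a \<in> {1..N}" and l: "\<And>s. s \<in> {1..N} \<Longrightarrow> s \<noteq> a \<Longrightarrow> nat \<bar>l s\<bar> \<noteq> i"
    and la: "(l a = - int i \<and> la = - int i - 1) \<or> (i \<ge> 1 \<and> l a = int i \<and> la = int i - 1)"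
  shows "ddt i (Pf (us @ ent k N r l)) = Pf (us @ ent k N (r(a := r a - 1)) (l(a := la)))"
proof -
  let ?xs = "map (\<lambda>s. entry (k, r s, l s)) [1..<a]" and ?ys = "map (\<lambda>s. entry (k, r s, l s)) [a + 1..<N + 1]"
  have inv: "\<exists>\<kappa> l. fst x = theta \<kappa> l \<and> nat \<bar>l\<bar> \<noteq> i" if "x \<in> set (us @ ?xs) \<union> set ?ys" for x
  proof -
    have "x \<in> set us \<or> (\<exists>s\<in>{1..N}. s \<noteq> a \<and> x = entry (k, r s, l s))"
    proof -
      have "x \<in> set us \<or> (\<exists>s\<in>{1..<a} \<union> {a + 1..<N + 1}. x = entry (k, r s, l s))"
        using that by (auto simp: image_iff)
      then show ?thesis
      proof
        assume "\<exists>s\<in>{1..<a} \<union> {a + 1..<N + 1}. x = entry (k, r s, l s)"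
        then obtain s where "s \<in> {1..<a} \<union> {a + 1..<N + 1}" "x = entry (k, r s, l s)" by blast
        then show ?thesis using a by (intro disjI2 bexI[of _ s]) auto
      qed blast
    qed
    then consider "x \<in> set us" | s where "s \<in> {1..N}" "s \<noteq> a" "x = entry (k, r s, l s)" by blast
    then show ?thesis
    proof cases
      case 2
      then show ?thesis using l[of s] by (auto simp: entry_def)
    qed (use us in auto)
  qed
  have new: "us @ ent k N (r(a := r a - 1)) (l(a := la)) = (us @ ?xs) @ (theta k la, r a - 1) # ?ys"
    unfolding ent_split[OF a] by (auto simp del: upt_Suc)
  have old: "us @ ent k N r l = (us @ ?xs) @ (theta k (l a), r a) # ?ys"
    by (simp add: ent_split[OF a])
  show ?thesis
  proof (cases "l a = - int i \<and> la = - int i - 1")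
    case True
    then have la': "l a = - int i" "la = - int i - 1" by auto
    show ?thesis unfolding new old unfolding la'
      by (rule ddt_Pf_single[OF _ theta_step_neg alpha_st], rule inv)
  next
    case False
    then have i: "i \<ge> 1" and la': "l a = int i" "la = int i - 1" using la by auto
    have al: "alpha i = - tv i - - tv (i + 1)" using i by (simp add: alpha_def)
    show ?thesis unfolding new old unfolding la'
      by (rule ddt_Pf_single[OF _ theta_step_pos[OF i] al], rule inv)
  qed
qed

lemma ddt_ent_double:
  assumes us: "\<And>x. x \<in> set us \<Longrightarrow> \<exists>\<kappa> l. fst x = theta \<kappa> l \<and> nat \<bar>l\<bar> \<noteq> i"
    and i: "i \<ge> 1" and ab: "a \<in> {1..N}" "b \<in> {1..N}" "a < b"
    and l: "\<And>s. s \<in> {1..N} \<Longrightarrow> s \<noteq> a \<Longrightarrow> s \<noteq> b \<Longrightarrow> nat \<bar>l s\<bar> \<noteq> i"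
    and la: "l a = int i" "l b = - int i"
  shows "ddt i (Pf (us @ ent k N r l)) = Pf (us @ ent k N (r(a := r a - 1)) (l(a := int i - 1, b := - int i - 1)))
    + Pf (us @ ent k N (r(b := r b - 1)) (l(a := int i - 1, b := - int i - 1)))"
proof -
  let ?f = "\<lambda>s. entry (k, r s, l s)"
  let ?xs = "map ?f [1..<a]" and ?ys = "map ?f [a + 1..<b]" and ?zs = "map ?f [b + 1..<N + 1]"
  have up: "[a + 1..<N + 1] = [a + 1..<b] @ b # [b + 1..<N + 1]"
    using upt_add_eq_append[of "a + 1" b "N + 1 - b"] upt_conv_Cons[of b "N + 1"] ab by auto
  have spl: "us @ ent k N r' l' = (us @ map (\<lambda>s. entry (k, r' s, l' s)) [1..<a]) @ (theta k (l' a), r' a) #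
     map (\<lambda>s. entry (k, r' s, l' s)) [a + 1..<b] @ (theta k (l' b), r' b) #
     map (\<lambda>s. entry (k, r' s, l' s)) [b + 1..<N + 1]" for r' l'
    unfolding ent_split[OF ab(1)] up by (simp add: entry_def)
  have inv: "\<exists>\<kappa> l. fst x = theta \<kappa> l \<and> nat \<bar>l\<bar> \<noteq> i" if "x \<in> set (us @ ?xs) \<union> set ?ys \<union> set ?zs" for x
  proof -
    have "x \<in> set us \<or> (\<exists>s\<in>{1..N}. s \<noteq> a \<and> s \<noteq> b \<and> x = entry (k, r s, l s))"
    proof -
      have "x \<in> set us \<or> (\<exists>s\<in>{1..<a} \<union> {a + 1..<b} \<union> {b + 1..<N + 1}. x = entry (k, r s, l s))"
        using that by (auto simp: image_iff)
      then show ?thesis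
      proof
        assume "\<exists>s\<in>{1..<a} \<union> {a + 1..<b} \<union> {b + 1..<N + 1}. x = entry (k, r s, l s)"
        then obtain s where "s \<in> {1..<a} \<union> {a + 1..<b} \<union> {b + 1..<N + 1}" "x = entry (k, r s, l s)" by blast
        then show ?thesis using ab by (intro disjI2 bexI[of _ s]) auto
      qed blast
    qed
    then consider "x \<in> set us" | s where "s \<in> {1..N}" "s \<noteq> a" "s \<noteq> b" "x = entry (k, r s, l s)" by blast
    then show ?thesis
    proof cases
      case 2
      then show ?thesis using l[of s] by (auto simp: entry_def)
    qed (use us in auto)
  qed
  have new1: "us @ ent k N (r(a := r a - 1)) (l(a := int i - 1, b := - int i - 1))
      = (us @ ?xs) @ (theta k (int i - 1), r a - 1) # ?ys @ (theta k (- int i - 1), r b) # ?zs"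
    unfolding spl using ab by auto
  have new2: "us @ ent k N (r(b := r b - 1)) (l(a := int i - 1, b := - int i - 1))
      = (us @ ?xs) @ (theta k (int i - 1), r a) # ?ys @ (theta k (- int i - 1), r b - 1) # ?zs"
    unfolding spl using ab by auto
  have old: "us @ ent k N r l = (us @ ?xs) @ (theta k (int i), r a) # ?ys @ (theta k (- int i), r b) # ?zs"
    unfolding spl la ..
  show ?thesis unfolding new1 new2 old by (rule ddt_Pf_double[OF i inv])
qed

lemma aI_insert:
  assumes "finite I" "(a, b) \<notin> I" "a \<noteq> b"
  shows "aI (insert (a, b) I) s = aI I s + (if s = a then 1 else 0) - (if s = b then 1 else 0)"
proof -
  have fin: "finite {j. (s, j) \<in> I}" "finite {i. (i, s) \<in> I}" for s
    by (rule finite_subset[of _ "snd ` I"], force, simp add: assms(1))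
      (rule finite_subset[of _ "fst ` I"], force, simp add: assms(1))
  have "{j. (s, j) \<in> insert (a, b) I} = (if s = a then insert b {j. (s, j) \<in> I} else {j. (s, j) \<in> I})"
    "{i. (i, s) \<in> insert (a, b) I} = (if s = b then insert a {i. (i, s) \<in> I} else {i. (i, s) \<in> I})" by auto
  then show ?thesis using fin assms(2,3) by (auto simp: aI_def)
qed

text \<open>The base index at a is lowered for all subsets. A subset without the new pair accounts
  for the term lowered at a; adding the pair raises a again and lowers b, which gives the term
  lowered at b.\<close>

lemma ddt_sum_double:
  assumes us: "\<And>x. x \<in> set us \<Longrightarrow> \<exists>\<kappa> l. fst x = theta \<kappa> l \<and> nat \<bar>l\<bar> \<noteq> i"
    and i: "i \<ge> 1" and ab: "a \<in> {1..N}" "b \<in> {1..N}" "a < b"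
    and l: "\<And>s. s \<in> {1..N} \<Longrightarrow> s \<noteq> a \<Longrightarrow> s \<noteq> b \<Longrightarrow> nat \<bar>l s\<bar> \<noteq> i"
    and la: "l a = int i" "l b = - int i"
    and D: "finite D" "(a, b) \<notin> D"
  shows "ddt i (\<Sum>I\<in>Pow D. Pf (us @ ent k N (\<lambda>s. r s + aI I s) l))
    = (\<Sum>I\<in>Pow (insert (a, b) D). Pf (us @ ent k N (\<lambda>s. (r(a := r a - 1)) s + aI I s) (l(a := int i - 1, b := - int i - 1))))"
proof -
  let ?l = "l(a := int i - 1, b := - int i - 1)"
  let ?g = "\<lambda>I. Pf (us @ ent k N (\<lambda>s. (r(a := r a - 1)) s + aI I s) ?l)"
  have 1: "ddt i (Pf (us @ ent k N (\<lambda>s. r s + aI I s) l)) = ?g I + ?g (insert (a, b) I)" if I: "I \<in> Pow D" for I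
  proof -
    have fI: "finite I" "(a, b) \<notin> I" using I D finite_subset by auto
    have "ent k N ((\<lambda>s. r s + aI I s)(a := r a + aI I a - 1)) ?l = ent k N (\<lambda>s. (r(a := r a - 1)) s + aI I s) ?l"
      by (rule ent_cong) auto
    moreover have "ent k N ((\<lambda>s. r s + aI I s)(b := r b + aI I b - 1)) ?l
        = ent k N (\<lambda>s. (r(a := r a - 1)) s + aI (insert (a, b) I) s) ?l"
      by (rule ent_cong) (use aI_insert[OF fI, of] ab in auto)
    ultimately show ?thesis
      using ddt_ent_double[where r = "\<lambda>s. r s + aI I s" and k = k and l = l and us = us, OF us i ab l la] by simp
  qed
  have "ddt i (\<Sum>I\<in>Pow D. Pf (us @ ent k N (\<lambda>s. r s + aI I s) l)) = (\<Sum>I\<in>Pow D. ?g I + ?g (insert (a, b) I))"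
    unfolding ddt_sum by (rule sum.cong[OF refl 1])
  also have "\<dots> = (\<Sum>I\<in>Pow D. ?g I) + (\<Sum>I\<in>insert (a, b) ` Pow D. ?g I)"
  proof -
    have "inj_on (insert (a, b)) (Pow D)" 
    proof (rule inj_onI)
      fix x y assume xy: "x \<in> Pow D" "y \<in> Pow D" "insert (a, b) x = insert (a, b) y"
      then have "(a, b) \<notin> x" "(a, b) \<notin> y" using D(2) by auto
      then show "x = y" using xy(3) by (simp add: insert_ident)
    qed
    then show ?thesis by (simp add: sum.distrib sum.reindex)
  qed
  also have "\<dots> = (\<Sum>I\<in>Pow (insert (a, b) D). ?g I)"
    unfolding Pow_insert by (rule sum.union_disjoint[symmetric]) (use D in auto)
  finally show ?thesis .
qed

lemma ddt_sum_single:
  assumes us: "\<And>x. x \<in> set us \<Longrightarrow> \<exists>\<kappa> l. fst x = theta \<kappa> l \<and> nat \<bar>l\<bar> \<noteq> i"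
    and a: "a \<in> {1..N}" and l: "\<And>s. s \<in> {1..N} \<Longrightarrow> s \<noteq> a \<Longrightarrow> nat \<bar>l s\<bar> \<noteq> i"
    and la: "(l a = - int i \<and> la = - int i - 1) \<or> (i \<ge> 1 \<and> l a = int i \<and> la = int i - 1)"
  shows "ddt i (\<Sum>I\<in>S. Pf (us @ ent k N (\<lambda>s. r s + aI I s) l))
    = (\<Sum>I\<in>S. Pf (us @ ent k N (\<lambda>s. (r(a := r a - 1)) s + aI I s) (l(a := la))))"
  unfolding ddt_sum
proof (rule sum.cong[OF refl])
  fix I
  have "ent k N ((\<lambda>s. r s + aI I s)(a := r a + aI I a - 1)) (l(a := la))
      = ent k N (\<lambda>s. (r(a := r a - 1)) s + aI I s) (l(a := la))"
    by (rule ent_cong) auto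
  then show "ddt i (Pf (us @ ent k N (\<lambda>s. r s + aI I s) l))
     = Pf (us @ ent k N (\<lambda>s. (r(a := r a - 1)) s + aI I s) (l(a := la)))"
    using ddt_ent_single[where r = "\<lambda>s. r s + aI I s" and k = k and l = l and us = us, OF us a l la] by simp
qed

section \<open>Pseudo-Grassmannian elements\<close>

lemma DD_iff: "(x, y) \<in> DD a b w \<longleftrightarrow> 1 \<le> x \<and> x < y \<and> y \<le> b - a \<and> chi a b w x + chi a b w y < 0"
  by (simp add: DD_def)

lemma finite_DD: "finite (DD a b w)"
  by (rule finite_subset[of _ "{1..b - a} \<times> {1..b - a}"]) (auto simp: DD_def)

context flag
begin

abbreviation "k \<equiv> K 1"
abbreviation "m \<equiv> K 2"
abbreviation "N \<equiv> K 2 - K 1"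

definition tail :: "((int \<Rightarrow> Rinf) \<times> int) list" where
  "tail = concat (map (\<lambda>i. theta_B (B_tilde K i)) (rev [2..<p + 1]))"

text \<open>The letterwise conditions that the steps below preserve; they involve no
  lengths.\<close>

definition cls :: "(int \<Rightarrow> int) \<Rightarrow> bool" where
  "cls w \<longleftrightarrow> w \<in> W_inf \<and> (\<forall>x > int (K (p + 1)). w x = x) \<and>
     (\<forall>i\<in>{2..p}. \<forall>j\<in>{1..K (i + 1) - K i}. w (int (K i + j)) = - int (K (i + 1) + 1 - j)) \<and>
     (\<forall>q\<in>{1..k}. 0 < w (int q)) \<and> (\<forall>q. 1 \<le> q \<and> q < k \<longrightarrow> w (int q) < w (int q + 1)) \<and>
     (\<forall>s. 1 \<le> s \<and> s < N \<longrightarrow> w (int (k + s)) < w (int (k + s) + 1))"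

lemma km: "k < m"
  using K[of 1] p by (simp add: numeral_2_eq_2)

lemma block_pos: "P \<le> p \<Longrightarrow> m < x \<Longrightarrow> x \<le> K (P + 1) \<Longrightarrow> \<exists>i\<in>{2..p}. \<exists>j\<in>{1..K (i + 1) - K i}. x = K i + j"
proof (induction P)
  case 0
  then show ?case using km by simp
next
  case (Suc P)
  show ?case
  proof (cases "x \<le> K (P + 1)")
    case True
    then show ?thesis using Suc by simp
  next
    case False
    have "P + 1 \<noteq> 1"
    proof
      assume "P + 1 = 1"
      then have "K (Suc P + 1) = m" by (simp add: numeral_2_eq_2)
      then show False using Suc.prems by simp
    qed
    then show ?thesis using False Suc.prems
      by (intro bexI[of _ "P + 1"] bexI[of _ "x - K (P + 1)"]) auto
  qed
qed

lemma clsD: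
  assumes "cls w"
  shows "w \<in> W_inf" "\<And>x. x > int (K (p + 1)) \<Longrightarrow> w x = x"
    "\<And>i j. i \<in> {2..p} \<Longrightarrow> j \<in> {1..K (i + 1) - K i} \<Longrightarrow> w (int (K i + j)) = - int (K (i + 1) + 1 - j)"
    "\<And>q. q \<in> {1..k} \<Longrightarrow> 0 < w (int q)" "\<And>q. 1 \<le> q \<Longrightarrow> q < k \<Longrightarrow> w (int q) < w (int q + 1)"
    "\<And>s. 1 \<le> s \<Longrightarrow> s < N \<Longrightarrow> w (int (k + s)) < w (int (k + s) + 1)"
  using assms by (auto simp: cls_def)

lemma abs_inj: "w \<in> W_inf \<Longrightarrow> \<bar>w x\<bar> = \<bar>w y\<bar> \<Longrightarrow> x > 0 \<Longrightarrow> y > 0 \<Longrightarrow> x = y"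
proof -
  assume w: "w \<in> W_inf" and e: "\<bar>w x\<bar> = \<bar>w y\<bar>" and xy: "x > 0" "y > 0"
  then have "w x = w y \<or> w x = w (- y)" using W_inf_minus[OF w, of y] by (auto simp: abs_eq_iff)
  then show "x = y" using W_inf_inj[OF w] xy by auto
qed

text \<open>The barred blocks and the fixed points beyond them occupy all absolute values above m,
  so the first m letters form a signed permutation of 1, ..., m.\<close>

lemma large_pos:
  assumes w: "cls w" and x: "x > m"
  shows "\<bar>w (int x)\<bar> > int m"
proof (cases "x \<le> K (p + 1)")
  case True
  from block_pos[OF order_refl x True] obtain i j where ij: "i \<in> {2..p}" "j \<in> {1..K (i + 1) - K i}" "x = K i + j" by blast
  have "m \<le> K i" using ij by (intro K_le) auto
  then show ?thesis using clsD(3)[OF w ij(1,2)] ij(2,3) by auto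
next
  case False
  then show ?thesis using clsD(2)[OF w, of "int x"] x by simp
qed

lemma small_pos:
  assumes w: "cls w" and q: "q \<in> {1..m}"
  shows "1 \<le> \<bar>w (int q)\<bar>" "\<bar>w (int q)\<bar> \<le> int m"
proof -
  note ww = clsD(1)[OF w]
  show "1 \<le> \<bar>w (int q)\<bar>" using W_inf_eq_0[OF ww, of "int q"] q by simp
  show "\<bar>w (int q)\<bar> \<le> int m"
  proof (rule ccontr)
    assume *: "\<not> \<bar>w (int q)\<bar> \<le> int m"
    define c where "c = nat \<bar>w (int q)\<bar>"
    have c: "c > m" "int c = \<bar>w (int q)\<bar>" using * by (auto simp: c_def)
    have "\<exists>y. y > m \<and> \<bar>w (int y)\<bar> = int c"
    proof (cases "c \<le> K (p + 1)")
      case True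
      from block_pos[OF order_refl c(1) True] obtain i j where ij: "i \<in> {2..p}" "j \<in> {1..K (i + 1) - K i}" "c = K i + j" by blast
      have "m \<le> K i" using ij by (intro K_le) auto
      \<comment> \<open>The letters of a block run backwards, so -c stands at the mirror image of c
        in its block.\<close>
      define y where "y = K i + (K (i + 1) - K i + 1 - j)"
      have "w (int y) = - int c"
      proof -
        have "K (i + 1) - K i + 1 - j \<in> {1..K (i + 1) - K i}" "K (i + 1) + 1 - (K (i + 1) - K i + 1 - j) = c"
          using ij(2,3) by auto
        then show ?thesis using clsD(3)[OF w ij(1), of "K (i + 1) - K i + 1 - j"] unfolding y_def by metis
      qed
      moreover have "y > m" using \<open>m \<le> K i\<close> ij(2) by (auto simp: y_def)
      ultimately show ?thesis by (intro exI[of _ y]) simp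
    next
      case False
      then show ?thesis using clsD(2)[OF w, of "int c"] c by (intro exI[of _ c]) auto
    qed
    then obtain y where y: "y > m" "\<bar>w (int y)\<bar> = \<bar>w (int q)\<bar>" using c by auto
    have "int y = int q" by (rule abs_inj[OF ww y(2)]) (use y(1) q in simp_all)
    then show False using y q by simp
  qed
qed

lemma onto:
  assumes w: "cls w" and c: "1 \<le> c" "c \<le> int m"
  obtains q where "q \<in> {1..m}" "\<bar>w (int q)\<bar> = c"
proof -
  note ww = clsD(1)[OF w]
  have "w (inv w c) = c" using W_inf_bij[OF ww] by (simp add: bij_is_surj surj_f_inv_f)
  then have q: "\<bar>w (\<bar>inv w c\<bar>)\<bar> = c" using W_inf_minus[OF ww, of "inv w c"] c by (cases "inv w c \<ge> 0") auto
  define x where "x = nat \<bar>inv w c\<bar>"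
  have x: "\<bar>w (int x)\<bar> = c" using q by (simp add: x_def)
  have "x \<noteq> 0" using x c W_inf_0[OF ww] by (intro notI) simp
  moreover have "x \<le> m" using large_pos[OF w, of x] x c by (cases "x \<le> m") auto
  ultimately show ?thesis using that[of x] x by simp
qed

lemma letters_mono:
  assumes w: "cls w"
  shows "1 \<le> s \<Longrightarrow> s < s' \<Longrightarrow> s' \<le> N \<Longrightarrow> w (int (k + s)) < w (int (k + s'))"
proof (induction s')
  case (Suc s')
  have "w (int (k + s')) < w (int (k + Suc s'))" if "1 \<le> s'"
    using clsD(6)[OF w, of s'] that Suc.prems by (simp add: add.commute add.left_commute)
  then show ?case using Suc by (cases "s = s'") auto
qed simp

lemma v_mono:
  assumes w: "cls w"
  shows "1 \<le> q \<Longrightarrow> q < q' \<Longrightarrow> q' \<le> k \<Longrightarrow> w (int q) < w (int q')"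
proof (induction q')
  case (Suc q')
  have "w (int q') < w (int (Suc q'))" if "1 \<le> q'"
    using clsD(5)[OF w, of q'] that Suc.prems by (simp add: add.commute)
  then show ?case using Suc by (cases "q = q'") auto
qed simp

text \<open>Since these letters increase, the negative ones fill an initial segment; hence \<chi>
  and \<lambda> can be read off from the sign of a single letter.\<close>

lemma num_neg_iff:
  assumes w: "cls w" and s: "s \<in> {1..N}"
  shows "s \<le> num_neg k m w \<longleftrightarrow> w (int (k + s)) < 0"
proof -
  let ?S = "{i \<in> {k + 1..m}. w (int i) < 0}"
  show ?thesis
  proof (cases "w (int (k + s)) < 0")
    case True
    have "{k + 1..k + s} \<subseteq> ?S"
    proof
      fix i assume i: "i \<in> {k + 1..k + s}"
      have "w (int i) \<le> w (int (k + s))"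
      proof (cases "i = k + s")
        case False
        then have "1 \<le> i - k" "i - k < s" "k + (i - k) = i" using i by auto
        then show ?thesis using letters_mono[OF w, of "i - k" s] s by auto
      qed simp
      then show "i \<in> ?S" using i s True by auto
    qed
    then have "card {k + 1..k + s} \<le> card ?S" by (intro card_mono) auto
    then show ?thesis using True by (simp add: num_neg_def)
  next
    case False
    have "?S \<subseteq> {k + 1..<k + s}"
    proof
      fix i assume i: "i \<in> ?S"
      have "i < k + s"
      proof (rule ccontr)
        assume "\<not> i < k + s"
        then have "w (int (k + s)) \<le> w (int i)"
        proof (cases "i = k + s")
          case False
          then have "s < i - k" "i - k \<le> N" "k + (i - k) = i" using i s \<open>\<not> i < k + s\<close> by auto
          then show ?thesis using letters_mono[OF w, of s "i - k"] s by auto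
        qed simp
        then show False using i False by auto
      qed
      then show "i \<in> {k + 1..<k + s}" using i by auto
    qed
    then have "card ?S \<le> card {k + 1..<k + s}" by (intro card_mono) auto
    then have "num_neg k m w \<le> s - 1" by (simp add: num_neg_def)
    moreover have "1 \<le> s" using s by simp
    ultimately have "\<not> s \<le> num_neg k m w" by linarith
    then show ?thesis using False by blast
  qed
qed

lemma chi_eq:
  assumes w: "cls w" and s: "s \<in> {1..N}"
  shows "chi k m w s = (if w (int (k + s)) < 0 then - w (int (k + s)) - 1 else - w (int (k + s)))"
  using num_neg_iff[OF w s] by (auto simp: chi_def zeta_def uu_def)

lemma lam_eq:
  assumes w: "cls w" and s: "s \<in> {1..N}"
  shows "lam k m w s = (if w (int (k + s)) < 0 then - w (int (k + s)) + int k
      else int (card {q \<in> {1..k}. w (int q) > w (int (k + s))}))"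
  using num_neg_iff[OF w s] by (auto simp: lam_def zeta_def uu_def)

definition FF :: "(int \<Rightarrow> int) \<Rightarrow> Rinf" where
  "FF w = (\<Sum>I\<in>Pow (DD k m w). Pf (tail @ ent k N (\<lambda>s. lam k m w s + aI I s) (chi k m w)))"

text \<open>Entries of level at least m are fixed by s_i^t for i < m, so the steps below act on the
  first block only.\<close>

lemma tail_theta: "x \<in> set tail \<Longrightarrow> \<exists>\<kappa> l r. x = (theta \<kappa> l, r) \<and> l \<ge> int m"
proof -
  assume "x \<in> set tail"
  then obtain i where i: "2 \<le> i" "i \<le> p" "x \<in> set (blk (K i) (K (i + 1) - K i))"
    by (auto simp: tail_def B_tilde_blk simp del: One_nat_def)
  have "m \<le> K i" using i by (intro K_le) auto
  then show ?thesis using blk_theta[OF i(3)] by fastforce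
qed

lemma tail_inv: "i < m \<Longrightarrow> x \<in> set tail \<Longrightarrow> \<exists>\<kappa> l. fst x = theta \<kappa> l \<and> nat \<bar>l\<bar> \<noteq> i"
  using tail_theta[of x] by fastforce

lemma FF_eqI:
  assumes "DD k m w = D" "\<And>s. s \<in> {1..N} \<Longrightarrow> lam k m w s = r s \<and> chi k m w s = l s"
  shows "(\<Sum>I\<in>Pow D. Pf (tail @ ent k N (\<lambda>s. r s + aI I s) l)) = FF w"
  unfolding FF_def assms(1)
proof (rule sum.cong[OF refl])
  fix I
  have "ent k N (\<lambda>s. r s + aI I s) l = ent k N (\<lambda>s. lam k m w s + aI I s) (chi k m w)"
    by (rule ent_cong) (use assms(2) in auto)
  then show "Pf (tail @ ent k N (\<lambda>s. r s + aI I s) l) = Pf (tail @ ent k N (\<lambda>s. lam k m w s + aI I s) (chi k m w))"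
    by simp
qed

text \<open>Lowering \<chi>_a by one makes \<chi>_a + \<chi>_s negative only if this sum was 0, so
  that |\<chi>_s| = i. No other slot has this absolute value, and D(\<lambda>) stays the
  same.\<close>

lemma step_single:
  assumes i: "i < m" and a: "a \<in> {1..N}"
    and chi: "\<And>s. s \<in> {1..N} \<Longrightarrow> s \<noteq> a \<Longrightarrow> chi k m w s = chi k m w' s \<and> nat \<bar>chi k m w' s\<bar> \<noteq> i"
    and lam: "\<And>s. s \<in> {1..N} \<Longrightarrow> s \<noteq> a \<Longrightarrow> lam k m w s = lam k m w' s"
    and a1: "lam k m w a = lam k m w' a - 1"
    and a2: "(chi k m w' a = - int i \<and> chi k m w a = - int i - 1) \<or> (i \<ge> 1 \<and> chi k m w' a = int i \<and> chi k m w a = int i - 1)"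
  shows "ddt i (FF w') = FF w"
proof -
  have eq: "chi k m w' x + chi k m w' y < 0 \<longleftrightarrow> chi k m w x + chi k m w y < 0"
    if "x \<in> {1..N}" "y \<in> {1..N}" "x \<noteq> y" for x y
    using chi[of x] chi[of y] a2 that by (cases "x = a"; cases "y = a") auto
  have D: "DD k m w = DD k m w'"
  proof (rule set_eqI)
    fix z :: "nat \<times> nat" obtain x y where z: "z = (x, y)" by (cases z)
    show "z \<in> DD k m w \<longleftrightarrow> z \<in> DD k m w'"
    proof (cases "1 \<le> x \<and> x < y \<and> y \<le> N")
      case True
      then have "chi k m w' x + chi k m w' y < 0 \<longleftrightarrow> chi k m w x + chi k m w y < 0"
        by (intro eq) auto
      then show ?thesis by (simp add: DD_iff z)
    next
      case False
      then show ?thesis unfolding z DD_iff by auto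
    qed
  qed
  have "ddt i (FF w') = (\<Sum>I\<in>Pow (DD k m w'). Pf (tail @ ent k N
      (\<lambda>s. ((lam k m w')(a := lam k m w' a - 1)) s + aI I s) ((chi k m w')(a := chi k m w a))))"
    unfolding FF_def
    by (rule ddt_sum_single[where us = tail and k = k and N = N and r = "lam k m w'" and l = "chi k m w'"
        and la = "chi k m w a" and S = "Pow (DD k m w')", OF _ a _ a2])
      (rule tail_inv[OF i], assumption, rule conjunct2[OF chi])
  also have "\<dots> = FF w"
    by (rule FF_eqI[OF D]) (use chi lam a1 in auto)
  finally show ?thesis .
qed

text \<open>The sum \<chi>_a + \<chi>_b drops from 0 to -2, so the pair (a, b) enters D(\<lambda>).
  All other sums keep their sign, as no third slot has absolute value i.\<close>

lemma step_double:
  assumes i: "1 \<le> i" "i < m" and ab: "a \<in> {1..N}" "b \<in> {1..N}" "a < b"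
    and chi: "\<And>s. s \<in> {1..N} \<Longrightarrow> s \<noteq> a \<Longrightarrow> s \<noteq> b \<Longrightarrow> chi k m w s = chi k m w' s \<and> nat \<bar>chi k m w' s\<bar> \<noteq> i"
    and lam: "\<And>s. s \<in> {1..N} \<Longrightarrow> s \<noteq> a \<Longrightarrow> lam k m w s = lam k m w' s"
    and a1: "lam k m w a = lam k m w' a - 1"
    and a2: "chi k m w' a = int i" "chi k m w a = int i - 1" "chi k m w' b = - int i" "chi k m w b = - int i - 1"
  shows "ddt i (FF w') = FF w"
proof -
  have eq: "chi k m w' x + chi k m w' y < 0 \<longleftrightarrow> chi k m w x + chi k m w y < 0"
    if "x \<in> {1..N}" "y \<in> {1..N}" "x < y" "(x, y) \<noteq> (a, b)" for x y
    using chi[of x] chi[of y] a2 that ab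
    by (cases "x = a"; cases "y = a"; cases "x = b"; cases "y = b") auto
  have ab': "chi k m w a + chi k m w b < 0" "\<not> chi k m w' a + chi k m w' b < 0" using a2 by auto
  have D: "DD k m w = insert (a, b) (DD k m w')"
  proof (rule set_eqI)
    fix z :: "nat \<times> nat" obtain x y where z: "z = (x, y)" by (cases z)
    show "z \<in> DD k m w \<longleftrightarrow> z \<in> insert (a, b) (DD k m w')"
    proof (cases "z = (a, b)")
      case True
      then show ?thesis using ab' ab by (simp add: DD_iff)
    next
      case False
      show ?thesis
      proof (cases "1 \<le> x \<and> x < y \<and> y \<le> N")
        case True
        then have "chi k m w' x + chi k m w' y < 0 \<longleftrightarrow> chi k m w x + chi k m w y < 0"
          using False z by (intro eq) auto
        then show ?thesis using False True by (auto simp: DD_iff z)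
      next
        case out: False
        then show ?thesis using False unfolding z insert_iff DD_iff by blast
      qed
    qed
  qed
  have nD: "(a, b) \<notin> DD k m w'" using ab' by (simp add: DD_iff)
  have "ddt i (FF w') = (\<Sum>I\<in>Pow (insert (a, b) (DD k m w')). Pf (tail @ ent k N
      (\<lambda>s. ((lam k m w')(a := lam k m w' a - 1)) s + aI I s) ((chi k m w')(a := int i - 1, b := - int i - 1))))"
    unfolding FF_def
    by (rule ddt_sum_double[OF _ i(1) ab _ a2(1,3) finite_DD nD], rule tail_inv[OF i(2)], assumption, rule conjunct2[OF chi])
  also have "\<dots> = FF w"
    by (rule FF_eqI[OF D]) (use chi lam a1 a2 ab in auto)
  finally show ?thesis .
qed

lemma cls_gen:
  assumes w: "cls w" and i: "i < m" and w': "w' = gen i \<circ> w"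
    and v: "\<And>q. q \<in> {1..k} \<Longrightarrow> 0 < w' (int q)" "\<And>q. 1 \<le> q \<Longrightarrow> q < k \<Longrightarrow> w' (int q) < w' (int q + 1)"
    and u: "\<And>s. 1 \<le> s \<Longrightarrow> s < N \<Longrightarrow> w' (int (k + s)) < w' (int (k + s) + 1)"
  shows "cls w'"
proof -
  have fix': "gen i x = x" if "\<bar>x\<bar> > int m" for x
    using that i by (cases "i = 0") (auto simp: gen_0 gen_pos)
  have "w' x = x" if x: "x > int (K (p + 1))" for x
  proof -
    have "m \<le> K (p + 1)" using p by (intro K_le) auto
    then show ?thesis using clsD(2)[OF w x] x fix'[of x] by (simp add: w')
  qed
  moreover have "w' (int (K i + j)) = - int (K (i + 1) + 1 - j)"
    if ij: "i \<in> {2..p}" "j \<in> {1..K (i + 1) - K i}" for i j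
  proof -
    have "m \<le> K i" using ij by (intro K_le) auto
    then have "\<bar>w (int (K i + j))\<bar> > int m" using ij by (intro large_pos[OF w]) auto
    then show ?thesis using clsD(3)[OF w ij] fix' by (simp add: w' del: of_nat_add)
  qed
  moreover have "w' \<in> W_inf" unfolding w' by (rule W_inf_comp[OF W_inf_gen clsD(1)[OF w]])
  ultimately show ?thesis using v u by (simp add: cls_def)
qed

lemma C_step:
  assumes w: "cls w" and w': "w' = gen i \<circ> w" "desc (inv w') i" "cls w'" and F: "ddt i (FF w') = FF w" "C w' = FF w'"
  shows "C w = FF w"
proof -
  have "gen i \<circ> w' = w" unfolding w'(1) by (rule ext) simp
  then have "ddt i (C w') = C w" using ddt_C[OF clsD(1)[OF w'(3)], of i] w'(2) by simp
  then show ?thesis using F by simp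
qed

text \<open>The induction moves to smaller letters in the positions k + 1, ..., m. Adding m keeps
  the summands nonnegative, so that \<open>nat\<close> loses nothing.\<close>

definition mu :: "(int \<Rightarrow> int) \<Rightarrow> nat" where
  "mu w = (\<Sum>s\<in>{1..N}. nat (w (int (k + s)) + int m))"

lemma mu_less:
  assumes "cls w'" "\<And>s. s \<in> {1..N} \<Longrightarrow> w' (int (k + s)) \<le> w (int (k + s))"
    "a \<in> {1..N}" "w' (int (k + a)) < w (int (k + a))"
  shows "mu w' < mu w"
  unfolding mu_def
proof (rule sum_strict_mono_ex1)
  have "\<bar>w' (int (k + a))\<bar> \<le> int m" by (rule small_pos(2)[OF assms(1)]) (use assms(3) in auto)
  then have "- int m \<le> w' (int (k + a))" by linarith
  then show "\<exists>x\<in>{1..N}. nat (w' (int (k + x)) + int m) < nat (w (int (k + x)) + int m)"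
    using assms(3,4) by (intro bexI[of _ a]) auto
  show "\<forall>s\<in>{1..N}. nat (w' (int (k + s)) + int m) \<le> nat (w (int (k + s)) + int m)"
    using assms(2) by (intro ballI nat_mono add_right_mono)
qed simp

end

lemma gen_other: "\<bar>x\<bar> \<noteq> int i \<Longrightarrow> \<bar>x\<bar> \<noteq> int i + 1 \<Longrightarrow> gen i x = x"
  by (cases "i = 0") (auto simp: gen_0 gen_pos)

lemma gen_at: "i \<ge> 1 \<Longrightarrow> gen i (int i) = int i + 1" "i \<ge> 1 \<Longrightarrow> gen i (int i + 1) = int i"
  "i \<ge> 1 \<Longrightarrow> gen i (- int i) = - (int i + 1)"
  by (auto simp: gen_pos)

context flag
begin

lemma descI:
  assumes "w' \<in> W_inf" "i \<ge> 1" "w' x = int i" "w' y = int i + 1" "y < x"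
  shows "desc (inv w') i"
  using inv_W_eq[OF assms(1,3)] inv_W_eq[OF assms(1,4)] assms(2,5) by (simp add: desc_def)

lemma tail_pos: "s \<in> {1..N} \<Longrightarrow> k + s \<in> {1..m}"
  using km by auto

lemma letter_distinct: "cls w \<Longrightarrow> q \<in> {1..m} \<Longrightarrow> q' \<in> {1..m} \<Longrightarrow> \<bar>w (int q)\<bar> = \<bar>w (int q')\<bar> \<Longrightarrow> q = q'"
  using abs_inj[OF clsD(1), of w "int q" "int q'"] by auto

lemma next_ne:
  assumes "cls w" "s \<in> {1..N}" "q \<in> {1..k}"
  shows "\<bar>w (int (k + s))\<bar> \<noteq> \<bar>w (int q)\<bar>"
proof
  assume "\<bar>w (int (k + s))\<bar> = \<bar>w (int q)\<bar>"
  then have "k + s = q" by (rule letter_distinct[OF assms(1), rotated 2]) (use assms km in auto)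
  then show False using assms by auto
qed

text \<open>Barring the letter 1 changes \<chi>_b from -1 to 0 and \<lambda>_b from k to k + 1, as
  all of the first k letters exceed 1.\<close>

lemma step_0:
  assumes w: "cls w" and b: "b \<in> {1..N}" "w (int (k + b)) = 1"
    and IH: "\<And>w'. cls w' \<Longrightarrow> mu w' < mu w \<Longrightarrow> C w' = FF w'"
  shows "C w = FF w"
proof -
  define w' where "w' = gen 0 \<circ> w"
  have kb: "k + b \<in> {1..m}" using b by auto
  have ne: "\<bar>w (int q)\<bar> \<noteq> 1" if "q \<in> {1..m}" "q \<noteq> k + b" for q
    using letter_distinct[OF w that(1) kb] b(2) that(2) by auto
  have same: "w' (int q) = w (int q)" if "q \<in> {1..m}" "q \<noteq> k + b" for q
    using ne[OF that] small_pos(1)[OF w that(1)] unfolding w'_def comp_apply by (intro gen_other) auto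
  have sameT: "w' (int (k + s)) = w (int (k + s))" if "s \<in> {1..N}" "s \<noteq> b" for s
    by (rule same) (use that in auto)
  have neT: "\<bar>w (int (k + s))\<bar> \<noteq> 1" "\<bar>w (int (k + s))\<bar> \<ge> 1" if "s \<in> {1..N}" "s \<noteq> b" for s
    using ne[OF tail_pos[OF that(1)]] small_pos(1)[OF w tail_pos[OF that(1)]] that km by auto
  have at: "w' (int (k + b)) = - 1" unfolding w'_def comp_apply b(2) by (simp add: gen_0)
  have sameV: "w' (int q) = w (int q)" if "q \<in> {1..k}" for q
    by (rule same) (use that b km in auto)
  have w': "cls w'"
  proof (rule cls_gen[OF w _ w'_def])
    show "0 < m" using km by simp
    show "0 < w' (int q)" if "q \<in> {1..k}" for q using sameV[OF that] clsD(4)[OF w that] by simp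
    show "w' (int q) < w' (int q + 1)" if "1 \<le> q" "q < k" for q
      using sameV[of q] sameV[of "q + 1"] clsD(5)[OF w that] that by (simp add: add.commute)
    show "w' (int (k + s)) < w' (int (k + s) + 1)" if s: "1 \<le> s" "s < N" for s
    proof -
      obtain t where t: "t = s + 1" by simp
      have e: "int (k + s) + 1 = int (k + t)" by (simp add: t)
      have lt: "w (int (k + s)) < w (int (k + t))" using clsD(6)[OF w s] unfolding e .
      have r: "s \<in> {1..N}" "t \<in> {1..N}" "s \<noteq> t" using s by (auto simp: t)
      show ?thesis unfolding e
        using lt r at b(2) sameT[OF r(1)] sameT[OF r(2)] neT[OF r(1)]
        by (cases "s = b"; cases "t = b") auto
    qed
  qed
  have "desc (inv w') 0"
  proof -
    have "w' (- int (k + b)) = 1" using W_inf_minus[OF clsD(1)[OF w'], of "int (k + b)"] at by simp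
    then have "inv w' 1 = - int (k + b)" by (rule inv_W_eq[OF clsD(1)[OF w']])
    then show ?thesis using b by (simp add: desc_def)
  qed
  moreover have "C w' = FF w'"
  proof (rule IH[OF w'], rule mu_less[OF w' _ b(1)])
    show "w' (int (k + s)) \<le> w (int (k + s))" if "s \<in> {1..N}" for s
      using sameT[OF that] at b(2) by (cases "s = b") auto
  qed (unfold at b(2), simp)
  moreover have "ddt 0 (FF w') = FF w"
  proof (rule step_single[OF _ b(1)])
    fix s assume s: "s \<in> {1..N}" "s \<noteq> b"
    show "chi k m w s = chi k m w' s \<and> nat \<bar>chi k m w' s\<bar> \<noteq> 0"
      unfolding chi_eq[OF w s(1)] chi_eq[OF w' s(1)] sameT[OF s] using neT[OF s] by auto
    show "lam k m w s = lam k m w' s"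
    proof -
      have "{q \<in> {1..k}. w (int q) > w (int (k + s))} = {q \<in> {1..k}. w' (int q) > w (int (k + s))}"
        using sameV by auto
      then show ?thesis unfolding lam_eq[OF w s(1)] lam_eq[OF w' s(1)] sameT[OF s] by simp
    qed
  next
    have "{q \<in> {1..k}. w (int q) > 1} = {1..k}"
    proof -
      have "w (int q) > 1" if q: "q \<in> {1..k}" for q
        using clsD(4)[OF w q] ne[of q] q b km by auto
      then show ?thesis by auto
    qed
    then show "lam k m w b = lam k m w' b - 1"
      unfolding lam_eq[OF w b(1)] lam_eq[OF w' b(1)] at b(2) by simp
    show "chi k m w' b = - int 0 \<and> chi k m w b = - int 0 - 1 \<or>
       1 \<le> (0::nat) \<and> chi k m w' b = int 0 \<and> chi k m w b = int 0 - 1"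
      unfolding chi_eq[OF w b(1)] chi_eq[OF w' b(1)] at b(2) by simp
  qed (use km in simp)
  ultimately show ?thesis by (intro C_step[OF w w'_def _ w'])
qed

text \<open>Exchanging i and i + 1 between the first k letters and slot b adds one to the count
  \<lambda>_b and changes \<chi>_b from -i - 1 to -i.\<close>

lemma step_v_u:
  assumes w: "cls w" and i: "i \<ge> 1" and q: "q \<in> {1..k}" "w (int q) = int i"
    and b: "b \<in> {1..N}" "w (int (k + b)) = int i + 1"
    and neg: "\<And>s. s \<in> {1..N} \<Longrightarrow> s < b \<Longrightarrow> w (int (k + s)) < 0"
    and IH: "\<And>w'. cls w' \<Longrightarrow> mu w' < mu w \<Longrightarrow> C w' = FF w'"
  shows "C w = FF w"
proof -
  define w' where "w' = gen i \<circ> w"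
  have kb: "k + b \<in> {1..m}" and qm: "q \<in> {1..m}" using b q km by auto
  have im: "i < m" using small_pos(2)[OF w kb] b(2) by simp
  have ne: "\<bar>w (int x)\<bar> \<noteq> int i \<and> \<bar>w (int x)\<bar> \<noteq> int i + 1" if "x \<in> {1..m}" "x \<noteq> k + b" "x \<noteq> q" for x
    using letter_distinct[OF w that(1) kb] letter_distinct[OF w that(1) qm] b(2) q(2) that(2,3) by auto
  have same: "w' (int x) = w (int x)" if "x \<in> {1..m}" "x \<noteq> k + b" "x \<noteq> q" for x
    using ne[OF that] unfolding w'_def comp_apply by (intro gen_other) auto
  have sameT: "w' (int (k + s)) = w (int (k + s))" and neT: "\<bar>w (int (k + s))\<bar> \<noteq> int i" "\<bar>w (int (k + s))\<bar> \<noteq> int i + 1"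
    if "s \<in> {1..N}" "s \<noteq> b" for s
    using same[OF tail_pos[OF that(1)]] ne[OF tail_pos[OF that(1)]] that q km by auto
  have sameV: "w' (int x) = w (int x)" and neV: "w (int x) \<noteq> int i" "w (int x) \<noteq> int i + 1" if "x \<in> {1..k}" "x \<noteq> q" for x
    using same[of x] ne[of x] that b km by auto
  have atb: "w' (int (k + b)) = int i" unfolding w'_def comp_apply b(2) by (rule gen_at[OF i])
  have atq: "w' (int q) = int i + 1" unfolding w'_def comp_apply q(2) by (rule gen_at[OF i])
  have w': "cls w'"
  proof (rule cls_gen[OF w im w'_def])
    show "0 < w' (int x)" if "x \<in> {1..k}" for x
      using sameV[OF that] clsD(4)[OF w that] atq by (cases "x = q") auto
    show "w' (int x) < w' (int x + 1)" if x: "1 \<le> x" "x < k" for x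
    proof -
      have e: "int x + 1 = int (x + 1)" by simp
      have lt: "w (int x) < w (int (x + 1))" using clsD(5)[OF w x] unfolding e .
      show ?thesis unfolding e
        using lt x atq q(2) sameV[of x] sameV[of "x + 1"] neV[of "x + 1"]
        by (cases "x = q"; cases "x + 1 = q") auto
    qed
    show "w' (int (k + s)) < w' (int (k + s) + 1)" if s: "1 \<le> s" "s < N" for s
    proof -
      obtain t where t: "t = s + 1" by simp
      have e: "int (k + s) + 1 = int (k + t)" by (simp add: t)
      have lt: "w (int (k + s)) < w (int (k + t))" using clsD(6)[OF w s] unfolding e .
      have r: "s \<in> {1..N}" "t \<in> {1..N}" "s \<noteq> t" using s by (auto simp: t)
      show ?thesis unfolding e
        using lt r atb b(2) sameT[OF r(1)] sameT[OF r(2)] neg[of s] i t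
        by (cases "s = b"; cases "t = b") (auto simp del: of_nat_add)
    qed
  qed
  have "desc (inv w') i"
    by (rule descI[OF clsD(1)[OF w'] i atb atq]) (use q b in auto)
  moreover have "C w' = FF w'"
  proof (rule IH[OF w'], rule mu_less[OF w' _ b(1)])
    show "w' (int (k + s)) \<le> w (int (k + s))" if "s \<in> {1..N}" for s
      using sameT[OF that] atb b(2) by (cases "s = b") auto
  qed (unfold atb b(2), simp)
  moreover have "ddt i (FF w') = FF w"
  proof (rule step_single[OF im b(1)])
    fix s assume s: "s \<in> {1..N}" "s \<noteq> b"
    show "chi k m w s = chi k m w' s \<and> nat \<bar>chi k m w' s\<bar> \<noteq> i"
      unfolding chi_eq[OF w s(1)] chi_eq[OF w' s(1)] sameT[OF s] using neT[OF s] by auto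
    show "lam k m w s = lam k m w' s"
    proof -
      have "w (int x) > w (int (k + s)) \<longleftrightarrow> w' (int x) > w (int (k + s))" if "x \<in> {1..k}" for x
        using sameV[OF that] atq q(2) neT[OF s] by (cases "x = q") auto
      then have "{x \<in> {1..k}. w (int x) > w (int (k + s))} = {x \<in> {1..k}. w' (int x) > w (int (k + s))}"
        by blast
      then show ?thesis unfolding lam_eq[OF w s(1)] lam_eq[OF w' s(1)] sameT[OF s] by simp
    qed
  next
    have "w' (int x) > int i \<longleftrightarrow> x = q \<or> w (int x) > int i + 1" if "x \<in> {1..k}" for x
      using sameV[OF that] neV[OF that] atq by (cases "x = q") auto
    then have "{x \<in> {1..k}. w' (int x) > int i} = insert q {x \<in> {1..k}. w (int x) > int i + 1}"
      using q(1) by blast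
    moreover have "q \<notin> {x \<in> {1..k}. w (int x) > int i + 1}" using q(2) by simp
    ultimately have "card {x \<in> {1..k}. w' (int x) > int i} = Suc (card {x \<in> {1..k}. w (int x) > int i + 1})"
      by simp
    then show "lam k m w b = lam k m w' b - 1"
      unfolding lam_eq[OF w b(1)] lam_eq[OF w' b(1)] atb b(2) using i by simp
    show "chi k m w' b = - int i \<and> chi k m w b = - int i - 1 \<or>
       1 \<le> i \<and> chi k m w' b = int i \<and> chi k m w b = int i - 1"
      unfolding chi_eq[OF w b(1)] chi_eq[OF w' b(1)] atb b(2) using i by simp
  qed
  ultimately show ?thesis by (intro C_step[OF w w'_def _ w'])
qed

text \<open>Here both i and i + 1 belong to slots, one barred and one not. In the larger element
  their indices are i and -i, and descending from it enlarges D(\<lambda>).\<close>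

lemma step_neg_u:
  assumes w: "cls w" and i: "i \<ge> 1" and a: "a \<in> {1..N}" "w (int (k + a)) = - int i"
    and b: "b \<in> {1..N}" "w (int (k + b)) = int i + 1"
    and neg: "\<And>s. s \<in> {1..N} \<Longrightarrow> s < b \<Longrightarrow> w (int (k + s)) < 0"
    and IH: "\<And>w'. cls w' \<Longrightarrow> mu w' < mu w \<Longrightarrow> C w' = FF w'"
  shows "C w = FF w"
proof -
  define w' where "w' = gen i \<circ> w"
  have kb: "k + b \<in> {1..m}" and ka: "k + a \<in> {1..m}" using a b by auto
  have im: "i < m" using small_pos(2)[OF w kb] b(2) by simp
  have ab: "a < b"
  proof (rule ccontr)
    assume "\<not> a < b"
    then have "w (int (k + b)) \<le> w (int (k + a))" using letters_mono[OF w, of b a] a b by (cases "a = b") auto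
    then show False using a b by simp
  qed
  have ne: "\<bar>w (int x)\<bar> \<noteq> int i \<and> \<bar>w (int x)\<bar> \<noteq> int i + 1" if "x \<in> {1..m}" "x \<noteq> k + b" "x \<noteq> k + a" for x
    using letter_distinct[OF w that(1) kb] letter_distinct[OF w that(1) ka] b(2) a(2) that(2,3) by auto
  have same: "w' (int x) = w (int x)" if "x \<in> {1..m}" "x \<noteq> k + b" "x \<noteq> k + a" for x
    using ne[OF that] unfolding w'_def comp_apply by (intro gen_other) auto
  have sameT: "w' (int (k + s)) = w (int (k + s))" and neT: "\<bar>w (int (k + s))\<bar> \<noteq> int i" "\<bar>w (int (k + s))\<bar> \<noteq> int i + 1"
    if "s \<in> {1..N}" "s \<noteq> a" "s \<noteq> b" for s
    using same[OF tail_pos[OF that(1)]] ne[OF tail_pos[OF that(1)]] that km by auto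
  have sameV: "w' (int x) = w (int x)" and neV: "w (int x) \<noteq> int i" "w (int x) \<noteq> int i + 1" if "x \<in> {1..k}" for x
    using same[of x] ne[of x] that a b km by auto
  have atb: "w' (int (k + b)) = int i" unfolding w'_def comp_apply b(2) by (rule gen_at[OF i])
  have ata: "w' (int (k + a)) = - (int i + 1)" unfolding w'_def comp_apply a(2) by (rule gen_at[OF i])
  have w': "cls w'"
  proof (rule cls_gen[OF w im w'_def])
    show "0 < w' (int x)" if "x \<in> {1..k}" for x using sameV[OF that] clsD(4)[OF w that] by simp
    show "w' (int x) < w' (int x + 1)" if "1 \<le> x" "x < k" for x
      using sameV[of x] sameV[of "x + 1"] clsD(5)[OF w that] that by (simp add: add.commute)
    show "w' (int (k + s)) < w' (int (k + s) + 1)" if s: "1 \<le> s" "s < N" for s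
    proof -
      obtain t where t: "t = s + 1" by simp
      have e: "int (k + s) + 1 = int (k + t)" by (simp add: t)
      have lt: "w (int (k + s)) < w (int (k + t))" using clsD(6)[OF w s] unfolding e .
      have r: "s \<in> {1..N}" "t \<in> {1..N}" "s \<noteq> t" using s by (auto simp: t)
      consider "s = a" "t = b" | "s = a" "t \<noteq> b" | "s = b" "t \<noteq> a" | "s \<noteq> a" "s \<noteq> b" "t = a"
        | "s \<noteq> a" "s \<noteq> b" "t = b" | "s \<noteq> a" "s \<noteq> b" "t \<noteq> a" "t \<noteq> b"
        using ab t by fastforce
      then have "w' (int (k + s)) < w' (int (k + t))"
      proof cases
        case 1
        then show ?thesis using ata atb by simp
      next
        case 2
        then show ?thesis using ata a(2) lt sameT[OF r(2)] r(3) by simp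
      next
        case 3
        then show ?thesis using atb b(2) lt sameT[OF r(2)] r(3) by simp
      next
        case 4
        then show ?thesis using ata a(2) lt sameT[OF r(1)] neT[OF r(1)] by simp
      next
        case 5
        then show ?thesis using atb sameT[OF r(1)] neg[OF r(1)] t by simp
      next
        case 6
        then show ?thesis using lt sameT[OF r(1)] sameT[OF r(2)] by simp
      qed
      then show ?thesis unfolding e .
    qed
  qed
  have "w' (- int (k + a)) = int i + 1" using W_inf_minus[OF clsD(1)[OF w'], of "int (k + a)"] ata by simp
  then have "desc (inv w') i"
    by (rule descI[OF clsD(1)[OF w'] i atb]) (use b in auto)
  moreover have "C w' = FF w'"
  proof (rule IH[OF w'], rule mu_less[OF w' _ b(1)])
    show "w' (int (k + s)) \<le> w (int (k + s))" if "s \<in> {1..N}" for s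
      using sameT[OF that] atb ata a(2) b(2) by (cases "s = b"; cases "s = a") auto
  qed (unfold atb b(2), simp)
  moreover have "ddt i (FF w') = FF w"
  proof (rule step_double[OF i im a(1) b(1) ab])
    fix s assume s: "s \<in> {1..N}" "s \<noteq> a" "s \<noteq> b"
    show "chi k m w s = chi k m w' s \<and> nat \<bar>chi k m w' s\<bar> \<noteq> i"
      unfolding chi_eq[OF w s(1)] chi_eq[OF w' s(1)] sameT[OF s] using neT[OF s] by auto
  next
    fix s assume s: "s \<in> {1..N}" "s \<noteq> a"
    show "lam k m w s = lam k m w' s"
    proof (cases "s = b")
      case True
      \<comment> \<open>Neither i nor i + 1 is among the first k letters, so \<lambda>_b counts the
        same letters before and after.\<close>
      have "w (int x) > int i + 1 \<longleftrightarrow> w' (int x) > int i" if "x \<in> {1..k}" for x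
        using sameV[OF that] neV[OF that] by auto
      then have "{x \<in> {1..k}. w (int x) > int i + 1} = {x \<in> {1..k}. w' (int x) > int i}" by blast
      then show ?thesis unfolding True lam_eq[OF w b(1)] lam_eq[OF w' b(1)] atb b(2) by simp
    next
      case False
      have "{x \<in> {1..k}. w (int x) > w (int (k + s))} = {x \<in> {1..k}. w' (int x) > w (int (k + s))}"
        using sameV by auto
      then show ?thesis unfolding lam_eq[OF w s(1)] lam_eq[OF w' s(1)] sameT[OF s False] by simp
    qed
  next
    show "lam k m w a = lam k m w' a - 1"
      unfolding lam_eq[OF w a(1)] lam_eq[OF w' a(1)] ata a(2) using i by simp
    show "chi k m w' a = int i" "chi k m w a = int i - 1" "chi k m w' b = - int i" "chi k m w b = - int i - 1"
      unfolding chi_eq[OF w a(1)] chi_eq[OF w' a(1)] chi_eq[OF w b(1)] chi_eq[OF w' b(1)] ata a(2) atb b(2)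
      using i by simp_all
  qed
  ultimately show ?thesis by (intro C_step[OF w w'_def _ w'])
qed

text \<open>All slots are barred, so no \<lambda>_s is a count and changing the first k letters
  affects none. Only slot a moves: \<chi>_a and \<lambda>_a are one larger for the new
  element.\<close>

lemma step_v_neg:
  assumes w: "cls w" and i: "i \<ge> 1" and q: "q \<in> {1..k}" "w (int q) = int i + 1"
    and a: "a \<in> {1..N}" "w (int (k + a)) = - int i"
    and neg: "\<And>s. s \<in> {1..N} \<Longrightarrow> w (int (k + s)) < 0"
    and IH: "\<And>w'. cls w' \<Longrightarrow> mu w' < mu w \<Longrightarrow> C w' = FF w'"
  shows "C w = FF w"
proof -
  define w' where "w' = gen i \<circ> w"
  have ka: "k + a \<in> {1..m}" and qm: "q \<in> {1..m}" using a q km by auto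
  have im: "i < m" using small_pos(2)[OF w qm] q(2) by simp
  have ne: "\<bar>w (int x)\<bar> \<noteq> int i \<and> \<bar>w (int x)\<bar> \<noteq> int i + 1" if "x \<in> {1..m}" "x \<noteq> k + a" "x \<noteq> q" for x
    using letter_distinct[OF w that(1) ka] letter_distinct[OF w that(1) qm] a(2) q(2) that(2,3) by auto
  have same: "w' (int x) = w (int x)" if "x \<in> {1..m}" "x \<noteq> k + a" "x \<noteq> q" for x
    using ne[OF that] unfolding w'_def comp_apply by (intro gen_other) auto
  have sameT: "w' (int (k + s)) = w (int (k + s))" and neT: "\<bar>w (int (k + s))\<bar> \<noteq> int i" "\<bar>w (int (k + s))\<bar> \<noteq> int i + 1"
    if "s \<in> {1..N}" "s \<noteq> a" for s
    using same[OF tail_pos[OF that(1)]] ne[OF tail_pos[OF that(1)]] that q km by auto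
  have sameV: "w' (int x) = w (int x)" and neV: "w (int x) \<noteq> int i" "w (int x) \<noteq> int i + 1" if "x \<in> {1..k}" "x \<noteq> q" for x
    using same[of x] ne[of x] that a km by auto
  have ata: "w' (int (k + a)) = - (int i + 1)" unfolding w'_def comp_apply a(2) by (rule gen_at[OF i])
  have atq: "w' (int q) = int i" unfolding w'_def comp_apply q(2) by (rule gen_at[OF i])
  have w': "cls w'"
  proof (rule cls_gen[OF w im w'_def])
    show "0 < w' (int x)" if "x \<in> {1..k}" for x
      using sameV[OF that] clsD(4)[OF w that] atq i by (cases "x = q") auto
    show "w' (int x) < w' (int x + 1)" if x: "1 \<le> x" "x < k" for x
    proof -
      have e: "int x + 1 = int (x + 1)" by simp
      have lt: "w (int x) < w (int (x + 1))" using clsD(5)[OF w x] unfolding e .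
      show ?thesis unfolding e
        using lt x atq q(2) sameV[of x] sameV[of "x + 1"] neV[of x]
        by (cases "x = q"; cases "x + 1 = q") auto
    qed
    show "w' (int (k + s)) < w' (int (k + s) + 1)" if s: "1 \<le> s" "s < N" for s
    proof -
      obtain t where t: "t = s + 1" by simp
      have e: "int (k + s) + 1 = int (k + t)" by (simp add: t)
      have lt: "w (int (k + s)) < w (int (k + t))" using clsD(6)[OF w s] unfolding e .
      have r: "s \<in> {1..N}" "t \<in> {1..N}" "s \<noteq> t" using s by (auto simp: t)
      show ?thesis unfolding e
        using lt r ata a(2) sameT[OF r(1)] sameT[OF r(2)] neT[OF r(1)]
        by (cases "s = a"; cases "t = a") auto
    qed
  qed
  have "w' (- int (k + a)) = int i + 1" using W_inf_minus[OF clsD(1)[OF w'], of "int (k + a)"] ata by simp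
  then have "desc (inv w') i"
    by (rule descI[OF clsD(1)[OF w'] i atq]) (use q in auto)
  moreover have "C w' = FF w'"
  proof (rule IH[OF w'], rule mu_less[OF w' _ a(1)])
    show "w' (int (k + s)) \<le> w (int (k + s))" if "s \<in> {1..N}" for s
      using sameT[OF that] ata a(2) by (cases "s = a") auto
  qed (unfold ata a(2), simp)
  moreover have "ddt i (FF w') = FF w"
  proof (rule step_single[OF im a(1)])
    fix s assume s: "s \<in> {1..N}" "s \<noteq> a"
    show "chi k m w s = chi k m w' s \<and> nat \<bar>chi k m w' s\<bar> \<noteq> i"
      unfolding chi_eq[OF w s(1)] chi_eq[OF w' s(1)] sameT[OF s] using neT[OF s] by auto
    show "lam k m w s = lam k m w' s"
      unfolding lam_eq[OF w s(1)] lam_eq[OF w' s(1)] sameT[OF s] using neg[OF s(1)] by simp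
  next
    show "lam k m w a = lam k m w' a - 1"
      unfolding lam_eq[OF w a(1)] lam_eq[OF w' a(1)] ata a(2) using i by simp
    show "chi k m w' a = - int i \<and> chi k m w a = - int i - 1 \<or>
       1 \<le> i \<and> chi k m w' a = int i \<and> chi k m w a = int i - 1"
      unfolding chi_eq[OF w a(1)] chi_eq[OF w' a(1)] ata a(2) using i by simp
  qed
  ultimately show ?thesis by (intro C_step[OF w w'_def _ w'])
qed

lemma letters_gap:
  assumes w: "cls w"
  shows "1 \<le> s \<Longrightarrow> s + d \<le> N \<Longrightarrow> w (int (k + s)) + int d \<le> w (int (k + (s + d)))"
proof (induction d)
  case (Suc d)
  have "w (int (k + (s + d))) < w (int (k + (s + Suc d)))"
    by (rule letters_mono[OF w]) (use Suc.prems in auto)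
  then show ?case using Suc by simp
qed simp

text \<open>The letters in the slots increase, lie at or above -m and end below -k, which leaves
  only -m, ..., -(k+1). All \<chi>_s are then at least k, so D(\<lambda>) is empty and the sum is
  one Pfaffian, that of \<open>longest\<close>.\<close>

lemma top_case:
  assumes w: "cls w" and top: "\<And>q. q \<in> {1..k} \<Longrightarrow> w (int q) = int q"
    and neg: "\<And>s. s \<in> {1..N} \<Longrightarrow> w (int (k + s)) < 0"
  shows "C w = FF w"
proof -
  have letters: "w (int (k + s)) = - int (m + 1 - s)" if s: "s \<in> {1..N}" for s
  proof -
    \<comment> \<open>The values 1, ..., k are taken by the first k positions.\<close>
    have big: "\<bar>w (int (k + N))\<bar> > int k"
    proof (rule ccontr)
      assume *: "\<not> \<bar>w (int (k + N))\<bar> > int k"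
      have "1 \<le> \<bar>w (int (k + N))\<bar>" by (rule small_pos(1)[OF w]) (use km in auto)
      then have c: "nat \<bar>w (int (k + N))\<bar> \<in> {1..k}" using * by auto
      have "\<bar>w (int (k + N))\<bar> = \<bar>w (int (nat \<bar>w (int (k + N))\<bar>))\<bar>" using top[OF c] by simp
      then show False using next_ne[OF w _ c, of N] km by auto
    qed
    have "w (int (k + N)) \<le> - int k - 1"
    proof -
      have "w (int (k + N)) < 0" by (rule neg) (use km in auto)
      then show ?thesis using big by linarith
    qed
    moreover have "w (int (k + s)) + int (N - s) \<le> w (int (k + N))"
      using letters_gap[OF w, of s "N - s"] s by auto
    moreover have "w (int (k + 1)) + int (s - 1) \<le> w (int (k + s))"
      using letters_gap[OF w, of 1 "s - 1"] s by auto
    moreover have "\<bar>w (int (k + 1))\<bar> \<le> int m" by (rule small_pos(2)[OF w]) (use km in auto)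
    moreover have "int (N - s) = int m - int k - int s" "int (s - 1) = int s - 1" "int (m + 1 - s) = int m + 1 - int s"
      using s km by auto
    ultimately show ?thesis by linarith
  qed
  have cs: "chi k m w s = int m - int s" and ls: "lam k m w s = int m + 1 - int s + int k" if s: "s \<in> {1..N}" for s
  proof -
    have "int (m + 1 - s) = int m + 1 - int s" "int s \<le> int m" using s by auto
    then show "chi k m w s = int m - int s" "lam k m w s = int m + 1 - int s + int k"
      unfolding chi_eq[OF w s] lam_eq[OF w s] letters[OF s] by auto
  qed
  have D: "DD k m w = {}"
  proof -
    have "(x, y) \<notin> DD k m w" for x y
      using cs[of x] cs[of y] km by (auto simp: DD_iff)
    then show ?thesis by (metis equals0I prod.collapse)
  qed
  \<comment> \<open>Slot s meets the entry j = N + 1 - s of \<open>B_tilde K 1\<close>, because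
    \<open>theta_B\<close> reverses: 2k + j = m + 1 - s + k and k + j - 1 = m - s.\<close>
  have "ent k N (\<lambda>s. lam k m w s + aI {} s) (chi k m w) = theta_B (B_tilde K 1)"
  proof (rule nth_equalityI)
    show "length (ent k N (\<lambda>s. lam k m w s + aI {} s) (chi k m w)) = length (theta_B (B_tilde K 1))"
      by (simp add: ent_def theta_B_def B_tilde_def numeral_2_eq_2)
    fix j assume "j < length (ent k N (\<lambda>s. lam k m w s + aI {} s) (chi k m w))"
    then have j: "j < N" by (simp add: ent_def del: upt_Suc)
    then have jN: "Suc j \<in> {1..N}" by auto
    have up: "[1..<N + 1] ! x = Suc x" if "x < N" for x
      using nth_upt[of 1 x "N + 1"] that by (simp del: upt_Suc)
    have "ent k N (\<lambda>s. lam k m w s + aI {} s) (chi k m w) ! j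
        = entry (k, lam k m w (Suc j) + aI {} (Suc j), chi k m w (Suc j))"
      using j up[OF j] by (simp add: ent_def del: upt_Suc)
    also have "\<dots> = entry (k, int m - int j + int k, int m - int j - 1)"
    proof -
      have "lam k m w (Suc j) + aI {} (Suc j) = int m - int j + int k" "chi k m w (Suc j) = int m - int j - 1"
        using cs[OF jN] ls[OF jN] by (simp_all add: aI_def)
      then show ?thesis by (simp only:)
    qed
    finally have 1: "ent k N (\<lambda>s. lam k m w s + aI {} s) (chi k m w) ! j
        = entry (k, int m - int j + int k, int m - int j - 1)" .
    define h where "h s = entry (k, int (2 * k + s), int (k + s) - 1)" for s
    have "theta_B (B_tilde K 1) = rev (map h [1..<N + 1])"
      by (simp add: theta_B_def B_tilde_def comp_def numeral_2_eq_2 h_def[abs_def] del: upt_Suc)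
    then have "theta_B (B_tilde K 1) ! j = h ([1..<N + 1] ! (N - Suc j))"
      using j by (simp add: rev_nth del: upt_Suc)
    also have "\<dots> = h (N - j)"
      using j up[of "N - Suc j"] by (simp add: Suc_diff_Suc del: upt_Suc)
    finally have "theta_B (B_tilde K 1) ! j = entry (k, int (2 * k + (N - j)), int (k + (N - j)) - 1)"
      unfolding h_def .
    moreover have "int (2 * k + (N - j)) = int m - int j + int k" "int (k + (N - j)) - 1 = int m - int j - 1"
      using j by auto
    ultimately show "ent k N (\<lambda>s. lam k m w s + aI {} s) (chi k m w) ! j = theta_B (B_tilde K 1) ! j"
      using 1 by (simp only:)
  qed
  then have F: "FF w = Pf (tail @ theta_B (B_tilde K 1))"
    unfolding FF_def D by simp
  have "good w (concat (map (\<lambda>i. theta_B (B_tilde K i)) (rev [1..<p + 1]))) (K (p + 1)) (K (p + 1))"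
  proof (rule longest)
    show "w (int (K i + j)) = - int (K (i + 1) + 1 - j)" if ij: "i \<in> {1..p}" "j \<in> {1..K (i + 1) - K i}" for i j
    proof (cases "i = 1")
      case True
      then show ?thesis using letters[of j] ij by (simp add: numeral_2_eq_2)
    next
      case False
      then show ?thesis using clsD(3)[OF w _ ij(2)] ij(1) by auto
    qed
  qed (use clsD[OF w] top in auto)
  moreover have "[1..<p + 1] = 1 # [2..<p + 1]" using p by (simp add: upt_conv_Cons numeral_2_eq_2)
  ultimately show ?thesis unfolding F good_def tail_def by (simp del: upt_Suc)
qed

text \<open>Unless the top case applies, some s_i with i < m carries w to a longer element of the
  class with smaller \<open>mu\<close>. The cases differ in where the letter of absolute value i
  stands.\<close>

theorem C_FF: "cls w \<Longrightarrow> C w = FF w"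
proof (induction "mu w" arbitrary: w rule: less_induct)
  case less
  note w = less.prems
  have IH: "C w' = FF w'" if "cls w'" "mu w' < mu w" for w' using less.hyps[OF that(2,1)] .
  have nz: "w (int (k + s)) \<noteq> 0" if "s \<in> {1..N}" for s
    using small_pos(1)[OF w tail_pos[OF that]] km by auto
  show ?case
  proof (cases "\<exists>s\<in>{1..N}. w (int (k + s)) > 0")
    case True
    \<comment> \<open>Lowering the first positive letter among the slots leaves all earlier ones
      negative, so their order cannot be disturbed.\<close>
    define b where "b = (LEAST s. s \<in> {1..N} \<and> w (int (k + s)) > 0)"
    have b: "b \<in> {1..N}" "w (int (k + b)) > 0"
      using LeastI_ex[of "\<lambda>s. s \<in> {1..N} \<and> w (int (k + s)) > 0"] True unfolding b_def by blast+
    have neg: "w (int (k + s)) < 0" if "s \<in> {1..N}" "s < b" for s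
      using not_less_Least[of s "\<lambda>s. s \<in> {1..N} \<and> w (int (k + s)) > 0"] that nz[OF that(1)] unfolding b_def
      by (meson linorder_neqE)
    show ?thesis
    proof (cases "w (int (k + b)) = 1")
      case True
      then show ?thesis using step_0[OF w b(1) True] IH by blast
    next
      case False
      define i where "i = nat (w (int (k + b)) - 1)"
      have i: "i \<ge> 1" "w (int (k + b)) = int i + 1" using b(2) False by (auto simp: i_def)
      have "w (int (k + b)) \<le> int m" using small_pos(2)[OF w, of "k + b"] b by auto
      then obtain q where q: "q \<in> {1..m}" "\<bar>w (int q)\<bar> = int i"
        using onto[OF w, of "int i"] i by auto
      show ?thesis
      proof (cases "q \<le> k")
        case True
        then have "q \<in> {1..k}" "w (int q) = int i" using q clsD(4)[OF w, of q] by auto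
        then show ?thesis using step_v_u[OF w i(1) _ _ b(1) i(2) neg IH] by blast
      next
        case False
        define a where "a = q - k"
        have a: "a \<in> {1..N}" "k + a = q" using False q by (auto simp: a_def)
        \<comment> \<open>The letter i itself cannot stand here: slots before b are negative, and
          those after b exceed i + 1.\<close>
        have "w (int (k + a)) = - int i"
        proof (rule ccontr)
          assume "w (int (k + a)) \<noteq> - int i"
          then have pos: "w (int (k + a)) = int i" using q(2) a(2) by auto
          consider "a < b" | "a = b" | "b < a" by linarith
          then show False
          proof cases
            case 1
            then show False using neg[OF a(1)] pos by simp
          next
            case 2
            then show False using pos i(2) by simp
          next
            case 3
            then have "w (int (k + b)) < w (int (k + a))" using letters_mono[OF w, of b a] a b by auto
            then show False using pos i(2) by simp
          qed
        qed
        then show ?thesis using step_neg_u[OF w i(1) a(1) _ b(1) i(2) neg IH] by blast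
      qed
    qed
  next
    case False
    then have neg: "w (int (k + s)) < 0" if "s \<in> {1..N}" for s using nz[OF that] that by force
    show ?thesis
    proof (cases "\<forall>q\<in>{1..k}. w (int q) = int q")
      case True
      then show ?thesis using top_case[OF w _ neg] by blast
    next
      case False
      \<comment> \<open>At the first deviation from the identity the letter i + 1 is too large, and
        i is missing from the first k letters: smaller positions hold smaller letters, larger ones
        exceed i + 1. So i occurs barred in some slot.\<close>
      define q where "q = (LEAST q. q \<in> {1..k} \<and> w (int q) \<noteq> int q)"
      have q: "q \<in> {1..k}" "w (int q) \<noteq> int q"
        using LeastI_ex[of "\<lambda>q. q \<in> {1..k} \<and> w (int q) \<noteq> int q"] False unfolding q_def by blast+
      have below: "w (int r) = int r" if "r \<in> {1..k}" "r < q" for r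
        using not_less_Least[of r "\<lambda>q. q \<in> {1..k} \<and> w (int q) \<noteq> int q"] that unfolding q_def by blast
      have gt: "w (int q) > int q"
      proof (cases "q = 1")
        case True
        then show ?thesis using clsD(4)[OF w q(1)] q(2) by simp
      next
        case False
        then have "q - 1 \<in> {1..k}" "q - 1 < q" using q by auto
        then have "w (int (q - 1)) = int (q - 1)" "w (int (q - 1)) < w (int q)"
          using below[of "q - 1"] v_mono[OF w, of "q - 1" q] q by auto
        then show ?thesis using q by simp
      qed
      define i where "i = nat (w (int q) - 1)"
      have i: "i \<ge> q" "w (int q) = int i + 1" "i \<ge> 1" using gt q(1) by (auto simp: i_def)
      have "w (int q) \<le> int m" using small_pos(2)[OF w, of q] q km by auto
      then obtain x where x: "x \<in> {1..m}" "\<bar>w (int x)\<bar> = int i"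
        using onto[OF w, of "int i"] i by auto
      have "\<not> x \<le> k"
      proof
        assume xk: "x \<le> k"
        then have wx: "w (int x) = int i" using x clsD(4)[OF w, of x] by auto
        consider "x < q" | "x = q" | "q < x" by linarith
        then show False
        proof cases
          case 1
          then show False using below[of x] x xk wx i(1) by auto
        next
          case 2
          then show False using wx i(2) by simp
        next
          case 3
          then have "w (int q) < w (int x)" using v_mono[OF w, of q x] q xk by auto
          then show False using wx i(2) by simp
        qed
      qed
      define a where "a = x - k"
      have a: "a \<in> {1..N}" "k + a = x" using \<open>\<not> x \<le> k\<close> x by (auto simp: a_def)
      have "w (int (k + a)) = - int i" using neg[OF a(1)] x(2) a(2) by auto
      then show ?thesis using step_v_neg[OF w i(3) q(1) i(2) a(1) _ neg IH] by blast
    qed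
  qed
qed

end

theorem theorem8p13:
  fixes n p k m :: nat and J :: "nat set" and K :: "nat \<Rightarrow> nat"
    and w :: "int \<Rightarrow> int" and C :: "(int \<Rightarrow> int) \<Rightarrow> Rinf"
  assumes "double_schubert C"
    and "n \<ge> 1" and "p \<ge> 1"
    and "J \<subseteq> {0..<n}" and "J = K ` {1..p}" and "strict_mono_on {1..p} K" and "K (p + 1) = n"
    and "k = K 1" and "m = K 2"
    and "pseudo_grassmannian n p J K w"
  shows "C w = (\<Sum>I\<in>Pow (DD k m w).
           Pf (concat (map (\<lambda>i. theta_B (B_tilde K i)) (rev [2..<p + 1])) @
               map (\<lambda>s. entry (k, lam k m w s + aI I s, chi k m w s)) [1..<m - k + 1]))"
proof -
  \<comment> \<open>The last inequality K p < n comes from J being contained in {0, ..., n -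
    1}.\<close>
  have Kless: "K i < K (i + 1)" if i: "i \<in> {1..p}" for i
  proof (cases "i = p")
    case True
    have "K p \<in> J" using assms(3,5) by auto
    then show ?thesis using True assms(4,7) by auto
  next
    case False
    then show ?thesis using i by (intro strict_mono_onD[OF assms(6)]) auto
  qed
  interpret flag C p K
    by unfold_locales (use assms(1,3) Kless in auto)
  have wf: "w \<in> W_fin n" and wp: "w \<in> W_par J"
    and blocks: "\<forall>i\<in>{2..p}. \<forall>j\<in>{1..K (i + 1) - K i}. w (int (K i + j)) = - int (K (i + 1) + 1 - j)"
    using assms(10) by (auto simp: pseudo_grassmannian_def)
  have ww: "w \<in> W_inf" using wf by (simp add: W_fin_def)
  have nd: "\<not> desc w i" if "i \<notin> J" for i
    using wp that len_less_iff'[OF ww, of i] by (auto simp: W_par_def)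
  have asc: "w (int q) < w (int q + 1)" if "q \<ge> 1" "q \<notin> J" for q
    using nd[OF that(2)] that(1) W_inf_inj[OF ww, of "int q" "int q + 1"] by (auto simp: desc_def)
  have J1: "q \<notin> J" if "q < K 1" for q
    using that K_le[of 1] unfolding assms(5) by fastforce
  have J2: "q \<notin> J" if "K 1 < q" "q < K 2" for q
  proof
    assume "q \<in> J"
    then obtain i where i: "i \<in> {1..p}" "q = K i" unfolding assms(5) by blast
    show False
    proof (cases "i = 1")
      case False
      then have "K 2 \<le> K i" using i by (intro K_le) auto
      then show ?thesis using that i by simp
    qed (use that i in simp)
  qed
  \<comment> \<open>If k is at least 1 then 0 is not in J, so w 1 is positive, and positivity
    spreads along the ascents up to k.\<close>
  have pos: "0 < w (int q)" if "1 \<le> q" "q \<le> K 1" for q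
    using that
  proof (induction q)
    case (Suc q)
    show ?case
    proof (cases "q = 0")
      case True
      then have "\<not> desc w 0" using nd J1[of 0] Suc.prems by simp
      then show ?thesis using True W_inf_eq_0[OF ww, of 1] by (auto simp: desc_def)
    next
      case False
      then have "0 < w (int q)" "w (int q) < w (int q + 1)" using Suc asc J1[of q] by auto
      then show ?thesis by (simp add: add.commute)
    qed
  qed simp
  have "cls w"
    unfolding cls_def
  proof (intro conjI)
    show "\<forall>x>int (K (p + 1)). w x = x" using wf assms(7) by (auto simp: W_fin_def)
    show "\<forall>q. 1 \<le> q \<and> q < K 1 \<longrightarrow> w (int q) < w (int q + 1)" using asc J1 by auto
    show "\<forall>s. 1 \<le> s \<and> s < K 2 - K 1 \<longrightarrow> w (int (K 1 + s)) < w (int (K 1 + s) + 1)"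
    proof (intro allI impI)
      fix s assume s: "1 \<le> s \<and> s < K 2 - K 1"
      then have "K 1 + s \<notin> J" by (intro J2) auto
      then show "w (int (K 1 + s)) < w (int (K 1 + s) + 1)" using s by (intro asc) auto
    qed
  qed (use ww blocks pos in auto)
  from C_FF[OF this] show ?thesis
    unfolding FF_def ent_def tail_def assms(8,9) .
qed

end
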